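(* Let $k\geq 1$, let $G$ be a $k$-step nilpotent Lie group, let $\Gamma\leq G$ be a discrete co-compact subgroup, let $\mu_{G/\Gamma}$ be the Haar measure on $G/\Gamma$, and let $a\in G$ be such that the nilsystem $(G/\Gamma,\mu_{G/\Gamma},R_a)$ is ergodic. Let $f\in L^\infty(G/\Gamma,\mu_{G/\Gamma})$ and suppose that $f$ is orthogonal (in $L^2(G/\Gamma,\mu_{G/\Gamma})$) to the subspace spanned by all eigenfunctions of $R_a$. Then $$\lim_{n\to\infty}\int_{G/\Gamma} R_a^n f\cdot\overline{f}\,d\mu_{G/\Gamma}=0.$$
   Context: A $k$-step nilmanifold is a compact manifold $G/\Gamma$ with $G$ a $k$-step nilpotent Lie group (not assumed connected; its lower central series $G_1=G$, $G_{i+1}=[G,G_i]$ satisfies $G_{k+1}=\{e\}$) and $\Gamma$ a discrete co-compact subgroup. The Haar measure $\mu_{G/\Gamma}$ is the unique Borel probability measure on $G/\Gamma$ invariant under all left translations by $G$. For $a\in G$, $R_a(g\Gamma)=(ag)\Gamma$, and $R_a$ also denotes the unitary Koopman operator $R_af=f\circ R_a$ on $L^2(G/\Gamma,\mu_{G/\Gamma})$. The nilsystem $(G/\Gamma,\mu_{G/\Gamma},R_a)$ is ergodic if the only $R_a$-invariant functions in $L^2(G/\Gamma,\mu_{G/\Gamma})$ are constants. An eigenfunction of $R_a$ is a nonzero $h\in L^2(G/\Gamma,\mu_{G/\Gamma})$ with $R_ah=\lambda h$ for some $\lambda\in\mathbb{C}$. *)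

theory Defs
  imports
    "HOL-Analysis.Analysis"
    "HOL-Algebra.Left_Coset"
    "HOL-Algebra.Generated_Groups"
    "HOL-Probability.Probability_Measure"
begin

section \<open>Lie groups\<close>

text \<open>\<open>C_diff n S f\<close>: \<open>f\<close> is of class \<open>C\<^sup>n\<close> on the open set \<open>S\<close>.  The derivative is iterated
  direction by direction, so that its type does not change along the recursion; since the domain
  is finite-dimensional, this is the same as asking that the derivative, as a map into linear
  maps, be of class \<open>C\<^sup>n\<^sup>-\<^sup>1\<close>.\<close>

primrec C_diff ::
    "nat \<Rightarrow> 'a::euclidean_space set \<Rightarrow> ('a \<Rightarrow> 'b::real_normed_vector) \<Rightarrow> bool" where
  "C_diff 0 S f \<longleftrightarrow> continuous_on S f"
| "C_diff (Suc n) S f \<longleftrightarrow>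
     (\<forall>x\<in>S. f differentiable (at x)) \<and>
     (\<forall>v. C_diff n S (\<lambda>x. frechet_derivative f (at x) v))"

definition smooth_on ::
    "'a::euclidean_space set \<Rightarrow> ('a \<Rightarrow> 'b::real_normed_vector) \<Rightarrow> bool" where
  "smooth_on S f \<longleftrightarrow> (\<forall>n. C_diff n S f)"

text \<open>An atlas is a set of charts \<open>(U, \<phi>)\<close>, where \<open>\<phi>\<close> matters only on \<open>U\<close>.\<close>

definition smooth_atlas :: "'g topology \<Rightarrow> ('g set \<times> ('g \<Rightarrow> 'e::euclidean_space)) set \<Rightarrow> bool" where
  "smooth_atlas X A \<longleftrightarrow>
     (\<Union>(U, \<phi>)\<in>A. U) = topspace X \<and>
     (\<forall>(U, \<phi>)\<in>A. openin X U \<and> open (\<phi> ` U) \<and>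
        homeomorphic_map (subtopology X U) (top_of_set (\<phi> ` U)) \<phi>) \<and>
     (\<forall>(U, \<phi>)\<in>A. \<forall>(V, \<psi>)\<in>A. smooth_on (\<phi> ` (U \<inter> V)) (\<psi> \<circ> inv_into U \<phi>))"

definition prod_atlas ::
    "('g set \<times> ('g \<Rightarrow> 'd)) set \<Rightarrow> ('h set \<times> ('h \<Rightarrow> 'e)) set \<Rightarrow>
     (('g \<times> 'h) set \<times> ('g \<times> 'h \<Rightarrow> 'd \<times> 'e)) set" where
  "prod_atlas A B = {(U \<times> V, map_prod \<phi> \<psi>) | U \<phi> V \<psi>. (U, \<phi>) \<in> A \<and> (V, \<psi>) \<in> B}"

definition smooth_map ::
    "'g topology \<Rightarrow> ('g set \<times> ('g \<Rightarrow> 'd::euclidean_space)) set \<Rightarrow>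
     'h topology \<Rightarrow> ('h set \<times> ('h \<Rightarrow> 'e::euclidean_space)) set \<Rightarrow> ('g \<Rightarrow> 'h) \<Rightarrow> bool" where
  "smooth_map X A Y B f \<longleftrightarrow>
     continuous_map X Y f \<and>
     (\<forall>(U, \<phi>)\<in>A. \<forall>(V, \<psi>)\<in>B. smooth_on (\<phi> ` {x\<in>U. f x \<in> V}) (\<psi> \<circ> f \<circ> inv_into U \<phi>))"

text \<open>Manifolds are Hausdorff and second countable; Lie groups need not be connected.  The types of
  class \<open>euclidean_space\<close> have dimension at least 1, so the Lie groups of dimension 0, that is, the
  countable discrete groups, are a separate case (in which the atlas plays no role).\<close>

definition lie_group ::
    "('g, 'm) monoid_scheme \<Rightarrow> 'g topology \<Rightarrow> ('g set \<times> ('g \<Rightarrow> 'e::euclidean_space)) set \<Rightarrow> bool" where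
  "lie_group G T A \<longleftrightarrow>
     group G \<and> topspace T = carrier G \<and> Hausdorff_space T \<and> second_countable T \<and>
     (T = discrete_topology (carrier G) \<or>
      smooth_atlas T A \<and>
      smooth_map (prod_topology T T) (prod_atlas A A) T A (\<lambda>(x, y). x \<otimes>\<^bsub>G\<^esub> y) \<and>
      smooth_map T A T A (\<lambda>x. inv\<^bsub>G\<^esub> x))"


section \<open>Nilpotent groups\<close>

definition commutator_subgroup :: "('g, 'm) monoid_scheme \<Rightarrow> 'g set \<Rightarrow> 'g set \<Rightarrow> 'g set" where
  "commutator_subgroup G H K =
     generate G (\<Union>h\<in>H. \<Union>k\<in>K. {h \<otimes>\<^bsub>G\<^esub> k \<otimes>\<^bsub>G\<^esub> inv\<^bsub>G\<^esub> h \<otimes>\<^bsub>G\<^esub> inv\<^bsub>G\<^esub> k})"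

text \<open>The index is shifted by one: \<open>lower_central G i\<close> is \<open>G\<^sub>i\<^sub>+\<^sub>1\<close>, where \<open>G\<^sub>1 = G\<close>.\<close>

primrec lower_central :: "('g, 'm) monoid_scheme \<Rightarrow> nat \<Rightarrow> 'g set" where
  "lower_central G 0 = carrier G"
| "lower_central G (Suc i) = commutator_subgroup G (carrier G) (lower_central G i)"

definition nilpotent_step :: "nat \<Rightarrow> ('g, 'm) monoid_scheme \<Rightarrow> bool" where
  "nilpotent_step k G \<longleftrightarrow> lower_central G k = {\<one>\<^bsub>G\<^esub>}"


section \<open>The homogeneous space of left cosets\<close>

definition lcoset_topology :: "('g, 'm) monoid_scheme \<Rightarrow> 'g topology \<Rightarrow> 'g set \<Rightarrow> 'g set topology" where
  "lcoset_topology G T \<Gamma> =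
     topology (\<lambda>\<U>. \<U> \<subseteq> lcosets\<^bsub>G\<^esub> \<Gamma> \<and> openin T {g \<in> topspace T. g <#\<^bsub>G\<^esub> \<Gamma> \<in> \<U>})"

lemma openin_lcoset_topology:
  "openin (lcoset_topology G T \<Gamma>) \<U> \<longleftrightarrow>
     \<U> \<subseteq> lcosets\<^bsub>G\<^esub> \<Gamma> \<and> openin T {g \<in> topspace T. g <#\<^bsub>G\<^esub> \<Gamma> \<in> \<U>}"
proof -
  let ?P = "\<lambda>\<U>. \<U> \<subseteq> lcosets\<^bsub>G\<^esub> \<Gamma> \<and> openin T {g \<in> topspace T. g <#\<^bsub>G\<^esub> \<Gamma> \<in> \<U>}"
  have "istopology ?P"
    unfolding istopology_def
  proof (intro conjI allI impI)
    fix S R assume SR: "?P S" "?P R"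
    show "S \<inter> R \<subseteq> lcosets\<^bsub>G\<^esub> \<Gamma>"
      using SR by blast
    have "{g \<in> topspace T. g <#\<^bsub>G\<^esub> \<Gamma> \<in> S \<inter> R} =
          {g \<in> topspace T. g <#\<^bsub>G\<^esub> \<Gamma> \<in> S} \<inter> {g \<in> topspace T. g <#\<^bsub>G\<^esub> \<Gamma> \<in> R}"
      by blast
    then show "openin T {g \<in> topspace T. g <#\<^bsub>G\<^esub> \<Gamma> \<in> S \<inter> R}"
      using SR by (simp add: openin_Int)
  next
    fix \<K> assume K: "\<forall>S\<in>\<K>. ?P S"
    show "\<Union>\<K> \<subseteq> lcosets\<^bsub>G\<^esub> \<Gamma>"
      using K by blast
    have "{g \<in> topspace T. g <#\<^bsub>G\<^esub> \<Gamma> \<in> \<Union>\<K>} = (\<Union>S\<in>\<K>. {g \<in> topspace T. g <#\<^bsub>G\<^esub> \<Gamma> \<in> S})"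
      by blast
    then show "openin T {g \<in> topspace T. g <#\<^bsub>G\<^esub> \<Gamma> \<in> \<Union>\<K>}"
      using K by (auto intro!: openin_Union)
  qed
  then show ?thesis
    by (simp add: lcoset_topology_def)
qed

lemma topspace_lcoset_topology:
  assumes "topspace T = carrier G"
  shows "topspace (lcoset_topology G T \<Gamma>) = lcosets\<^bsub>G\<^esub> \<Gamma>"
proof
  show "topspace (lcoset_topology G T \<Gamma>) \<subseteq> lcosets\<^bsub>G\<^esub> \<Gamma>"
    using openin_lcoset_topology by (metis openin_topspace)
  have "{g \<in> topspace T. g <#\<^bsub>G\<^esub> \<Gamma> \<in> lcosets\<^bsub>G\<^esub> \<Gamma>} = topspace T"
    using assms by (auto simp: LCOSETS_def)
  then have "openin (lcoset_topology G T \<Gamma>) (lcosets\<^bsub>G\<^esub> \<Gamma>)"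
    by (simp add: openin_lcoset_topology)
  then show "lcosets\<^bsub>G\<^esub> \<Gamma> \<subseteq> topspace (lcoset_topology G T \<Gamma>)"
    by (rule openin_subset)
qed

lemma quotient_map_lcoset_topology:
  assumes "topspace T = carrier G"
  shows "quotient_map T (lcoset_topology G T \<Gamma>) (\<lambda>g. g <#\<^bsub>G\<^esub> \<Gamma>)"
  unfolding quotient_map_def topspace_lcoset_topology[OF assms]
  using assms by (auto simp: openin_lcoset_topology LCOSETS_def)

definition borel_of :: "'x topology \<Rightarrow> 'x measure" where
  "borel_of X = sigma (topspace X) {U. openin X U}"

definition haar_on_lcosets ::
    "('g, 'm) monoid_scheme \<Rightarrow> 'g topology \<Rightarrow> 'g set \<Rightarrow> 'g set measure \<Rightarrow> bool" where
  "haar_on_lcosets G T \<Gamma> \<mu> \<longleftrightarrow>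
     prob_space \<mu> \<and> sets \<mu> = sets (borel_of (lcoset_topology G T \<Gamma>)) \<and>
     (\<forall>g\<in>carrier G. distr \<mu> \<mu> (\<lambda>x. g <#\<^bsub>G\<^esub> x) = \<mu>)"


section \<open>The Koopman operator\<close>

text \<open>Elements of \<open>L\<^sup>2\<close> and \<open>L\<^sup>\<infinity>\<close> are represented by measurable functions; equality in these spaces
  is equality almost everywhere.\<close>

definition L2 :: "'x measure \<Rightarrow> ('x \<Rightarrow> complex) set" where
  "L2 \<mu> = {f \<in> borel_measurable \<mu>. integrable \<mu> (\<lambda>x. (cmod (f x))\<^sup>2)}"

definition L_infinity :: "'x measure \<Rightarrow> ('x \<Rightarrow> complex) set" where
  "L_infinity \<mu> = {f \<in> borel_measurable \<mu>. \<exists>C. AE x in \<mu>. cmod (f x) \<le> C}"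

definition L2_inner :: "'x measure \<Rightarrow> ('x \<Rightarrow> complex) \<Rightarrow> ('x \<Rightarrow> complex) \<Rightarrow> complex" where
  "L2_inner \<mu> f h = (\<integral>x. f x * cnj (h x) \<partial>\<mu>)"

text \<open>For a coset \<open>x = g\<Gamma>\<close>, the set \<open>a <# x\<close> is the coset \<open>(ag)\<Gamma>\<close>.\<close>

definition koopman ::
    "('g, 'm) monoid_scheme \<Rightarrow> 'g \<Rightarrow> ('g set \<Rightarrow> complex) \<Rightarrow> 'g set \<Rightarrow> complex" where
  "koopman G a f = (\<lambda>x. f (a <#\<^bsub>G\<^esub> x))"

definition ergodic_translation ::
    "('g, 'm) monoid_scheme \<Rightarrow> 'g set measure \<Rightarrow> 'g \<Rightarrow> bool" where
  "ergodic_translation G \<mu> a \<longleftrightarrow>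
     (\<forall>h\<in>L2 \<mu>. (AE x in \<mu>. koopman G a h x = h x) \<longrightarrow> (\<exists>c. AE x in \<mu>. h x = c))"

definition eigenfunctions ::
    "('g, 'm) monoid_scheme \<Rightarrow> 'g set measure \<Rightarrow> 'g \<Rightarrow> ('g set \<Rightarrow> complex) set" where
  "eigenfunctions G \<mu> a =
     {h \<in> L2 \<mu>. \<not> (AE x in \<mu>. h x = 0) \<and> (\<exists>c. AE x in \<mu>. koopman G a h x = c * h x)}"

definition complex_span :: "('x \<Rightarrow> complex) set \<Rightarrow> ('x \<Rightarrow> complex) set" where
  "complex_span E = {\<lambda>x. \<Sum>h\<in>F. c h * h x | F c. finite F \<and> F \<subseteq> E}"

end

(* Let u be the Koopman operator, written as translation by \<alpha> = a^-1, and suppose that <u^n f, f> does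
   not tend to 0.  Along a suitable ultrafilter u^n f converges weakly to some v with <v, f> \<noteq> 0, and
   v is again orthogonal to all eigenfunctions.  The stabilizer S of v in G is closed.  It is stable
   under a Mautner argument, and it contains the limits of the y_n when s_n y_n is the conjugate of
   some b_n tending to 1 by \<alpha>^n and s_n lies in S.  With the exponential map and induction along the lower
   central series these two properties give that the Lie algebra of S is an ideal modulo which Ad \<alpha>
   acts trivially, so that b and its conjugates by powers of \<alpha> lie in the same coset of S for all b
   near 1.  Hence the orbit (u^n v) is equicontinuous under translation by small elements of G, and by
   averaging over such translations it is precompact in L^2.  A vector with precompact orbit
   that is orthogonal to all eigenvectors is 0, which contradicts <v, f> \<noteq> 0. *)

theory Submission
  imports Defs "HOL-Library.Function_Algebras"
begin

text \<open>The function f itself need not be fixed by any translation; the gain is in the passage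
  to v. If b_n tends to 1, then the conjugate of b_n by \<alpha>^n moves u^n f exactly as far as b_n
  moves f, so whatever these conjugates converge to modulo S must fix the weak limit v. For b_n =
  exp(W / n) this catches Ad \<alpha> W - W: by nilpotency Ad(\<alpha>^n) W is polynomial in n, and
  the induction along the central series leaves only its linear term modulo the Lie algebra of S. As
  G may be disconnected, \<alpha> need not be an exponential; it enters through Ad \<alpha> alone,
  and only elements near 1 are written as exponentials. Smoothness is used to second order only,
  through sequences t_n with n t_n convergent in a chart. In the last step the mean over the orbit
  of the rank-one forms |<w, u^n v>|^2 is an invariant, weakly continuous form. Maximizing it, and
  then Re <u w, w> on the maximal eigenspace, produces an eigenvector of u.\<close>

section \<open>Universal filters\<close>

text \<open>These are the ultrafilters, written as filters so that limits along them are ordinary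
  limits.\<close>

definition universal_filter :: "'a filter \<Rightarrow> bool" where
  "universal_filter F \<longleftrightarrow> F \<noteq> bot \<and> (\<forall>P. eventually P F \<or> eventually (\<lambda>x. \<not> P x) F)"

text \<open>Zorn's lemma for the reversed order: a minimal proper filter decides every
  predicate.\<close>

lemma universal_filter_exists:
  fixes F :: "'a filter"
  assumes "F \<noteq> bot"
  obtains F' where "F' \<le> F" "universal_filter F'"
proof -
  let ?A = "{K. K \<le> F \<and> K \<noteq> bot}"
  let ?P = "\<lambda>a b :: 'a filter. b \<le> a"
  have po: "partial_order_on ?A (relation_of ?P ?A)"
    by (rule partial_order_on_relation_ofI) auto
  have ub: "\<exists>u\<in>?A. \<forall>a\<in>C. ?P a u" if C: "C \<in> Chains (relation_of ?P ?A)" for C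
  proof (cases "C = {}")
    case True
    then show ?thesis using assms by auto
  next
    case False
    have CA: "C \<subseteq> ?A" and ch: "\<And>a b. a \<in> C \<Longrightarrow> b \<in> C \<Longrightarrow> a \<le> b \<or> b \<le> a"
      using C by (auto simp: Chains_def relation_of_def)
    have base: "\<exists>x\<in>C. x \<le> inf a b" if "a \<in> C" "b \<in> C" for a b
      using ch[OF that] that by (metis inf.absorb_iff2 inf.orderE order_refl)
    \<comment> \<open>A chain of filters is a base of its infimum, so \<open>False\<close> would
      already be eventual in one member of the chain.\<close>
    have "\<not> eventually (\<lambda>_. False) (Inf C)"
      using CA by (subst eventually_Inf_base[OF False base]) (auto simp: trivial_limit_def)
    then have "Inf C \<noteq> bot"
      by (simp add: trivial_limit_def)
    moreover obtain K where "K \<in> C" "K \<le> F"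
      using False CA by blast
    then have "Inf C \<le> F"
      by (rule Inf_lower2)
    ultimately show ?thesis
      by (intro bexI[of _ "Inf C"]) (auto intro: Inf_lower)
  qed
  have "\<exists>m\<in>?A. \<forall>a\<in>?A. ?P m a \<longrightarrow> a = m"
    by (rule predicate_Zorn[OF po ub])
  then obtain M where M: "M \<in> ?A" and max: "\<And>K. K \<in> ?A \<Longrightarrow> K \<le> M \<Longrightarrow> K = M"
    by blast
  have MF: "M \<le> F" "M \<noteq> bot"
    using M by auto
  have "eventually P M" if n: "\<not> eventually (\<lambda>x. \<not> P x) M" for P
  proof -
    \<comment> \<open>If the negation of \<open>P\<close> is not eventual, then restricting
      \<open>M\<close> to \<open>P\<close> keeps it proper, and minimality makes the restriction
      equal to \<open>M\<close>.\<close>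
    let ?K = "inf M (principal {x. P x})"
    have "?K \<noteq> bot"
      using n unfolding trivial_limit_def eventually_inf_principal by simp
    moreover have "?K \<le> F"
      by (rule order_trans[OF inf_le1 MF(1)])
    ultimately have "?K = M"
      by (intro max) simp_all
    moreover have "eventually P ?K"
      unfolding eventually_inf_principal by simp
    ultimately show ?thesis
      by simp
  qed
  then have "universal_filter M"
    using MF(2) unfolding universal_filter_def by blast
  with MF(1) show ?thesis
    by (rule that)
qed

text \<open>A cluster point in the compact closure is a limit, because an ultrafilter that does not
  eventually enter an open set eventually avoids it.\<close>

lemma universal_filter_convergent:
  fixes f :: "'a \<Rightarrow> 'b::heine_borel"
  assumes U: "universal_filter F" and b: "bounded (range f)"
  obtains l where "(f \<longlongrightarrow> l) F"
proof -
  have comp: "compact (closure (range f))"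
    using b by (simp add: compact_closure)
  have "filtermap f F \<noteq> bot"
    using U by (auto simp: universal_filter_def trivial_limit_def eventually_filtermap)
  moreover have "eventually (\<lambda>x. x \<in> closure (range f)) (filtermap f F)"
    by (auto simp: eventually_filtermap intro!: always_eventually closure_subset[THEN subsetD])
  ultimately obtain l where l: "inf (nhds l) (filtermap f F) \<noteq> bot"
    using comp unfolding compact_filter by blast
  have "(f \<longlongrightarrow> l) F"
  proof (rule topological_tendstoI)
    fix S assume S: "open S" "l \<in> S"
    show "eventually (\<lambda>x. f x \<in> S) F"
    proof (rule ccontr)
      assume "\<not> ?thesis"
      then have "eventually (\<lambda>x. x \<notin> S) (filtermap f F)"
        using U by (auto simp: universal_filter_def eventually_filtermap)
      moreover have "eventually (\<lambda>x. x \<in> S) (nhds l)"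
        using S by (rule eventually_nhds_in_open)
      ultimately have "eventually (\<lambda>_. False) (inf (nhds l) (filtermap f F))"
        unfolding eventually_inf by blast
      then show False using l by (simp add: trivial_limit_def)
    qed
  qed
  then show ?thesis ..
qed

section \<open>Hilbert space: weak compactness and vectors with precompact orbit\<close>

section \<open>Semi-inner product spaces\<close>

text \<open>The form may be degenerate, as functions stand for their classes modulo null functions.
  The same inequalities then also serve the auxiliary positive forms \<open>kap\<close>,
  \<open>?q\<close> and \<open>?r\<close>; the null vectors of the last two are
  eigenvectors.\<close>

locale semi_ip =
  fixes H :: "'v::ab_group_add set" and sc :: "complex \<Rightarrow> 'v \<Rightarrow> 'v" and ip :: "'v \<Rightarrow> 'v \<Rightarrow> complex"
  assumes zero_H: "0 \<in> H"
    and add_H: "x \<in> H \<Longrightarrow> y \<in> H \<Longrightarrow> x + y \<in> H"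
    and uminus_H: "x \<in> H \<Longrightarrow> - x \<in> H"
    and sc_H: "x \<in> H \<Longrightarrow> sc c x \<in> H"
    and ip_add: "x \<in> H \<Longrightarrow> y \<in> H \<Longrightarrow> z \<in> H \<Longrightarrow> ip (x + y) z = ip x z + ip y z"
    and ip_sc: "x \<in> H \<Longrightarrow> y \<in> H \<Longrightarrow> ip (sc c x) y = c * ip x y"
    and ip_cnj: "x \<in> H \<Longrightarrow> y \<in> H \<Longrightarrow> ip y x = cnj (ip x y)"
    and ip_pos: "x \<in> H \<Longrightarrow> 0 \<le> Re (ip x x)"
begin

definition nrm :: "'v \<Rightarrow> real" where "nrm x = sqrt (Re (ip x x))"

lemma minus_H: "x \<in> H \<Longrightarrow> y \<in> H \<Longrightarrow> x - y \<in> H"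
  using add_H[of x "- y"] uminus_H by simp

lemma ip_zero: "x \<in> H \<Longrightarrow> ip 0 x = 0"
  using ip_add[of 0 0 x] zero_H by simp

lemma ip_uminus: "x \<in> H \<Longrightarrow> y \<in> H \<Longrightarrow> ip (- x) y = - ip x y"
  using ip_add[of x "- x" y] uminus_H[of x] ip_zero[of y] by (simp add: add_eq_0_iff)

lemma ip_diff: "x \<in> H \<Longrightarrow> y \<in> H \<Longrightarrow> z \<in> H \<Longrightarrow> ip (x - y) z = ip x z - ip y z"
  using ip_add[of x "- y" z] uminus_H[of y] ip_uminus[of y z] by simp

lemma ip_add2: "x \<in> H \<Longrightarrow> y \<in> H \<Longrightarrow> z \<in> H \<Longrightarrow> ip z (x + y) = ip z x + ip z y"
  using ip_cnj[of "x + y" z] ip_cnj[of x z] ip_cnj[of y z] ip_add[of x y z] add_H by simp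

lemma ip_diff2: "x \<in> H \<Longrightarrow> y \<in> H \<Longrightarrow> z \<in> H \<Longrightarrow> ip z (x - y) = ip z x - ip z y"
  using ip_cnj[of "x - y" z] ip_cnj[of x z] ip_cnj[of y z] ip_diff[of x y z] minus_H by simp

lemma ip_sc2: "x \<in> H \<Longrightarrow> y \<in> H \<Longrightarrow> ip x (sc c y) = cnj c * ip x y"
  using ip_cnj[of "sc c y" x] ip_cnj[of y x] ip_sc[of y x c] sc_H by simp

lemmas ip_simps = ip_add ip_add2 ip_diff ip_diff2 ip_sc ip_sc2 add_H minus_H sc_H

lemma nrm_sq: "x \<in> H \<Longrightarrow> (nrm x)\<^sup>2 = Re (ip x x)"
  by (simp add: nrm_def ip_pos)

lemma nrm_nonneg: "x \<in> H \<Longrightarrow> 0 \<le> nrm x"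
  by (simp add: nrm_def ip_pos)

lemma ip_self: "x \<in> H \<Longrightarrow> ip x x = of_real ((nrm x)\<^sup>2)"
  using ip_cnj[of x x] by (simp add: nrm_sq complex_eq_iff)

lemma nrm_sq_diff_sc:
  assumes "x \<in> H" "y \<in> H"
  shows "(nrm (x - sc c y))\<^sup>2 = (nrm x)\<^sup>2 - 2 * Re (cnj c * ip x y) + (cmod c)\<^sup>2 * (nrm y)\<^sup>2"
proof -
  have "ip (x - sc c y) (x - sc c y) =
      ip x x - cnj c * ip x y - c * cnj (ip x y) + (c * cnj c) * ip y y"
    using assms ip_cnj[of x y] by (simp add: ip_simps algebra_simps)
  moreover have "Re (c * cnj (ip x y)) = Re (cnj c * ip x y)"
    by simp
  moreover have "Re ((c * cnj c) * ip y y) = (cmod c)\<^sup>2 * (nrm y)\<^sup>2"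
    using assms by (simp add: ip_self complex_norm_square[symmetric] flip: of_real_power)
  ultimately have "Re (ip (x - sc c y) (x - sc c y)) =
      Re (ip x x) - 2 * Re (cnj c * ip x y) + (cmod c)\<^sup>2 * (nrm y)\<^sup>2"
    by (simp only: minus_complex.sel plus_complex.sel)
  then show ?thesis
    using assms by (simp only: nrm_sq minus_H sc_H)
qed

lemma cauchy_schwarz:
  assumes x: "x \<in> H" and y: "y \<in> H"
  shows "cmod (ip x y) \<le> nrm x * nrm y"
proof -
  \<comment> \<open>Expand |x - t <x, y> y|^2 >= 0; this choice of the scalar makes the cross term
    real.\<close>
  have *: "2 * t * (cmod (ip x y))\<^sup>2 \<le> (nrm x)\<^sup>2 + t\<^sup>2 * (cmod (ip x y))\<^sup>2 * (nrm y)\<^sup>2" for t :: real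
  proof -
    let ?c = "of_real t * ip x y"
    have "cnj ?c * ip x y = of_real (t * (cmod (ip x y))\<^sup>2)"
      by (simp add: complex_norm_square mult_ac flip: of_real_power)
    then have "Re (cnj ?c * ip x y) = t * (cmod (ip x y))\<^sup>2" by (metis Re_complex_of_real)
    moreover have "(cmod ?c)\<^sup>2 = t\<^sup>2 * (cmod (ip x y))\<^sup>2"
      by (simp add: norm_mult power_mult_distrib)
    moreover have "0 \<le> (nrm (x - sc ?c y))\<^sup>2" by simp
    ultimately show ?thesis
      unfolding nrm_sq_diff_sc[OF x y] by (simp add: algebra_simps)
  qed
  show ?thesis
  proof (cases "nrm y = 0")
    case True
    have "cmod (ip x y) = 0"
    proof (rule ccontr)
      assume n: "cmod (ip x y) \<noteq> 0"
      \<comment> \<open>With |y| = 0 the bound \<open>*\<close> is linear in t, and a large t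
        refutes it.\<close>
      have "2 * (((nrm x)\<^sup>2 + 1) / (cmod (ip x y))\<^sup>2) * (cmod (ip x y))\<^sup>2 \<le> (nrm x)\<^sup>2"
        using *[of "((nrm x)\<^sup>2 + 1) / (cmod (ip x y))\<^sup>2"] True by simp
      then show False using n by (simp add: not_le) (smt (verit) zero_le_power2)
    qed
    then show ?thesis using True by simp
  next
    case False
    have "2 * (1 / (nrm y)\<^sup>2) * (cmod (ip x y))\<^sup>2
        \<le> (nrm x)\<^sup>2 + (1 / (nrm y)\<^sup>2) * (cmod (ip x y))\<^sup>2"
      using *[of "1 / (nrm y)\<^sup>2"] False by (simp add: power2_eq_square)
    then have "(cmod (ip x y))\<^sup>2 / (nrm y)\<^sup>2 \<le> (nrm x)\<^sup>2"
      by (simp add: field_simps)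
    then have "(cmod (ip x y))\<^sup>2 \<le> (nrm x * nrm y)\<^sup>2"
      using False by (simp add: field_simps power_mult_distrib)
    then show ?thesis
      using nrm_nonneg x y by (meson mult_nonneg_nonneg power2_le_imp_le)
  qed
qed

lemma nrm_triangle:
  assumes x: "x \<in> H" and y: "y \<in> H"
  shows "nrm (x + y) \<le> nrm x + nrm y"
proof -
  have "(nrm (x + y))\<^sup>2 = (nrm x)\<^sup>2 + 2 * Re (ip x y) + (nrm y)\<^sup>2"
    using assms ip_cnj[of x y] by (simp add: nrm_sq ip_simps)
  also have "\<dots> \<le> (nrm x)\<^sup>2 + 2 * (nrm x * nrm y) + (nrm y)\<^sup>2"
    using cauchy_schwarz[OF x y] complex_Re_le_cmod[of "ip x y"] by simp
  also have "\<dots> = (nrm x + nrm y)\<^sup>2"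
    by (simp add: power2_eq_square algebra_simps)
  finally show ?thesis
    using nrm_nonneg x y by (meson add_nonneg_nonneg power2_le_imp_le)
qed

lemma nrm_uminus: "x \<in> H \<Longrightarrow> nrm (- x) = nrm x"
  using ip_uminus[of x "- x"] ip_cnj[of "- x" x] ip_uminus[of x x] uminus_H[of x] ip_cnj[of x x]
  by (simp add: nrm_def)

lemma nrm_minus_commute: "x \<in> H \<Longrightarrow> y \<in> H \<Longrightarrow> nrm (x - y) = nrm (y - x)"
  using nrm_uminus[of "x - y"] minus_H by simp

lemma nrm_sc:
  assumes x: "x \<in> H"
  shows "nrm (sc c x) = cmod c * nrm x"
proof -
  have "ip (sc c x) (sc c x) = of_real ((cmod c)\<^sup>2 * (nrm x)\<^sup>2)"
    using x ip_self[OF x] complex_norm_square[of c] by (simp add: ip_sc ip_sc2 sc_H mult_ac)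
  then have "Re (ip (sc c x) (sc c x)) = (cmod c * nrm x)\<^sup>2"
    by (simp only: Re_complex_of_real power_mult_distrib)
  then show ?thesis
    unfolding nrm_def[of "sc c x"] using nrm_nonneg[OF x] by simp
qed

lemma nrm_triangle3: "x \<in> H \<Longrightarrow> y \<in> H \<Longrightarrow> z \<in> H \<Longrightarrow> nrm (x - z) \<le> nrm (x - y) + nrm (y - z)"
  using nrm_triangle[of "x - y" "y - z"] minus_H by simp

lemma nrm_zero: "nrm 0 = 0"
  using ip_zero[OF zero_H] by (simp add: nrm_def)

text \<open>Null vectors of a positive form lie in its radical. This turns an extremal vector of a
  quadratic form into the solution of a linear equation, which is how eigenvectors are found in
  \<open>orbit_null\<close>.\<close>

lemma ip_eq_0_if_nrm_0:
  assumes "x \<in> H" "y \<in> H" "nrm x = 0"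
  shows "ip x y = 0" "ip y x = 0"
  using cauchy_schwarz[OF assms(1,2)] cauchy_schwarz[OF assms(2,1)] assms(3) by auto

lemma ip_cong_nrm_0:
  assumes "x \<in> H" "x' \<in> H" "y \<in> H" "nrm (x - x') = 0"
  shows "ip x y = ip x' y"
  using ip_eq_0_if_nrm_0(1)[of "x - x'" y] assms ip_diff minus_H by simp

lemma nrm_reverse: "x \<in> H \<Longrightarrow> y \<in> H \<Longrightarrow> \<bar>nrm x - nrm y\<bar> \<le> nrm (x - y)"
  using nrm_triangle[of "x - y" y] nrm_triangle[of "y - x" x] minus_H nrm_minus_commute[of x y]
  by force

lemma nrm_tendsto:
  assumes "\<And>i. X i \<in> H" "x \<in> H" "((\<lambda>i. nrm (X i - x)) \<longlongrightarrow> 0) F"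
  shows "((\<lambda>i. nrm (X i)) \<longlongrightarrow> nrm x) F"
  by (rule LIM_zero_cancel, rule Lim_null_comparison[OF _ assms(3)])
    (use nrm_reverse assms in auto)

lemma ip_bound_diff:
  assumes "x \<in> H" "x' \<in> H" "y \<in> H" "y' \<in> H"
  shows "cmod (ip x y - ip x' y') \<le> nrm (x - x') * nrm y + nrm x' * nrm (y - y')"
proof -
  have "ip x y - ip x' y' = ip (x - x') y + ip x' (y - y')"
    using assms by (simp add: ip_simps)
  then show ?thesis
    using cauchy_schwarz[of "x - x'" y] cauchy_schwarz[of x' "y - y'"] assms minus_H
    by (metis add_mono norm_triangle_le)
qed

end

text \<open>Vanishing of the first variation: near t = 0 the linear term dominates. The constant is
  enlarged to |c| + 1 so that one can divide by it whatever the sign of c.\<close>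

lemma quadratic_bound_imp_eq:
  fixes a b c :: real
  assumes *: "\<And>t. 2 * t * (a - b) \<le> t\<^sup>2 * c"
  shows "b = a"
proof (rule ccontr)
  assume n: "b \<noteq> a"
  define K where "K = \<bar>c\<bar> + 1"
  have K: "K > 0" "c < K" by (auto simp: K_def)
  have "2 * ((a - b) / K) * (a - b) \<le> ((a - b) / K)\<^sup>2 * c" by (rule *)
  also have "\<dots> \<le> ((a - b) / K)\<^sup>2 * K" using K by (intro mult_left_mono) auto
  finally have "2 * ((a - b) / K) * (a - b) \<le> ((a - b) / K)\<^sup>2 * K" .
  moreover have "2 * ((a - b) / K) * (a - b) = 2 * (a - b)\<^sup>2 / K"
    by (simp only: power2_eq_square times_divide_eq_left times_divide_eq_right mult.assoc)
  moreover have "((a - b) / K)\<^sup>2 * K = (a - b)\<^sup>2 / K"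
    using K by (simp add: power2_eq_square)
  ultimately have "2 * (a - b)\<^sup>2 / K \<le> (a - b)\<^sup>2 / K"
    by argo
  then have "2 * (a - b)\<^sup>2 \<le> (a - b)\<^sup>2"
    using K by (simp add: divide_le_cancel)
  moreover have "(a - b)\<^sup>2 > 0" using n by simp
  ultimately show False by linarith
qed

locale semi_hilbert = semi_ip +
  assumes complete:
    "(\<And>n. X n \<in> H) \<Longrightarrow> (\<And>e. 0 < e \<Longrightarrow> \<exists>N. \<forall>m\<ge>N. \<forall>n\<ge>N. nrm (X m - X n) < e)
      \<Longrightarrow> \<exists>x\<in>H. (\<lambda>n. nrm (X n - x)) \<longlonglongrightarrow> 0"
begin

text \<open>\<open>L\<close> is conjugate-linear because \<open>ip\<close> is so in its second
  argument. The proof is variational and works on the carrier set with its degenerate form.\<close>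

lemma riesz:
  assumes add: "\<And>y z. y \<in> H \<Longrightarrow> z \<in> H \<Longrightarrow> L (y + z) = L y + L z"
    and sc: "\<And>y c. y \<in> H \<Longrightarrow> L (sc c y) = cnj c * L y"
    and bd: "\<And>y. y \<in> H \<Longrightarrow> cmod (L y) \<le> R * nrm y"
  obtains x where "x \<in> H" "\<And>y. y \<in> H \<Longrightarrow> ip x y = L y"
proof -
  \<comment> \<open>Up to the constant |x|^2 this is |y - x|^2 for the vector x to be found, so x is
    sought as a minimizer.\<close>
  define J where "J y = (nrm y)\<^sup>2 - 2 * Re (L y)" for y
  have Jlow: "- (R\<^sup>2) \<le> J y" if "y \<in> H" for y
  proof -
    have "Re (L y) \<le> R * nrm y"
      using bd[OF that] complex_Re_le_cmod order_trans by blast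
    moreover have "0 \<le> (nrm y - R)\<^sup>2" by simp
    ultimately show ?thesis
      unfolding J_def by (simp add: power2_eq_square algebra_simps)
  qed
  define d where "d = Inf (J ` H)"
  have bb: "bdd_below (J ` H)"
    using Jlow by (intro bdd_belowI2[of _ "- (R\<^sup>2)"]) auto
  have d_le: "d \<le> J y" if "y \<in> H" for y
    unfolding d_def using bb that by (auto intro: cInf_lower)
  have "\<exists>y\<in>H. J y < d + 1 / (Suc n)" for n
  proof -
    have "Inf (J ` H) < d + 1 / (Suc n)"
      by (simp add: d_def)
    then show ?thesis
      using zero_H by (subst (asm) cInf_less_iff[OF _ bb]) auto
  qed
  then obtain Y where Y: "\<And>n. Y n \<in> H" "\<And>n. J (Y n) < d + 1 / (Suc n)"
    by metis
  \<comment> \<open>Parallelogram law: the midpoint has \<open>J\<close> at least d, so two almost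
    minimal vectors are close to each other.\<close>
  have par: "(nrm (Y m - Y n))\<^sup>2 \<le> 2 / Suc m + 2 / Suc n" for m n
  proof -
    let ?h = "sc (1/2) (Y m + Y n)"
    have gen: "2 * a + 2 * b - 4 * c \<le> 2 * (d + p) + 2 * (d + q) - 4 * d"
      if "a < d + p" "b < d + q" "d \<le> c" for a b c p q :: real
      using that by argo
    have h: "?h \<in> H" using Y by (simp add: sc_H add_H)
    have "(nrm ?h)\<^sup>2 = (nrm (Y m + Y n))\<^sup>2 / 4"
      using Y by (simp add: nrm_sc add_H power_divide norm_divide)
    moreover have "(nrm (Y m + Y n))\<^sup>2 + (nrm (Y m - Y n))\<^sup>2 = 2 * (nrm (Y m))\<^sup>2 + 2 * (nrm (Y n))\<^sup>2"
      using Y by (simp add: nrm_sq ip_simps)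
    moreover have "Re (L ?h) = (Re (L (Y m)) + Re (L (Y n))) / 2"
      using Y by (simp add: sc add add_H)
    ultimately have "(nrm (Y m - Y n))\<^sup>2 = 2 * J (Y m) + 2 * J (Y n) - 4 * J ?h"
      by (simp add: J_def)
    also have "\<dots> \<le> 2 * (d + 1 / Suc m) + 2 * (d + 1 / Suc n) - 4 * d"
      by (rule gen[OF Y(2)[of m] Y(2)[of n] d_le[OF h]])
    finally show ?thesis by simp
  qed
  have "\<exists>N. \<forall>m\<ge>N. \<forall>n\<ge>N. nrm (Y m - Y n) < e" if "0 < e" for e :: real
  proof -
    obtain N :: nat where N: "4 / e\<^sup>2 < N"
      using reals_Archimedean2 by blast
    have "nrm (Y m - Y n) < e" if mn: "m \<ge> N" "n \<ge> N" for m n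
    proof -
      have "4 / e\<^sup>2 < Suc N" using N by simp
      then have "4 / real (Suc N) < e\<^sup>2"
        using \<open>0 < e\<close> by (simp add: field_simps)
      moreover have "2 / real (Suc m) \<le> 2 / real (Suc N)" "2 / real (Suc n) \<le> 2 / real (Suc N)"
        using mn by (auto simp: field_simps)
      ultimately have "(nrm (Y m - Y n))\<^sup>2 < e\<^sup>2"
        using par[of m n] by argo
      then show ?thesis
        using \<open>0 < e\<close> by (simp add: power_less_imp_less_base)
    qed
    then show ?thesis by blast
  qed
  then obtain x where x: "x \<in> H" and lim: "(\<lambda>n. nrm (Y n - x)) \<longlonglongrightarrow> 0"
    using complete Y(1) by blast
  have diffL: "L (y - z) = L y - L z" if "y \<in> H" "z \<in> H" for y z
    using add[of "y - z" z] that minus_H by simp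
  have limn: "(\<lambda>n. nrm (Y n)) \<longlonglongrightarrow> nrm x"
    using Y(1) x by (intro nrm_tendsto lim)
  have limL: "(\<lambda>n. L (Y n)) \<longlonglongrightarrow> L x"
  proof (rule LIM_zero_cancel, rule Lim_null_comparison)
    show "\<forall>\<^sub>F n in sequentially. norm (L (Y n) - L x) \<le> R * nrm (Y n - x)"
      using Y(1) x bd[OF minus_H] by (auto simp: diffL)
    show "(\<lambda>n. R * nrm (Y n - x)) \<longlonglongrightarrow> 0"
      using tendsto_mult_left[OF lim, of R] by simp
  qed
  have Jx: "J x = d"
  proof (rule antisym)
    have l1: "(\<lambda>n. J (Y n)) \<longlonglongrightarrow> J x"
      unfolding J_def by (intro tendsto_intros limn limL)
    have l2: "(\<lambda>n. d + 1 / Suc n) \<longlonglongrightarrow> d + 0"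
      by (rule tendsto_add[OF tendsto_const LIMSEQ_Suc[OF lim_1_over_n]])
    show "J x \<le> d"
      using LIMSEQ_le[OF l1 l2] Y(2) by (auto intro: less_imp_le)
  qed (rule d_le[OF x])
  have ReL: "Re (ip x y) = Re (L y)" if y: "y \<in> H" for y
  proof -
    have *: "2 * t * (Re (L y) - Re (ip x y)) \<le> t\<^sup>2 * (nrm y)\<^sup>2" for t :: real
    proof -
      let ?z = "x - sc (of_real (- t)) y"
      have z: "?z \<in> H" using x y by (simp add: ip_simps)
      have "J ?z = (nrm x)\<^sup>2 + 2 * t * Re (ip x y) + t\<^sup>2 * (nrm y)\<^sup>2 - 2 * Re (L x) - 2 * t * Re (L y)"
        using x y unfolding J_def nrm_sq_diff_sc[OF x y]
        by (simp add: diffL sc sc_H algebra_simps)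
      moreover have "d \<le> J ?z" by (rule d_le[OF z])
      ultimately show ?thesis
        using Jx by (simp add: J_def algebra_simps)
    qed
    show ?thesis
      by (rule quadratic_bound_imp_eq[OF *])
  qed
  have "ip x y = L y" if y: "y \<in> H" for y
  proof (rule complex_eqI)
    show "Re (ip x y) = Re (L y)" by (rule ReL[OF y])
    \<comment> \<open>The real part at i y is the imaginary part at y.\<close>
    have "Re (ip x (sc \<i> y)) = Re (L (sc \<i> y))"
      using y by (intro ReL sc_H)
    then show "Im (ip x y) = Im (L y)"
      using x y by (simp add: ip_simps sc)
  qed
  with x show ?thesis by (rule that)
qed

text \<open>Along an ultrafilter every bounded scalar sequence converges, so the functional of
  limits exists on all of \<open>H\<close> at once and Riesz represents it; this replaces a choice
  of subsequences.\<close>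

lemma weak_limit:
  assumes F: "universal_filter F" and X: "\<And>i. X i \<in> H" and R: "\<And>i. nrm (X i) \<le> R"
  obtains x where "x \<in> H" "nrm x \<le> R" "\<And>y. y \<in> H \<Longrightarrow> ((\<lambda>i. ip (X i) y) \<longlongrightarrow> ip x y) F"
proof -
  have nb: "F \<noteq> bot" using F by (simp add: universal_filter_def)
  have bd: "cmod (ip (X i) y) \<le> R * nrm y" if "y \<in> H" for y i
    using cauchy_schwarz[OF X that] R[of i] nrm_nonneg[OF that]
    by (meson mult_right_mono order_trans)
  have "\<exists>l. ((\<lambda>i. ip (X i) y) \<longlongrightarrow> l) F" if "y \<in> H" for y
  proof -
    have "bounded (range (\<lambda>i. ip (X i) y))"
      using bd[OF that] by (intro boundedI[of _ "R * nrm y"]) auto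
    then show ?thesis
      by (rule universal_filter_convergent[OF F]) blast
  qed
  then obtain L where L: "\<And>y. y \<in> H \<Longrightarrow> ((\<lambda>i. ip (X i) y) \<longlongrightarrow> L y) F"
    by metis
  have Lbd: "cmod (L y) \<le> R * nrm y" if "y \<in> H" for y
    using tendsto_norm[OF L[OF that]] bd[OF that] nb
    by (intro tendsto_upperbound[of "\<lambda>i. cmod (ip (X i) y)" _ F]) auto
  obtain x where x: "x \<in> H" "\<And>y. y \<in> H \<Longrightarrow> ip x y = L y"
  proof (rule riesz[of L R])
    fix y z assume yz: "y \<in> H" "z \<in> H"
    have "((\<lambda>i. ip (X i) (y + z)) \<longlongrightarrow> L y + L z) F"
      using tendsto_add[OF L[OF yz(1)] L[OF yz(2)]] yz X by (simp add: ip_simps)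
    then show "L (y + z) = L y + L z"
      using L[OF add_H[OF yz]] nb tendsto_unique by blast
  next
    fix y c assume y: "y \<in> H"
    have "((\<lambda>i. ip (X i) (sc c y)) \<longlongrightarrow> cnj c * L y) F"
      using tendsto_mult_left[OF L[OF y], of "cnj c"] y X by (simp add: ip_simps)
    then show "L (sc c y) = cnj c * L y"
      using L[OF sc_H[OF y]] nb tendsto_unique by blast
  qed (use Lbd in auto)
  have "(nrm x)\<^sup>2 \<le> R * nrm x"
    using Lbd[OF x(1)] x ip_self[OF x(1)] by (simp add: norm_power nrm_nonneg)
  moreover have "0 \<le> R"
    using R X nrm_nonneg order_trans by blast
  ultimately have "nrm x \<le> R"
    using nrm_nonneg[OF x(1)] by (cases "nrm x = 0") (auto simp: power2_eq_square)
  then show ?thesis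
    by (intro that[of x]) (use x L in auto)
qed

end

section \<open>Means along a filter\<close>

text \<open>An ultrafilter limit of Cesaro averages, hence a shift-invariant mean on bounded
  sequences.\<close>

definition mean :: "nat filter \<Rightarrow> (nat \<Rightarrow> complex) \<Rightarrow> complex" where
  "mean F f = Lim F (\<lambda>N. (\<Sum>n<N. f n) / of_nat N)"

locale mean_filter =
  fixes F :: "nat filter"
  assumes univ: "universal_filter F" and le_seq: "F \<le> sequentially"
begin

lemma nb: "F \<noteq> bot"
  using univ by (simp add: universal_filter_def)

lemma average_bound:
  assumes "\<And>n. cmod (f n) \<le> B"
  shows "cmod ((\<Sum>n<N. f n) / of_nat N) \<le> B"
proof -
  have "0 \<le> B" using assms[of 0] norm_ge_zero order_trans by blast
  have "cmod (\<Sum>n<N. f n) \<le> real N * B"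
    using sum_norm_bound[of "{..<N}" f B] assms by simp
  then show ?thesis
    using \<open>0 \<le> B\<close> by (cases "N = 0") (auto simp: norm_divide field_simps)
qed

lemma mean_tendsto:
  assumes "\<And>n. cmod (f n) \<le> B"
  shows "((\<lambda>N. (\<Sum>n<N. f n) / of_nat N) \<longlongrightarrow> mean F f) F"
proof -
  have "bounded (range (\<lambda>N. (\<Sum>n<N. f n) / of_nat N))"
    using average_bound[OF assms] by (intro boundedI[of _ B]) auto
  then obtain l where l: "((\<lambda>N. (\<Sum>n<N. f n) / of_nat N) \<longlongrightarrow> l) F"
    by (rule universal_filter_convergent[OF univ])
  then have "mean F f = l"
    unfolding mean_def using nb by (intro tendsto_Lim)
  with l show ?thesis by simp
qed

lemma mean_eqI:
  "((\<lambda>N. (\<Sum>n<N. f n) / of_nat N) \<longlongrightarrow> l) F \<Longrightarrow> mean F f = l"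
  unfolding mean_def using nb by (rule tendsto_Lim)

lemma mean_add:
  assumes "\<And>n. cmod (f n) \<le> B" "\<And>n. cmod (g n) \<le> C"
  shows "mean F (\<lambda>n. f n + g n) = mean F f + mean F g"
  using tendsto_add[OF mean_tendsto[OF assms(1)] mean_tendsto[OF assms(2)]]
  by (intro mean_eqI) (simp add: sum.distrib add_divide_distrib)

lemma mean_sum:
  assumes "finite J" "\<And>j n. j \<in> J \<Longrightarrow> cmod (f j n) \<le> B"
  shows "mean F (\<lambda>n. \<Sum>j\<in>J. f j n) = (\<Sum>j\<in>J. mean F (f j))"
  using assms
proof (induction J)
  case empty
  have "mean F (\<lambda>n. 0) = 0" by (rule mean_eqI) simp
  then show ?case by simp
next
  case (insert j J)
  have "cmod (\<Sum>j\<in>J. f j n) \<le> of_nat (card J) * B" for n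
    using insert.prems by (intro sum_norm_bound) auto
  then have "mean F (\<lambda>n. f j n + (\<Sum>j\<in>J. f j n)) = mean F (f j) + mean F (\<lambda>n. \<Sum>j\<in>J. f j n)"
    using insert.prems by (intro mean_add) auto
  with insert show ?case by simp
qed

lemma mean_cmult:
  assumes "\<And>n. cmod (f n) \<le> B"
  shows "mean F (\<lambda>n. c * f n) = c * mean F f"
  using tendsto_mult_left[OF mean_tendsto[OF assms(1)], of c]
  by (intro mean_eqI) (simp add: sum_distrib_left)

lemma mean_cnj:
  assumes "\<And>n. cmod (f n) \<le> B"
  shows "mean F (\<lambda>n. cnj (f n)) = cnj (mean F f)"
  using tendsto_cnj[OF mean_tendsto[OF assms(1)]]
  by (intro mean_eqI) simp

lemma mean_bound:
  assumes "\<And>n. cmod (f n) \<le> B"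
  shows "cmod (mean F f) \<le> B"
proof (rule tendsto_upperbound[OF _ _ nb])
  show "((\<lambda>N. cmod ((\<Sum>n<N. f n) / of_nat N)) \<longlongrightarrow> cmod (mean F f)) F"
    by (rule tendsto_norm[OF mean_tendsto[OF assms]])
qed (use average_bound[OF assms] in auto)

lemma mean_Re_ge:
  assumes "\<And>n. cmod (f n) \<le> B" "\<And>n. b \<le> Re (f n)"
  shows "b \<le> Re (mean F f)"
proof (rule tendsto_lowerbound[OF _ _ nb])
  show "((\<lambda>N. Re ((\<Sum>n<N. f n) / of_nat N)) \<longlongrightarrow> Re (mean F f)) F"
    by (rule tendsto_Re[OF mean_tendsto[OF assms(1)]])
  \<comment> \<open>The average at N = 0 is 0 by division by zero and may violate the bound, hence N
    > 0, which \<open>le_seq\<close> makes eventual.\<close>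
  have "eventually (\<lambda>N. b \<le> Re ((\<Sum>n<N. f n) / of_nat N)) sequentially"
    using eventually_gt_at_top[of 0]
  proof eventually_elim
    case (elim N)
    have "real N * b \<le> (\<Sum>n<N. Re (f n))"
      using sum_mono[of "{..<N}" "\<lambda>_. b" "\<lambda>n. Re (f n)"] assms(2) by simp
    then show ?case
      using elim by (simp add: Re_divide_of_nat field_simps)
  qed
  then show "eventually (\<lambda>N. b \<le> Re ((\<Sum>n<N. f n) / of_nat N)) F"
    using le_seq by (simp add: le_filter_def)
qed

text \<open>The averages of a sequence and of its shift differ by a boundary term of size at most 2
  B / N.\<close>

lemma mean_shift:
  assumes "\<And>n. cmod (f n) \<le> B"
  shows "mean F (\<lambda>n. f (Suc n)) = mean F f"
proof (rule mean_eqI)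
  have B: "0 \<le> B" using assms[of 0] norm_ge_zero order_trans by blast
  have *: "(\<Sum>n<N. f (Suc n)) = (\<Sum>n<N. f n) + (f N - f 0)" for N
    by (induction N) auto
  have "((\<lambda>N. (f N - f 0) / of_nat N) \<longlongrightarrow> 0) sequentially"
  proof (rule Lim_null_comparison)
    show "\<forall>\<^sub>F N in sequentially. norm ((f N - f 0) / of_nat N) \<le> (2 * B) * (1 / real N)"
    proof (intro always_eventually allI)
      fix N
      have "cmod (f N - f 0) \<le> 2 * B"
        using norm_triangle_ineq4[of "f N" "f 0"] assms[of N] assms[of 0] by linarith
      then show "norm ((f N - f 0) / of_nat N) \<le> (2 * B) * (1 / real N)"
        by (simp add: norm_divide divide_right_mono)
    qed
    show "((\<lambda>N. (2 * B) * (1 / real N)) \<longlongrightarrow> 0) sequentially"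
      using tendsto_mult_left[OF lim_1_over_n, of "2 * B"] by simp
  qed
  then have "((\<lambda>N. (f N - f 0) / of_nat N) \<longlongrightarrow> 0) F"
    using le_seq tendsto_mono by blast
  from tendsto_add[OF mean_tendsto[OF assms] this]
  show "((\<lambda>N. (\<Sum>n<N. f (Suc n)) / of_nat N) \<longlongrightarrow> mean F f) F"
    by (simp add: * add_divide_distrib)
qed

end

section \<open>Precompact orbits of a unitary operator\<close>

text \<open>That \<open>V'\<close> inverts \<open>V\<close> is expressed by \<open>iso\<close> and
  \<open>iso'\<close>, because for translations of functions the composites fix a vector only up to
  a null vector.\<close>

locale unitary_op = semi_hilbert +
  fixes V V' :: "'a \<Rightarrow> 'a"
  assumes V_H: "x \<in> H \<Longrightarrow> V x \<in> H" and V'_H: "x \<in> H \<Longrightarrow> V' x \<in> H"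
    and adj: "x \<in> H \<Longrightarrow> y \<in> H \<Longrightarrow> ip (V x) y = ip x (V' y)"
    and iso: "x \<in> H \<Longrightarrow> y \<in> H \<Longrightarrow> ip (V x) (V y) = ip x y"
    and iso': "x \<in> H \<Longrightarrow> y \<in> H \<Longrightarrow> ip (V' x) (V' y) = ip x y"
begin

definition eigen :: "complex \<Rightarrow> 'a \<Rightarrow> bool" where
  "eigen c h \<longleftrightarrow> h \<in> H \<and> nrm (V h - sc c h) = 0"

definition E_perp :: "'a set" where
  "E_perp = {w \<in> H. \<forall>c h. eigen c h \<longrightarrow> ip w h = 0}"

lemma adj': "x \<in> H \<Longrightarrow> y \<in> H \<Longrightarrow> ip (V' x) y = ip x (V y)"
  using adj[of y x] ip_cnj[of "V y" x] ip_cnj[of y "V' x"] V_H V'_H by simp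

lemma ip_V_sc: "x \<in> H \<Longrightarrow> y \<in> H \<Longrightarrow> ip (V (sc c x)) y = c * ip (V x) y"
  by (simp add: adj ip_simps V'_H)

lemma null_iff: "x \<in> H \<Longrightarrow> nrm x = 0 \<longleftrightarrow> (\<forall>y\<in>H. ip x y = 0)"
  using ip_eq_0_if_nrm_0(1)[of x] nrm_def[of x] by force

lemma eigenI:
  assumes "h \<in> H" "\<And>y. y \<in> H \<Longrightarrow> ip (V h) y = c * ip h y"
  shows "eigen c h"
  unfolding eigen_def using assms by (subst null_iff) (auto simp: ip_simps V_H)

lemma eigen_H: "eigen c h \<Longrightarrow> h \<in> H"
  by (simp add: eigen_def)

lemma eigenD:
  assumes "eigen c h" "y \<in> H"
  shows "ip (V h) y = c * ip h y"
proof -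
  have h: "h \<in> H" using assms by (simp add: eigen_def)
  then have "ip (V h - sc c h) y = 0"
    using assms by (intro ip_eq_0_if_nrm_0) (auto simp: eigen_def ip_simps V_H)
  then show ?thesis
    using h assms by (simp add: ip_simps V_H)
qed

lemma eigen_V:
  assumes e: "eigen c h"
  shows "eigen c (V h)"
proof (rule eigenI)
  show "V h \<in> H" using V_H[OF eigen_H[OF e]] .
  fix y assume "y \<in> H"
  then show "ip (V (V h)) y = c * ip (V h) y"
    using adj[OF V_H[OF eigen_H[OF e]], of y] adj[OF eigen_H[OF e], of y] eigenD[OF e, of "V' y"]
    by (simp add: V'_H)
qed

lemma eigen_V':
  assumes e: "eigen c h"
  shows "eigen c (V' h)"
proof (rule eigenI)
  have h: "h \<in> H" by (rule eigen_H[OF e])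
  show "V' h \<in> H" using h V'_H by blast
  fix y assume y: "y \<in> H"
  have "ip (V (V' h)) y = ip h y"
    using h y by (simp add: adj V'_H iso')
  also have "\<dots> = ip (V h) (V y)" using h y by (simp add: iso)
  also have "\<dots> = c * ip h (V y)" using eigenD[OF e] y V_H by blast
  also have "\<dots> = c * ip (V' h) y" using h y by (simp add: adj')
  finally show "ip (V (V' h)) y = c * ip (V' h) y" .
qed

lemma E_perp_H: "w \<in> E_perp \<Longrightarrow> w \<in> H"
  by (simp add: E_perp_def)

lemma E_perpD: "w \<in> E_perp \<Longrightarrow> eigen c h \<Longrightarrow> ip w h = 0"
  by (simp add: E_perp_def)

lemma E_perpI: "w \<in> H \<Longrightarrow> (\<And>c h. eigen c h \<Longrightarrow> ip w h = 0) \<Longrightarrow> w \<in> E_perp"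
  by (simp add: E_perp_def)

lemma E_perp_V: "w \<in> E_perp \<Longrightarrow> V w \<in> E_perp"
  using E_perpD[OF _ eigen_V'] by (intro E_perpI) (auto simp: V_H adj eigen_H E_perp_H)

lemma E_perp_V': "w \<in> E_perp \<Longrightarrow> V' w \<in> E_perp"
  using E_perpD[OF _ eigen_V] by (intro E_perpI) (auto simp: V'_H adj' eigen_H E_perp_H)

lemma E_perp_closed:
  shows "0 \<in> E_perp" "x \<in> E_perp \<Longrightarrow> y \<in> E_perp \<Longrightarrow> x + y \<in> E_perp"
    "x \<in> E_perp \<Longrightarrow> - x \<in> E_perp" "x \<in> E_perp \<Longrightarrow> sc c x \<in> E_perp"
    "x \<in> E_perp \<Longrightarrow> y \<in> E_perp \<Longrightarrow> x - y \<in> E_perp"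
  using zero_H by (auto simp: E_perp_def ip_zero ip_simps uminus_H ip_uminus eigen_def)

lemma nrm_V: "x \<in> H \<Longrightarrow> nrm (V x) = nrm x"
  by (simp add: nrm_def iso)

lemma nrm_V_diff: "x \<in> H \<Longrightarrow> y \<in> H \<Longrightarrow> nrm (V x - V y) = nrm (x - y)"
  by (simp add: nrm_def ip_simps iso V_H)

end

locale precompact_orbit = unitary_op + mean_filter +
  fixes v
  assumes v_H: "v \<in> H"
    and tb: "0 < e \<Longrightarrow> \<exists>D. finite D \<and> D \<subseteq> H \<and> (\<forall>n. \<exists>d\<in>D. nrm ((V ^^ n) v - d) < e)"
begin

abbreviation "orb n \<equiv> (V ^^ n) v"

lemma orb_H: "orb n \<in> H"
  by (induction n) (auto simp: v_H V_H)

lemma nrm_orb: "nrm (orb n) = nrm v"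
  by (induction n) (auto simp: nrm_V orb_H)

lemma ip_orb_bound: "x \<in> H \<Longrightarrow> cmod (ip x (orb n)) \<le> nrm x * nrm v"
  using cauchy_schwarz[of x "orb n"] orb_H nrm_orb by simp

text \<open>The mean over the orbit of the rank-one forms given by V^n v. It is the form of a
  positive operator that commutes with \<open>V\<close> by shift invariance and is compact because
  the orbit is totally bounded.\<close>

definition kap where "kap w z = mean F (\<lambda>n. ip w (orb n) * cnj (ip z (orb n)))"

lemma term_bound:
  assumes "z \<in> H" "\<And>n. cmod (ip w (orb n)) \<le> B"
  shows "cmod (ip w (orb n) * cnj (ip z (orb n))) \<le> B * (nrm z * nrm v)"
  using assms(2)[of n] ip_orb_bound[OF assms(1), of n]
  by (simp add: norm_mult) (meson mult_mono norm_ge_zero order_trans)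

lemmas term_bound' = term_bound[OF _ ip_orb_bound]

lemma kap_bound:
  assumes "z \<in> H" "\<And>n. cmod (ip w (orb n)) \<le> B"
  shows "cmod (kap w z) \<le> B * (nrm z * nrm v)"
  unfolding kap_def by (rule mean_bound[OF term_bound[OF assms]])

sublocale K: semi_ip H sc kap
proof
  fix x y z c
  show "kap (x + y) z = kap x z + kap y z" if "x \<in> H" "y \<in> H" "z \<in> H"
    using that mean_add[OF term_bound'[of z x] term_bound'[of z y]]
    by (simp add: kap_def ip_simps orb_H ring_distribs)
  show "kap (sc c x) y = c * kap x y" if "x \<in> H" "y \<in> H"
    using that mean_cmult[OF term_bound'[of y x], of c]
    by (simp add: kap_def ip_simps orb_H mult.assoc)
  show "kap y x = cnj (kap x y)" if "x \<in> H" "y \<in> H"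
    using that mean_cnj[OF term_bound'[of y x]]
    by (simp add: kap_def mult.commute)
  show "0 \<le> Re (kap x x)" if "x \<in> H"
    unfolding kap_def by (rule mean_Re_ge[OF term_bound'[OF that that]]) simp
qed (use zero_H add_H uminus_H sc_H in auto)

lemma kap_V: "w \<in> H \<Longrightarrow> z \<in> H \<Longrightarrow> kap (V w) z = kap w (V' z)"
proof -
  assume wz: "w \<in> H" "z \<in> H"
  have "kap (V w) z = mean F (\<lambda>n. ip (V w) (orb (Suc n)) * cnj (ip z (orb (Suc n))))"
    unfolding kap_def using wz by (intro mean_shift[OF term_bound', symmetric]) (auto simp: V_H)
  also have "\<dots> = kap w (V' z)"
    unfolding kap_def using wz by (simp add: iso adj' orb_H)
  finally show ?thesis .
qed

lemma kap_V': "w \<in> H \<Longrightarrow> z \<in> H \<Longrightarrow> kap (V' w) z = kap w (V z)"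
  using kap_V[of z w] K.ip_cnj[of "V z" w] K.ip_cnj[of z "V' w"] V_H V'_H by simp

text \<open>Weak convergence tests one vector at a time; a finite net of the orbit makes it uniform
  along the orbit.\<close>

lemma ip_orb_uniform:
  assumes X: "\<And>i. X i \<in> H" "\<And>i. nrm (X i) \<le> R" and x: "x \<in> H"
    and lim: "\<And>y. y \<in> H \<Longrightarrow> ((\<lambda>i. ip (X i) y) \<longlongrightarrow> ip x y) G" and e: "0 < e"
  shows "eventually (\<lambda>i. \<forall>n. cmod (ip (X i - x) (orb n)) \<le> e) G"
proof -
  define C where "C = R + nrm x + 1"
  have R: "0 \<le> R" using X nrm_nonneg order_trans by blast
  have C: "0 < C" using R nrm_nonneg[OF x] by (simp add: C_def)
  have nC: "nrm (X i - x) \<le> C" for i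
    using nrm_triangle[of "X i" "- x"] nrm_uminus[OF x] X[of i] x uminus_H[OF x]
    by (simp add: C_def)
  obtain D where D: "finite D" "D \<subseteq> H" "\<And>n. \<exists>d\<in>D. nrm (orb n - d) < e / (2 * C)"
    using tb[of "e / (2 * C)"] e C by auto
  have "eventually (\<lambda>i. \<forall>d\<in>D. cmod (ip (X i) d - ip x d) < e / 2) G"
  proof (intro eventually_ball_finite D(1) ballI)
    fix d assume "d \<in> D"
    then have "((\<lambda>i. ip (X i) d) \<longlongrightarrow> ip x d) G" using lim D by blast
    then show "eventually (\<lambda>i. cmod (ip (X i) d - ip x d) < e / 2) G"
      using e by (auto dest!: tendstoD[where e = "e / 2"] simp: dist_norm)
  qed
  then show ?thesis
  proof eventually_elim
    case (elim i)
    show ?case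
    proof
      fix n
      obtain d where d: "d \<in> D" "nrm (orb n - d) < e / (2 * C)" using D(3) by blast
      have dH: "d \<in> H" using d D by blast
      have "ip (X i - x) (orb n) = (ip (X i) d - ip x d) + ip (X i - x) (orb n - d)"
        using X x dH orb_H by (simp add: ip_simps)
      moreover have "cmod (ip (X i - x) (orb n - d)) \<le> C * (e / (2 * C))"
        using cauchy_schwarz[of "X i - x" "orb n - d"] nC[of i] d(2) X x dH orb_H C
          nrm_nonneg[of "X i - x"] nrm_nonneg[of "orb n - d"] minus_H
        by (smt (verit) mult_mono)
      moreover have "C * (e / (2 * C)) = e / 2" using C by simp
      moreover have "cmod (ip (X i) d - ip x d) < e / 2" using elim d by blast
      ultimately show "cmod (ip (X i - x) (orb n)) \<le> e"
        using norm_triangle_ineq[of "ip (X i) d - ip x d" "ip (X i - x) (orb n - d)"] by simp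
    qed
  qed
qed

text \<open>Compactness of the operator behind \<open>kap\<close>: weakly null bounded sequences
  become norm null, which shows in pairings with arbitrary bounded sequences.\<close>

lemma kap_weak_continuous:
  assumes X: "\<And>i. X i \<in> H" "\<And>i. nrm (X i) \<le> R" and Z: "\<And>i. Z i \<in> H" "\<And>i. nrm (Z i) \<le> R"
    and x: "x \<in> H"
    and lim: "\<And>y. y \<in> H \<Longrightarrow> ((\<lambda>i. ip (X i) y) \<longlongrightarrow> ip x y) G"
  shows "((\<lambda>i. kap (X i - x) (Z i)) \<longlongrightarrow> 0) G"
proof (rule tendstoI)
  fix e :: real assume e: "0 < e"
  have R: "0 \<le> R" using X nrm_nonneg order_trans by blast
  define M where "M = R * nrm v + 1"
  have M: "0 < M" using R nrm_nonneg[OF v_H] by (simp add: M_def add_nonneg_pos)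
  have "eventually (\<lambda>i. \<forall>n. cmod (ip (X i - x) (orb n)) \<le> e / (2 * M)) G"
    using e M by (intro ip_orb_uniform[OF X x lim]) auto
  then show "eventually (\<lambda>i. dist (kap (X i - x) (Z i)) 0 < e) G"
  proof eventually_elim
    case (elim i)
    have "cmod (kap (X i - x) (Z i)) \<le> e / (2 * M) * (nrm (Z i) * nrm v)"
      using elim Z by (intro kap_bound) auto
    also have "\<dots> \<le> e / (2 * M) * M"
    proof (rule mult_left_mono)
      have "nrm (Z i) * nrm v \<le> R * nrm v"
        by (rule mult_right_mono[OF Z(2) nrm_nonneg[OF v_H]])
      then show "nrm (Z i) * nrm v \<le> M" by (simp add: M_def)
      show "0 \<le> e / (2 * M)" using e M by simp
    qed
    also have "\<dots> < e" using e M by simp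
    finally show ?case by simp
  qed
qed

lemma kap_weak_limits:
  assumes X: "\<And>i. X i \<in> H" "\<And>i. nrm (X i) \<le> R" and x: "x \<in> H"
    and lim: "\<And>y. y \<in> H \<Longrightarrow> ((\<lambda>i. ip (X i) y) \<longlongrightarrow> ip x y) G"
  shows "z \<in> H \<Longrightarrow> ((\<lambda>i. kap (X i) z) \<longlongrightarrow> kap x z) G"
    and "((\<lambda>i. kap (X i) (X i)) \<longlongrightarrow> kap x x) G"
proof -
  have *: "((\<lambda>i. kap (X i) z) \<longlongrightarrow> kap x z) G" if z: "z \<in> H" for z
  proof (rule LIM_zero_cancel)
    have R: "nrm (X i) \<le> max R (nrm z)" for i
      using X(2)[of i] by simp
    have "((\<lambda>i. kap (X i - x) z) \<longlongrightarrow> 0) G"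
      by (rule kap_weak_continuous[OF X(1) R _ _ x lim]) (use z in auto)
    then show "((\<lambda>i. kap (X i) z - kap x z) \<longlongrightarrow> 0) G"
      using X(1) x z by (simp add: K.ip_simps)
  qed
  then show "z \<in> H \<Longrightarrow> ((\<lambda>i. kap (X i) z) \<longlongrightarrow> kap x z) G" .
  have "((\<lambda>i. kap (X i - x) (X i)) \<longlongrightarrow> 0) G"
    by (rule kap_weak_continuous[OF X X x lim])
  moreover have "((\<lambda>i. cnj (kap (X i) x)) \<longlongrightarrow> cnj (kap x x)) G"
    by (intro tendsto_cnj * x)
  ultimately have "((\<lambda>i. kap (X i - x) (X i) + cnj (kap (X i) x)) \<longlongrightarrow> 0 + cnj (kap x x)) G"
    by (rule tendsto_add)
  moreover have "kap (X i - x) (X i) + cnj (kap (X i) x) = kap (X i) (X i)" for i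
    using X(1)[of i] x K.ip_cnj[of "X i" x] by (simp add: K.ip_simps)
  moreover have "cnj (kap x x) = kap x x"
    using K.ip_cnj[OF x x] by simp
  ultimately show "((\<lambda>i. kap (X i) (X i)) \<longlongrightarrow> kap x x) G"
    by simp
qed

lemma kap_iso:
  assumes wz: "w \<in> H" "z \<in> H"
  shows "kap (V w) (V z) = kap w z"
proof -
  have "kap (V w) (V z) = mean F (\<lambda>n. ip (V w) (orb (Suc n)) * cnj (ip (V z) (orb (Suc n))))"
    unfolding kap_def using wz by (intro mean_shift[OF term_bound', symmetric]) (auto simp: V_H)
  also have "\<dots> = kap w z"
    unfolding kap_def using wz by (simp add: iso orb_H)
  finally show ?thesis .
qed

lemma kap_orb: "kap (orb j) (orb j) = kap v v"
  by (induction j) (simp_all add: kap_iso orb_H)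

text \<open>Precompactness forces recurrence: for finitely many indices j, every
  \<open>orb n\<close> has a large inner product with one of the \<open>orb j\<close>. So the sum of
  the values \<open>kap (orb j) (orb j)\<close> is positive, and by invariance each of them equals
  \<open>kap v v\<close>.\<close>

lemma kap_v_pos:
  assumes nv: "nrm v \<noteq> 0"
  shows "0 < Re (kap v v)"
proof -
  \<comment> \<open>A net of radius |v| / 4 becomes one of radius |v| / 2 when its centres are moved
    into the orbit, which leaves at least |v|^2 / 2 of the inner product.\<close>
  define e where "e = nrm v / 4"
  have vp: "0 < nrm v" and e: "0 < e" using nv nrm_nonneg[OF v_H] by (auto simp: e_def)
  obtain D where D: "finite D" "D \<subseteq> H" "\<And>n. \<exists>d\<in>D. nrm (orb n - d) < e"
    using tb[OF e] by blast
  define P where "P d j \<longleftrightarrow> nrm (orb j - d) < e" for d j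
  define J where "J = (\<lambda>d. SOME j. P d j) ` D"
  have fJ: "finite J" using D by (simp add: J_def)
  have "\<exists>j\<in>J. nrm (orb n - orb j) < 2 * e" for n
  proof -
    obtain d where d: "d \<in> D" "P d n" using D(3) by (auto simp: P_def)
    then have j: "P d (SOME j. P d j)" by (auto intro: someI)
    have "nrm (orb n - orb (SOME j. P d j)) < 2 * e"
      using nrm_triangle3[of "orb n" d "orb (SOME j. P d j)"] d j D(2) orb_H
        nrm_minus_commute[of d "orb (SOME j. P d j)"] by (auto simp: P_def)
    then show ?thesis using d by (auto simp: J_def)
  qed
  then have close: "\<exists>j\<in>J. (nrm v)\<^sup>2 / 2 \<le> cmod (ip (orb j) (orb n))" for n
  proof -
    obtain j where j: "j \<in> J" "nrm (orb n - orb j) < 2 * e"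
      using \<open>\<And>n. \<exists>j\<in>J. nrm (orb n - orb j) < 2 * e\<close> by blast
    have "ip (orb n) (orb n) = ip (orb n - orb j) (orb n) + ip (orb j) (orb n)"
      by (simp add: ip_simps orb_H)
    then have "(nrm v)\<^sup>2 \<le> cmod (ip (orb n - orb j) (orb n)) + cmod (ip (orb j) (orb n))"
      using ip_self[OF orb_H[of n]] norm_triangle_ineq nrm_orb[of n]
      by (metis abs_of_nonneg norm_of_real zero_le_power2)
    moreover have "cmod (ip (orb n - orb j) (orb n)) \<le> 2 * e * nrm v"
      using ip_orb_bound[of "orb n - orb j" n] j(2) vp minus_H[OF orb_H orb_H]
      by (smt (verit) mult_right_mono)
    ultimately have "(nrm v)\<^sup>2 / 2 \<le> cmod (ip (orb j) (orb n))"
      by (simp add: e_def power2_eq_square)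
    then show ?thesis using j by blast
  qed
  have low: "((nrm v)\<^sup>2 / 2)\<^sup>2 \<le> Re (\<Sum>j\<in>J. ip (orb j) (orb n) * cnj (ip (orb j) (orb n)))" for n
  proof -
    obtain j where j: "j \<in> J" "(nrm v)\<^sup>2 / 2 \<le> cmod (ip (orb j) (orb n))" using close by blast
    have "((nrm v)\<^sup>2 / 2)\<^sup>2 \<le> (cmod (ip (orb j) (orb n)))\<^sup>2"
      using j by (intro power_mono) auto
    also have "\<dots> \<le> (\<Sum>j\<in>J. (cmod (ip (orb j) (orb n)))\<^sup>2)"
      using j(1) fJ by (intro member_le_sum) auto
    also have "\<dots> = Re (\<Sum>j\<in>J. ip (orb j) (orb n) * cnj (ip (orb j) (orb n)))"
      by (simp add: complex_norm_square[symmetric] flip: of_real_power)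
    finally show ?thesis .
  qed
  have tb: "cmod (ip (orb j) (orb n) * cnj (ip (orb j) (orb n))) \<le> nrm v * nrm v * (nrm v * nrm v)" for j n
    using term_bound'[of "orb j" "orb j" n] orb_H nrm_orb by simp
  have "cmod (\<Sum>j\<in>J. ip (orb j) (orb n) * cnj (ip (orb j) (orb n)))
      \<le> of_nat (card J) * (nrm v * nrm v * (nrm v * nrm v))" for n
    by (intro sum_norm_bound tb)
  from mean_Re_ge[OF this low] have "((nrm v)\<^sup>2 / 2)\<^sup>2 \<le> Re (\<Sum>j\<in>J. kap (orb j) (orb j))"
    using mean_sum[OF fJ tb] by (simp add: kap_def)
  then have "((nrm v)\<^sup>2 / 2)\<^sup>2 \<le> card J * Re (kap v v)"
    by (simp add: kap_orb)
  moreover have "0 < ((nrm v)\<^sup>2 / 2)\<^sup>2" using vp by simp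
  ultimately have "0 < card J * Re (kap v v)" by linarith
  then show ?thesis
    by (simp add: zero_less_mult_iff)
qed

lemma weak_limit_E_perp:
  assumes "\<And>i. X i \<in> E_perp" "x \<in> H" "\<And>y. y \<in> H \<Longrightarrow> ((\<lambda>i. ip (X i) y) \<longlongrightarrow> ip x y) F"
  shows "x \<in> E_perp"
proof (rule E_perpI)
  fix c h assume h: "eigen c h"
  then have "((\<lambda>i. ip (X i) h) \<longlongrightarrow> ip x h) F" using assms eigen_H by blast
  moreover have "(\<lambda>i. ip (X i) h) = (\<lambda>_. 0)" using assms(1) h E_perpD by blast
  ultimately show "ip x h = 0"
    using nb tendsto_unique[OF nb _ tendsto_const[of "0::complex"]] by metis
qed (rule assms)

text \<open>The spectral theorem for the compact operator behind \<open>kap\<close>, carried out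
  inside \<open>E_perp\<close>: its largest eigenvalue is attained, the eigenspace is invariant
  under \<open>V\<close> and behaves like a finite-dimensional space, so \<open>V\<close> has an
  eigenvector there, which would be orthogonal to itself.\<close>

theorem orbit_null:
  assumes vE: "v \<in> E_perp"
  shows "nrm v = 0"
proof (rule ccontr)
  assume nv: "nrm v \<noteq> 0"
  have EH: "w \<in> H" if "w \<in> E_perp" for w using that by (rule E_perp_H)
  \<comment> \<open>The supremum s of these values is the largest eigenvalue;
    \<open>kap_v_pos\<close> makes it positive.\<close>
  define B where "B = (\<lambda>w. Re (kap w w)) ` {w \<in> E_perp. nrm w \<le> 1}"
  define s where "s = Sup B"
  have Bbd: "Re (kap w w) \<le> (nrm v)\<^sup>2" if "w \<in> E_perp" "nrm w \<le> 1" for w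
  proof -
    have "Re (kap w w) \<le> nrm w * nrm v * (nrm w * nrm v)"
      using kap_bound[OF EH ip_orb_bound[OF EH]] that complex_Re_le_cmod order_trans by blast
    also have "\<dots> \<le> 1 * nrm v * (1 * nrm v)"
      using that(2) nrm_nonneg[OF EH[OF that(1)]] nrm_nonneg[OF v_H]
      by (intro mult_mono) auto
    finally show ?thesis by (simp add: power2_eq_square)
  qed
  have Bb: "bdd_above B" unfolding B_def using Bbd by (intro bdd_aboveI2) auto
  have Bne: "B \<noteq> {}" using E_perp_closed(1) nrm_zero by (auto simp: B_def intro!: exI[of _ 0])
  have le_s: "Re (kap w w) \<le> s * (nrm w)\<^sup>2" if w: "w \<in> E_perp" for w
  proof (cases "nrm w = 0")
    case True
    then have "kap w w = 0"
      using kap_bound[OF EH ip_orb_bound[OF EH], of w w] w by simp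
    then show ?thesis using True by simp
  next
    case False
    let ?c = "complex_of_real (1 / nrm w)"
    have n: "0 < nrm w" using False nrm_nonneg[OF EH[OF w]] by simp
    have "Re (kap (sc ?c w) (sc ?c w)) \<le> s"
      unfolding s_def using n w E_perp_closed(4)[OF w] EH[OF w]
      by (intro cSup_upper Bb) (auto simp: B_def nrm_sc norm_divide)
    moreover have "kap (sc ?c w) (sc ?c w) = of_real ((1 / nrm w)\<^sup>2) * kap w w"
      using EH[OF w] by (simp add: K.ip_simps power2_eq_square)
    then have "Re (kap (sc ?c w) (sc ?c w)) = (1 / nrm w)\<^sup>2 * Re (kap w w)"
      by (simp only: Re_complex_of_real Im_complex_of_real times_complex.sel mult_zero_left diff_zero)
    ultimately have "(1 / nrm w)\<^sup>2 * Re (kap w w) \<le> s"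
      by (simp only:)
    then show ?thesis
      using n by (simp add: field_simps power_divide)
  qed
  have s_pos: "0 < s"
    using le_s[OF vE] kap_v_pos[OF nv] by (metis less_le_trans zero_less_mult_pos2 zero_less_power2 nv)
  have "\<exists>w\<in>E_perp. nrm w \<le> 1 \<and> s - 1 / Suc i < Re (kap w w)" for i
  proof -
    have "s - 1 / Suc i < Sup B" by (simp add: s_def)
    then show ?thesis unfolding less_cSup_iff[OF Bne Bb] by (auto simp: B_def)
  qed
  then have "\<exists>X. \<forall>i. X i \<in> E_perp \<and> nrm (X i) \<le> 1 \<and> s - 1 / Suc i < Re (kap (X i) (X i))"
    by (intro choice) blast
  then obtain X where "\<forall>i. X i \<in> E_perp \<and> nrm (X i) \<le> 1 \<and> s - 1 / Suc i < Re (kap (X i) (X i))"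
    by (rule exE)
  then have X: "\<And>i. X i \<in> E_perp" "\<And>i. nrm (X i) \<le> 1"
    and Xs: "\<And>i. s - 1 / Suc i < Re (kap (X i) (X i))" by blast+
  obtain x where x: "x \<in> H" "nrm x \<le> 1" and xl: "\<And>y. y \<in> H \<Longrightarrow> ((\<lambda>i. ip (X i) y) \<longlongrightarrow> ip x y) F"
    by (rule weak_limit[where X = X, OF univ EH[OF X(1)] X(2)]) (rule that)
  have xE: "x \<in> E_perp" by (rule weak_limit_E_perp[where X = X, OF X(1) x(1) xl])
  \<comment> \<open>Weak continuity of \<open>kap\<close> lets the weak limit of a maximizing
    sequence attain the supremum.\<close>
  have "s \<le> Re (kap x x)"
  proof (rule tendsto_le[OF nb])
    show "((\<lambda>i. Re (kap (X i) (X i))) \<longlongrightarrow> Re (kap x x)) F"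
      by (rule tendsto_Re[OF kap_weak_limits(2)[where X = X, OF EH[OF X(1)] X(2) x(1) xl]])
    have "(\<lambda>i. s - 1 / Suc i) \<longlonglongrightarrow> s - 0"
      by (rule tendsto_diff[OF tendsto_const LIMSEQ_Suc[OF lim_1_over_n]])
    then show "((\<lambda>i. s - 1 / Suc i) \<longlongrightarrow> s) F"
      using le_seq tendsto_mono by force
    show "\<forall>\<^sub>F i in F. s - 1 / Suc i \<le> Re (kap (X i) (X i))"
      using Xs by (intro always_eventually) (auto intro: less_imp_le)
  qed
  moreover have "s * (nrm x)\<^sup>2 \<le> s * 1"
    using s_pos x(2) nrm_nonneg[OF x(1)] by (intro mult_left_mono) (auto simp: power_le_one)
  ultimately have kx: "Re (kap x x) = s" and "s * (nrm x)\<^sup>2 = s"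
    using le_s[OF xE] by linarith+
  then have nx: "nrm x = 1"
    using s_pos nrm_nonneg[OF x(1)] by (simp add: power2_eq_1_iff)
  \<comment> \<open>This form is nonnegative on \<open>E_perp\<close> and vanishes at x, so x is an
    eigenvector for s.\<close>
  let ?q = "\<lambda>w z. of_real s * ip w z - kap w z"
  interpret q: semi_ip E_perp sc ?q
  proof
    fix x y z c
    show "?q (x + y) z = ?q x z + ?q y z" if "x \<in> E_perp" "y \<in> E_perp" "z \<in> E_perp"
      using that EH by (simp add: ip_simps K.ip_simps algebra_simps)
    show "?q (sc c x) y = c * ?q x y" if "x \<in> E_perp" "y \<in> E_perp"
      using that EH by (simp add: ip_simps K.ip_simps algebra_simps)
    show "?q y x = cnj (?q x y)" if "x \<in> E_perp" "y \<in> E_perp"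
      using that EH ip_cnj[of x y] K.ip_cnj[of x y] by simp
    show "0 \<le> Re (?q x x)" if "x \<in> E_perp"
      using le_s[OF that] nrm_sq[OF EH[OF that]] by simp
  qed (use E_perp_closed in auto)
  define W where "W = {w \<in> E_perp. \<forall>z\<in>E_perp. kap w z = of_real s * ip w z}"
  have WE: "w \<in> E_perp" and WH: "w \<in> H" if "w \<in> W" for w
    using that EH by (auto simp: W_def)
  have Wk: "kap w z = of_real s * ip w z" if "w \<in> W" "z \<in> E_perp" for w z
    using that by (auto simp: W_def)
  have "q.nrm x = 0"
    using kx nx nrm_sq[OF x(1)] by (simp add: q.nrm_def)
  then have xW: "x \<in> W"
    using q.ip_eq_0_if_nrm_0(1)[OF xE] xE by (auto simp: W_def)
  have W_V: "V w \<in> W" if "w \<in> W" for w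
    using that EH by (auto simp: W_def E_perp_V E_perp_V' kap_V adj)
  have W_V': "V' w \<in> W" if "w \<in> W" for w
    using that EH by (auto simp: W_def E_perp_V E_perp_V' kap_V' adj')
  have W_closed: "0 \<in> W" "x \<in> W \<Longrightarrow> y \<in> W \<Longrightarrow> x + y \<in> W" "x \<in> W \<Longrightarrow> - x \<in> W"
    "x \<in> W \<Longrightarrow> sc c x \<in> W" "x \<in> W \<Longrightarrow> y \<in> W \<Longrightarrow> x - y \<in> W" for x y c
    using EH by (auto simp: W_def E_perp_closed ip_zero K.ip_zero ip_uminus K.ip_uminus
        ip_simps K.ip_simps algebra_simps)
  \<comment> \<open>On the eigenspace, the self-adjoint part of \<open>V\<close> is maximized in
    turn.\<close>
  define C where "C = (\<lambda>w. Re (ip (V w) w)) ` {w \<in> W. nrm w = 1}"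
  define t where "t = Sup C"
  have V1: "\<bar>Re (ip (V w) w)\<bar> \<le> 1" if "w \<in> W" "nrm w = 1" for w
    using cauchy_schwarz[of "V w" w] abs_Re_le_cmod[of "ip (V w) w"] that WH[OF that(1)]
    by (simp add: V_H nrm_V)
  have Cb: "bdd_above C" unfolding C_def using V1 by (intro bdd_aboveI2[of _ _ 1]) (auto simp: abs_le_iff)
  have Cne: "C \<noteq> {}" using xW nx by (auto simp: C_def)
  have le_t: "Re (ip (V w) w) \<le> t" if "w \<in> W" "nrm w = 1" for w
    unfolding t_def using that by (intro cSup_upper Cb) (auto simp: C_def)
  have le_t': "Re (ip (V w) w) \<le> t * (nrm w)\<^sup>2" if w: "w \<in> W" for w
  proof (cases "nrm w = 0")
    case True
    then show ?thesis
      using ip_eq_0_if_nrm_0(2)[OF WH[OF w] V_H[OF WH[OF w]]] by simp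
  next
    case False
    let ?c = "complex_of_real (1 / nrm w)"
    have n: "0 < nrm w" using False nrm_nonneg[OF WH[OF w]] by simp
    have cw: "sc ?c w \<in> W" using W_closed(4)[OF w] .
    have "Re (ip (V (sc ?c w)) (sc ?c w)) \<le> t"
      using n WH[OF w] by (intro le_t cw) (simp add: nrm_sc norm_divide)
    moreover have "ip (V (sc ?c w)) (sc ?c w) = of_real ((1 / nrm w)\<^sup>2) * ip (V w) w"
      using WH[OF w] by (simp add: ip_V_sc ip_simps V_H power2_eq_square)
    then have "Re (ip (V (sc ?c w)) (sc ?c w)) = (1 / nrm w)\<^sup>2 * Re (ip (V w) w)"
      by (simp only: Re_complex_of_real Im_complex_of_real times_complex.sel mult_zero_left diff_zero)
    ultimately have "(1 / nrm w)\<^sup>2 * Re (ip (V w) w) \<le> t"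
      by (simp only:)
    then show ?thesis
      using n by (simp add: field_simps power_divide)
  qed
  have "\<exists>w\<in>W. nrm w = 1 \<and> t - 1 / Suc i < Re (ip (V w) w)" for i
  proof -
    have "t - 1 / Suc i < Sup C" by (simp add: t_def)
    then show ?thesis unfolding less_cSup_iff[OF Cne Cb] by (auto simp: C_def)
  qed
  then have "\<exists>Y. \<forall>i. Y i \<in> W \<and> nrm (Y i) = 1 \<and> t - 1 / Suc i < Re (ip (V (Y i)) (Y i))"
    by (intro choice) blast
  then obtain Y where "\<forall>i. Y i \<in> W \<and> nrm (Y i) = 1 \<and> t - 1 / Suc i < Re (ip (V (Y i)) (Y i))"
    by (rule exE)
  then have Y: "\<And>i. Y i \<in> W" "\<And>i. nrm (Y i) = 1"
    and Yt: "\<And>i. t - 1 / Suc i < Re (ip (V (Y i)) (Y i))" by blast+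
  have Y1: "\<And>i. nrm (Y i) \<le> 1" using Y by simp
  obtain y where y: "y \<in> H" and yl: "\<And>z. z \<in> H \<Longrightarrow> ((\<lambda>i. ip (Y i) z) \<longlongrightarrow> ip y z) F"
    by (rule weak_limit[where X = Y, OF univ WH[OF Y(1)] Y1]) (rule that)
  have kl1: "((\<lambda>i. kap (Y i) z) \<longlongrightarrow> kap y z) F" if "z \<in> H" for z
    by (rule kap_weak_limits(1)[where X = Y, OF WH[OF Y(1)] Y1 y _ that]) (rule yl)
  have kl2: "((\<lambda>i. kap (Y i) (Y i)) \<longlongrightarrow> kap y y) F"
    by (rule kap_weak_limits(2)[where X = Y, OF WH[OF Y(1)] Y1 y]) (rule yl)
  have yE: "y \<in> E_perp" by (rule weak_limit_E_perp[where X = Y, OF WE[OF Y(1)] y yl])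
  have yW: "y \<in> W"
    unfolding W_def
  proof (intro CollectI conjI ballI yE)
    fix z assume z: "z \<in> E_perp"
    have "((\<lambda>i. kap (Y i) z) \<longlongrightarrow> kap y z) F" by (rule kl1[OF EH[OF z]])
    moreover have "((\<lambda>i. of_real s * ip (Y i) z) \<longlongrightarrow> of_real s * ip y z) F"
      by (intro tendsto_mult_left yl EH z)
    moreover have "(\<lambda>i. kap (Y i) z) = (\<lambda>i. of_real s * ip (Y i) z)"
      using Wk[OF Y(1) z] by simp
    ultimately show "kap y z = of_real s * ip y z"
      using tendsto_unique[OF nb] by simp
  qed
  \<comment> \<open>On \<open>W\<close> the square of the norm is a multiple of \<open>kap\<close>,
    which is weakly continuous; as s > 0, no norm is lost in the weak limit, and the convergence is
    in norm.\<close>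
  have "kap (Y i) (Y i) = of_real s" for i
    using Wk[OF Y(1) WE[OF Y(1)]] ip_self[OF WH[OF Y(1)]] Y(2) by simp
  then have "kap y y = of_real s"
    using kl2 tendsto_unique[OF nb _ tendsto_const] by simp
  then have "of_real s * ip y y = of_real s" using Wk[OF yW yE] by simp
  then have iy: "ip y y = 1" using s_pos by simp
  then have ny: "nrm y = 1" by (simp add: nrm_def)
  have "((\<lambda>i. (nrm (Y i - y))\<^sup>2) \<longlongrightarrow> 2 - 2 * Re (ip y y)) F"
  proof -
    have "(nrm (Y i - y))\<^sup>2 = 2 - 2 * Re (ip (Y i) y)" for i
    proof -
      have "(nrm (Y i - y))\<^sup>2 = Re (ip (Y i) (Y i)) + Re (ip y y) - 2 * Re (ip (Y i) y)"
        using WH[OF Y(1)[of i]] y ip_cnj[of "Y i" y] by (simp add: nrm_sq ip_simps)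
      then show ?thesis using nrm_sq[OF WH[OF Y(1)[of i]]] Y(2)[of i] iy by simp
    qed
    then show ?thesis
      using tendsto_diff[OF tendsto_const tendsto_mult_left[OF tendsto_Re[OF yl[OF y]], of 2], of 2]
      by simp
  qed
  then have "((\<lambda>i. sqrt ((nrm (Y i - y))\<^sup>2)) \<longlongrightarrow> sqrt 0) F"
    by (intro tendsto_real_sqrt) (simp add: iy)
  then have Yy: "((\<lambda>i. nrm (Y i - y)) \<longlongrightarrow> 0) F"
    using nrm_nonneg[OF minus_H[OF WH[OF Y(1)] y]] by simp
  have "((\<lambda>i. ip (V (Y i)) (Y i)) \<longlongrightarrow> ip (V y) y) F"
  proof (rule LIM_zero_cancel, rule Lim_null_comparison)
    show "\<forall>\<^sub>F i in F. norm (ip (V (Y i)) (Y i) - ip (V y) y) \<le> 2 * nrm (Y i - y)"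
    proof (intro always_eventually allI)
      fix i
      show "norm (ip (V (Y i)) (Y i) - ip (V y) y) \<le> 2 * nrm (Y i - y)"
        using ip_bound_diff[of "V (Y i)" "V y" "Y i" y] WH[OF Y(1)[of i]] y Y(2)[of i] ny
        by (simp add: V_H nrm_V nrm_V_diff)
    qed
    show "((\<lambda>i. 2 * nrm (Y i - y)) \<longlongrightarrow> 0) F"
      using tendsto_mult_left[OF Yy, of 2] by simp
  qed
  then have "t \<le> Re (ip (V y) y)"
  proof (intro tendsto_le[OF nb tendsto_Re])
    have "(\<lambda>i. t - 1 / Suc i) \<longlonglongrightarrow> t - 0"
      by (rule tendsto_diff[OF tendsto_const LIMSEQ_Suc[OF lim_1_over_n]])
    then show "((\<lambda>i. t - 1 / Suc i) \<longlongrightarrow> t) F"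
      using le_seq tendsto_mono by force
    show "\<forall>\<^sub>F i in F. t - 1 / Suc i \<le> Re (ip (V (Y i)) (Y i))"
      using Yt by (intro always_eventually) (auto intro: less_imp_le)
  qed
  then have ty: "Re (ip (V y) y) = t" using le_t[OF yW ny] by simp
  have t1: "\<bar>t\<bar> \<le> 1" using V1[OF yW ny] ty by simp
  \<comment> \<open>The form of t minus the self-adjoint part of \<open>V\<close>: nonnegative on
    \<open>W\<close> and zero at y, hence V y + V' y = 2 t y.\<close>
  let ?r = "\<lambda>w z. of_real t * ip w z - (ip w (V' z) + ip w (V z)) / 2"
  interpret r: semi_ip W sc ?r
  proof
    fix x y z c
    show "?r (x + y) z = ?r x z + ?r y z" if "x \<in> W" "y \<in> W" "z \<in> W"
      using that WH by (simp add: ip_simps V_H V'_H algebra_simps add_divide_distrib)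
    show "?r (sc c x) y = c * ?r x y" if "x \<in> W" "y \<in> W"
      using that WH by (simp add: ip_simps V_H V'_H algebra_simps)
    show "?r y x = cnj (?r x y)" if "x \<in> W" "y \<in> W"
      using that WH ip_cnj[of x y] ip_cnj[of "V x" y] ip_cnj[of "V' x" y]
      by (simp add: V_H V'_H adj adj' add.commute)
    show "0 \<le> Re (?r x x)" if "x \<in> W"
    proof -
      have "Re (ip x (V' x)) = Re (ip (V x) x)" "Re (ip x (V x)) = Re (ip (V x) x)"
        using WH[OF that] ip_cnj[of "V x" x] by (simp_all add: adj V_H)
      then show ?thesis
        using le_t'[OF that] nrm_sq[OF WH[OF that]] by simp
    qed
  qed (use W_closed in auto)
  have "Re (?r y y) = 0"
    using ty iy y ip_cnj[of "V y" y] by (simp add: V_H flip: adj)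
  then have ry: "r.nrm y = 0"
    by (simp add: r.nrm_def)
  define z where "z = sc (of_real (2 * t)) y - V y - V' y"
  have zW: "z \<in> W" unfolding z_def using yW W_V W_V' W_closed by simp
  have zH: "z \<in> H" using zW by (rule WH)
  have ipz: "ip z g = of_real (2 * t) * ip y g - ip (V y) g - ip (V' y) g" if "g \<in> H" for g
    unfolding z_def using y that by (simp add: ip_simps V_H V'_H)
  have "?r y z = 0" by (rule r.ip_eq_0_if_nrm_0(1)[OF yW zW ry])
  then have "ip z z = 0"
    using ipz[OF zH] adj[OF y zH] adj'[OF y zH] by (simp add: field_simps)
  then have "nrm z = 0" by (simp add: nrm_def)
  then have rel: "of_real (2 * t) * ip y g = ip (V y) g + ip (V' y) g" if "g \<in> H" for g
    using ip_eq_0_if_nrm_0(1)[OF zH that] ipz[OF that] by (simp add: algebra_simps)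
  \<comment> \<open>A root on the unit circle of z^2 - 2 t z + 1, the polynomial in \<open>V\<close>
    that annihilates y.\<close>
  define ze where "ze = Complex t (sqrt (1 - t\<^sup>2))"
  have "t\<^sup>2 \<le> 1" using t1 by (simp add: abs_square_le_1)
  then have "(sqrt (1 - t\<^sup>2))\<^sup>2 = 1 - t\<^sup>2"
    by (intro real_sqrt_pow2) linarith
  then have sq: "Re ze = t" "(Im ze)\<^sup>2 = 1 - t\<^sup>2"
    unfolding ze_def complex.sel by - (rule refl, assumption)
  have "(Re ze)\<^sup>2 + (Im ze)\<^sup>2 = 1"
    unfolding sq by argo
  then have ze1: "ze * cnj ze = 1"
    unfolding complex_mult_cnj by (simp only: of_real_1)
  have ze2: "ze + cnj ze = of_real (2 * t)"
    unfolding complex_add_cnj sq(1) by (rule refl)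
  \<comment> \<open>Factor the quadratic equation: u is an eigenvector for \<open>ze\<close>, so u
    is null, and then y is an eigenvector for \<open>cnj ze\<close>.\<close>
  define u where "u = V y - sc (cnj ze) y"
  have uE: "u \<in> E_perp"
    unfolding u_def by (intro E_perp_closed E_perp_V yE)
  have "eigen ze u"
  proof (rule eigenI)
    show "u \<in> H" by (rule EH[OF uE])
    fix g assume g: "g \<in> H"
    have "of_real (2 * t) * ip (V y) g = ip (V y) (V' g) + ip y g"
      using rel[OF V'_H[OF g]] unfolding adj[OF y g, symmetric] iso'[OF y g] .
    then have 1: "ip (V y) (V' g) = of_real (2 * t) * ip (V y) g - ip y g"
      by (simp only: add_diff_cancel_right')
    have "ip (V u) g = ip u (V' g)"
      by (rule adj[OF EH[OF uE] g])
    also have "\<dots> = ip (V y) (V' g) - cnj ze * ip y (V' g)"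
      unfolding u_def using V_H[OF y] V'_H[OF g] y by (simp only: ip_diff ip_sc sc_H)
    also have "\<dots> = of_real (2 * t) * ip (V y) g - ip y g - cnj ze * ip (V y) g"
      unfolding 1 adj[OF y g, symmetric] ..
    also have "\<dots> = (ze + cnj ze) * ip (V y) g - (ze * cnj ze) * ip y g - cnj ze * ip (V y) g"
      by (simp only: ze1 ze2 mult_1_left)
    also have "\<dots> = ze * ip u g"
      using g y by (simp add: u_def ip_simps V_H algebra_simps)
    finally show "ip (V u) g = ze * ip u g" .
  qed
  then have "ip u u = 0" using E_perpD[OF uE] by blast
  then have "nrm u = 0" by (simp add: nrm_def)
  then have "eigen (cnj ze) y" using y by (simp add: eigen_def u_def)
  then show False using E_perpD[OF yE] iy by simp
qed

end

section \<open>Lie theory from second-order estimates of the product\<close>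

section \<open>Second-order estimates for a product with unit\<close>

text \<open>\<open>C_diff\<close> controls second derivatives one direction at a time; their bounds
  on the compact ball in the finitely many basis directions add up to a Lipschitz constant of the
  derivative.\<close>

lemma C_diff_2_Lipschitz_derivative:
  fixes F :: "'a::euclidean_space \<Rightarrow> 'b::real_normed_vector"
  assumes C2: "C_diff (Suc (Suc 0)) S F" and K: "cball p R \<subseteq> S"
  obtains M where "0 \<le> M"
    "\<And>x y v. x \<in> cball p R \<Longrightarrow> y \<in> cball p R \<Longrightarrow>
      norm (frechet_derivative F (at x) v - frechet_derivative F (at y) v) \<le> M * norm (x - y) * norm v"
proof -
  define D where "D v x = frechet_derivative F (at x) v" for v x
  have F: "F differentiable (at x)" if "x \<in> S" for x
    using C2 that by simp
  have D: "D v differentiable (at x)" if "x \<in> S" for v x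
    using C2 that unfolding D_def by simp
  have cont: "continuous_on S (\<lambda>x. frechet_derivative (D v) (at x) w)" for v w
    using C2 unfolding D_def by simp
  have "\<exists>B. \<forall>x\<in>cball p R. norm (frechet_derivative (D v) (at x) w) \<le> B" for v w
  proof -
    have "compact ((\<lambda>x. frechet_derivative (D v) (at x) w) ` cball p R)"
      by (intro compact_continuous_image continuous_on_subset[OF cont K] compact_cball)
    then show ?thesis
      using compact_imp_bounded by (force simp: bounded_iff)
  qed
  then obtain B where B: "\<And>v w x. x \<in> cball p R \<Longrightarrow> norm (frechet_derivative (D v) (at x) w) \<le> B v w"
    by metis
  define N where "N v = (\<Sum>w\<in>Basis. \<bar>B v w\<bar>)" for v
  have lin: "linear (frechet_derivative (D v) (at x))" if "x \<in> S" for v x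
    using D[OF that] frechet_derivative_works has_derivative_linear by blast
  have linF: "linear (frechet_derivative F (at x))" if "x \<in> S" for x
    using F[OF that] frechet_derivative_works has_derivative_linear by blast
  have bN: "norm (frechet_derivative (D v) (at x) h) \<le> N v * norm h" if x: "x \<in> cball p R" for v x h
  proof -
    have xS: "x \<in> S" using x K by blast
    have "frechet_derivative (D v) (at x) h =
        frechet_derivative (D v) (at x) (\<Sum>w\<in>Basis. (h \<bullet> w) *\<^sub>R w)"
      by (simp add: euclidean_representation)
    also have "\<dots> = (\<Sum>w\<in>Basis. (h \<bullet> w) *\<^sub>R frechet_derivative (D v) (at x) w)"
      by (simp add: linear_sum[OF lin[OF xS]] linear_cmul[OF lin[OF xS]])
    also have "norm \<dots> \<le> (\<Sum>w\<in>Basis. norm h * \<bar>B v w\<bar>)"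
    proof (rule sum_norm_le)
      fix w :: 'a assume w: "w \<in> Basis"
      have "norm (frechet_derivative (D v) (at x) w) \<le> \<bar>B v w\<bar>"
        using B[OF x, of v w] by linarith
      then show "norm ((h \<bullet> w) *\<^sub>R frechet_derivative (D v) (at x) w) \<le> norm h * \<bar>B v w\<bar>"
        using Basis_le_norm[OF w, of h] by (simp add: mult_mono)
    qed
    finally show ?thesis
      by (simp add: N_def sum_distrib_left mult.commute)
  qed
  have lipD: "norm (D v x - D v y) \<le> N v * norm (x - y)" if xy: "x \<in> cball p R" "y \<in> cball p R" for v x y
  proof (rule differentiable_bound[OF convex_cball, of p R "D v" "\<lambda>x. frechet_derivative (D v) (at x)"])
    fix z assume z: "z \<in> cball p R"
    then show "(D v has_derivative frechet_derivative (D v) (at z)) (at z within cball p R)"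
      using D[of z v] K frechet_derivative_works by (blast intro: has_derivative_at_withinI)
    show "onorm (frechet_derivative (D v) (at z)) \<le> N v"
      by (rule onorm_le) (rule bN[OF z])
  qed (use xy in auto)
  define M where "M = (\<Sum>w\<in>Basis. N w)"
  have N0: "0 \<le> N v" for v unfolding N_def by (simp add: sum_nonneg)
  show ?thesis
  proof (rule that[of M])
    show "0 \<le> M" unfolding M_def by (simp add: N0 sum_nonneg)
    fix x y v assume xy: "x \<in> cball p R" "y \<in> cball p R"
    have S: "x \<in> S" "y \<in> S" using xy K by blast+
    have e: "frechet_derivative F (at z) v = (\<Sum>w\<in>Basis. (v \<bullet> w) *\<^sub>R D w z)" if "z \<in> S" for z
    proof -
      have "frechet_derivative F (at z) v = frechet_derivative F (at z) (\<Sum>w\<in>Basis. (v \<bullet> w) *\<^sub>R w)"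
        by (simp add: euclidean_representation)
      then show ?thesis
        by (simp add: linear_sum[OF linF[OF that]] linear_cmul[OF linF[OF that]] D_def)
    qed
    have "frechet_derivative F (at x) v - frechet_derivative F (at y) v
        = (\<Sum>w\<in>Basis. (v \<bullet> w) *\<^sub>R (D w x - D w y))"
      unfolding e[OF S(1)] e[OF S(2)] by (simp add: sum_subtractf scaleR_diff_right)
    also have "norm \<dots> \<le> (\<Sum>w\<in>Basis. norm v * (N w * norm (x - y)))"
    proof (rule sum_norm_le)
      fix w :: 'a assume w: "w \<in> Basis"
      show "norm ((v \<bullet> w) *\<^sub>R (D w x - D w y)) \<le> norm v * (N w * norm (x - y))"
        using Basis_le_norm[OF w, of v] lipD[OF xy, of w] by (simp add: mult_mono)
    qed
    also have "\<dots> = M * norm (x - y) * norm v"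
      by (simp add: M_def sum_distrib_left sum_distrib_right mult_ac)
    finally show "norm (frechet_derivative F (at x) v - frechet_derivative F (at y) v)
        \<le> M * norm (x - y) * norm v" .
  qed
qed

lemma has_derivative_fst_slice:
  assumes "F differentiable (at (u, w))"
  shows "((\<lambda>u. F (u, w)) has_derivative (\<lambda>h. frechet_derivative F (at (u, w)) (h, 0))) (at u)"
proof -
  have "((\<lambda>u. (u, w)) has_derivative (\<lambda>h. (h, 0))) (at u)"
    by (auto intro!: derivative_eq_intros)
  from has_derivative_compose[OF this] assms show ?thesis
    unfolding frechet_derivative_works by blast
qed

lemma has_derivative_snd_slice:
  assumes "F differentiable (at (u, w))"
  shows "((\<lambda>w. F (u, w)) has_derivative (\<lambda>h. frechet_derivative F (at (u, w)) (0, h))) (at w)"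
proof -
  have "((\<lambda>w. (u, w)) has_derivative (\<lambda>h. (0, h))) (at w)"
    by (auto intro!: derivative_eq_intros)
  from has_derivative_compose[OF this] assms show ?thesis
    unfolding frechet_derivative_works by blast
qed

text \<open>A first-order expansion at the scale 1 / n; tangent vectors are represented by such
  sequences rather than by curves.\<close>

lemma scaled_difference_tendsto:
  fixes f :: "'a::real_normed_vector \<Rightarrow> 'b::real_normed_vector"
  assumes f: "(f has_derivative f') (at p)" and x: "(\<lambda>n. real n *\<^sub>R (x n - p)) \<longlonglongrightarrow> X"
  shows "(\<lambda>n. real n *\<^sub>R (f (x n) - f p)) \<longlonglongrightarrow> f' X"
proof -
  have bl: "bounded_linear f'" using f by (rule has_derivative_bounded_linear)
  have "(\<lambda>n. (1 / real n) *\<^sub>R (real n *\<^sub>R (x n - p))) \<longlonglongrightarrow> 0 *\<^sub>R X"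
    by (intro tendsto_scaleR x lim_1_over_n)
  moreover have "\<forall>\<^sub>F n in sequentially. (1 / real n) *\<^sub>R (real n *\<^sub>R (x n - p)) = x n - p"
    using eventually_gt_at_top[of 0] by eventually_elim simp
  ultimately have x0: "(\<lambda>n. x n - p) \<longlonglongrightarrow> 0"
    using tendsto_cong by force
  have l1: "(\<lambda>n. f' (real n *\<^sub>R (x n - p))) \<longlonglongrightarrow> f' X"
    by (rule bounded_linear.tendsto[OF bl x])
  have l2: "(\<lambda>n. real n *\<^sub>R (f (x n) - f p) - f' (real n *\<^sub>R (x n - p))) \<longlonglongrightarrow> 0"
  proof (rule tendstoI)
    fix e :: real assume e: "0 < e"
    \<comment> \<open>The 1 gives a positive bound strictly above the limit |X| of n |x n -
      p|.\<close>
    define e' where "e' = e / (2 * (norm X + 1))"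
    have nX: "0 < norm X + 1" by (rule add_nonneg_pos) auto
    have e': "0 < e'" using e nX by (simp add: e'_def)
    have half: "e / (2 * K) * K = e / 2" if "0 < K" for K using that by simp
    obtain d where d: "0 < d" "\<And>y. norm (y - p) < d \<Longrightarrow> norm (f y - f p - f' (y - p)) \<le> e' * norm (y - p)"
      using f e' unfolding has_derivative_within_alt by (metis UNIV_I)
    have "\<forall>\<^sub>F n in sequentially. norm (x n - p) < d"
      using tendstoD[OF x0 d(1)] by simp
    moreover have "\<forall>\<^sub>F n in sequentially. norm (real n *\<^sub>R (x n - p)) < norm X + 1"
      using order_tendstoD(2)[OF tendsto_norm[OF x], of "norm X + 1"] by simp
    ultimately show "\<forall>\<^sub>F n in sequentially. dist (real n *\<^sub>R (f (x n) - f p) - f' (real n *\<^sub>R (x n - p))) 0 < e"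
    proof eventually_elim
      case (elim n)
      have "real n *\<^sub>R (f (x n) - f p) - f' (real n *\<^sub>R (x n - p)) = real n *\<^sub>R (f (x n) - f p - f' (x n - p))"
        unfolding linear_cmul[OF bounded_linear.linear[OF bl]] by (rule scaleR_diff_right[symmetric])
      then have "norm (real n *\<^sub>R (f (x n) - f p) - f' (real n *\<^sub>R (x n - p)))
          \<le> real n * (e' * norm (x n - p))"
        using d(2)[OF elim(1)] by (simp add: mult_left_mono)
      also have "\<dots> = e' * norm (real n *\<^sub>R (x n - p))" by simp
      also have "\<dots> \<le> e' * (norm X + 1)" using elim(2) e' by (intro mult_left_mono) auto
      also have "\<dots> = e / 2" unfolding e'_def by (rule half[OF nX])
      also have "\<dots> < e" using e by simp
      finally show ?case by (simp add: dist_norm)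
    qed
  qed
  from tendsto_add[OF l2 l1] show ?thesis by simp
qed

text \<open>The product of a group read in a chart in which the identity has coordinate p.\<close>

locale C2_product =
  fixes F :: "'e::euclidean_space \<times> 'e \<Rightarrow> 'e" and S p
  assumes S: "open S" "(p, p) \<in> S" and C2: "C_diff (Suc (Suc 0)) S F"
    and right_unit: "(u, p) \<in> S \<Longrightarrow> F (u, p) = u" and left_unit: "(p, w) \<in> S \<Longrightarrow> F (p, w) = w"
begin

abbreviation "F' x \<equiv> frechet_derivative F (at x)"

lemma diff: "x \<in> S \<Longrightarrow> F differentiable (at x)"
  by (rule bspec[OF conjunct1[OF C2[unfolded C_diff.simps]]])

lemma F'_right_unit:
  assumes "(u, p) \<in> S"
  shows "F' (u, p) (h, 0) = h"
proof -
  obtain A B where AB: "open A" "open B" "u \<in> A" "p \<in> B" "A \<times> B \<subseteq> S"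
    by (rule open_prod_elim[OF S(1) assms], elim SigmaE2, rule that)
  have "((\<lambda>u. F (u, p)) has_derivative (\<lambda>h. h)) (at u)"
    by (rule has_derivative_transform_within_open[OF has_derivative_ident AB(1,3)])
      (use AB right_unit in auto)
  from has_derivative_unique[OF has_derivative_fst_slice[OF diff[OF assms]] this]
  show ?thesis by metis
qed

lemma F'_left_unit:
  assumes "(p, w) \<in> S"
  shows "F' (p, w) (0, h) = h"
proof -
  obtain A B where AB: "open A" "open B" "p \<in> A" "w \<in> B" "A \<times> B \<subseteq> S"
    by (rule open_prod_elim[OF S(1) assms], elim SigmaE2, rule that)
  have "((\<lambda>w. F (p, w)) has_derivative (\<lambda>h. h)) (at w)"
    by (rule has_derivative_transform_within_open[OF has_derivative_ident AB(2,4)])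
      (use AB left_unit in auto)
  from has_derivative_unique[OF has_derivative_snd_slice[OF diff[OF assms]] this]
  show ?thesis by metis
qed

text \<open>By the unit law the derivative of F(u, w) - u in u vanishes at w = p, hence is of order
  |w - p|; the mean value inequality gives the first estimate, and the second is symmetric.\<close>

lemma estimates:
  obtains r C where "0 < r" "0 \<le> C" "cball p r \<times> cball p r \<subseteq> S"
    "\<And>u u' w. u \<in> cball p r \<Longrightarrow> u' \<in> cball p r \<Longrightarrow> w \<in> cball p r \<Longrightarrow>
       norm (F (u, w) - F (u', w) - (u - u')) \<le> C * norm (w - p) * norm (u - u')"
    "\<And>u w w'. u \<in> cball p r \<Longrightarrow> w \<in> cball p r \<Longrightarrow> w' \<in> cball p r \<Longrightarrow>
       norm (F (u, w) - F (u, w') - (w - w')) \<le> C * norm (u - p) * norm (w - w')"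
proof -
  obtain R where R: "0 < R" "cball (p, p) R \<subseteq> S"
    using S open_contains_cball[of S] by blast
  obtain M where M: "0 \<le> M"
    "\<And>x y v. x \<in> cball (p, p) R \<Longrightarrow> y \<in> cball (p, p) R \<Longrightarrow>
      norm (F' x v - F' y v) \<le> M * norm (x - y) * norm v"
    using C_diff_2_Lipschitz_derivative[OF C2 R(2)] by metis
  define r where "r = R / 2"
  have sub: "(u, w) \<in> cball (p, p) R" if "u \<in> cball p r" "w \<in> cball p r" for u w
    using that norm_Pair_le[of "p - u" "p - w"] by (auto simp: r_def dist_norm)
  have rp: "p \<in> cball p r" using R by (simp add: r_def)
  have inS: "(u, w) \<in> S" if "u \<in> cball p r" "w \<in> cball p r" for u w
    using sub[OF that] R by blast
  show ?thesis
  proof (rule that[of r M])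
    show "0 < r" using R by (simp add: r_def)
    show "cball p r \<times> cball p r \<subseteq> S"
      by (rule subsetI, erule SigmaE, hypsubst, rule inS)
    fix u u' w assume u: "u \<in> cball p r" "u' \<in> cball p r" and w: "w \<in> cball p r"
    have "norm ((F (u, w) - u) - (F (u', w) - u')) \<le> M * norm (w - p) * norm (u - u')"
    proof (rule differentiable_bound[OF convex_cball, of p r "\<lambda>u. F (u, w) - u" "\<lambda>u h. F' (u, w) (h, 0) - h"])
      fix z assume z: "z \<in> cball p r"
      show "((\<lambda>u. F (u, w) - u) has_derivative (\<lambda>h. F' (z, w) (h, 0) - h)) (at z within cball p r)"
        by (rule has_derivative_at_withinI,
            rule has_derivative_diff[OF has_derivative_fst_slice[OF diff] has_derivative_ident],
            rule inS[OF z w])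
      show "onorm (\<lambda>h. F' (z, w) (h, 0) - h) \<le> M * norm (w - p)"
      proof (rule onorm_le)
        fix h
        have "norm (F' (z, w) (h, 0) - F' (z, p) (h, 0)) \<le> M * norm ((z, w) - (z, p)) * norm (h, 0::'e)"
          by (rule M(2)[OF sub[OF z w] sub[OF z rp]])
        then show "norm (F' (z, w) (h, 0) - h) \<le> M * norm (w - p) * norm h"
          by (simp add: F'_right_unit[OF inS[OF z rp]] norm_Pair)
      qed
    qed (use u in auto)
    then show "norm (F (u, w) - F (u', w) - (u - u')) \<le> M * norm (w - p) * norm (u - u')"
      by (simp add: algebra_simps)
  next
    fix u w w' assume u: "u \<in> cball p r" and w: "w \<in> cball p r" "w' \<in> cball p r"
    have "norm ((F (u, w) - w) - (F (u, w') - w')) \<le> M * norm (u - p) * norm (w - w')"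
    proof (rule differentiable_bound[OF convex_cball, of p r "\<lambda>w. F (u, w) - w" "\<lambda>w h. F' (u, w) (0, h) - h"])
      fix z assume z: "z \<in> cball p r"
      show "((\<lambda>w. F (u, w) - w) has_derivative (\<lambda>h. F' (u, z) (0, h) - h)) (at z within cball p r)"
        by (rule has_derivative_at_withinI,
            rule has_derivative_diff[OF has_derivative_snd_slice[OF diff] has_derivative_ident],
            rule inS[OF u z])
      show "onorm (\<lambda>h. F' (u, z) (0, h) - h) \<le> M * norm (u - p)"
      proof (rule onorm_le)
        fix h
        have "norm (F' (u, z) (0, h) - F' (p, z) (0, h)) \<le> M * norm ((u, z) - (p, z)) * norm (0::'e, h)"
          by (rule M(2)[OF sub[OF u z] sub[OF rp z]])
        then show "norm (F' (u, z) (0, h) - h) \<le> M * norm (u - p) * norm h"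
          by (simp add: F'_left_unit[OF inS[OF rp z]] norm_Pair)
      qed
    qed (use w in auto)
    then show "norm (F (u, w) - F (u, w') - (w - w')) \<le> M * norm (u - p) * norm (w - w')"
      by (simp add: algebra_simps)
  qed (rule M)
qed

text \<open>The two mixed second derivatives at (p, p); their difference will be the Lie
  bracket.\<close>

lemma slice_derivatives:
  obtains L R where "((\<lambda>u. F' (u, p) (0, Z)) has_derivative L) (at p)"
    "((\<lambda>w. F' (p, w) (Z, 0)) has_derivative R) (at p)"
proof -
  have d: "(\<lambda>x. F' x v) differentiable (at (p, p))" for v
    by (rule bspec[OF conjunct1[OF spec[OF conjunct2[OF C2[unfolded C_diff.simps]]]] S(2)])
  show ?thesis
    by (rule that) (rule has_derivative_fst_slice[OF d], rule has_derivative_snd_slice[OF d])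
qed

end

section \<open>Sequences in topological groups\<close>

locale top_group = group G for G (structure) +
  fixes T :: "'a topology"
  assumes topspace: "topspace T = carrier G"
    and hausdorff: "Hausdorff_space T"
    and mult_cont: "continuous_map (prod_topology T T) T (\<lambda>(x, y). x \<otimes> y)"
    and inv_cont: "continuous_map T T (\<lambda>x. inv x)"
begin

lemma limit_carrier: "limitin T x a F \<Longrightarrow> a \<in> carrier G"
  using limitin_topspace topspace by metis

lemma limit_mult:
  assumes "limitin T x a F" "limitin T y b F"
  shows "limitin T (\<lambda>n. x n \<otimes> y n) (a \<otimes> b) F"
proof -
  have "limitin (prod_topology T T) (\<lambda>n. (x n, y n)) (a, b) F"
    using assms by (simp add: limitin_pairwise o_def)
  from continuous_map_limit[OF mult_cont this] show ?thesis by (simp add: o_def)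
qed

lemma limit_inv: "limitin T x a F \<Longrightarrow> limitin T (\<lambda>n. inv (x n)) (inv a) F"
  using continuous_map_limit[OF inv_cont, of x a F] by (simp add: o_def)

lemma limit_const: "a \<in> carrier G \<Longrightarrow> limitin T (\<lambda>_. a) a F"
  by (simp add: limitin_const_iff topspace)

lemma limit_pow: "limitin T x a F \<Longrightarrow> limitin T (\<lambda>n. x n [^] (k::nat)) (a [^] k) F"
  by (induction k) (simp_all add: limit_const limit_mult topspace)

lemma limit_unique: "limitin T x a F \<Longrightarrow> limitin T x b F \<Longrightarrow> F \<noteq> bot \<Longrightarrow> a = b"
  using limitin_Hausdorff_unique hausdorff by metis

lemma limit_subseq: "limitin T x a sequentially \<Longrightarrow> filterlim q at_top sequentially \<Longrightarrow>
    limitin T (\<lambda>n. x (q n)) a sequentially"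
  by (auto simp: limitin_def filterlim_iff)

lemma limit_cong:
  "\<forall>\<^sub>F n in F. x n = y n \<Longrightarrow> limitin T x a F \<Longrightarrow> limitin T y a F"
  by (rule limitin_transform_eventually)

end

section \<open>The exponential map of a Lie group\<close>

text \<open>A sequence \<open>t\<close> with \<open>n \<phi> (t n) \<longlonglongrightarrow> W\<close> represents the tangent vector \<open>W\<close> at the identity;
  all differentiation in the group is expressed through such sequences.\<close>

definition tangent ::
    "('g, 'm) monoid_scheme \<Rightarrow> 'g set \<Rightarrow> ('g \<Rightarrow> 'e::euclidean_space) \<Rightarrow> (nat \<Rightarrow> 'g) \<Rightarrow> 'e \<Rightarrow> bool" where
  "tangent G U \<phi> t W \<longleftrightarrow> (\<forall>n. t n \<in> carrier G) \<and> (\<forall>\<^sub>F n in sequentially. t n \<in> U) \<and>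
     (\<lambda>n. real n *\<^sub>R \<phi> (t n)) \<longlonglongrightarrow> W"

text \<open>The differential of the conjugation is tested on tangent sequences, so that no chart at
  g is mentioned.\<close>

definition conj_derivative ::
    "('g, 'm) monoid_scheme \<Rightarrow> 'g set \<Rightarrow> ('g \<Rightarrow> 'e::euclidean_space) \<Rightarrow> 'g \<Rightarrow> ('e \<Rightarrow> 'e) \<Rightarrow> bool" where
  "conj_derivative G U \<phi> g A \<longleftrightarrow> linear A \<and>
     (\<forall>t X. tangent G U \<phi> t X \<longrightarrow> tangent G U \<phi> (\<lambda>n. g \<otimes>\<^bsub>G\<^esub> t n \<otimes>\<^bsub>G\<^esub> inv\<^bsub>G\<^esub> g) (A X))"

text \<open>What the exponential map and the adjoint representation use of the smooth structure, in
  one chart at the identity. \<open>bracket_ex\<close> is the derivative at the identity of the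
  differentials in \<open>conj_derivative_ex\<close>.\<close>

locale chart_group = top_group G T for G (structure) and T :: "'a topology" +
  fixes U :: "'a set" and \<phi> :: "'a \<Rightarrow> 'e::euclidean_space" and r C :: real
  assumes U_open: "openin T U" and one_U: "\<one> \<in> U" and phi_one: "\<phi> \<one> = 0"
    and homeo: "homeomorphic_map (subtopology T U) (top_of_set (\<phi> ` U)) \<phi>"
    and r_pos: "0 < r" and C_nonneg: "0 \<le> C" and cball_r: "cball 0 r \<subseteq> \<phi> ` U"
    and mult_U: "x \<in> U \<Longrightarrow> y \<in> U \<Longrightarrow> norm (\<phi> x) \<le> r \<Longrightarrow> norm (\<phi> y) \<le> r \<Longrightarrow> x \<otimes> y \<in> U"
    and E1: "x \<in> U \<Longrightarrow> x' \<in> U \<Longrightarrow> y \<in> U \<Longrightarrow> norm (\<phi> x) \<le> r \<Longrightarrow> norm (\<phi> x') \<le> r \<Longrightarrow> norm (\<phi> y) \<le> r \<Longrightarrow>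
       norm (\<phi> (x \<otimes> y) - \<phi> (x' \<otimes> y) - (\<phi> x - \<phi> x')) \<le> C * norm (\<phi> y) * norm (\<phi> x - \<phi> x')"
    and E2: "x \<in> U \<Longrightarrow> y \<in> U \<Longrightarrow> y' \<in> U \<Longrightarrow> norm (\<phi> x) \<le> r \<Longrightarrow> norm (\<phi> y) \<le> r \<Longrightarrow> norm (\<phi> y') \<le> r \<Longrightarrow>
       norm (\<phi> (x \<otimes> y) - \<phi> (x \<otimes> y') - (\<phi> y - \<phi> y')) \<le> C * norm (\<phi> x) * norm (\<phi> y - \<phi> y')"
    and conj_derivative_ex: "g \<in> carrier G \<Longrightarrow> \<exists>A. conj_derivative G U \<phi> g A"
    and bracket_ex: "\<exists>B. \<forall>t X Z A. tangent G U \<phi> t X \<longrightarrow> (\<forall>n. conj_derivative G U \<phi> (t n) (A n)) \<longrightarrow>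
       (\<lambda>n. real n *\<^sub>R (A n Z - Z)) \<longlonglongrightarrow> B X Z"
begin

lemma U_carrier: "x \<in> U \<Longrightarrow> x \<in> carrier G"
  using U_open openin_subset topspace by blast

lemma topU: "topspace (subtopology T U) = U"
  using U_open openin_subset by fastforce

lemma inj_phi: "inj_on \<phi> U"
  using homeomorphic_imp_injective_map[OF homeo] topU by simp

definition c where "c \<xi> = inv_into U \<phi> \<xi>"

lemma c_phi: "x \<in> U \<Longrightarrow> c (\<phi> x) = x"
  using inj_phi by (simp add: c_def)

lemma phi_c: "norm \<xi> \<le> r \<Longrightarrow> \<phi> (c \<xi>) = \<xi>" and c_U: "norm \<xi> \<le> r \<Longrightarrow> c \<xi> \<in> U"
  using cball_r by (auto simp: c_def f_inv_into_f inv_into_into subset_iff)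

lemma limit_chart:
  assumes "y \<in> U" "\<forall>\<^sub>F n in F. x n \<in> U" "((\<lambda>n. \<phi> (x n)) \<longlongrightarrow> \<phi> y) F"
  shows "limitin T x y F"
proof -
  obtain g where g: "homeomorphic_maps (subtopology T U) (top_of_set (\<phi> ` U)) \<phi> g"
    using homeo homeomorphic_map_maps by blast
  have gc: "continuous_map (top_of_set (\<phi> ` U)) (subtopology T U) g"
    and gp: "\<And>x. x \<in> U \<Longrightarrow> g (\<phi> x) = x"
    using g topU by (auto simp: homeomorphic_maps_def)
  have "limitin (top_of_set (\<phi> ` U)) (\<lambda>n. \<phi> (x n)) (\<phi> y) F"
    using assms by (auto simp: limitin_subtopology elim!: eventually_mono)
  from continuous_map_limit[OF gc this]
  have "limitin T (\<lambda>n. g (\<phi> (x n))) y F"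
    using gp assms(1) by (simp add: limitin_subtopology o_def)
  moreover have "\<forall>\<^sub>F n in F. g (\<phi> (x n)) = x n"
    using assms(2) by eventually_elim (rule gp)
  ultimately show ?thesis
    by (rule limit_cong[rotated])
qed

lemma limit_chartD:
  assumes "limitin T x y F" "y \<in> U"
  shows "\<forall>\<^sub>F n in F. x n \<in> U" "((\<lambda>n. \<phi> (x n)) \<longlongrightarrow> \<phi> y) F"
proof -
  show ev: "\<forall>\<^sub>F n in F. x n \<in> U"
    using assms U_open by (auto simp: limitin_def)
  have "limitin (subtopology T U) x y F"
    using assms ev by (simp add: limitin_subtopology)
  from continuous_map_limit[OF homeomorphic_imp_continuous_map[OF homeo] this]
  show "((\<lambda>n. \<phi> (x n)) \<longlongrightarrow> \<phi> y) F"
    by (simp add: limitin_subtopology o_def)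
qed

lemma E_mult:
  assumes "x \<in> U" "y \<in> U" "norm (\<phi> x) \<le> r" "norm (\<phi> y) \<le> r"
  shows "norm (\<phi> (x \<otimes> y) - (\<phi> x + \<phi> y)) \<le> C * norm (\<phi> x) * norm (\<phi> y)"
proof -
  have "norm (\<phi> (x \<otimes> y) - \<phi> (\<one> \<otimes> y) - (\<phi> x - \<phi> \<one>)) \<le> C * norm (\<phi> y) * norm (\<phi> x - \<phi> \<one>)"
    using assms one_U phi_one r_pos by (intro E1) auto
  then show ?thesis
    using assms U_carrier by (simp add: phi_one algebra_simps)
qed

subsection \<open>Powers near the identity\<close>

text \<open>As long as n |phi x| is at most \<open>rho\<close>, the powers of x up to n stay in the
  ball of radius r, thanks to r / 2, and each multiplication adds an error of at most |phi x|,
  thanks to 2 C rho <= 1.\<close>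

definition rho where "rho = min (r / 2) (1 / (2 * C + 2))"

lemma rho_pos: "0 < rho"
  using r_pos C_nonneg by (simp add: rho_def)

lemma rho_r: "2 * rho \<le> r"
  by (simp add: rho_def)

lemma rho_C: "2 * C * rho \<le> 1"
proof -
  have "2 * C * rho \<le> 2 * C * (1 / (2 * C + 2))"
    using C_nonneg by (intro mult_left_mono) (auto simp: rho_def)
  also have "\<dots> \<le> 1" using C_nonneg by (simp add: field_simps)
  finally show ?thesis .
qed

lemma rho_C': "real n * d \<le> rho \<Longrightarrow> j \<le> n \<Longrightarrow> 0 \<le> d \<Longrightarrow> 2 * C * (real j * d) \<le> 1"
  using rho_C C_nonneg mult_left_mono[of "real j * d" rho "2 * C"] mult_right_mono[of "real j" "real n" d]
  by simp

text \<open>Each multiplication by x adds |phi x| and an error of at most the same size, hence the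
  factor 2.\<close>

lemma pow_bound:
  assumes x: "x \<in> U" and n: "real n * norm (\<phi> x) \<le> rho"
  shows "j \<le> n \<Longrightarrow> x [^] j \<in> U \<and> norm (\<phi> (x [^] j)) \<le> 2 * real j * norm (\<phi> x)"
proof (induction j)
  case 0
  then show ?case using one_U phi_one by simp
next
  case (Suc j)
  let ?d = "norm (\<phi> x)"
  have IH: "x [^] j \<in> U" "norm (\<phi> (x [^] j)) \<le> 2 * real j * ?d" using Suc by auto
  have jd: "real j * ?d \<le> rho" "?d \<le> rho"
    using n Suc.prems mult_right_mono[of "real j" "real n" ?d] mult_right_mono[of 1 "real n" ?d]
    by auto
  have nr: "norm (\<phi> (x [^] j)) \<le> r" "?d \<le> r"
    using IH(2) jd rho_r rho_pos by linarith+
  have "norm (\<phi> (x [^] j \<otimes> x) - (\<phi> (x [^] j) + \<phi> x)) \<le> C * norm (\<phi> (x [^] j)) * ?d"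
    by (rule E_mult[OF IH(1) x nr])
  also have "\<dots> \<le> C * (2 * real j * ?d) * ?d"
    using IH(2) C_nonneg by (intro mult_right_mono mult_left_mono) auto
  also have "\<dots> = (2 * C * (real j * ?d)) * ?d" by simp
  also have "\<dots> \<le> 1 * ?d"
    using Suc.prems by (intro mult_right_mono rho_C'[OF n]) auto
  finally have "norm (\<phi> (x [^] j \<otimes> x) - (\<phi> (x [^] j) + \<phi> x)) \<le> ?d" by simp
  moreover have "norm (\<phi> (x [^] j \<otimes> x)) \<le>
      norm (\<phi> (x [^] j \<otimes> x) - (\<phi> (x [^] j) + \<phi> x)) + norm (\<phi> (x [^] j)) + ?d"
    using norm_triangle_ineq[of "\<phi> (x [^] j \<otimes> x) - (\<phi> (x [^] j) + \<phi> x)" "\<phi> (x [^] j) + \<phi> x"]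
      norm_triangle_ineq[of "\<phi> (x [^] j)" "\<phi> x"] by simp
  ultimately have "norm (\<phi> (x [^] j \<otimes> x)) \<le> 2 * real (Suc j) * ?d"
    using IH(2) by (simp add: algebra_simps)
  then show ?case
    using mult_U[OF IH(1) x nr] by simp
qed

lemma pow_norm_r:
  assumes "x \<in> U" "real n * norm (\<phi> x) \<le> rho" "j \<le> n"
  shows "norm (\<phi> (x [^] j)) \<le> r"
  using pow_bound[OF assms] mult_right_mono[of "real j" "real n" "norm (\<phi> x)"] assms rho_r
  by simp

text \<open>The error 2 C j |phi x|^2 of step j sums to C (j |phi x|)^2, because 2 j <= (j + 1)^2 -
  j^2.\<close>

lemma pow_linear:
  assumes x: "x \<in> U" and n: "real n * norm (\<phi> x) \<le> rho"
  shows "j \<le> n \<Longrightarrow> norm (\<phi> (x [^] j) - real j *\<^sub>R \<phi> x) \<le> C * (real j * norm (\<phi> x))\<^sup>2"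
proof (induction j)
  case 0
  then show ?case using phi_one by simp
next
  case (Suc j)
  let ?d = "norm (\<phi> x)" and ?y = "x [^] j"
  have y: "?y \<in> U" "norm (\<phi> ?y) \<le> 2 * real j * ?d" "norm (\<phi> ?y) \<le> r"
    using pow_bound[OF x n, of j] pow_norm_r[OF x n, of j] Suc by auto
  have "?d \<le> rho" using n Suc.prems mult_right_mono[of 1 "real n" ?d] by auto
  then have dr: "?d \<le> r" using rho_r rho_pos by linarith
  have "norm (\<phi> (?y \<otimes> x) - (\<phi> ?y + \<phi> x)) \<le> C * norm (\<phi> ?y) * ?d"
    by (rule E_mult[OF y(1) x y(3) dr])
  also have "\<dots> \<le> C * (2 * real j * ?d) * ?d"
    using y(2) C_nonneg by (intro mult_right_mono mult_left_mono) auto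
  finally have 1: "norm (\<phi> (?y \<otimes> x) - (\<phi> ?y + \<phi> x)) \<le> C * (2 * real j * ?d\<^sup>2)"
    by (simp add: power2_eq_square mult_ac)
  have IH: "norm (\<phi> ?y - real j *\<^sub>R \<phi> x) \<le> C * (real j * ?d)\<^sup>2"
    using Suc by simp
  have eq: "\<phi> (?y \<otimes> x) - real (Suc j) *\<^sub>R \<phi> x =
      (\<phi> (?y \<otimes> x) - (\<phi> ?y + \<phi> x)) + (\<phi> ?y - real j *\<^sub>R \<phi> x)"
    by (simp add: algebra_simps)
  have "norm (\<phi> (?y \<otimes> x) - real (Suc j) *\<^sub>R \<phi> x) \<le> C * (2 * real j * ?d\<^sup>2) + C * (real j * ?d)\<^sup>2"
    unfolding eq by (rule norm_triangle_le[OF add_mono[OF 1 IH]])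
  also have "\<dots> \<le> C * (real (Suc j) * ?d)\<^sup>2"
    using C_nonneg by (simp add: power2_eq_square algebra_simps)
  finally show ?case by simp
qed

text \<open>The factor 4 counts, in each step, 1 for the new factor, 1 for the error from
  \<open>E2\<close> and 2 for the error from \<open>E1\<close>.\<close>

lemma pow_diff:
  assumes x: "x \<in> U" "real n * norm (\<phi> x) \<le> rho" and y: "y \<in> U" "real n * norm (\<phi> y) \<le> rho"
  shows "j \<le> n \<Longrightarrow> norm (\<phi> (x [^] j) - \<phi> (y [^] j)) \<le> 4 * real j * norm (\<phi> x - \<phi> y)"
proof (induction j)
  case 0
  then show ?case by simp
next
  case (Suc j)
  let ?D = "norm (\<phi> x - \<phi> y)" and ?u = "x [^] j" and ?v = "y [^] j"
  have u: "?u \<in> U" "norm (\<phi> ?u) \<le> r" and v: "?v \<in> U" "norm (\<phi> ?v) \<le> 2 * real j * norm (\<phi> y)" "norm (\<phi> ?v) \<le> r"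
    using pow_bound[OF x, of j] pow_norm_r[OF x, of j] pow_bound[OF y, of j] pow_norm_r[OF y, of j] Suc
    by auto
  have "norm (\<phi> x) \<le> rho" "norm (\<phi> y) \<le> rho"
    using x(2) y(2) Suc.prems mult_right_mono[of 1 "real n" "norm (\<phi> x)"] mult_right_mono[of 1 "real n" "norm (\<phi> y)"]
    by auto
  then have nr: "norm (\<phi> x) \<le> r" "norm (\<phi> y) \<le> r" using rho_r rho_pos by linarith+
  have IH: "norm (\<phi> ?u - \<phi> ?v) \<le> 4 * real j * ?D" using Suc by simp
  have "norm (\<phi> (?u \<otimes> x) - \<phi> (?v \<otimes> x) - (\<phi> ?u - \<phi> ?v)) \<le> C * norm (\<phi> x) * norm (\<phi> ?u - \<phi> ?v)"
    using u v nr x by (intro E1) auto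
  also have "\<dots> \<le> C * norm (\<phi> x) * (4 * real j * ?D)"
    using IH C_nonneg by (intro mult_left_mono) auto
  also have "\<dots> = 2 * ((2 * C * (real j * norm (\<phi> x))) * ?D)" by simp
  also have "\<dots> \<le> 2 * (1 * ?D)"
    using Suc.prems by (intro mult_left_mono mult_right_mono rho_C'[OF x(2)]) auto
  finally have 1: "norm (\<phi> (?u \<otimes> x) - \<phi> (?v \<otimes> x) - (\<phi> ?u - \<phi> ?v)) \<le> 2 * ?D" by simp
  have "norm (\<phi> (?v \<otimes> x) - \<phi> (?v \<otimes> y) - (\<phi> x - \<phi> y)) \<le> C * norm (\<phi> ?v) * ?D"
    using v nr x y by (intro E2) auto
  also have "\<dots> \<le> C * (2 * real j * norm (\<phi> y)) * ?D"
    using v(2) C_nonneg by (intro mult_right_mono mult_left_mono) auto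
  also have "\<dots> = (2 * C * (real j * norm (\<phi> y))) * ?D" by simp
  also have "\<dots> \<le> 1 * ?D"
    using Suc.prems by (intro mult_right_mono rho_C'[OF y(2)]) auto
  finally have 2: "norm (\<phi> (?v \<otimes> x) - \<phi> (?v \<otimes> y) - (\<phi> x - \<phi> y)) \<le> ?D" by simp
  have "\<phi> (?u \<otimes> x) - \<phi> (?v \<otimes> y) = (\<phi> (?u \<otimes> x) - \<phi> (?v \<otimes> x) - (\<phi> ?u - \<phi> ?v))
      + (\<phi> (?v \<otimes> x) - \<phi> (?v \<otimes> y) - (\<phi> x - \<phi> y)) + (\<phi> ?u - \<phi> ?v) + (\<phi> x - \<phi> y)"
    by simp
  also have "norm \<dots> \<le> 2 * ?D + ?D + 4 * real j * ?D + ?D"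
    using 1 2 IH by (intro norm_triangle_le add_mono) auto
  finally show ?case by (simp add: algebra_simps)
qed

subsection \<open>Definition and continuity of the exponential map\<close>

lemma c_small:
  assumes "norm X \<le> rho" "0 < n"
  shows "c (X /\<^sub>R real n) \<in> U" "\<phi> (c (X /\<^sub>R real n)) = X /\<^sub>R real n"
    "real n * norm (\<phi> (c (X /\<^sub>R real n))) = norm X"
proof -
  have "norm X / real n \<le> norm X" using assms(2) by (simp add: divide_le_eq mult_le_cancel_left1)
  then have "norm (X /\<^sub>R real n) \<le> r"
    using assms rho_r rho_pos by (simp add: divide_inverse mult.commute)
  then show "c (X /\<^sub>R real n) \<in> U" and e: "\<phi> (c (X /\<^sub>R real n)) = X /\<^sub>R real n"
    by (rule c_U, rule phi_c)
  show "real n * norm (\<phi> (c (X /\<^sub>R real n))) = norm X"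
    unfolding e using assms(2) by simp
qed

definition expc where "expc X n = \<phi> (c (X /\<^sub>R real n) [^] n)"

text \<open>The m-th power of c(X / (m n)) agrees with c(X / n) up to C (|X| / n)^2 by
  \<open>pow_linear\<close>, and taking n-th powers multiplies the error by at most 4 n. The bound
  rho / 2 leaves room for that m-th power, which may be twice as large as X / n.\<close>

lemma expc_refine:
  assumes X: "norm X \<le> rho / 2" and n: "0 < n" and m: "0 < m"
  shows "norm (expc X (m * n) - expc X n) \<le> 4 * C * (norm X)\<^sup>2 / real n"
proof -
  have X': "norm X \<le> rho" using X rho_pos by simp
  let ?x = "c (X /\<^sub>R real (m * n))" and ?y = "c (X /\<^sub>R real n)"
  have x: "?x \<in> U" "\<phi> ?x = X /\<^sub>R real (m * n)" "real (m * n) * norm (\<phi> ?x) = norm X"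
    and y: "?y \<in> U" "\<phi> ?y = X /\<^sub>R real n" "real n * norm (\<phi> ?y) = norm X"
    using c_small[OF X', of "m * n"] c_small[OF X' n] n m by (auto simp del: of_nat_mult)
  have mn: "m \<le> m * n" using n by simp
  have z: "?x [^] m \<in> U" "norm (\<phi> (?x [^] m)) \<le> 2 * real m * norm (\<phi> ?x)"
    using pow_bound[OF x(1) _ mn] x(3) X' by auto
  have "real n * norm (\<phi> (?x [^] m)) \<le> real n * (2 * real m * norm (\<phi> ?x))"
    by (intro mult_left_mono z) simp
  also have "\<dots> = 2 * (real (m * n) * norm (\<phi> ?x))" by simp
  also have "\<dots> \<le> rho" using x(3) X by simp
  finally have nz: "real n * norm (\<phi> (?x [^] m)) \<le> rho" .
  have "real (m * n) * norm (\<phi> ?x) \<le> rho"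
    unfolding x(3) by (rule X')
  then have "norm (\<phi> (?x [^] m) - real m *\<^sub>R \<phi> ?x) \<le> C * (real m * norm (\<phi> ?x))\<^sup>2"
    by (rule pow_linear[OF x(1) _ mn])
  moreover have "real m *\<^sub>R \<phi> ?x = \<phi> ?y" using x(2) y(2) m by simp
  moreover have "real m * norm (\<phi> ?x) = norm X / real n"
    using x(3) n m by (simp add: field_simps)
  ultimately have d: "norm (\<phi> (?x [^] m) - \<phi> ?y) \<le> C * (norm X / real n)\<^sup>2" by simp
  have "norm (\<phi> ((?x [^] m) [^] n) - \<phi> (?y [^] n)) \<le> 4 * real n * norm (\<phi> (?x [^] m) - \<phi> ?y)"
    by (rule pow_diff[OF z(1) nz y(1) _ order_refl]) (unfold y(3), rule X')
  also have "\<dots> \<le> 4 * real n * (C * (norm X / real n)\<^sup>2)"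
    using d by (intro mult_left_mono) auto
  also have "\<dots> = 4 * C * (norm X)\<^sup>2 / real n"
    using n by (simp add: power2_eq_square field_simps)
  finally show ?thesis
    unfolding expc_def using x(1) U_carrier by (simp add: nat_pow_pow)
qed

definition explim where "explim X = lim (expc X)"

lemma expc_tendsto:
  assumes X: "norm X \<le> rho / 2"
  shows "expc X \<longlonglongrightarrow> explim X"
proof -
  define K where "K = 4 * C * (norm X)\<^sup>2"
  have K: "0 \<le> K" using C_nonneg by (simp add: K_def)
  have "Cauchy (expc X)"
  proof (rule CauchyI)
    fix e :: real assume e: "0 < e"
    obtain N :: nat where N: "2 * K / e < N" "0 < N"
      using reals_Archimedean2[of "2 * K / e"] K e by (metis divide_nonneg_pos gr0I mult_nonneg_nonneg
          not_less of_nat_0 zero_le_numeral)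
    show "\<exists>M. \<forall>m\<ge>M. \<forall>n\<ge>M. norm (expc X m - expc X n) < e"
    proof (intro exI allI impI)
      fix m n assume mn: "N \<le> m" "N \<le> n"
      \<comment> \<open>The stages m and n are compared through their common refinement m n.\<close>
      have "norm (expc X (m * n) - expc X n) \<le> K / real n" "norm (expc X (n * m) - expc X m) \<le> K / real m"
        using expc_refine[OF X, of n m] expc_refine[OF X, of m n] mn N by (auto simp: K_def)
      moreover have "K / real n \<le> K / real N" "K / real m \<le> K / real N"
        using mn N K by (auto intro!: divide_left_mono)
      ultimately have "norm (expc X m - expc X n) \<le> K / real N + K / real N"
        using norm_triangle_ineq4[of "expc X (m * n) - expc X n" "expc X (m * n) - expc X m"]
        by (simp only: mult.commute[of n m] diff_diff_eq2 diff_add_cancel) (simp add: norm_minus_commute)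
      also have "\<dots> < e" using N e by (simp add: field_simps)
      finally show "norm (expc X m - expc X n) < e" .
    qed
  qed
  then show ?thesis
    unfolding explim_def using Cauchy_convergent_iff convergent_LIMSEQ_iff by blast
qed

lemma expc_bounds:
  assumes X: "norm X \<le> rho" and n: "0 < n"
  shows "norm (expc X n - X) \<le> C * (norm X)\<^sup>2" "norm (expc X n) \<le> 2 * norm X"
    "c (X /\<^sub>R real n) [^] n \<in> U"
proof -
  let ?x = "c (X /\<^sub>R real n)"
  note x = c_small[OF X n]
  have nn: "real n * norm (\<phi> ?x) \<le> rho" unfolding x(3) by (rule X)
  have "real n *\<^sub>R \<phi> ?x = X" using x(2) n by simp
  then show "norm (expc X n - X) \<le> C * (norm X)\<^sup>2"
    using pow_linear[OF x(1) nn order_refl] x(3) by (simp add: expc_def)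
  have "2 * real n * norm (\<phi> ?x) = 2 * norm X" using x(3) by simp
  then show "norm (expc X n) \<le> 2 * norm X" "?x [^] n \<in> U"
    using pow_bound[OF x(1) nn order_refl] by (auto simp: expc_def)
qed

lemma explim_bounds:
  assumes X: "norm X \<le> rho / 2"
  shows "norm (explim X - X) \<le> C * (norm X)\<^sup>2" "norm (explim X) \<le> 2 * norm X" "norm (explim X) \<le> r"
proof -
  have X': "norm X \<le> rho" using X rho_pos by simp
  have ev: "\<forall>\<^sub>F n in sequentially. (0::nat) < n" by (rule eventually_gt_at_top)
  show "norm (explim X - X) \<le> C * (norm X)\<^sup>2"
    by (rule tendsto_upperbound[OF tendsto_norm[OF tendsto_diff[OF expc_tendsto[OF X] tendsto_const]]])
      (use eventually_mono[OF ev expc_bounds(1)[OF X']] in auto)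
  show 2: "norm (explim X) \<le> 2 * norm X"
    by (rule tendsto_upperbound[OF tendsto_norm[OF expc_tendsto[OF X]]])
      (use eventually_mono[OF ev expc_bounds(2)[OF X']] in auto)
  show "norm (explim X) \<le> r" using 2 X rho_r rho_pos by linarith
qed

lemma explim_Lipschitz:
  assumes X: "norm X \<le> rho / 2" and Y: "norm Y \<le> rho / 2"
  shows "norm (explim X - explim Y) \<le> 4 * norm (X - Y)"
proof (rule tendsto_upperbound[OF tendsto_norm[OF tendsto_diff[OF expc_tendsto[OF X] expc_tendsto[OF Y]]]])
  have X': "norm X \<le> rho" and Y': "norm Y \<le> rho" using X Y rho_pos by auto
  show "\<forall>\<^sub>F n in sequentially. norm (expc X n - expc Y n) \<le> 4 * norm (X - Y)"
    using eventually_gt_at_top[of 0]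
  proof eventually_elim
    case (elim n)
    note x = c_small[OF X' elim] and y = c_small[OF Y' elim]
    have "real n * norm (\<phi> (c (X /\<^sub>R real n))) \<le> rho" "real n * norm (\<phi> (c (Y /\<^sub>R real n))) \<le> rho"
      unfolding x(3) y(3) by (rule X', rule Y')
    from pow_diff[OF x(1) this(1) y(1) this(2) order_refl]
    have "norm (expc X n - expc Y n) \<le> 4 * real n * norm (X /\<^sub>R real n - Y /\<^sub>R real n)"
      unfolding expc_def x(2) y(2) .
    also have "X /\<^sub>R real n - Y /\<^sub>R real n = (X - Y) /\<^sub>R real n"
      by (simp add: scaleR_diff_right)
    also have "4 * real n * norm ((X - Y) /\<^sub>R real n) = 4 * norm (X - Y)"
      using elim by simp
    finally show ?case .
  qed
qed simp

definition lexp where "lexp X = c (explim X)"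

lemma lexp_U: "norm X \<le> rho / 2 \<Longrightarrow> lexp X \<in> U" and phi_lexp: "norm X \<le> rho / 2 \<Longrightarrow> \<phi> (lexp X) = explim X"
  using explim_bounds c_U phi_c by (auto simp: lexp_def)

lemma pow_tendsto_lexp:
  assumes t: "\<forall>\<^sub>F n in sequentially. t n \<in> U" and q: "filterlim q at_top sequentially"
    and lim: "(\<lambda>n. real (q n) *\<^sub>R \<phi> (t n)) \<longlonglongrightarrow> W" and W: "norm W < rho / 2"
  shows "limitin T (\<lambda>n. t n [^] q n) (lexp W) sequentially"
proof (rule limit_chart[OF lexp_U])
  have W': "norm W \<le> rho / 2" "norm W \<le> rho" using W rho_pos by auto
  have "norm W < rho" using W rho_pos by linarith
  then have e1: "\<forall>\<^sub>F n in sequentially. norm (real (q n) *\<^sub>R \<phi> (t n)) < rho"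
    by (rule order_tendstoD(2)[OF tendsto_norm[OF lim]])
  have e2: "\<forall>\<^sub>F n in sequentially. 0 < q n"
    using q eventually_gt_at_top[of 0] by (auto simp: filterlim_iff)
  show "norm W \<le> rho / 2" by fact
  show "\<forall>\<^sub>F n in sequentially. t n [^] q n \<in> U"
    using t e1 by eventually_elim (use pow_bound[OF _ _ order_refl] in auto)
  \<comment> \<open>Compare with the powers of c(W / q n) that define the exponential;
    \<open>pow_diff\<close> bounds the difference by 4 |q n phi(t n) - W|.\<close>
  have "(\<lambda>n. \<phi> (t n [^] q n) - expc W (q n)) \<longlonglongrightarrow> 0"
  proof (rule Lim_null_comparison)
    show "\<forall>\<^sub>F n in sequentially. norm (\<phi> (t n [^] q n) - expc W (q n)) \<le> 4 * norm (real (q n) *\<^sub>R \<phi> (t n) - W)"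
      using t e1 e2
    proof eventually_elim
      case (elim n)
      note y = c_small[OF W'(2) elim(3)]
      have "real (q n) * norm (\<phi> (t n)) \<le> rho" "real (q n) * norm (\<phi> (c (W /\<^sub>R real (q n)))) \<le> rho"
        using elim(2) W'(2) unfolding y(3) by simp_all
      from pow_diff[OF elim(1) this(1) y(1) this(2) order_refl]
      have "norm (\<phi> (t n [^] q n) - expc W (q n)) \<le> 4 * real (q n) * norm (\<phi> (t n) - W /\<^sub>R real (q n))"
        unfolding expc_def y(2) .
      also have "\<phi> (t n) - W /\<^sub>R real (q n) = (real (q n) *\<^sub>R \<phi> (t n) - W) /\<^sub>R real (q n)"
        using elim(3) by (simp add: scaleR_diff_right)
      also have "4 * real (q n) * norm ((real (q n) *\<^sub>R \<phi> (t n) - W) /\<^sub>R real (q n))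
          = 4 * norm (real (q n) *\<^sub>R \<phi> (t n) - W)"
        using elim(3) by simp
      finally show ?case .
    qed
    have "(\<lambda>n. 4 * norm (real (q n) *\<^sub>R \<phi> (t n) - W)) \<longlonglongrightarrow> 4 * norm (W - W)"
      by (intro tendsto_intros lim)
    then show "(\<lambda>n. 4 * norm (real (q n) *\<^sub>R \<phi> (t n) - W)) \<longlonglongrightarrow> 0" by simp
  qed
  moreover have "(\<lambda>n. expc W (q n)) \<longlonglongrightarrow> explim W"
    by (rule filterlim_compose[OF expc_tendsto[OF W'(1)] q])
  ultimately have "(\<lambda>n. \<phi> (t n [^] q n) - expc W (q n) + expc W (q n)) \<longlonglongrightarrow> 0 + explim W"
    by (rule tendsto_add)
  then show "(\<lambda>n. \<phi> (t n [^] q n)) \<longlonglongrightarrow> \<phi> (lexp W)"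
    using phi_lexp[OF W'(1)] by simp
qed

text \<open>The integer N = floor(2 |W| / rho) + 1 brings W / N below rho / 2, into the range where
  \<open>explim\<close> is a limit. That the choice of N does not matter follows from
  \<open>pow_tendsto_expo\<close>.\<close>

definition expo where
  "expo W = lexp (W /\<^sub>R real (nat \<lfloor>2 * norm W / rho\<rfloor> + 1)) [^] (nat \<lfloor>2 * norm W / rho\<rfloor> + 1)"

lemma expo_small:
  assumes "norm W < rho / 2"
  shows "expo W = lexp W"
proof -
  have "2 * norm W / rho < 1" using assms rho_pos by (simp add: field_simps)
  moreover have "0 \<le> 2 * norm W / rho" using rho_pos by simp
  ultimately have "\<lfloor>2 * norm W / rho\<rfloor> = 0" by (simp add: floor_eq_iff)
  then show ?thesis
    unfolding expo_def using lexp_U[of W] U_carrier assms by simp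
qed

lemma chart_tendsto_0:
  assumes q: "filterlim q at_top sequentially" and lim: "(\<lambda>n. real (q n) *\<^sub>R x n) \<longlonglongrightarrow> (W :: 'e)"
  shows "x \<longlonglongrightarrow> 0"
proof -
  have "(\<lambda>n. (1 / real (q n)) *\<^sub>R (real (q n) *\<^sub>R x n)) \<longlonglongrightarrow> 0 *\<^sub>R W"
    by (intro tendsto_scaleR lim filterlim_compose[OF lim_1_over_n q])
  moreover have "\<forall>\<^sub>F n in sequentially. 0 < q n"
    using q eventually_gt_at_top[of 0] by (auto simp: filterlim_iff)
  then have "\<forall>\<^sub>F n in sequentially. (1 / real (q n)) *\<^sub>R (real (q n) *\<^sub>R x n) = x n"
    by eventually_elim simp
  ultimately show ?thesis
    using tendsto_cong by force
qed

text \<open>The key property of the exponential map: \<open>t\<^sub>n\<^bsup>q\<^sub>n\<^esup> \<longlonglongrightarrow> exp W\<close> as soon as \<open>q\<^sub>n \<phi> (t\<^sub>n) \<longlonglongrightarrow> W\<close>.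
  The general case is reduced to small \<open>W\<close> by dividing \<open>q\<^sub>n\<close> by a fixed \<open>N\<close>.\<close>

lemma pow_tendsto_expo:
  assumes tc: "\<And>n. t n \<in> carrier G"
    and t: "\<forall>\<^sub>F n in sequentially. t n \<in> U" and q: "filterlim q at_top sequentially"
    and lim: "(\<lambda>n. real (q n) *\<^sub>R \<phi> (t n)) \<longlonglongrightarrow> W"
  shows "limitin T (\<lambda>n. t n [^] q n) (expo W) sequentially"
proof -
  define N where "N = nat \<lfloor>2 * norm W / rho\<rfloor> + 1"
  have N: "0 < N" by (simp add: N_def)
  have "2 * norm W / rho < real N"
    unfolding N_def using rho_pos by linarith
  then have WN: "norm (W /\<^sub>R real N) < rho / 2"
    using rho_pos N by (simp add: field_simps)
  \<comment> \<open>Write q = p N + s with s < N: the N-th power of t^p tends to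
    \<open>expo W\<close>, and the factor t^s tends to the identity because s is bounded.\<close>
  define p where "p n = q n div N" for n
  define s where "s n = q n mod N" for n
  have qps: "q n = p n * N + s n" for n by (simp add: p_def s_def)
  have sN: "s n < N" for n using N by (simp add: s_def)
  have p: "filterlim p at_top sequentially"
    unfolding filterlim_at_top
  proof
    fix Z
    have "\<forall>\<^sub>F n in sequentially. Z * N \<le> q n" using q by (simp add: filterlim_at_top)
    then show "\<forall>\<^sub>F n in sequentially. Z \<le> p n"
      by eventually_elim (use N in \<open>simp add: p_def less_eq_div_iff_mult_less_eq\<close>)
  qed
  have x0: "(\<lambda>n. \<phi> (t n)) \<longlonglongrightarrow> 0" by (rule chart_tendsto_0[OF q lim])
  have sx: "(\<lambda>n. real (s n) *\<^sub>R \<phi> (t n)) \<longlonglongrightarrow> 0"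
  proof (rule Lim_null_comparison)
    show "\<forall>\<^sub>F n in sequentially. norm (real (s n) *\<^sub>R \<phi> (t n)) \<le> real N * norm (\<phi> (t n))"
      using sN by (intro always_eventually allI) (simp add: mult_right_mono less_imp_le)
    have "(\<lambda>n. real N * norm (\<phi> (t n))) \<longlonglongrightarrow> real N * norm (0::'e)"
      by (intro tendsto_intros x0)
    then show "(\<lambda>n. real N * norm (\<phi> (t n))) \<longlonglongrightarrow> 0" by simp
  qed
  have "(\<lambda>n. (real (q n) *\<^sub>R \<phi> (t n) - real (s n) *\<^sub>R \<phi> (t n)) /\<^sub>R real N) \<longlonglongrightarrow> (W - 0) /\<^sub>R real N"
    by (intro tendsto_intros lim sx)
  moreover have "(real (q n) *\<^sub>R \<phi> (t n) - real (s n) *\<^sub>R \<phi> (t n)) /\<^sub>R real N = real (p n) *\<^sub>R \<phi> (t n)" for n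
    using N by (simp add: qps scaleR_left_distrib)
  ultimately have "(\<lambda>n. real (p n) *\<^sub>R \<phi> (t n)) \<longlonglongrightarrow> W /\<^sub>R real N" by simp
  from limit_pow[OF pow_tendsto_lexp[OF t p this WN], of N]
  have l1: "limitin T (\<lambda>n. (t n [^] p n) [^] N) (expo W) sequentially"
    unfolding expo_def N_def by simp
  have l2: "limitin T (\<lambda>n. t n [^] s n) \<one> sequentially"
  proof (rule limit_chart[OF one_U])
    have "\<forall>\<^sub>F n in sequentially. norm (real N *\<^sub>R \<phi> (t n)) < rho"
      using order_tendstoD(2)[OF tendsto_norm[OF tendsto_scaleR[OF tendsto_const x0, of "real N"]], of rho] rho_pos
      by simp
    with t have ev: "\<forall>\<^sub>F n in sequentially. t n [^] s n \<in> U \<and> norm (\<phi> (t n [^] s n)) \<le> norm (2 * norm (real (s n) *\<^sub>R \<phi> (t n)))"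
      by eventually_elim (use pow_bound[OF _ _ less_imp_le[OF sN]] in \<open>auto simp: mult.assoc\<close>)
    then show "\<forall>\<^sub>F n in sequentially. t n [^] s n \<in> U" by eventually_elim simp
    have "(\<lambda>n. 2 * norm (real (s n) *\<^sub>R \<phi> (t n))) \<longlonglongrightarrow> 2 * norm (0::'e)"
      by (intro tendsto_intros sx)
    then have l: "(\<lambda>n. 2 * norm (real (s n) *\<^sub>R \<phi> (t n))) \<longlonglongrightarrow> 0" by simp
    have "\<forall>\<^sub>F n in sequentially. norm (\<phi> (t n [^] s n)) \<le> 2 * norm (real (s n) *\<^sub>R \<phi> (t n))"
      using ev by eventually_elim simp
    from Lim_null_comparison[OF this l] show "(\<lambda>n. \<phi> (t n [^] s n)) \<longlonglongrightarrow> \<phi> \<one>"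
      unfolding phi_one .
  qed
  have "(t n [^] p n) [^] N \<otimes> t n [^] s n = t n [^] q n" for n
    using tc by (simp add: nat_pow_pow nat_pow_mult qps)
  then show ?thesis
    using limit_mult[OF l1 l2] limit_carrier[OF l1] by simp
qed

end

section \<open>Closures of subgroups and the closed lower central series\<close>

context top_group
begin

lemma continuous_mult:
  assumes "continuous_map X T f" "continuous_map X T g"
  shows "continuous_map X T (\<lambda>x. f x \<otimes> g x)"
proof -
  have "continuous_map X (prod_topology T T) (\<lambda>x. (f x, g x))"
    using assms by (simp add: continuous_map_pairwise o_def)
  from continuous_map_compose[OF this mult_cont] show ?thesis by (simp add: o_def)
qed

lemma continuous_inv: "continuous_map X T f \<Longrightarrow> continuous_map X T (\<lambda>x. inv (f x))"
  using continuous_map_compose[OF _ inv_cont, of X f] by (simp add: o_def)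

lemma continuous_const: "a \<in> carrier G \<Longrightarrow> continuous_map X T (\<lambda>_. a)"
  by (simp add: topspace)

lemma conj_mult:
  "g \<in> carrier G \<Longrightarrow> x \<in> carrier G \<Longrightarrow> y \<in> carrier G \<Longrightarrow>
    (g \<otimes> x \<otimes> inv g) \<otimes> (g \<otimes> y \<otimes> inv g) = g \<otimes> (x \<otimes> y) \<otimes> inv g"
  by (metis inv_closed inv_solve_left m_assoc m_closed)

lemma conj_pow:
  "g \<in> carrier G \<Longrightarrow> x \<in> carrier G \<Longrightarrow> (g \<otimes> x \<otimes> inv g) [^] (n::nat) = g \<otimes> x [^] n \<otimes> inv g"
  by (induction n) (simp_all add: conj_mult)

lemma subgroup_closure:
  assumes H: "subgroup H G"
  shows "subgroup (T closure_of H) G"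
proof (rule subgroupI)
  have HG: "H \<subseteq> carrier G" using subgroup.subset[OF H] .
  show "T closure_of H \<subseteq> carrier G"
    using closure_of_subset_topspace topspace by metis
  have sub: "H \<subseteq> T closure_of H"
    using HG by (intro closure_of_subset) (simp add: topspace)
  then show "T closure_of H \<noteq> {}"
    using subgroup.one_closed[OF H] by blast
  show "inv x \<in> T closure_of H" if x: "x \<in> T closure_of H" for x
  proof -
    have "(\<lambda>x. inv x) ` (T closure_of H) \<subseteq> T closure_of ((\<lambda>x. inv x) ` H)"
      by (rule continuous_map_image_closure_subset[OF inv_cont])
    also have "\<dots> \<subseteq> T closure_of H"
      by (rule closure_of_mono) (use subgroup.m_inv_closed[OF H] in auto)
    finally show ?thesis using x by blast
  qed
  show "x \<otimes> y \<in> T closure_of H" if xy: "x \<in> T closure_of H" "y \<in> T closure_of H" for x y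
  proof -
    have "(\<lambda>(x, y). x \<otimes> y) ` (prod_topology T T closure_of (H \<times> H))
        \<subseteq> T closure_of ((\<lambda>(x, y). x \<otimes> y) ` (H \<times> H))"
      by (rule continuous_map_image_closure_subset[OF mult_cont])
    also have "\<dots> \<subseteq> T closure_of H"
      by (rule closure_of_mono) (use subgroup.m_closed[OF H] in auto)
    finally show ?thesis using xy unfolding closure_of_Times by fast
  qed
qed

lemma lower_central_subgroup: "subgroup (lower_central G i) G"
proof (induction i)
  case 0
  show ?case using subgroup_self by simp
next
  case (Suc i)
  have "lower_central G i \<subseteq> carrier G" using subgroup.subset[OF Suc] .
  then have "(\<Union>h\<in>carrier G. \<Union>k\<in>lower_central G i. {h \<otimes> k \<otimes> inv h \<otimes> inv k}) \<subseteq> carrier G"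
    by (auto intro!: m_closed inv_closed)
  then show ?case
    unfolding lower_central.simps commutator_subgroup_def by (rule generate_is_subgroup)
qed

text \<open>The lower central subgroups are not known to be closed, whereas limits of commutators
  have to stay in the next term of the series.\<close>

definition cl where "cl i = T closure_of (lower_central G i)"

lemma cl_subgroup: "subgroup (cl i) G"
  unfolding cl_def by (rule subgroup_closure[OF lower_central_subgroup])

lemma cl_0: "cl 0 = carrier G"
  by (simp add: cl_def closure_of_topspace topspace[symmetric])

text \<open>For fixed g the commutator is continuous in x, so the defining inclusion passes to the
  closure.\<close>

lemma cl_commutator:
  assumes g: "g \<in> carrier G" and x: "x \<in> cl i"
  shows "g \<otimes> x \<otimes> inv g \<otimes> inv x \<in> cl (Suc i)"
proof -
  have cont: "continuous_map T T (\<lambda>x. g \<otimes> x \<otimes> inv g \<otimes> inv x)"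
    using g by (intro continuous_mult continuous_inv continuous_const inv_closed continuous_map_id[unfolded id_def])
  have "(\<lambda>x. g \<otimes> x \<otimes> inv g \<otimes> inv x) ` cl i \<subseteq> T closure_of ((\<lambda>x. g \<otimes> x \<otimes> inv g \<otimes> inv x) ` lower_central G i)"
    unfolding cl_def by (rule continuous_map_image_closure_subset[OF cont])
  also have "\<dots> \<subseteq> cl (Suc i)"
    unfolding cl_def lower_central.simps commutator_subgroup_def
    using g by (intro closure_of_mono) (auto intro!: generate.incl)
  finally show ?thesis using x by blast
qed

lemma cl_nilpotent:
  assumes "nilpotent_step k G"
  shows "cl k = {\<one>}"
  using assms closedin_Hausdorff_singleton[OF hausdorff, of \<one>]
  unfolding cl_def nilpotent_step_def by (simp add: closure_of_closedin topspace)

lemma closed_limit: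
  assumes "closedin T S" "limitin T x a sequentially" "\<And>n. x n \<in> S"
  shows "a \<in> S"
  using limitin_closedin[OF assms(2,1)] assms(3) by (simp add: always_eventually)

end

context chart_group
begin

subsection \<open>Tangent sequences\<close>

abbreviation "tang \<equiv> tangent G U \<phi>"

lemma tangD:
  assumes "tang t W"
  shows "t n \<in> carrier G" "\<forall>\<^sub>F n in sequentially. t n \<in> U" "(\<lambda>n. real n *\<^sub>R \<phi> (t n)) \<longlonglongrightarrow> W"
    "(\<lambda>n. \<phi> (t n)) \<longlonglongrightarrow> 0" "limitin T t \<one> sequentially"
proof -
  show "t n \<in> carrier G" and U: "\<forall>\<^sub>F n in sequentially. t n \<in> U" and l: "(\<lambda>n. real n *\<^sub>R \<phi> (t n)) \<longlonglongrightarrow> W"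
    using assms by (auto simp: tangent_def)
  show l0: "(\<lambda>n. \<phi> (t n)) \<longlonglongrightarrow> 0"
    using chart_tendsto_0[OF filterlim_ident l] .
  show "limitin T t \<one> sequentially"
    by (rule limit_chart[OF one_U U]) (simp add: phi_one l0)
qed

lemma tang_unique: "tang t W \<Longrightarrow> tang t W' \<Longrightarrow> W = W'"
  using tangD(3) LIMSEQ_unique by blast

lemma tang_pow: "tang t W \<Longrightarrow> limitin T (\<lambda>n. t n [^] n) (expo W) sequentially"
  using pow_tendsto_expo[of t "\<lambda>n. n" W] tangD by (simp add: filterlim_ident)

lemma ev_small:
  assumes "(\<lambda>n. \<phi> (t n)) \<longlonglongrightarrow> 0"
  shows "\<forall>\<^sub>F n in sequentially. norm (\<phi> (t n)) \<le> r"
  using order_tendstoD(2)[OF tendsto_norm[OF assms], of r] r_pos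
  by (auto elim: eventually_mono)

lemma tang_mult:
  assumes t: "tang t X" and s: "tang s Y"
  shows "tang (\<lambda>n. t n \<otimes> s n) (X + Y)"
proof -
  note T = tangD[OF t] and S = tangD[OF s]
  have ev: "\<forall>\<^sub>F n in sequentially. t n \<in> U \<and> s n \<in> U \<and> norm (\<phi> (t n)) \<le> r \<and> norm (\<phi> (s n)) \<le> r"
    using T(2) S(2) ev_small[OF T(4)] ev_small[OF S(4)] by eventually_elim simp
  have "(\<lambda>n. real n *\<^sub>R \<phi> (t n \<otimes> s n) - (real n *\<^sub>R \<phi> (t n) + real n *\<^sub>R \<phi> (s n))) \<longlonglongrightarrow> 0"
  proof (rule Lim_null_comparison)
    show "\<forall>\<^sub>F n in sequentially. norm (real n *\<^sub>R \<phi> (t n \<otimes> s n) - (real n *\<^sub>R \<phi> (t n) + real n *\<^sub>R \<phi> (s n)))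
        \<le> C * norm (real n *\<^sub>R \<phi> (t n)) * norm (\<phi> (s n))"
      using ev
    proof eventually_elim
      case (elim n)
      have "real n *\<^sub>R \<phi> (t n \<otimes> s n) - (real n *\<^sub>R \<phi> (t n) + real n *\<^sub>R \<phi> (s n))
          = real n *\<^sub>R (\<phi> (t n \<otimes> s n) - (\<phi> (t n) + \<phi> (s n)))"
        by (simp add: algebra_simps)
      then have "norm (real n *\<^sub>R \<phi> (t n \<otimes> s n) - (real n *\<^sub>R \<phi> (t n) + real n *\<^sub>R \<phi> (s n)))
          \<le> real n * (C * norm (\<phi> (t n)) * norm (\<phi> (s n)))"
        using E_mult[of "t n" "s n"] elim by (simp add: mult_left_mono)
      then show ?case by (simp add: mult_ac)
    qed
    have "(\<lambda>n. C * norm (real n *\<^sub>R \<phi> (t n)) * norm (\<phi> (s n))) \<longlonglongrightarrow> C * norm X * norm (0::'e)"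
      by (intro tendsto_intros T S)
    then show "(\<lambda>n. C * norm (real n *\<^sub>R \<phi> (t n)) * norm (\<phi> (s n))) \<longlonglongrightarrow> 0" by simp
  qed
  from tendsto_add[OF this tendsto_add[OF T(3) S(3)]]
  have "(\<lambda>n. real n *\<^sub>R \<phi> (t n \<otimes> s n)) \<longlonglongrightarrow> X + Y" by simp
  moreover have "\<forall>\<^sub>F n in sequentially. t n \<otimes> s n \<in> U"
    using ev by eventually_elim (simp add: mult_U)
  ultimately show ?thesis
    using T(1) S(1) by (simp add: tangent_def)
qed

lemma tang_inv:
  assumes t: "tang t X"
  shows "tang (\<lambda>n. inv (t n)) (- X)"
proof -
  note T = tangD[OF t]
  have l: "limitin T (\<lambda>n. inv (t n)) \<one> sequentially"
    using limit_inv[OF T(5)] by simp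
  note I = limit_chartD[OF l one_U, unfolded phi_one]
  have ev: "\<forall>\<^sub>F n in sequentially. t n \<in> U \<and> inv (t n) \<in> U \<and> norm (\<phi> (t n)) \<le> r \<and> norm (\<phi> (inv (t n))) \<le> r"
    using T(2) I(1) ev_small[OF T(4)] ev_small[OF I(2)] by eventually_elim simp
  have "(\<lambda>n. real n *\<^sub>R \<phi> (t n) + real n *\<^sub>R \<phi> (inv (t n))) \<longlonglongrightarrow> 0"
  proof (rule Lim_null_comparison)
    show "\<forall>\<^sub>F n in sequentially. norm (real n *\<^sub>R \<phi> (t n) + real n *\<^sub>R \<phi> (inv (t n)))
        \<le> C * norm (real n *\<^sub>R \<phi> (t n)) * norm (\<phi> (inv (t n)))"
      using ev
    proof eventually_elim
      case (elim n)
      \<comment> \<open>Apply \<open>E_mult\<close> to t n and its inverse, whose product has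
        coordinate 0.\<close>
      have "norm (\<phi> (t n) + \<phi> (inv (t n))) \<le> C * norm (\<phi> (t n)) * norm (\<phi> (inv (t n)))"
        using E_mult[of "t n" "inv (t n)"] elim T(1)[of n]
        by (simp add: phi_one norm_minus_commute[of 0]) (metis norm_minus_cancel minus_add_distrib diff_conv_add_uminus)
      moreover have "norm (real n *\<^sub>R \<phi> (t n) + real n *\<^sub>R \<phi> (inv (t n))) = real n * norm (\<phi> (t n) + \<phi> (inv (t n)))"
        by (simp flip: scaleR_add_right)
      moreover have "real n * (C * norm (\<phi> (t n)) * norm (\<phi> (inv (t n)))) = C * norm (real n *\<^sub>R \<phi> (t n)) * norm (\<phi> (inv (t n)))"
        by simp
      ultimately show ?case using mult_left_mono[of _ _ "real n"] of_nat_0_le_iff by metis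
    qed
    have "(\<lambda>n. C * norm (real n *\<^sub>R \<phi> (t n)) * norm (\<phi> (inv (t n)))) \<longlonglongrightarrow> C * norm X * norm (0::'e)"
      by (intro tendsto_intros T I)
    then show "(\<lambda>n. C * norm (real n *\<^sub>R \<phi> (t n)) * norm (\<phi> (inv (t n)))) \<longlonglongrightarrow> 0" by simp
  qed
  from tendsto_diff[OF this T(3)]
  have "(\<lambda>n. real n *\<^sub>R \<phi> (inv (t n))) \<longlonglongrightarrow> - X" by simp
  then show ?thesis
    using T(1) I(1) by (simp add: tangent_def)
qed

subsection \<open>Elementary properties of the exponential map\<close>

lemma expo_carrier [simp]: "expo W \<in> carrier G"
proof -
  have h: "norm (W /\<^sub>R real N) \<le> rho / 2" if "2 * norm W / rho < real N" "0 < N" for N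
    using rho_pos that by (simp add: field_simps)
  have h2: "2 * norm W / rho < real (nat \<lfloor>2 * norm W / rho\<rfloor> + 1)"
    using rho_pos by linarith
  have "norm (W /\<^sub>R real (nat \<lfloor>2 * norm W / rho\<rfloor> + 1)) \<le> rho / 2"
    by (rule h[OF h2]) simp
  then show ?thesis
    unfolding expo_def by (intro nat_pow_closed U_carrier lexp_U)
qed

lemma scale_tendsto_0: "(\<lambda>n. X /\<^sub>R real n) \<longlonglongrightarrow> (0 :: 'e)"
proof -
  have "(\<lambda>n. (1 / real n) *\<^sub>R X) \<longlonglongrightarrow> 0 *\<^sub>R X" by (intro tendsto_intros lim_1_over_n)
  then show ?thesis by (simp add: inverse_eq_divide)
qed

text \<open>The quadratic error of \<open>explim\<close> at X / n is still of order 1 / n after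
  multiplication by n.\<close>

lemma tang_expo: "tang (\<lambda>n. expo (X /\<^sub>R real n)) X"
proof -
  have "\<forall>\<^sub>F n in sequentially. norm (X /\<^sub>R real n) < rho / 2"
    using order_tendstoD(2)[OF tendsto_norm[OF scale_tendsto_0[of X]], of "rho / 2"] rho_pos by simp
  then have ev: "\<forall>\<^sub>F n in sequentially. expo (X /\<^sub>R real n) \<in> U \<and> 0 < n \<and>
      norm (\<phi> (expo (X /\<^sub>R real n)) - X /\<^sub>R real n) \<le> C * (norm (X /\<^sub>R real n))\<^sup>2"
    using eventually_gt_at_top[of 0]
  proof eventually_elim
    case (elim n)
    note h = less_imp_le[OF elim(1)]
    show ?case
      unfolding expo_small[OF elim(1)] phi_lexp[OF h] using lexp_U[OF h] explim_bounds(1)[OF h] elim(2) by blast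
  qed
  have "(\<lambda>n. real n *\<^sub>R \<phi> (expo (X /\<^sub>R real n)) - X) \<longlonglongrightarrow> 0"
  proof (rule Lim_null_comparison)
    show "\<forall>\<^sub>F n in sequentially. norm (real n *\<^sub>R \<phi> (expo (X /\<^sub>R real n)) - X) \<le> C * norm X * norm (X /\<^sub>R real n)"
      using ev
    proof eventually_elim
      case (elim n)
      then have "real n *\<^sub>R \<phi> (expo (X /\<^sub>R real n)) - X = real n *\<^sub>R (\<phi> (expo (X /\<^sub>R real n)) - X /\<^sub>R real n)"
        by (simp add: scaleR_diff_right)
      then have "norm (real n *\<^sub>R \<phi> (expo (X /\<^sub>R real n)) - X) \<le> real n * (C * (norm (X /\<^sub>R real n))\<^sup>2)"
        using elim by (simp add: mult_left_mono)
      also have "\<dots> = C * norm X * norm (X /\<^sub>R real n)"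
        using elim by (simp add: power2_eq_square)
      finally show ?case .
    qed
    have "(\<lambda>n. C * norm X * norm (X /\<^sub>R real n)) \<longlonglongrightarrow> C * norm X * norm (0::'e)"
      by (intro tendsto_intros scale_tendsto_0)
    then show "(\<lambda>n. C * norm X * norm (X /\<^sub>R real n)) \<longlonglongrightarrow> 0" by simp
  qed
  then have "(\<lambda>n. real n *\<^sub>R \<phi> (expo (X /\<^sub>R real n))) \<longlonglongrightarrow> X" by (rule LIM_zero_cancel)
  moreover have "\<forall>\<^sub>F n in sequentially. expo (X /\<^sub>R real n) \<in> U" using ev by eventually_elim simp
  ultimately show ?thesis by (simp add: tangent_def)
qed

lemma expo_zero [simp]: "expo 0 = \<one>"
proof -
  have "tang (\<lambda>_. \<one>) 0" by (simp add: tangent_def one_U phi_one)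
  from tang_pow[OF this] have "limitin T (\<lambda>_. \<one>) (expo 0) sequentially" by simp
  then show ?thesis using limit_unique[OF limit_const[OF one_closed]] by (metis trivial_limit_sequentially)
qed

text \<open>Both sides are limits of the same sequence exp(X / n)^(n k).\<close>

lemma expo_pow: "expo X [^] k = expo (real k *\<^sub>R X)"
proof (cases "k = 0")
  case False
  note t = tang_expo[of X]
  have q: "filterlim (\<lambda>n. n * k) at_top sequentially"
    using False by (intro filterlim_subseq strict_monoI) simp
  have "(\<lambda>n. real k *\<^sub>R (real n *\<^sub>R \<phi> (expo (X /\<^sub>R real n)))) \<longlonglongrightarrow> real k *\<^sub>R X"
    by (intro tendsto_intros tangD(3)[OF t])
  then have "(\<lambda>n. real (n * k) *\<^sub>R \<phi> (expo (X /\<^sub>R real n))) \<longlonglongrightarrow> real k *\<^sub>R X"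
    by (simp add: mult.commute)
  from pow_tendsto_expo[OF tangD(1)[OF t] tangD(2)[OF t] q this]
  have "limitin T (\<lambda>n. expo (X /\<^sub>R real n) [^] (n * k)) (expo (real k *\<^sub>R X)) sequentially" .
  moreover have "limitin T (\<lambda>n. expo (X /\<^sub>R real n) [^] (n * k)) (expo X [^] k) sequentially"
    using limit_pow[OF tang_pow[OF t], of k] by (simp add: nat_pow_pow)
  ultimately show ?thesis
    using limit_unique trivial_limit_sequentially by metis
qed simp

lemma expo_div_pow: "0 < n \<Longrightarrow> expo (X /\<^sub>R real n) [^] n = expo X"
  by (simp add: expo_pow)

lemma inv_expo: "inv (expo X) = expo (- X)"
proof -
  have "limitin T (\<lambda>n. inv (expo (X /\<^sub>R real n)) [^] n) (expo (- X)) sequentially"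
    by (rule tang_pow[OF tang_inv[OF tang_expo]])
  moreover have "limitin T (\<lambda>n. inv (expo (X /\<^sub>R real n) [^] n)) (inv (expo X)) sequentially"
    by (rule limit_inv[OF tang_pow[OF tang_expo]])
  then have "limitin T (\<lambda>n. inv (expo (X /\<^sub>R real n)) [^] n) (inv (expo X)) sequentially"
    by (simp add: nat_pow_inv)
  ultimately show ?thesis
    by (rule limit_unique[OF _ _ trivial_limit_sequentially, symmetric])
qed

lemma trotter: "limitin T (\<lambda>n. (expo (X /\<^sub>R real n) \<otimes> expo (Y /\<^sub>R real n)) [^] n) (expo (X + Y)) sequentially"
  by (rule tang_pow[OF tang_mult[OF tang_expo tang_expo]])

lemma expo_continuous:
  assumes "X \<longlonglongrightarrow> Y"
  shows "limitin T (\<lambda>n. expo (X n)) (expo Y) sequentially"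
proof -
  obtain N :: nat where N: "2 * norm Y / rho < real N" using reals_Archimedean2 by blast
  have "0 \<le> 2 * norm Y / rho" using rho_pos by simp
  then have N0: "0 < N" using N by (metis gr0I not_less of_nat_0)
  have YN: "norm (Y /\<^sub>R real N) < rho / 2" using N N0 rho_pos by (simp add: field_simps)
  have l: "(\<lambda>n. X n /\<^sub>R real N) \<longlonglongrightarrow> Y /\<^sub>R real N" by (intro tendsto_intros assms)
  have ev: "\<forall>\<^sub>F n in sequentially. norm (X n /\<^sub>R real N) < rho / 2"
    by (rule order_tendstoD(2)[OF tendsto_norm[OF l] YN])
  have "limitin T (\<lambda>n. expo (X n /\<^sub>R real N)) (expo (Y /\<^sub>R real N)) sequentially"
  proof (rule limit_chart)
    show "expo (Y /\<^sub>R real N) \<in> U" using YN by (simp add: expo_small lexp_U)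
    show "\<forall>\<^sub>F n in sequentially. expo (X n /\<^sub>R real N) \<in> U"
      using ev by eventually_elim (simp add: expo_small lexp_U)
    show "(\<lambda>n. \<phi> (expo (X n /\<^sub>R real N))) \<longlonglongrightarrow> \<phi> (expo (Y /\<^sub>R real N))"
    proof (rule LIM_zero_cancel, rule Lim_null_comparison)
      show "\<forall>\<^sub>F n in sequentially. norm (\<phi> (expo (X n /\<^sub>R real N)) - \<phi> (expo (Y /\<^sub>R real N)))
          \<le> 4 * norm (X n /\<^sub>R real N - Y /\<^sub>R real N)"
        using ev
      proof eventually_elim
        case (elim n)
        have "norm (explim (X n /\<^sub>R real N) - explim (Y /\<^sub>R real N)) \<le> 4 * norm (X n /\<^sub>R real N - Y /\<^sub>R real N)"
          by (rule explim_Lipschitz[OF less_imp_le[OF elim] less_imp_le[OF YN]])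
        then show ?case
          unfolding expo_small[OF elim] expo_small[OF YN] phi_lexp[OF less_imp_le[OF elim]] phi_lexp[OF less_imp_le[OF YN]] .
      qed
      have "(\<lambda>n. 4 * norm (X n /\<^sub>R real N - Y /\<^sub>R real N)) \<longlonglongrightarrow> 4 * norm (Y /\<^sub>R real N - Y /\<^sub>R real N)"
        by (intro tendsto_intros l)
      then show "(\<lambda>n. 4 * norm (X n /\<^sub>R real N - Y /\<^sub>R real N)) \<longlonglongrightarrow> 0" by simp
    qed
  qed
  from limit_pow[OF this, of N] show ?thesis
    using N0 by (simp add: expo_div_pow)
qed

text \<open>What is known of \<open>explim\<close> is a Lipschitz bound and |explim X - X| <= C
  |X|^2, but no differentiability away from 0, so Brouwer's theorem replaces the inverse function
  theorem.\<close>

lemma expo_neighbourhood: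
  obtains V where "openin T V" "\<one> \<in> V" "V \<subseteq> range expo"
proof -
  \<comment> \<open>Chosen to give C d <= 1 / 2: then \<open>explim\<close> moves the points of the
    ball of radius d by at most d / 2 and, by Brouwer, reaches every target in the ball of radius d
    / 2.\<close>
  define d where "d = min (rho / 4) (1 / (2 * C + 2))"
  have d: "0 < d" "d < rho / 2" using rho_pos C_nonneg by (auto simp: d_def)
  have "C * d \<le> C * (1 / (2 * C + 2))" using C_nonneg by (intro mult_left_mono) (auto simp: d_def)
  also have "\<dots> \<le> 1 / 2" using C_nonneg by (simp add: field_simps)
  finally have Cd: "C * d \<le> 1 / 2" .
  have cont: "continuous_on (cball 0 d) explim"
  proof (rule lipschitz_on_continuous_on)
    show "4-lipschitz_on (cball 0 d) explim"
      by (rule lipschitz_onI) (use d explim_Lipschitz in \<open>auto simp: dist_norm\<close>)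
  qed
  have surj: "\<exists>y\<in>cball 0 d. explim y = x" if x: "x \<in> cball 0 (d / 2)" for x
  proof (rule brouwer_surjective_cball[OF cont d(1) x])
    fix x y :: 'e assume x: "x \<in> cball 0 (d / 2)" and y: "y \<in> cball 0 d"
    have ny: "norm y \<le> d" using y by simp
    have "norm (explim y - y) \<le> C * (norm y)\<^sup>2"
      by (rule explim_bounds(1)) (use ny d in auto)
    also have "\<dots> \<le> C * d\<^sup>2" using ny C_nonneg by (intro mult_left_mono power_mono) auto
    also have "\<dots> = (C * d) * d" by (simp add: power2_eq_square)
    also have "\<dots> \<le> 1 / 2 * d" using d Cd by (intro mult_right_mono) auto
    finally have "norm (y - explim y) \<le> d / 2" by (simp add: norm_minus_commute)
    then have "norm (x + (y - explim y)) \<le> d"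
      using x norm_triangle_ineq[of x "y - explim y"] by simp
    then show "x + (y - explim y) \<in> cball 0 d" by simp
  qed
  define V where "V = {x \<in> topspace (subtopology T U). \<phi> x \<in> ball 0 (d / 2) \<inter> \<phi> ` U}"
  have "openin (subtopology T U) V"
    unfolding V_def
    by (rule openin_continuous_map_preimage[OF homeomorphic_imp_continuous_map[OF homeo]])
      (simp add: openin_open_Int Int_commute)
  then have V: "openin T V" using openin_open_subtopology[OF U_open] by blast
  show ?thesis
  proof (rule that[OF V])
    show "\<one> \<in> V" using one_U phi_one d topU by (simp add: V_def image_iff) (metis phi_one)
    show "V \<subseteq> range expo"
    proof
      fix x assume "x \<in> V"
      then have x: "x \<in> U" "\<phi> x \<in> cball 0 (d / 2)" using topU by (auto simp: V_def)
      obtain y where y: "y \<in> cball 0 d" "explim y = \<phi> x" using surj[OF x(2)] by blast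
      have ny: "norm y < rho / 2" using y d by simp
      have "x = c (explim y)" using c_phi[OF x(1)] y by simp
      also have "\<dots> = expo y" using expo_small[OF ny] by (simp add: lexp_def)
      finally show "x \<in> range expo" by simp
    qed
  qed
qed

subsection \<open>The adjoint representation\<close>

text \<open>The choice is unique: \<open>tang_expo\<close> and \<open>tang_unique\<close> determine
  the value on every vector.\<close>

definition Ad where "Ad g = (SOME A. conj_derivative G U \<phi> g A)"

lemma Ad_conj: "g \<in> carrier G \<Longrightarrow> conj_derivative G U \<phi> g (Ad g)"
  unfolding Ad_def by (rule someI_ex[OF conj_derivative_ex])

lemma Ad_linear: "g \<in> carrier G \<Longrightarrow> linear (Ad g)"
  using Ad_conj by (simp add: conj_derivative_def)

lemma tang_conj: "g \<in> carrier G \<Longrightarrow> tang t X \<Longrightarrow> tang (\<lambda>n. g \<otimes> t n \<otimes> inv g) (Ad g X)"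
  using Ad_conj by (simp add: conj_derivative_def)

lemma expo_conj:
  assumes g: "g \<in> carrier G"
  shows "g \<otimes> expo X \<otimes> inv g = expo (Ad g X)"
proof -
  have "limitin T (\<lambda>n. (g \<otimes> expo (X /\<^sub>R real n) \<otimes> inv g) [^] n) (expo (Ad g X)) sequentially"
    by (rule tang_pow[OF tang_conj[OF g tang_expo]])
  moreover have "limitin T (\<lambda>n. g \<otimes> expo (X /\<^sub>R real n) [^] n \<otimes> inv g) (g \<otimes> expo X \<otimes> inv g) sequentially"
    using g by (intro limit_mult limit_const tang_pow[OF tang_expo]) auto
  then have "limitin T (\<lambda>n. (g \<otimes> expo (X /\<^sub>R real n) \<otimes> inv g) [^] n) (g \<otimes> expo X \<otimes> inv g) sequentially"
    using g by (simp add: conj_pow)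
  ultimately show ?thesis
    by (rule limit_unique[OF _ _ trivial_limit_sequentially, symmetric])
qed

lemma Ad_mult:
  assumes g: "g \<in> carrier G" and h: "h \<in> carrier G"
  shows "Ad (g \<otimes> h) X = Ad g (Ad h X)"
proof (rule tang_unique)
  show "tang (\<lambda>n. (g \<otimes> h) \<otimes> expo (X /\<^sub>R real n) \<otimes> inv (g \<otimes> h)) (Ad (g \<otimes> h) X)"
    using g h by (intro tang_conj tang_expo) simp
  have "tang (\<lambda>n. g \<otimes> (h \<otimes> expo (X /\<^sub>R real n) \<otimes> inv h) \<otimes> inv g) (Ad g (Ad h X))"
    using g h by (intro tang_conj tang_expo)
  then show "tang (\<lambda>n. (g \<otimes> h) \<otimes> expo (X /\<^sub>R real n) \<otimes> inv (g \<otimes> h)) (Ad g (Ad h X))"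
    using g h by (simp add: inv_mult_group m_assoc)
qed

lemma Ad_one: "Ad \<one> X = X"
proof (rule tang_unique)
  show "tang (\<lambda>n. \<one> \<otimes> expo (X /\<^sub>R real n) \<otimes> inv \<one>) (Ad \<one> X)"
    by (intro tang_conj tang_expo) simp
  show "tang (\<lambda>n. \<one> \<otimes> expo (X /\<^sub>R real n) \<otimes> inv \<one>) X"
    using tang_expo[of X] by simp
qed

lemma Ad_inv_cancel: "g \<in> carrier G \<Longrightarrow> Ad g (Ad (inv g) X) = X"
  using Ad_mult[of g "inv g" X] Ad_one by simp

lemma tang_commutator:
  assumes g: "g \<in> carrier G"
  shows "tang (\<lambda>n. g \<otimes> expo (X /\<^sub>R real n) \<otimes> inv g \<otimes> inv (expo (X /\<^sub>R real n))) (Ad g X - X)"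
  using tang_mult[OF tang_conj[OF g tang_expo[of X]] tang_inv[OF tang_expo[of X]]] by simp

definition bracket where
  "bracket = (SOME B. \<forall>t X Z A. tang t X \<longrightarrow> (\<forall>n. conj_derivative G U \<phi> (t n) (A n)) \<longrightarrow>
       (\<lambda>n. real n *\<^sub>R (A n Z - Z)) \<longlonglongrightarrow> B X Z)"

lemma bracket_tendsto:
  assumes "tang t X"
  shows "(\<lambda>n. real n *\<^sub>R (Ad (t n) Z - Z)) \<longlonglongrightarrow> bracket X Z"
proof -
  have "\<forall>t X Z A. tang t X \<longrightarrow> (\<forall>n. conj_derivative G U \<phi> (t n) (A n)) \<longrightarrow>
       (\<lambda>n. real n *\<^sub>R (A n Z - Z)) \<longlonglongrightarrow> bracket X Z"
    unfolding bracket_def by (rule someI_ex[OF bracket_ex])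
  from this[rule_format, OF assms, of "\<lambda>n. Ad (t n)" Z] show ?thesis
    using Ad_conj[OF tangD(1)[OF assms]] by simp
qed

lemma bracket_linear: "linear (bracket X)"
proof (rule linearI)
  note l = bracket_tendsto[OF tang_expo[of X]] and A = Ad_linear[OF expo_carrier]
  show "bracket X (Y + Z) = bracket X Y + bracket X Z" for Y Z
    by (rule LIMSEQ_unique[OF l tendsto_add[OF l l, THEN tendsto_cong[THEN iffD1, rotated]]])
      (simp add: linear_add[OF A] algebra_simps)
  show "bracket X (k *\<^sub>R Z) = k *\<^sub>R bracket X Z" for k Z
    by (rule LIMSEQ_unique[OF l tendsto_scaleR[OF tendsto_const l, THEN tendsto_cong[THEN iffD1, rotated]]])
      (simp add: linear_cmul[OF A] algebra_simps)
qed

text \<open>In effect Ad(exp X) = exp(ad X), without the exponential series: Ad(exp X) is the n-th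
  power of Ad(exp(X / n)), which is 1 + (ad X) / n up to o(1 / n), and powers of 1 + (ad X) / n
  preserve V. A subspace is closed, so the limit stays in V.\<close>

lemma Ad_expo_invariant:
  assumes V: "subspace V" and B: "\<And>Z. Z \<in> V \<Longrightarrow> bracket X Z \<in> V" and Z: "Z \<in> V"
  shows "Ad (expo X) Z \<in> V"
proof -
  define L where "L = bracket X"
  define A where "A n = Ad (expo (X /\<^sub>R real n))" for n
  have linL: "linear L" unfolding L_def by (rule bracket_linear)
  have linA: "linear (A n)" for n unfolding A_def by (rule Ad_linear[OF expo_carrier])
  obtain K0 where K0: "\<And>x. norm (L x) \<le> norm x * K0"
    using bounded_linear.bounded linear_conv_bounded_linear linL by blast
  define K where "K = \<bar>K0\<bar>"
  have K: "norm (L x) \<le> K * norm x" "0 \<le> K" for x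
    unfolding K_def
    by (rule order_trans[OF K0[of x, unfolded mult.commute[of "norm x"]] mult_right_mono[OF abs_ge_self norm_ge_zero]])
      simp
  \<comment> \<open>The sum over the basis bounds the operator norm of n (A n - 1) - L and tends to
    0 by convergence on each basis vector.\<close>
  define err where "err n = (\<Sum>b\<in>Basis. norm (real n *\<^sub>R (A n b - b) - L b))" for n
  have e0: "0 \<le> err n" for n by (simp add: err_def sum_nonneg)
  have "(\<lambda>n. real n *\<^sub>R (A n b - b)) \<longlonglongrightarrow> L b" for b
    unfolding A_def L_def by (rule bracket_tendsto[OF tang_expo])
  then have "err \<longlonglongrightarrow> (\<Sum>b\<in>(Basis::'e set). norm (L b - L b))"
    unfolding err_def by (intro tendsto_intros)
  then have err: "err \<longlonglongrightarrow> 0" by simp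
  have bd: "norm (real n *\<^sub>R (A n x - x) - L x) \<le> err n * norm x" for n x
  proof -
    let ?D = "\<lambda>x. real n *\<^sub>R (A n x - x) - L x"
    have lin: "linear ?D"
      by (intro linear_compose_sub linear_compose_scale_right linA linL linear_ident)
    have "?D x = ?D (\<Sum>b\<in>Basis. (x \<bullet> b) *\<^sub>R b)" by (simp add: euclidean_representation)
    also have "\<dots> = (\<Sum>b\<in>Basis. (x \<bullet> b) *\<^sub>R ?D b)"
      unfolding linear_sum[OF lin] by (simp only: linear_cmul[OF lin])
    also have "norm \<dots> \<le> (\<Sum>b\<in>Basis. norm (?D b) * norm x)"
    proof (rule sum_norm_le)
      fix b :: 'e assume b: "b \<in> Basis"
      show "norm ((x \<bullet> b) *\<^sub>R ?D b) \<le> norm (?D b) * norm x"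
        using Basis_le_norm[OF b, of x] by (simp add: mult.commute mult_right_mono)
    qed
    finally show ?thesis by (simp add: err_def sum_distrib_right)
  qed
  define M where "M n x = x + L x /\<^sub>R real n" for n x
  have MV: "(M n ^^ j) Z \<in> V" for n j
  proof (induction j)
    case (Suc j)
    then show ?case
      using B[OF Suc] by (auto simp: M_def L_def intro!: subspace_add[OF V] subspace_scale[OF V])
  qed (simp add: Z)
  have AM: "norm (A n x - M n x) \<le> err n / real n * norm x" if "0 < n" for n x
  proof -
    have "A n x - M n x = (real n *\<^sub>R (A n x - x) - L x) /\<^sub>R real n"
      using that by (simp add: M_def algebra_simps)
    then have "norm (A n x - M n x) = norm (real n *\<^sub>R (A n x - x) - L x) / real n"
      by (simp only: norm_scaleR) (simp add: divide_inverse mult.commute)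
    also have "\<dots> \<le> err n * norm x / real n"
      by (rule divide_right_mono[OF bd]) simp
    finally show ?thesis by simp
  qed
  have nM: "norm (M n x) \<le> (1 + K / real n) * norm x" if "0 < n" for n x
  proof -
    have "norm (M n x) \<le> norm x + norm (L x) / real n"
      unfolding M_def using norm_triangle_ineq[of x "L x /\<^sub>R real n"] that by (simp add: divide_inverse mult.commute)
    also have "\<dots> \<le> norm x + K * norm x / real n" using K that by (intro add_left_mono divide_right_mono) auto
    finally show ?thesis by (simp add: algebra_simps)
  qed
  have nA: "norm (A n x) \<le> (1 + (K + err n) / real n) * norm x" if "0 < n" for n x
    using norm_triangle_ineq[of "M n x" "A n x - M n x"] nM[OF that, of x] AM[OF that, of x]
    by (simp add: algebra_simps add_divide_distrib)
  \<comment> \<open>Telescoping of A^j - M^j. Both operators have norm at most 1 + (K + err n) / n,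
    whose n-th power is at most exp(K + err n).\<close>
  have close: "norm ((A n ^^ j) Z - (M n ^^ j) Z) \<le> real j * (err n / real n) * (1 + (K + err n) / real n) ^ j * norm Z
      \<and> norm ((M n ^^ j) Z) \<le> (1 + (K + err n) / real n) ^ j * norm Z" if n: "0 < n" for n j
  proof (induction j)
    case (Suc j)
    let ?a = "1 + (K + err n) / real n"
    have gen: "\<alpha> * (m * e * p * z) + e * (\<alpha> * p * z) = (1 + m) * e * (\<alpha> * p) * z" for \<alpha> m e p z :: real
      by (simp add: algebra_simps)
    have a: "1 \<le> ?a" using K(2) e0[of n] by simp
    have e: "0 \<le> err n / real n" using e0 by simp
    let ?x = "(A n ^^ j) Z" and ?y = "(M n ^^ j) Z"
    have "norm (M n ?y) \<le> (1 + K / real n) * norm ?y" by (rule nM[OF n])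
    also have "\<dots> \<le> ?a * norm ?y" using e0[of n] by (intro mult_right_mono) (auto simp: divide_right_mono)
    also have "\<dots> \<le> ?a * (?a ^ j * norm Z)" using Suc a by (intro mult_left_mono) auto
    finally have 1: "norm (M n ?y) \<le> ?a ^ Suc j * norm Z" by simp
    have eq: "A n ?x - M n ?y = A n (?x - ?y) + (A n ?y - M n ?y)"
      by (simp add: linear_diff[OF linA])
    have "norm (A n ?x - M n ?y) \<le> ?a * norm (?x - ?y) + err n / real n * norm ?y"
      unfolding eq by (intro norm_triangle_le add_mono nA[OF n] AM[OF n])
    also have "\<dots> \<le> ?a * (real j * (err n / real n) * ?a ^ j * norm Z) + err n / real n * (?a ^ Suc j * norm Z)"
    proof (intro add_mono mult_left_mono)
      show "norm (?x - ?y) \<le> real j * (err n / real n) * ?a ^ j * norm Z" using Suc by blast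
      have "norm ?y \<le> ?a ^ j * norm Z" using Suc by blast
      also have "\<dots> \<le> ?a ^ Suc j * norm Z" using a by (intro mult_right_mono power_increasing) auto
      finally show "norm ?y \<le> ?a ^ Suc j * norm Z" .
    qed (use a e in auto)
    also have "\<dots> = real (Suc j) * (err n / real n) * ?a ^ Suc j * norm Z"
      unfolding power_Suc of_nat_Suc by (rule gen)
    finally show ?case using 1 by simp
  qed simp
  have "(\<lambda>n. (M (Suc n) ^^ Suc n) Z) \<longlonglongrightarrow> Ad (expo X) Z"
  proof (rule LIM_zero_cancel, rule Lim_null_comparison)
    have AX: "Ad (expo X) Z = (A n ^^ n) Z" if n: "0 < n" for n
    proof -
      have "Ad (expo (X /\<^sub>R real n) [^] j) Z = (A n ^^ j) Z" for j
      proof (induction j)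
        case (Suc j)
        have "Ad (expo (X /\<^sub>R real n) [^] Suc j) Z = Ad (expo (X /\<^sub>R real n) \<otimes> expo (X /\<^sub>R real n) [^] j) Z"
          unfolding nat_pow_Suc2[OF expo_carrier] by (rule refl)
        then show ?case using Suc by (simp add: Ad_mult A_def)
      qed (simp add: Ad_one)
      then show ?thesis using expo_div_pow[OF n, of X] by metis
    qed
    show "\<forall>\<^sub>F n in sequentially. norm ((M (Suc n) ^^ Suc n) Z - Ad (expo X) Z)
        \<le> err (Suc n) * exp (K + err (Suc n)) * norm Z"
    proof (intro always_eventually allI)
      fix n
      let ?n = "Suc n"
      have "norm ((M ?n ^^ ?n) Z - Ad (expo X) Z) = norm ((A ?n ^^ ?n) Z - (M ?n ^^ ?n) Z)"
        using AX[of ?n] by (simp add: norm_minus_commute)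
      also have "\<dots> \<le> real ?n * (err ?n / real ?n) * (1 + (K + err ?n) / real ?n) ^ ?n * norm Z"
        using close[of ?n ?n] by blast
      also have "\<dots> = err ?n * (1 + (K + err ?n) / real ?n) ^ ?n * norm Z" by simp
      also have "\<dots> \<le> err ?n * exp (K + err ?n) * norm Z"
        using exp_ge_one_plus_x_over_n_power_n[of ?n "K + err ?n"] K(2) e0[of ?n]
        by (intro mult_right_mono mult_left_mono) auto
      finally show "norm ((M ?n ^^ ?n) Z - Ad (expo X) Z) \<le> err ?n * exp (K + err ?n) * norm Z" .
    qed
    have "(\<lambda>n. err (Suc n) * exp (K + err (Suc n)) * norm Z) \<longlonglongrightarrow> 0 * exp (K + 0) * norm Z"
      by (intro tendsto_intros LIMSEQ_Suc[OF err])
    then show "(\<lambda>n. err (Suc n) * exp (K + err (Suc n)) * norm Z) \<longlonglongrightarrow> 0" by simp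
  qed
  then show ?thesis
    by (rule closed_sequentially[OF closed_subspace[OF V] MV])
qed

end

context chart_group
begin

subsection \<open>Lie algebras of closed subgroups\<close>

definition lie :: "'a set \<Rightarrow> 'e set" where
  "lie S = {X. \<forall>t::real. expo (t *\<^sub>R X) \<in> S}"

lemma lieD: "X \<in> lie S \<Longrightarrow> expo X \<in> S"
  by (auto simp: lie_def dest: spec[of _ 1])

lemma lie_scale: "X \<in> lie S \<Longrightarrow> k *\<^sub>R X \<in> lie S"
  by (simp add: lie_def)

lemma subgroup_pow:
  assumes "subgroup S G" "x \<in> S"
  shows "x [^] (n::nat) \<in> S"
  by (induction n) (use assms in \<open>auto simp: subgroup.one_closed subgroup.m_closed\<close>)

text \<open>Closure under sums is Trotter's formula, whose approximants lie in the sequentially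
  closed group S.\<close>

lemma lie_subspace:
  assumes S: "subgroup S G"
    and cl: "\<And>s a. (\<And>n. s n \<in> S) \<Longrightarrow> limitin T s a sequentially \<Longrightarrow> a \<in> S"
  shows "subspace (lie S)"
proof (rule subspaceI)
  show "0 \<in> lie S" using subgroup.one_closed[OF S] by (simp add: lie_def)
  show "c *\<^sub>R x \<in> lie S" if "x \<in> lie S" for c x using that by (rule lie_scale)
  show "x + y \<in> lie S" if xy: "x \<in> lie S" "y \<in> lie S" for x y
    unfolding lie_def
  proof (intro CollectI allI)
    fix t :: real
    have "limitin T (\<lambda>n. (expo ((t *\<^sub>R x) /\<^sub>R real n) \<otimes> expo ((t *\<^sub>R y) /\<^sub>R real n)) [^] n)
        (expo (t *\<^sub>R x + t *\<^sub>R y)) sequentially" by (rule trotter)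
    moreover have "(expo ((t *\<^sub>R x) /\<^sub>R real n) \<otimes> expo ((t *\<^sub>R y) /\<^sub>R real n)) [^] n \<in> S" for n
      by (intro subgroup_pow[OF S] subgroup.m_closed[OF S] lieD lie_scale xy)
    ultimately show "expo (t *\<^sub>R (x + y)) \<in> S"
      unfolding scaleR_add_right by (rule cl[rotated])
  qed
qed

lemma cl_limit: "(\<And>n. s n \<in> cl i) \<Longrightarrow> limitin T s a sequentially \<Longrightarrow> a \<in> cl i"
  unfolding cl_def by (rule closed_limit[OF closedin_closure_of])

lemma lie_cl_subspace: "subspace (lie (cl i))"
  by (rule lie_subspace[OF cl_subgroup cl_limit])

lemma commutator_tendsto:
  "g \<in> carrier G \<Longrightarrow>
    limitin T (\<lambda>n. (g \<otimes> expo (X /\<^sub>R real n) \<otimes> inv g \<otimes> inv (expo (X /\<^sub>R real n))) [^] n) (expo (Ad g X - X)) sequentially"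
  by (rule tang_pow[OF tang_commutator])

text \<open>exp(s (Ad g X - X)) is a limit of n-th powers of the commutators of g with exp(s X / n),
  so it stays in a closed subgroup that contains these commutators.\<close>

lemma Ad_diff_lie:
  assumes g: "g \<in> carrier G"
    and comm: "\<And>s n::nat. g \<otimes> expo ((s *\<^sub>R X) /\<^sub>R real n) \<otimes> inv g \<otimes> inv (expo ((s *\<^sub>R X) /\<^sub>R real n)) \<in> cl i"
  shows "Ad g X - X \<in> lie (cl i)"
  unfolding lie_def
proof (intro CollectI allI)
  fix s :: real
  have "expo (Ad g (s *\<^sub>R X) - s *\<^sub>R X) \<in> cl i"
    by (rule cl_limit[OF subgroup_pow[OF cl_subgroup comm] commutator_tendsto[OF g]])
  then show "expo (s *\<^sub>R (Ad g X - X)) \<in> cl i"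
    by (simp add: linear_cmul[OF Ad_linear[OF g]] scaleR_diff_right)
qed

lemma Ad_lie_cl:
  assumes "g \<in> carrier G" "X \<in> lie (cl i)"
  shows "Ad g X - X \<in> lie (cl (Suc i))"
  by (rule Ad_diff_lie[OF assms(1)]) (intro cl_commutator assms lieD lie_scale)

lemma Ad_cl_lie:
  assumes g: "g \<in> cl i"
  shows "Ad g X - X \<in> lie (cl (Suc i))"
proof (rule Ad_diff_lie)
  show gG: "g \<in> carrier G" using g subgroup.subset[OF cl_subgroup] by blast
  fix s :: real and n :: nat
  let ?x = "expo ((s *\<^sub>R X) /\<^sub>R real n)"
  have "inv (?x \<otimes> g \<otimes> inv ?x \<otimes> inv g) \<in> cl (Suc i)"
    by (intro subgroup.m_inv_closed[OF cl_subgroup] cl_commutator g expo_carrier)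
  then show "g \<otimes> ?x \<otimes> inv g \<otimes> inv ?x \<in> cl (Suc i)"
    using gG by (simp add: inv_mult_group m_assoc)
qed

text \<open>If every exp(X / n) is trivial, then the constant sequence at the identity represents
  both X and 0.\<close>

lemma lie_cl_nilpotent:
  assumes "nilpotent_step k G" "X \<in> lie (cl k)"
  shows "X = 0"
proof -
  have "expo (t *\<^sub>R X) = \<one>" for t
    using assms cl_nilpotent by (auto simp: lie_def)
  then have "tang (\<lambda>n. \<one>) X"
    using tang_expo[of X] by simp
  moreover have "tang (\<lambda>_. \<one>) 0" by (simp add: tangent_def one_U phi_one)
  ultimately show ?thesis by (rule tang_unique)
qed

lemma lower_central_antimono: "lower_central G (Suc i) \<subseteq> lower_central G i"
proof (induction i)
  case 0
  show ?case using subgroup.subset[OF lower_central_subgroup[of "Suc 0"]] by simp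
next
  case (Suc i)
  show ?case
    unfolding lower_central.simps(2)[of G "Suc i"] lower_central.simps(2)[of G i] commutator_subgroup_def
    using Suc by (intro mono_generate) (force simp: commutator_subgroup_def)
qed

lemma cl_antimono: "cl (Suc i) \<subseteq> cl i"
  unfolding cl_def by (rule closure_of_mono[OF lower_central_antimono])

lemma lie_cl_0: "lie (cl 0) = UNIV"
  by (simp add: lie_def cl_0)

end

section \<open>Nilpotent induction on the Lie algebra of the stabilizer\<close>

section \<open>Stabilisers under the Mautner phenomenon\<close>

text \<open>\<open>S\<close> plays the role of the stabiliser of a vector which is a weak limit of \<open>a\<^bsup>n\<^esup> f\<close> in a unitary
  representation; \<open>mautner\<close> and \<open>contraction\<close> are the two ways of producing new elements of such a
  stabiliser.\<close>

locale mautner_subgroup = chart_group G T U \<phi> r C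
  for G (structure) and T :: "'a topology" and U and \<phi> :: "'a \<Rightarrow> 'e::euclidean_space" and r C +
  fixes S :: "'a set" and a :: 'a and k :: nat
  assumes nilpotent: "nilpotent_step k G" and a_G: "a \<in> carrier G" and S: "subgroup S G"
    and S_closed: "(\<And>n. s n \<in> S) \<Longrightarrow> limitin T s x sequentially \<Longrightarrow> x \<in> S"
    and mautner: "limitin T b \<one> sequentially \<Longrightarrow> (\<And>n. s n \<in> S) \<Longrightarrow> (\<And>n. s' n \<in> S) \<Longrightarrow>
      (\<And>n. b n \<otimes> s n \<otimes> inv (b n) = y n \<otimes> s' n) \<Longrightarrow> (\<And>n. b n \<in> carrier G) \<Longrightarrow> (\<And>n. y n \<in> carrier G) \<Longrightarrow>
      limitin T y x sequentially \<Longrightarrow> x \<in> S"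
    and contraction: "limitin T b \<one> sequentially \<Longrightarrow> (\<And>n. s n \<in> S) \<Longrightarrow>
      (\<And>n. a [^] n \<otimes> b n \<otimes> inv (a [^] n) = s n \<otimes> y n) \<Longrightarrow> (\<And>n. b n \<in> carrier G) \<Longrightarrow> (\<And>n. y n \<in> carrier G) \<Longrightarrow>
      limitin T y x sequentially \<Longrightarrow> x \<in> S"
begin

lemma sub: "subspace (lie S)"
  by (rule lie_subspace[OF S S_closed])

definition normalizes :: "'e \<Rightarrow> bool" where
  "normalizes Y \<longleftrightarrow> (\<forall>t::real. \<forall>Z\<in>lie S. Ad (expo (t *\<^sub>R Y)) Z \<in> lie S)"

lemma normalizes_scale: "normalizes Y \<Longrightarrow> normalizes (t *\<^sub>R Y)"
  by (simp add: normalizes_def)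

text \<open>By the Trotter formula, \<open>exp (Y + Z)\<close> is a limit of \<open>(p s)\<^bsup>m\<^esup>\<close> with \<open>p = exp (Y / m)\<close>,
  \<open>s = exp (Z / m)\<close>, and \<open>(p s)\<^bsup>m\<^esup>\<close> lies in \<open>p\<^bsup>m\<^esup> S\<close> because \<open>p\<close> normalizes \<open>lie S\<close>.\<close>

lemma expo_add_coset:
  assumes Y: "normalizes Y" and Z: "Z \<in> lie S"
  shows "inv (expo Y) \<otimes> expo (Y + Z) \<in> S"
proof -
  have key: "inv (p [^] j) \<otimes> (p \<otimes> expo W) [^] j \<in> S"
    if p: "p = expo (t *\<^sub>R Y)" and W: "W \<in> lie S" for p W t and j :: nat
  proof -
    have pG: "p \<in> carrier G" using p by simp
    \<comment> \<open>(p s)^j is p^j times a product of elements p^-i s p^i. \<open>Q\<close>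
      collects the elements for which all these conjugates lie in S; it is stable under products and
      under conjugation by p^-1, so the induction on j can run inside it.\<close>
    define Q where "Q = {s \<in> carrier G. \<forall>i::nat. inv (p [^] i) \<otimes> s \<otimes> p [^] i \<in> S}"
    have Q1: "x \<otimes> y \<in> Q" if xy: "x \<in> Q" "y \<in> Q" for x y
    proof -
      have "inv (p [^] i) \<otimes> (x \<otimes> y) \<otimes> p [^] i = (inv (p [^] i) \<otimes> x \<otimes> p [^] i) \<otimes> (inv (p [^] i) \<otimes> y \<otimes> p [^] i)" for i :: nat
        using conj_mult[of "inv (p [^] i)" x y] xy pG by (auto simp: Q_def)
      then show ?thesis using xy subgroup.m_closed[OF S] by (auto simp: Q_def)
    qed
    have Q2: "inv p \<otimes> x \<otimes> p \<in> Q" if x: "x \<in> Q" for x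
    proof -
      have xG: "x \<in> carrier G" using x by (simp add: Q_def)
      have "inv (p [^] i) \<otimes> (inv p \<otimes> x \<otimes> p) \<otimes> p [^] i = inv (p [^] Suc i) \<otimes> x \<otimes> p [^] Suc i" for i :: nat
        unfolding nat_pow_Suc2[OF pG] using xG pG by (simp add: inv_mult_group m_assoc)
      moreover have "inv (p [^] Suc i) \<otimes> x \<otimes> p [^] Suc i \<in> S" for i :: nat
        using x unfolding Q_def by blast
      ultimately show ?thesis using pG xG by (simp only: Q_def mem_Collect_eq) simp
    qed
    have Q3: "expo W \<in> Q"
    proof -
      have "inv (p [^] i) \<otimes> expo W \<otimes> p [^] i \<in> S" for i :: nat
      proof -
        have pi: "inv (p [^] i) = expo ((- (real i * t)) *\<^sub>R Y)"
          unfolding p expo_pow inv_expo by (simp add: mult.commute)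
        have "inv (p [^] i) \<otimes> expo W \<otimes> inv (inv (p [^] i)) = expo (Ad (inv (p [^] i)) W)"
          using pG by (intro expo_conj) simp
        moreover have "Ad (inv (p [^] i)) W \<in> lie S"
          unfolding pi using Y W by (simp only: normalizes_def) 
        ultimately show ?thesis using lieD pG by simp
      qed
      then show ?thesis by (simp add: Q_def)
    qed
    have QG: "x \<in> carrier G" if "x \<in> Q" for x using that by (simp add: Q_def)
    have "inv (p [^] j) \<otimes> (p \<otimes> expo W) [^] j \<in> Q"
    proof (induction j)
      case 0
      have "\<one> \<in> Q" using pG subgroup.one_closed[OF S] by (simp add: Q_def)
      then show ?case by simp
    next
      case (Suc j)
      let ?x = "inv (p [^] j) \<otimes> (p \<otimes> expo W) [^] j"
      have "inv (p [^] Suc j) \<otimes> (p \<otimes> expo W) [^] Suc j = (inv p \<otimes> ?x \<otimes> p) \<otimes> expo W"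
        using pG by (simp add: inv_mult_group m_assoc)
      then show ?case using Q1[OF Q2[OF Suc] Q3] by metis
    qed
    then have "inv (p [^] (0::nat)) \<otimes> (inv (p [^] j) \<otimes> (p \<otimes> expo W) [^] j) \<otimes> p [^] (0::nat) \<in> S"
      unfolding Q_def by blast
    then show ?thesis using pG by simp
  qed
  let ?t = "\<lambda>n. (expo (Y /\<^sub>R real n) \<otimes> expo (Z /\<^sub>R real n)) [^] n"
  have "limitin T (\<lambda>n. inv (expo Y) \<otimes> ?t (Suc n)) (inv (expo Y) \<otimes> expo (Y + Z)) sequentially"
    by (intro limit_mult limit_const limit_subseq[OF trotter filterlim_Suc]) simp
  moreover have "inv (expo Y) \<otimes> ?t (Suc n) \<in> S" for n
  proof -
    have "inv (expo (Y /\<^sub>R real (Suc n)) [^] Suc n) \<otimes> ?t (Suc n) \<in> S"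
      by (rule key[OF refl lie_scale[OF Z]])
    then show ?thesis by (simp only: expo_div_pow[OF zero_less_Suc])
  qed
  ultimately show ?thesis by (rule S_closed[rotated])
qed

text \<open>The inverse of the element provided by \<open>expo_add_coset\<close> at -Y and
  -Z.\<close>

lemma expo_add_coset':
  assumes Y: "normalizes Y" and Z: "Z \<in> lie S"
  shows "expo (Y + Z) \<otimes> inv (expo Y) \<in> S"
proof -
  have "inv (expo (- Y)) \<otimes> expo (- Y + (- Z)) \<in> S"
    using normalizes_scale[OF Y, of "-1"] lie_scale[OF Z, of "-1"] by (intro expo_add_coset) auto
  then have "inv (inv (expo (- Y)) \<otimes> expo (- Y + (- Z))) \<in> S"
    by (rule subgroup.m_inv_closed[OF S])
  moreover have "inv (inv (expo (- Y)) \<otimes> expo (- Y + (- Z))) = expo (Y + Z) \<otimes> inv (expo Y)"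
    by (simp add: inv_mult_group inv_expo add.commute)
  ultimately show ?thesis by simp
qed

text \<open>Descending along the lower central series, \<open>lie S\<close> is an ideal.\<close>

lemma lie_S_ideal:
  assumes "i \<le> k"
  shows "X \<in> lie (cl i) \<Longrightarrow> normalizes X"
  using assms
proof (induction arbitrary: X rule: inc_induct)
  case base
  then have "X = 0" using lie_cl_nilpotent[OF nilpotent] by blast
  then show ?case by (simp add: normalizes_def Ad_one)
next
  case (step i)
  have br: "bracket X Z \<in> lie S" if X: "X \<in> lie (cl i)" and Z: "Z \<in> lie S" for X Z
  proof -
    \<comment> \<open>Conjugating exp(n W) by b n = exp(X / n) gives exp(Y n + n W) with Y n = n
      (Ad(b n) W - W), which tends to \<open>bracket X W\<close>. As Y n lies one step further down
      the central series, the induction hypothesis lets exp(Y n) be split off modulo S, and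
      \<open>mautner\<close> applies.\<close>
    have "expo (bracket X W) \<in> S" if W: "W \<in> lie S" for W
    proof -
      define b where "b n = expo (X /\<^sub>R real n)" for n
      define Y where "Y n = real n *\<^sub>R (Ad (b n) W - W)" for n
      have bG: "b n \<in> carrier G" for n by (simp add: b_def)
      have bt: "tang b X" unfolding b_def by (rule tang_expo)
      have "Y n \<in> lie (cl (Suc i))" for n
        unfolding Y_def b_def
        by (intro lie_scale Ad_cl_lie lieD X)
      then have Yn: "normalizes (Y n)" for n using step.IH by blast
      show ?thesis
      proof (rule mautner[where b = b and s = "\<lambda>n. expo (real n *\<^sub>R W)" and y = "\<lambda>n. expo (Y n)"
            and s' = "\<lambda>n. inv (expo (Y n)) \<otimes> expo (Y n + real n *\<^sub>R W)"])
        show "limitin T b \<one> sequentially" by (rule tangD(5)[OF bt])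
        show "expo (real n *\<^sub>R W) \<in> S" for n by (intro lieD lie_scale W)
        show "inv (expo (Y n)) \<otimes> expo (Y n + real n *\<^sub>R W) \<in> S" for n
          by (intro expo_add_coset Yn lie_scale W)
        show "b n \<otimes> expo (real n *\<^sub>R W) \<otimes> inv (b n) = expo (Y n) \<otimes> (inv (expo (Y n)) \<otimes> expo (Y n + real n *\<^sub>R W))" for n
        proof -
          have "b n \<otimes> expo (real n *\<^sub>R W) \<otimes> inv (b n) = expo (Ad (b n) (real n *\<^sub>R W))"
            by (rule expo_conj[OF bG])
          also have "Ad (b n) (real n *\<^sub>R W) = Y n + real n *\<^sub>R W"
            by (simp add: Y_def linear_cmul[OF Ad_linear[OF bG]] scaleR_diff_right)
          also have "expo (Y n + real n *\<^sub>R W) = expo (Y n) \<otimes> (inv (expo (Y n)) \<otimes> expo (Y n + real n *\<^sub>R W))"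
            by (simp flip: m_assoc)
          finally show ?thesis .
        qed
        have "Y \<longlonglongrightarrow> bracket X W"
          unfolding Y_def by (rule bracket_tendsto[OF bt])
        then show "limitin T (\<lambda>n. expo (Y n)) (expo (bracket X W)) sequentially"
          by (rule expo_continuous)
      qed (simp_all add: bG)
    qed
    \<comment> \<open>Linearity of the bracket yields the whole line through
      \<open>bracket X Z\<close> from the multiples of Z.\<close>
    from this[OF lie_scale[OF Z]] show ?thesis
      by (simp add: lie_def linear_cmul[OF bracket_linear])
  qed
  show ?case
    unfolding normalizes_def
    by (intro allI ballI Ad_expo_invariant[OF sub] br lie_scale step.prems)
qed

lemma normalizes_all: "normalizes X"
  by (rule lie_S_ideal[of 0]) (simp_all add: lie_cl_0)

text \<open>Ad a maps \<open>lie (cl i)\<close> to itself, since it changes a vector only by an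
  element of the next term; so \<open>D\<close> applies along the whole orbit and the differences
  telescope.\<close>

lemma Ad_pow_diff:
  assumes D: "\<And>X. X \<in> lie (cl i) \<Longrightarrow> Ad a X - X \<in> lie S" and X: "X \<in> lie (cl i)"
  shows "Ad (a [^] (n::nat)) X - X \<in> lie S"
proof -
  have "Ad (a [^] n) X \<in> lie (cl i) \<and> Ad (a [^] n) X - X \<in> lie S"
  proof (induction n)
    case 0
    then show ?case using X subspace_0[OF sub] by (simp add: Ad_one)
  next
    case (Suc n)
    let ?Y = "Ad (a [^] n) X"
    have e: "Ad (a [^] Suc n) X = Ad a ?Y"
      unfolding nat_pow_Suc2[OF a_G] using a_G by (intro Ad_mult) simp_all
    have "Ad a ?Y - ?Y \<in> lie (cl (Suc i))" using Ad_lie_cl[OF a_G] Suc by blast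
    moreover have "lie (cl (Suc i)) \<subseteq> lie (cl i)"
      unfolding lie_def using cl_antimono by blast
    ultimately have "Ad a ?Y - ?Y + ?Y \<in> lie (cl i)"
      using Suc by (intro subspace_add[OF lie_cl_subspace]) auto
    moreover have "(Ad a ?Y - ?Y) + (?Y - X) \<in> lie S"
      using D Suc by (intro subspace_add[OF sub]) auto
    ultimately show ?case unfolding e by simp
  qed
  then show ?thesis ..
qed

text \<open>Put D = Ad a X - X, which lies one step further down the series. The induction
  hypothesis gives Ad(a^n) X = X + n D modulo \<open>lie S\<close>, so conjugating exp(X / n) by a^n
  gives exp(X / n + D) up to a factor in S, and \<open>contraction\<close> puts exp D into
  S.\<close>

lemma Ad_a_diff:
  assumes "i \<le> k"
  shows "X \<in> lie (cl i) \<Longrightarrow> Ad a X - X \<in> lie S"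
  using assms
proof (induction arbitrary: X rule: inc_induct)
  case base
  then have "X = 0" using lie_cl_nilpotent[OF nilpotent] by blast
  then show ?case using linear_0[OF Ad_linear[OF a_G]] subspace_0[OF sub] by simp
next
  case (step i)
  have "expo (Ad a W - W) \<in> S" if W: "W \<in> lie (cl i)" for W
  proof -
    define D where "D = Ad a W - W"
    have Dc: "D \<in> lie (cl (Suc i))" unfolding D_def by (rule Ad_lie_cl[OF a_G W])
    have R: "Ad (a [^] n) W - W - real n *\<^sub>R D \<in> lie S" for n :: nat
    proof (induction n)
      case 0
      then show ?case using subspace_0[OF sub] by (simp add: Ad_one)
    next
      case (Suc n)
      have aG: "a [^] n \<in> carrier G" using a_G by simp
      have "Ad (a [^] Suc n) W = Ad (a [^] n) D + Ad (a [^] n) W"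
        using a_G by (simp add: Ad_mult D_def linear_diff[OF Ad_linear[OF aG]])
      then have "Ad (a [^] Suc n) W - W - real (Suc n) *\<^sub>R D
          = (Ad (a [^] n) D - D) + (Ad (a [^] n) W - W - real n *\<^sub>R D)"
        by (simp add: algebra_simps)
      moreover have "Ad (a [^] n) D - D \<in> lie S"
        by (rule Ad_pow_diff[OF step.IH Dc])
      ultimately show ?case using Suc subspace_add[OF sub] by metis
    qed
    define b where "b n = expo (W /\<^sub>R real n)" for n
    \<comment> \<open>The factor \<open>inverse (real n)\<close> stands outside so that Y 0 = 0: the
      conjugation identity is required for every n, and W / n + D would violate it at n = 0 unless
      exp D were trivial modulo S.\<close>
    define Y where "Y n = inverse (real n) *\<^sub>R (W + real n *\<^sub>R D)" for n
    define Z where "Z n = inverse (real n) *\<^sub>R (Ad (a [^] n) W - W - real n *\<^sub>R D)" for n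
    have ZS: "Z n \<in> lie S" for n unfolding Z_def by (intro lie_scale R)
    show ?thesis
      unfolding D_def[symmetric]
    proof (rule contraction[where b = b and s = "\<lambda>n. expo (Y n + Z n) \<otimes> inv (expo (Y n))" and y = "\<lambda>n. expo (Y n)"])
      show "limitin T b \<one> sequentially"
        unfolding b_def by (rule tangD(5)[OF tang_expo])
      show "expo (Y n + Z n) \<otimes> inv (expo (Y n)) \<in> S" for n
        by (rule expo_add_coset'[OF normalizes_all ZS])
      show "a [^] n \<otimes> b n \<otimes> inv (a [^] n) = expo (Y n + Z n) \<otimes> inv (expo (Y n)) \<otimes> expo (Y n)" for n
      proof -
        have aG: "a [^] n \<in> carrier G" using a_G by simp
        have "a [^] n \<otimes> b n \<otimes> inv (a [^] n) = expo (Ad (a [^] n) (W /\<^sub>R real n))"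
          unfolding b_def by (rule expo_conj[OF aG])
        also have "Ad (a [^] n) (W /\<^sub>R real n) = Y n + Z n"
          by (simp add: Y_def Z_def linear_cmul[OF Ad_linear[OF aG]] flip: scaleR_add_right)
        finally show ?thesis by (simp add: m_assoc)
      qed
      have "(\<lambda>n. W /\<^sub>R real n + D) \<longlonglongrightarrow> 0 + D"
        by (intro tendsto_intros scale_tendsto_0)
      moreover have "\<forall>\<^sub>F n in sequentially. W /\<^sub>R real n + D = Y n"
        using eventually_gt_at_top[of 0] by eventually_elim (simp add: Y_def scaleR_add_right)
      ultimately have "Y \<longlonglongrightarrow> D" using tendsto_cong by force
      then show "limitin T (\<lambda>n. expo (Y n)) (expo D) sequentially"
        by (rule expo_continuous)
    qed (simp_all add: b_def)
  qed
  from this[OF lie_scale[OF step.prems]] show ?case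
    by (simp add: lie_def linear_cmul[OF Ad_linear[OF a_G]] flip: scaleR_diff_right)
qed

text \<open>Near the identity b = exp X, and Ad(a^-n) X differs from X by an element of the ideal
  \<open>lie S\<close>. The neighbourhood is the range of exp near 1, the same for all n, which
  later gives equicontinuity.\<close>

theorem conj_pow_coset:
  obtains V where "openin T V" "\<one> \<in> V"
    "\<And>b n. b \<in> V \<Longrightarrow> inv b \<otimes> (inv (a [^] (n::nat)) \<otimes> b \<otimes> a [^] n) \<in> S"
proof -
  obtain V where V: "openin T V" "\<one> \<in> V" "V \<subseteq> range expo"
    by (rule expo_neighbourhood)
  show ?thesis
  proof (rule that[OF V(1,2)])
    fix b and n :: nat assume "b \<in> V"
    then obtain X where b: "b = expo X" using V by blast
    have aG: "a [^] n \<in> carrier G" "inv (a [^] n) \<in> carrier G" using a_G by simp_all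
    let ?Y = "Ad (inv (a [^] n)) X"
    have "Ad (a [^] n) ?Y - ?Y \<in> lie S"
      by (rule Ad_pow_diff[of 0]) (auto simp: lie_cl_0 intro: Ad_a_diff[of 0])
    then have "(-1) *\<^sub>R (X - ?Y) \<in> lie S"
      unfolding Ad_inv_cancel[OF aG(1)] by (rule lie_scale)
    then have "?Y - X \<in> lie S" by simp
    from expo_add_coset[OF normalizes_all[of X] this]
    have "inv (expo X) \<otimes> expo ?Y \<in> S" by simp
    moreover have "inv (a [^] n) \<otimes> b \<otimes> a [^] n = expo ?Y"
      using expo_conj[OF aG(2), of X] aG by (simp add: b)
    ultimately show "inv b \<otimes> (inv (a [^] n) \<otimes> b \<otimes> a [^] n) \<in> S" by (simp add: b)
  qed
qed

end

section \<open>From a smooth atlas to the estimates of \<open>chart_group\<close>\<close>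

section \<open>Charts of a Lie group\<close>

context C2_product
begin

text \<open>For the bracket: near p, the derivative at p of right multiplication by w is the
  identity up to order |w - p|.\<close>

lemma right_slice_bound:
  obtains d M where "0 < d" "0 \<le> M"
    "\<And>w. norm (w - p) \<le> d \<Longrightarrow> (p, w) \<in> S \<and> (w, p) \<in> S"
    "\<And>w h. norm (w - p) \<le> d \<Longrightarrow> norm (F' (p, w) (h, 0) - h) \<le> M * norm (w - p) * norm h"
proof -
  obtain R where R: "0 < R" "cball (p, p) R \<subseteq> S"
    using S open_contains_cball[of S] by blast
  obtain M where M: "0 \<le> M"
    "\<And>x y v. x \<in> cball (p, p) R \<Longrightarrow> y \<in> cball (p, p) R \<Longrightarrow>
      norm (F' x v - F' y v) \<le> M * norm (x - y) * norm v"
    using C_diff_2_Lipschitz_derivative[OF C2 R(2)] by metis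
  have in1: "(p, w) \<in> cball (p, p) R" "(w, p) \<in> cball (p, p) R" if "norm (w - p) \<le> R" for w
    using that by (simp_all add: dist_Pair_Pair dist_norm norm_minus_commute)
  show ?thesis
  proof (rule that[OF R(1) M(1)])
    fix w assume w: "norm (w - p) \<le> R"
    show "(p, w) \<in> S \<and> (w, p) \<in> S" using in1[OF w] R(2) by blast
    fix h
    have "norm (F' (p, w) (h, 0) - F' (p, p) (h, 0)) \<le> M * norm ((p, w) - (p, p)) * norm (h, 0::'e)"
      using R(1) by (intro M(2) in1 w) simp
    then show "norm (F' (p, w) (h, 0) - h) \<le> M * norm (w - p) * norm h"
      by (simp add: F'_right_unit[OF S(2)] norm_Pair)
  qed
qed

end

locale atlas_group = top_group G T for G (structure) and T :: "'a topology" +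
  fixes A :: "('a set \<times> ('a \<Rightarrow> 'e::euclidean_space)) set"
  assumes atlas: "smooth_atlas T A"
    and smooth_mult: "smooth_map (prod_topology T T) (prod_atlas A A) T A (\<lambda>(x, y). x \<otimes> y)"
begin

lemma chart_at:
  assumes "g \<in> carrier G"
  obtains U \<phi> where "(U, \<phi>) \<in> A" "g \<in> U"
  using assms atlas unfolding smooth_atlas_def topspace[symmetric] by blast

lemma chartD:
  assumes "(U, \<phi>) \<in> A"
  shows "openin T U" "open (\<phi> ` U)" "homeomorphic_map (subtopology T U) (top_of_set (\<phi> ` U)) \<phi>"
    "inj_on \<phi> U"
proof -
  show *: "openin T U" "open (\<phi> ` U)" "homeomorphic_map (subtopology T U) (top_of_set (\<phi> ` U)) \<phi>"
    using atlas assms unfolding smooth_atlas_def by blast+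
  have "topspace (subtopology T U) = U" using *(1) openin_subset by fastforce
  then show "inj_on \<phi> U" using homeomorphic_imp_injective_map[OF *(3)] by simp
qed

text \<open>Three charts are allowed, because conjugation by a distant g leaves the chart at the
  identity on the way.\<close>

definition pF where
  "pF U1 \<phi>1 U2 \<phi>2 \<phi>3 = \<phi>3 \<circ> (\<lambda>(x, y). x \<otimes> y) \<circ> inv_into (U1 \<times> U2) (map_prod \<phi>1 \<phi>2)"

definition pS where
  "pS U1 \<phi>1 U2 \<phi>2 U3 = map_prod \<phi>1 \<phi>2 ` {z \<in> U1 \<times> U2. (\<lambda>(x, y). x \<otimes> y) z \<in> U3}"

context
  fixes U1 \<phi>1 U2 \<phi>2 U3 \<phi>3
  assumes c1: "(U1, \<phi>1) \<in> A" and c2: "(U2, \<phi>2) \<in> A" and c3: "(U3, \<phi>3) \<in> A"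
begin

lemma pF_eval: "x \<in> U1 \<Longrightarrow> y \<in> U2 \<Longrightarrow> pF U1 \<phi>1 U2 \<phi>2 \<phi>3 (\<phi>1 x, \<phi>2 y) = \<phi>3 (x \<otimes> y)"
proof -
  assume xy: "x \<in> U1" "y \<in> U2"
  have "inj_on (map_prod \<phi>1 \<phi>2) (U1 \<times> U2)"
    by (rule map_prod_inj_on[OF chartD(4)[OF c1] chartD(4)[OF c2]])
  then have "inv_into (U1 \<times> U2) (map_prod \<phi>1 \<phi>2) (map_prod \<phi>1 \<phi>2 (x, y)) = (x, y)"
    using xy by (intro inv_into_f_f) auto
  then show ?thesis by (simp add: pF_def)
qed

lemma pS_mem: "x \<in> U1 \<Longrightarrow> y \<in> U2 \<Longrightarrow> (\<phi>1 x, \<phi>2 y) \<in> pS U1 \<phi>1 U2 \<phi>2 U3 \<longleftrightarrow> x \<otimes> y \<in> U3"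
  using chartD(4)[OF c1] chartD(4)[OF c2] by (auto simp: pS_def inj_on_def)

lemma pS_sub: "z \<in> pS U1 \<phi>1 U2 \<phi>2 U3 \<Longrightarrow> \<exists>x\<in>U1. \<exists>y\<in>U2. z = (\<phi>1 x, \<phi>2 y)"
  by (auto simp: pS_def)

lemma pF_smooth: "C_diff n (pS U1 \<phi>1 U2 \<phi>2 U3) (pF U1 \<phi>1 U2 \<phi>2 \<phi>3)"
proof -
  have "(U1 \<times> U2, map_prod \<phi>1 \<phi>2) \<in> prod_atlas A A"
    using c1 c2 unfolding prod_atlas_def by blast
  then have "smooth_on (pS U1 \<phi>1 U2 \<phi>2 U3) (pF U1 \<phi>1 U2 \<phi>2 \<phi>3)"
    using smooth_mult c3 unfolding smooth_map_def pS_def pF_def by blast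
  then show ?thesis by (simp add: smooth_on_def)
qed

lemma pS_open: "open (pS U1 \<phi>1 U2 \<phi>2 U3)"
proof -
  have h: "homeomorphic_map (subtopology (prod_topology T T) (U1 \<times> U2))
      (prod_topology (top_of_set (\<phi>1 ` U1)) (top_of_set (\<phi>2 ` U2))) (\<lambda>(x, y). (\<phi>1 x, \<phi>2 y))"
    unfolding subtopology_Times
    using chartD(3)[OF c1] chartD(3)[OF c2] unfolding homeomorphic_map_maps
    by (metis homeomorphic_maps_prod)
  have U12: "openin (prod_topology T T) (U1 \<times> U2)"
    using chartD(1)[OF c1] chartD(1)[OF c2] by (simp add: openin_prod_Times_iff)
  have "openin (prod_topology T T) {z \<in> topspace (prod_topology T T). (\<lambda>(x, y). x \<otimes> y) z \<in> U3}"
    by (rule openin_continuous_map_preimage[OF mult_cont chartD(1)[OF c3]])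
  from openin_Int[OF this U12]
  have "openin (prod_topology T T) {z \<in> U1 \<times> U2. (\<lambda>(x, y). x \<otimes> y) z \<in> U3}"
    by (rule back_subst[where P = "openin _"]) (use openin_subset[OF U12] in auto)
  then have "openin (subtopology (prod_topology T T) (U1 \<times> U2)) {z \<in> U1 \<times> U2. (\<lambda>(x, y). x \<otimes> y) z \<in> U3}"
    using openin_open_subtopology[OF U12] by blast
  then have o: "openin (prod_topology (top_of_set (\<phi>1 ` U1)) (top_of_set (\<phi>2 ` U2)))
      ((\<lambda>(x, y). (\<phi>1 x, \<phi>2 y)) ` {z \<in> U1 \<times> U2. (\<lambda>(x, y). x \<otimes> y) z \<in> U3})"
    using homeomorphic_imp_open_map[OF h] unfolding open_map_def by (elim allE impE)
  have p: "prod_topology (top_of_set (\<phi>1 ` U1)) (top_of_set (\<phi>2 ` U2)) = top_of_set (\<phi>1 ` U1 \<times> \<phi>2 ` U2)"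
    by (simp add: subtopology_Times[symmetric])
  have "open ((\<lambda>(x, y). (\<phi>1 x, \<phi>2 y)) ` {z \<in> U1 \<times> U2. (\<lambda>(x, y). x \<otimes> y) z \<in> U3})"
    by (rule openin_open_trans[OF o[unfolded p] open_Times[OF chartD(2)[OF c1] chartD(2)[OF c2]]])
  then show ?thesis by (simp add: pS_def map_prod_def)
qed

lemma pF_diff: "z \<in> pS U1 \<phi>1 U2 \<phi>2 U3 \<Longrightarrow> pF U1 \<phi>1 U2 \<phi>2 \<phi>3 differentiable (at z)"
  using pF_smooth[of "Suc 0"] by simp

end

lemma limit_chart_at:
  assumes c: "(U, \<phi>) \<in> A" and l: "limitin T x y F" and y: "y \<in> U"
  shows "\<forall>\<^sub>F n in F. x n \<in> U"
  using l chartD(1)[OF c] y by (auto simp: limitin_def)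

context
  fixes U \<phi>0
  assumes c0: "(U, \<phi>0) \<in> A" and one: "\<one> \<in> U"
begin

abbreviation "\<phi> x \<equiv> \<phi>0 x - \<phi>0 \<one>"

lemma tang_lim:
  assumes t: "tangent G U (\<lambda>x. \<phi> x) t X"
  shows "limitin T t \<one> sequentially"
proof -
  have U: "\<forall>\<^sub>F n in sequentially. t n \<in> U" and l: "(\<lambda>n. real n *\<^sub>R \<phi> (t n)) \<longlonglongrightarrow> X"
    using t by (auto simp: tangent_def)
  have "(\<lambda>n. (1 / real n) *\<^sub>R (real n *\<^sub>R \<phi> (t n))) \<longlonglongrightarrow> 0 *\<^sub>R X"
    by (intro tendsto_scaleR l lim_1_over_n)
  moreover have "\<forall>\<^sub>F n in sequentially. (1 / real n) *\<^sub>R (real n *\<^sub>R \<phi> (t n)) = \<phi> (t n)"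
    using eventually_gt_at_top[of 0] by eventually_elim simp
  ultimately have "(\<lambda>n. \<phi> (t n)) \<longlonglongrightarrow> 0" using tendsto_cong by force
  then have l0: "(\<lambda>n. \<phi>0 (t n)) \<longlonglongrightarrow> \<phi>0 \<one>" by (rule LIM_zero_cancel)
  obtain g where g: "homeomorphic_maps (subtopology T U) (top_of_set (\<phi>0 ` U)) \<phi>0 g"
    using chartD(3)[OF c0] homeomorphic_map_maps by blast
  have tU: "topspace (subtopology T U) = U" using chartD(1)[OF c0] openin_subset by fastforce
  have gc: "continuous_map (top_of_set (\<phi>0 ` U)) (subtopology T U) g"
    and gp: "\<And>x. x \<in> U \<Longrightarrow> g (\<phi>0 x) = x"
    using g tU by (auto simp: homeomorphic_maps_def)
  have "limitin (top_of_set (\<phi>0 ` U)) (\<lambda>n. \<phi>0 (t n)) (\<phi>0 \<one>) sequentially"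
    using U one l0 by (auto simp: limitin_subtopology elim!: eventually_mono)
  from continuous_map_limit[OF gc this]
  have "limitin T (\<lambda>n. g (\<phi>0 (t n))) \<one> sequentially"
    using gp one by (simp add: limitin_subtopology o_def)
  moreover have "\<forall>\<^sub>F n in sequentially. g (\<phi>0 (t n)) = t n"
    using U by eventually_elim (rule gp)
  ultimately show ?thesis by (rule limit_cong[rotated])
qed

text \<open>Conjugation is right multiplication by inv g followed by left multiplication by g. The
  intermediate points lie in a chart at inv g, and each map is a slice of the product, so the
  differential is a composite of two slice derivatives.\<close>

lemma conj_derivative_exists:
  assumes g: "g \<in> carrier G"
  shows "\<exists>A. conj_derivative G U (\<lambda>x. \<phi> x) g A"
proof -
  have ig: "inv g \<in> carrier G" using g by simp
  obtain U1 \<phi>1 where c1: "(U1, \<phi>1) \<in> A" "inv g \<in> U1" using chart_at[OF ig] by metis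
  obtain U2 \<phi>2 where c2: "(U2, \<phi>2) \<in> A" "g \<in> U2" using chart_at[OF g] by metis
  let ?F1 = "pF U \<phi>0 U1 \<phi>1 \<phi>1" and ?F2 = "pF U2 \<phi>2 U1 \<phi>1 \<phi>0"
  let ?q = "\<phi>1 (inv g)"
  have m1: "(\<phi>0 \<one>, ?q) \<in> pS U \<phi>0 U1 \<phi>1 U1"
    using pS_mem[OF c0 c1(1) c1(1) one c1(2)] c1(2) g by simp
  have m2: "(\<phi>2 g, ?q) \<in> pS U2 \<phi>2 U1 \<phi>1 U"
    using pS_mem[OF c2(1) c1(1) c0 c2(2) c1(2)] one g by simp
  note d1 = has_derivative_fst_slice[OF pF_diff[OF c0 c1(1) c1(1) m1]]
  note d2 = has_derivative_snd_slice[OF pF_diff[OF c2(1) c1(1) c0 m2]]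
  define f1 where "f1 h = frechet_derivative ?F1 (at (\<phi>0 \<one>, ?q)) (h, 0)" for h
  define f2 where "f2 h = frechet_derivative ?F2 (at (\<phi>2 g, ?q)) (0, h)" for h
  have lin: "linear (\<lambda>h. f2 (f1 h))"
    using linear_compose[OF has_derivative_linear[OF d1] has_derivative_linear[OF d2]]
    by (simp add: o_def f1_def f2_def)
  have e1: "?F1 (\<phi>0 \<one>, ?q) = ?q" using pF_eval[OF c0 c1(1) c1(1) one c1(2)] g by simp
  have e2: "?F2 (\<phi>2 g, ?q) = \<phi>0 \<one>" using pF_eval[OF c2(1) c1(1) c0 c2(2) c1(2)] g by simp
  have "tangent G U (\<lambda>x. \<phi> x) (\<lambda>n. g \<otimes> t n \<otimes> inv g) (f2 (f1 X))"
    if t: "tangent G U (\<lambda>x. \<phi> x) t X" for t X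
  proof -
    have tG: "t n \<in> carrier G" for n using t by (simp add: tangent_def)
    have tU: "\<forall>\<^sub>F n in sequentially. t n \<in> U" and l: "(\<lambda>n. real n *\<^sub>R (\<phi>0 (t n) - \<phi>0 \<one>)) \<longlonglongrightarrow> X"
      using t by (auto simp: tangent_def)
    have lt: "limitin T t \<one> sequentially" by (rule tang_lim[OF t])
    have l1: "limitin T (\<lambda>n. t n \<otimes> inv g) (inv g) sequentially"
      using limit_mult[OF lt limit_const[OF ig]] g by simp
    have U1: "\<forall>\<^sub>F n in sequentially. t n \<otimes> inv g \<in> U1"
      by (rule limit_chart_at[OF c1(1) l1 c1(2)])
    have "limitin T (\<lambda>n. g \<otimes> (t n \<otimes> inv g)) (g \<otimes> inv g) sequentially"
      by (rule limit_mult[OF limit_const[OF g] l1])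
    then have l2: "limitin T (\<lambda>n. g \<otimes> t n \<otimes> inv g) \<one> sequentially"
      using g tG by (simp add: m_assoc)
    have "(\<lambda>n. real n *\<^sub>R (?F1 (\<phi>0 (t n), ?q) - ?F1 (\<phi>0 \<one>, ?q))) \<longlonglongrightarrow> f1 X"
      unfolding f1_def by (rule scaled_difference_tendsto[OF d1 l])
    moreover have "\<forall>\<^sub>F n in sequentially. real n *\<^sub>R (?F1 (\<phi>0 (t n), ?q) - ?F1 (\<phi>0 \<one>, ?q))
        = real n *\<^sub>R (\<phi>1 (t n \<otimes> inv g) - ?q)"
      using tU by eventually_elim (simp add: e1 pF_eval[OF c0 c1(1) c1(1) _ c1(2)])
    ultimately have k1: "(\<lambda>n. real n *\<^sub>R (\<phi>1 (t n \<otimes> inv g) - ?q)) \<longlonglongrightarrow> f1 X"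
      by (rule Lim_transform_eventually)
    have "(\<lambda>n. real n *\<^sub>R (?F2 (\<phi>2 g, \<phi>1 (t n \<otimes> inv g)) - ?F2 (\<phi>2 g, ?q))) \<longlonglongrightarrow> f2 (f1 X)"
      unfolding f2_def by (rule scaled_difference_tendsto[OF d2 k1])
    moreover have "\<forall>\<^sub>F n in sequentially. real n *\<^sub>R (?F2 (\<phi>2 g, \<phi>1 (t n \<otimes> inv g)) - ?F2 (\<phi>2 g, ?q))
        = real n *\<^sub>R \<phi> (g \<otimes> t n \<otimes> inv g)"
      using U1 by eventually_elim (simp add: e2 pF_eval[OF c2(1) c1(1) c0 c2(2)] g tG m_assoc)
    ultimately have "(\<lambda>n. real n *\<^sub>R \<phi> (g \<otimes> t n \<otimes> inv g)) \<longlonglongrightarrow> f2 (f1 X)"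
      by (rule Lim_transform_eventually)
    then show ?thesis
      using tG g limit_chart_at[OF c0 l2 one] by (simp add: tangent_def)
  qed
  then show ?thesis
    using lin unfolding conj_derivative_def by (intro exI[of _ "\<lambda>h. f2 (f1 h)"]) blast
qed

abbreviation "F \<equiv> pF U \<phi>0 U \<phi>0 \<phi>0"
abbreviation "p \<equiv> \<phi>0 \<one>"

lemma product_chart: "C2_product F (pS U \<phi>0 U \<phi>0 U) p"
proof
  show "open (pS U \<phi>0 U \<phi>0 U)" by (rule pS_open[OF c0 c0 c0])
  show "(p, p) \<in> pS U \<phi>0 U \<phi>0 U" using pS_mem[OF c0 c0 c0 one one] one by simp
  show "C_diff (Suc (Suc 0)) (pS U \<phi>0 U \<phi>0 U) F" by (rule pF_smooth[OF c0 c0 c0])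
  have UG: "x \<in> carrier G" if "x \<in> U" for x
    using that openin_subset[OF chartD(1)[OF c0]] topspace by blast
  fix u
  show "F (u, p) = u" if s: "(u, p) \<in> pS U \<phi>0 U \<phi>0 U"
  proof -
    obtain x y where xy: "x \<in> U" "y \<in> U" "u = \<phi>0 x" "p = \<phi>0 y" using pS_sub[OF c0 c0 c0 s] by blast
    then show ?thesis using pF_eval[OF c0 c0 c0 xy(1) one] UG by simp
  qed
  show "F (p, u) = u" if s: "(p, u) \<in> pS U \<phi>0 U \<phi>0 U"
  proof -
    obtain x y where xy: "x \<in> U" "y \<in> U" "p = \<phi>0 x" "u = \<phi>0 y" using pS_sub[OF c0 c0 c0 s] by blast
    then show ?thesis using pF_eval[OF c0 c0 c0 one xy(2)] UG by simp
  qed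
qed

lemma chart_inv:
  obtains s where "\<And>Z. tangent G U (\<lambda>x. \<phi> x) (s Z) Z"
proof -
  obtain d where d: "0 < d" "ball p d \<subseteq> \<phi>0 ` U"
    using chartD(2)[OF c0] one open_contains_ball by blast
  \<comment> \<open>The identity is the default for the finitely many n at which p + Z / n leaves
    the chart.\<close>
  define s where "s Z n = (if p + Z /\<^sub>R real n \<in> \<phi>0 ` U then inv_into U \<phi>0 (p + Z /\<^sub>R real n) else \<one>)" for Z n
  have sU: "s Z n \<in> U" for Z n using one by (auto simp: s_def intro: inv_into_into)
  have "tangent G U (\<lambda>x. \<phi> x) (s Z) Z" for Z
    unfolding tangent_def
  proof (intro conjI allI always_eventually sU)
    show "s Z n \<in> carrier G" for n
      using sU openin_subset[OF chartD(1)[OF c0]] topspace by blast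
    have "(\<lambda>n. (1 / real n) *\<^sub>R Z) \<longlonglongrightarrow> 0 *\<^sub>R Z" by (intro tendsto_intros lim_1_over_n)
    then have "\<forall>\<^sub>F n in sequentially. norm (Z /\<^sub>R real n) < d"
      using d(1) order_tendstoD(2)[OF tendsto_norm[of _ "0 *\<^sub>R Z"], of "\<lambda>n. (1 / real n) *\<^sub>R Z" sequentially d]
      by (simp add: inverse_eq_divide)
    then have "\<forall>\<^sub>F n in sequentially. Z = real n *\<^sub>R \<phi> (s Z n)"
      using eventually_gt_at_top[of 0]
    proof eventually_elim
      case (elim n)
      have "p + Z /\<^sub>R real n \<in> \<phi>0 ` U" using elim(1) d(2) by (auto simp: dist_norm)
      then have "\<phi>0 (s Z n) = p + Z /\<^sub>R real n" by (simp add: s_def f_inv_into_f)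
      then show ?case using elim(2) by simp
    qed
    then show "(\<lambda>n. real n *\<^sub>R \<phi> (s Z n)) \<longlonglongrightarrow> Z"
      by (rule Lim_transform_eventually[OF tendsto_const])
  qed
  then show ?thesis by (rule that)
qed

text \<open>Differentiating x s = (x s x^-1) x at s = 1 expresses Ad x through the two slice
  derivatives of the product. Expanding these at x = 1 to first order gives the derivative of Ad as
  a difference of mixed second derivatives.\<close>

lemma bracket_exists:
  "\<exists>B. \<forall>t X Z A. tangent G U (\<lambda>x. \<phi> x) t X \<longrightarrow> (\<forall>n. conj_derivative G U (\<lambda>x. \<phi> x) (t n) (A n)) \<longrightarrow>
       (\<lambda>n. real n *\<^sub>R (A n Z - Z)) \<longlonglongrightarrow> B X Z"
proof -
  interpret P: C2_product F "pS U \<phi>0 U \<phi>0 U" p by (rule product_chart)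
  have UG: "x \<in> carrier G" if "x \<in> U" for x
    using that openin_subset[OF chartD(1)[OF c0]] topspace by blast
  obtain d M where d: "0 < d" "0 \<le> M"
    and dS: "\<And>w. norm (w - p) \<le> d \<Longrightarrow> (p, w) \<in> pS U \<phi>0 U \<phi>0 U \<and> (w, p) \<in> pS U \<phi>0 U \<phi>0 U"
    and dM: "\<And>w h. norm (w - p) \<le> d \<Longrightarrow> norm (P.F' (p, w) (h, 0) - h) \<le> M * norm (w - p) * norm h"
    by (rule P.right_slice_bound) (rule that)
  obtain s where s: "\<And>Z. tangent G U (\<lambda>x. \<phi> x) (s Z) Z" using chart_inv by metis
  have rel: "P.F' (p, \<phi>0 x) (B Z, 0) = P.F' (\<phi>0 x, p) (0, Z)"
    if x: "x \<in> U" "norm (\<phi> x) \<le> d" and B: "conj_derivative G U (\<lambda>x. \<phi> x) x B" for x B Z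
  proof -
    let ?u = "\<phi>0 x"
    have xG: "x \<in> carrier G" by (rule UG[OF x(1)])
    have uS: "(p, ?u) \<in> pS U \<phi>0 U \<phi>0 U" "(?u, p) \<in> pS U \<phi>0 U \<phi>0 U" using dS[OF x(2)] by auto
    let ?y = "\<lambda>n. x \<otimes> s Z n \<otimes> inv x"
    have y: "tangent G U (\<lambda>x. \<phi> x) ?y (B Z)" using B s unfolding conj_derivative_def by blast
    have sG: "s Z n \<in> carrier G" for n using s by (simp add: tangent_def)
    have sU: "\<forall>\<^sub>F n in sequentially. s Z n \<in> U" "(\<lambda>n. real n *\<^sub>R (\<phi>0 (s Z n) - p)) \<longlonglongrightarrow> Z"
      using s unfolding tangent_def by blast+
    have yU: "\<forall>\<^sub>F n in sequentially. ?y n \<in> U" "(\<lambda>n. real n *\<^sub>R (\<phi>0 (?y n) - p)) \<longlonglongrightarrow> B Z"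
      using y unfolding tangent_def by blast+
    have "(\<lambda>n. real n *\<^sub>R (F (?u, \<phi>0 (s Z n)) - F (?u, p))) \<longlonglongrightarrow> P.F' (?u, p) (0, Z)"
      by (rule scaled_difference_tendsto[OF has_derivative_snd_slice[OF P.diff[OF uS(2)]] sU(2)])
    moreover have "\<forall>\<^sub>F n in sequentially. real n *\<^sub>R (F (?u, \<phi>0 (s Z n)) - F (?u, p)) = real n *\<^sub>R (\<phi>0 (x \<otimes> s Z n) - ?u)"
      using sU(1) by eventually_elim (simp add: pF_eval[OF c0 c0 c0 x(1)] P.right_unit[OF uS(2)])
    ultimately have l1: "(\<lambda>n. real n *\<^sub>R (\<phi>0 (x \<otimes> s Z n) - ?u)) \<longlonglongrightarrow> P.F' (?u, p) (0, Z)"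
      by (rule Lim_transform_eventually)
    have "(\<lambda>n. real n *\<^sub>R (F (\<phi>0 (?y n), ?u) - F (p, ?u))) \<longlonglongrightarrow> P.F' (p, ?u) (B Z, 0)"
      by (rule scaled_difference_tendsto[OF has_derivative_fst_slice[OF P.diff[OF uS(1)]] yU(2)])
    moreover have "\<forall>\<^sub>F n in sequentially. real n *\<^sub>R (F (\<phi>0 (?y n), ?u) - F (p, ?u)) = real n *\<^sub>R (\<phi>0 (x \<otimes> s Z n) - ?u)"
      using yU(1)
    proof eventually_elim
      case (elim n)
      have "?y n \<otimes> x = x \<otimes> s Z n" using xG sG[of n] by (simp add: m_assoc)
      then show ?case by (simp add: pF_eval[OF c0 c0 c0 elim x(1)] P.left_unit[OF uS(1)])
    qed
    ultimately have "(\<lambda>n. real n *\<^sub>R (\<phi>0 (x \<otimes> s Z n) - ?u)) \<longlonglongrightarrow> P.F' (p, ?u) (B Z, 0)"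
      by (rule Lim_transform_eventually)
    then show ?thesis using l1 by (rule LIMSEQ_unique)
  qed
  have "\<exists>L R. ((\<lambda>u. P.F' (u, p) (0, Z)) has_derivative L) (at p) \<and>
      ((\<lambda>w. P.F' (p, w) (Z, 0)) has_derivative R) (at p)" for Z
    by (rule P.slice_derivatives[of Z]) blast
  then obtain L R where LR: "\<And>Z. ((\<lambda>u. P.F' (u, p) (0, Z)) has_derivative L Z) (at p)"
      "\<And>Z. ((\<lambda>w. P.F' (p, w) (Z, 0)) has_derivative R Z) (at p)" by metis
  show ?thesis
  proof (intro exI[of _ "\<lambda>X Z. L Z X - R Z X"] allI impI)
    fix t X Z and B :: "nat \<Rightarrow> 'e \<Rightarrow> 'e"
    assume t: "tangent G U (\<lambda>x. \<phi> x) t X" and B: "\<forall>n. conj_derivative G U (\<lambda>x. \<phi> x) (t n) (B n)"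
    have tU: "\<forall>\<^sub>F n in sequentially. t n \<in> U" and tl: "(\<lambda>n. real n *\<^sub>R (\<phi>0 (t n) - p)) \<longlonglongrightarrow> X"
      using t unfolding tangent_def by blast+
    have "(\<lambda>n. (1 / real n) *\<^sub>R (real n *\<^sub>R \<phi> (t n))) \<longlonglongrightarrow> 0 *\<^sub>R X"
      by (intro tendsto_scaleR tl lim_1_over_n)
    moreover have "\<forall>\<^sub>F n in sequentially. (1 / real n) *\<^sub>R (real n *\<^sub>R \<phi> (t n)) = \<phi> (t n)"
      using eventually_gt_at_top[of 0] by eventually_elim simp
    ultimately have t0: "(\<lambda>n. \<phi> (t n)) \<longlonglongrightarrow> 0" using tendsto_cong by force
    define Y where "Y n = real n *\<^sub>R (B n Z - Z)" for n
    \<comment> \<open>\<open>Y\<close> is the sequence whose limit is sought, and \<open>W\<close>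
      applies a map close to the identity to it. \<open>W\<close> converges by \<open>rel\<close>;
      since eventually M |phi(t n)| < 1 / 2, also |Y n| <= 2 |W n|, so W - Y tends to 0 although no
      bound on Y is known beforehand.\<close>
    define W where "W n = P.F' (p, \<phi>0 (t n)) (Y n, 0)" for n
    have evd: "\<forall>\<^sub>F n in sequentially. norm (\<phi> (t n)) < d"
      using order_tendstoD(2)[OF tendsto_norm[OF t0], of d] d by simp
    have "(\<lambda>n. real n *\<^sub>R (P.F' (\<phi>0 (t n), p) (0, Z) - P.F' (p, p) (0, Z))
        - real n *\<^sub>R (P.F' (p, \<phi>0 (t n)) (Z, 0) - P.F' (p, p) (Z, 0))) \<longlonglongrightarrow> L Z X - R Z X"
      by (intro tendsto_diff scaled_difference_tendsto[OF LR(1) tl] scaled_difference_tendsto[OF LR(2) tl])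
    moreover have "\<forall>\<^sub>F n in sequentially. real n *\<^sub>R (P.F' (\<phi>0 (t n), p) (0, Z) - P.F' (p, p) (0, Z))
        - real n *\<^sub>R (P.F' (p, \<phi>0 (t n)) (Z, 0) - P.F' (p, p) (Z, 0)) = W n"
      using tU evd
    proof eventually_elim
      case (elim n)
      have nd: "norm (\<phi> (t n)) \<le> d" using elim by simp
      have lin: "linear (\<lambda>h. P.F' (p, \<phi>0 (t n)) (h, 0))"
        using has_derivative_linear[OF has_derivative_fst_slice[OF P.diff]] dS[OF nd] by blast
      have "W n = real n *\<^sub>R (P.F' (p, \<phi>0 (t n)) (B n Z, 0) - P.F' (p, \<phi>0 (t n)) (Z, 0))"
        unfolding W_def Y_def using linear_cmul[OF lin] linear_diff[OF lin] by simp
      also have "P.F' (p, \<phi>0 (t n)) (B n Z, 0) = P.F' (\<phi>0 (t n), p) (0, Z)"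
        by (rule rel[OF elim(1) nd]) (use B in blast)
      finally show ?case
        using P.F'_left_unit[OF P.S(2)] P.F'_right_unit[OF P.S(2)] by (simp flip: scaleR_diff_right)
    qed
    ultimately have Wl: "W \<longlonglongrightarrow> L Z X - R Z X"
      by (rule Lim_transform_eventually)
    have "(\<lambda>n. M * norm (\<phi> (t n))) \<longlonglongrightarrow> M * norm (0::'e)"
      by (intro tendsto_intros t0)
    then have Ml: "(\<lambda>n. M * norm (\<phi> (t n))) \<longlonglongrightarrow> 0" by simp
    have evM: "\<forall>\<^sub>F n in sequentially. M * norm (\<phi> (t n)) < 1 / 2"
      by (rule order_tendstoD(2)[OF Ml]) simp
    have "(\<lambda>n. W n - Y n) \<longlonglongrightarrow> 0"
    proof (rule Lim_null_comparison)
      show "\<forall>\<^sub>F n in sequentially. norm (W n - Y n) \<le> M * norm (\<phi> (t n)) * (2 * norm (W n))"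
        using evd evM
      proof eventually_elim
        case (elim n)
        have 1: "norm (W n - Y n) \<le> M * norm (\<phi> (t n)) * norm (Y n)"
          unfolding W_def using elim by (intro dM) simp
        have "M * norm (\<phi> (t n)) * norm (Y n) \<le> 1 / 2 * norm (Y n)"
          using elim by (intro mult_right_mono) auto
        then have "norm (Y n) \<le> 2 * norm (W n)"
          using 1 norm_triangle_ineq4[of "W n" "W n - Y n"] by simp
        then have "M * norm (\<phi> (t n)) * norm (Y n) \<le> M * norm (\<phi> (t n)) * (2 * norm (W n))"
          using d by (intro mult_left_mono) auto
        with 1 show ?case by linarith
      qed
      have "(\<lambda>n. M * norm (\<phi> (t n)) * (2 * norm (W n))) \<longlonglongrightarrow> 0 * (2 * norm (L Z X - R Z X))"
        by (intro tendsto_intros Ml Wl)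
      then show "(\<lambda>n. M * norm (\<phi> (t n)) * (2 * norm (W n))) \<longlonglongrightarrow> 0" by simp
    qed
    from tendsto_diff[OF Wl this] show "(\<lambda>n. real n *\<^sub>R (B n Z - Z)) \<longlonglongrightarrow> L Z X - R Z X"
      by (simp add: Y_def)
  qed
qed

lemma chart_group_exists:
  obtains r C where "chart_group G T U (\<lambda>x. \<phi> x) r C"
proof -
  interpret P: C2_product F "pS U \<phi>0 U \<phi>0 U" p by (rule product_chart)
  obtain r C where rC: "0 < r" "0 \<le> C" "cball p r \<times> cball p r \<subseteq> pS U \<phi>0 U \<phi>0 U"
    "\<And>u u' w. u \<in> cball p r \<Longrightarrow> u' \<in> cball p r \<Longrightarrow> w \<in> cball p r \<Longrightarrow>
       norm (F (u, w) - F (u', w) - (u - u')) \<le> C * norm (w - p) * norm (u - u')"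
    "\<And>u w w'. u \<in> cball p r \<Longrightarrow> w \<in> cball p r \<Longrightarrow> w' \<in> cball p r \<Longrightarrow>
       norm (F (u, w) - F (u, w') - (w - w')) \<le> C * norm (u - p) * norm (w - w')"
    by (rule P.estimates) (rule that)
  have cb: "\<phi>0 x \<in> cball p r" if "norm (\<phi> x) \<le> r" for x
    using that by (simp add: dist_norm norm_minus_commute)
  have "chart_group G T U (\<lambda>x. \<phi> x) r C"
  proof
    show "openin T U" by (rule chartD(1)[OF c0])
    have im: "(\<lambda>x. \<phi> x) ` U = (\<lambda>u. u - p) ` (\<phi>0 ` U)" by auto
    have "homeomorphic_map (top_of_set (\<phi>0 ` U)) (top_of_set ((\<lambda>u. u - p) ` (\<phi>0 ` U))) (\<lambda>u. u - p)"
      unfolding homeomorphic_map_maps homeomorphic_maps_def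
      by (intro exI[of _ "\<lambda>u. u + p"]) (auto intro!: continuous_intros)
    from homeomorphic_map_compose[OF chartD(3)[OF c0] this]
    show "homeomorphic_map (subtopology T U) (top_of_set ((\<lambda>x. \<phi> x) ` U)) (\<lambda>x. \<phi> x)"
      unfolding im by (simp add: o_def)
    show "cball 0 r \<subseteq> (\<lambda>x. \<phi> x) ` U"
    proof
      fix \<xi> :: 'e assume "\<xi> \<in> cball 0 r"
      then have "(\<xi> + p, p) \<in> pS U \<phi>0 U \<phi>0 U" using rC(1,3) by (auto simp: dist_norm)
      then obtain x where "x \<in> U" "\<xi> + p = \<phi>0 x" using pS_sub[OF c0 c0 c0] by blast
      then show "\<xi> \<in> (\<lambda>x. \<phi> x) ` U" by (intro image_eqI[of _ _ x]) (auto simp: algebra_simps)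
    qed
    fix x y assume x: "x \<in> U" "norm (\<phi> x) \<le> r" and y: "y \<in> U" "norm (\<phi> y) \<le> r"
    show "x \<otimes> y \<in> U"
      using pS_mem[OF c0 c0 c0 x(1) y(1)] rC(3) cb[OF x(2)] cb[OF y(2)] by blast
    fix x' assume x': "x' \<in> U" "norm (\<phi> x') \<le> r"
    show "norm (\<phi> (x \<otimes> y) - \<phi> (x' \<otimes> y) - (\<phi> x - \<phi> x')) \<le> C * norm (\<phi> y) * norm (\<phi> x - \<phi> x')"
      using rC(4)[OF cb[OF x(2)] cb[OF x'(2)] cb[OF y(2)]]
      by (simp add: pF_eval[OF c0 c0 c0] x y x')
    show "norm (\<phi> (x \<otimes> y) - \<phi> (x \<otimes> x') - (\<phi> y - \<phi> x')) \<le> C * norm (\<phi> x) * norm (\<phi> y - \<phi> x')"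
      using rC(5)[OF cb[OF x(2)] cb[OF y(2)] cb[OF x'(2)]]
      by (simp add: pF_eval[OF c0 c0 c0] x y x')
  qed (use rC one conj_derivative_exists bracket_exists in auto)
  then show ?thesis by (rule that)
qed

end

end

lemma lie_group_top_group:
  assumes "lie_group G T A"
  shows "top_group G T"
proof -
  interpret group G using assms by (simp add: lie_group_def)
  show ?thesis
  proof
    show "topspace T = carrier G" "Hausdorff_space T"
      using assms by (auto simp: lie_group_def)
    have T: "T = discrete_topology (carrier G) \<or>
      smooth_map (prod_topology T T) (prod_atlas A A) T A (\<lambda>(x, y). x \<otimes>\<^bsub>G\<^esub> y) \<and>
      smooth_map T A T A (\<lambda>x. inv\<^bsub>G\<^esub> x)"
      using assms unfolding lie_group_def by blast
    then show "continuous_map (prod_topology T T) T (\<lambda>(x, y). x \<otimes>\<^bsub>G\<^esub> y)"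
      by (auto simp: smooth_map_def simp flip: prod_topology_discrete_topology)
    show "continuous_map T T (\<lambda>x. inv\<^bsub>G\<^esub> x)"
      using T by (auto simp: smooth_map_def)
  qed
qed

lemma lie_group_chart:
  fixes A :: "('g set \<times> ('g \<Rightarrow> 'e::euclidean_space)) set"
  assumes "lie_group G T A" "T \<noteq> discrete_topology (carrier G)"
  obtains U \<phi> r C where "chart_group G T U (\<phi> :: 'g \<Rightarrow> 'e) r C"
proof -
  interpret top_group G T by (rule lie_group_top_group[OF assms(1)])
  interpret atlas_group G T A
    by unfold_locales (use assms in \<open>auto simp: lie_group_def\<close>)
  obtain U \<phi>0 where U: "(U, \<phi>0) \<in> A" "\<one>\<^bsub>G\<^esub> \<in> U" using chart_at[OF one_closed] by metis
  obtain r C where c: "chart_group G T U (\<lambda>x. \<phi>0 x - \<phi>0 \<one>\<^bsub>G\<^esub>) r C"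
    by (rule chart_group_exists[OF U])
  show ?thesis
    by (rule that[OF c])
qed

section \<open>The unitary representation on square-integrable functions\<close>

section \<open>The Hilbert space \<open>L\<^sup>2\<close>\<close>

lemma borel_measurable_cnj [measurable]:
  "f \<in> borel_measurable M \<Longrightarrow> (\<lambda>x. cnj (f x)) \<in> borel_measurable M"
  by (rule measurable_compose[OF _ borel_measurable_continuous_onI[OF continuous_on_cnj[OF continuous_on_id]]])

context prob_space
begin

lemma L2_measurable: "f \<in> L2 M \<Longrightarrow> f \<in> borel_measurable M"
  by (simp add: L2_def)

lemma L2_integrable: "f \<in> L2 M \<Longrightarrow> integrable M (\<lambda>x. (cmod (f x))\<^sup>2)"
  by (simp add: L2_def)

lemma L2I_bound:
  assumes f: "f \<in> borel_measurable M" and g: "integrable M g"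
    and le: "\<And>x. x \<in> space M \<Longrightarrow> (cmod (f x))\<^sup>2 \<le> g x"
  shows "f \<in> L2 M"
proof -
  have "integrable M (\<lambda>x. (cmod (f x))\<^sup>2)"
  proof (rule Bochner_Integration.integrable_bound[OF g])
    show "(\<lambda>x. (cmod (f x))\<^sup>2) \<in> borel_measurable M" using f by measurable
    show "AE x in M. norm ((cmod (f x))\<^sup>2) \<le> norm (g x)"
    proof (rule AE_I2)
      fix x assume "x \<in> space M"
      from le[OF this] show "norm ((cmod (f x))\<^sup>2) \<le> norm (g x)" by simp
    qed
  qed
  then show ?thesis using f by (simp add: L2_def)
qed

lemma L2_inner_integrable:
  assumes f: "f \<in> L2 M" and g: "g \<in> L2 M"
  shows "integrable M (\<lambda>x. f x * cnj (g x))"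
proof (rule Bochner_Integration.integrable_bound)
  show "integrable M (\<lambda>x. (cmod (f x))\<^sup>2 + (cmod (g x))\<^sup>2)"
    using f g by (intro Bochner_Integration.integrable_add L2_integrable)
  have [measurable]: "f \<in> borel_measurable M" "g \<in> borel_measurable M"
    using f g by (auto intro: L2_measurable)
  show "(\<lambda>x. f x * cnj (g x)) \<in> borel_measurable M" by measurable
  have "a * b \<le> a\<^sup>2 + b\<^sup>2" if "0 \<le> a" "0 \<le> b" for a b :: real
    using sum_squares_bound[of a b] mult_nonneg_nonneg[OF that] by linarith
  then show "AE x in M. norm (f x * cnj (g x)) \<le> norm ((cmod (f x))\<^sup>2 + (cmod (g x))\<^sup>2)"
    by (intro AE_I2) (simp add: norm_mult)
qed

lemma L2_add:
  assumes f: "f \<in> L2 M" and g: "g \<in> L2 M"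
  shows "f + g \<in> L2 M"
proof (rule L2I_bound)
  have [measurable]: "f \<in> borel_measurable M" "g \<in> borel_measurable M"
    using f g by (auto intro: L2_measurable)
  show "f + g \<in> borel_measurable M" unfolding plus_fun_def by measurable
  show "integrable M (\<lambda>x. 2 * (cmod (f x))\<^sup>2 + 2 * (cmod (g x))\<^sup>2)"
    using L2_integrable[OF f] L2_integrable[OF g] by simp
  fix x
  have "(cmod ((f + g) x))\<^sup>2 \<le> (cmod (f x) + cmod (g x))\<^sup>2"
    by (intro power_mono) (auto simp: norm_triangle_ineq)
  also have "\<dots> \<le> 2 * (cmod (f x))\<^sup>2 + 2 * (cmod (g x))\<^sup>2"
    using sum_squares_bound[of "cmod (f x)" "cmod (g x)"] by (simp add: power2_sum)
  finally show "(cmod ((f + g) x))\<^sup>2 \<le> 2 * (cmod (f x))\<^sup>2 + 2 * (cmod (g x))\<^sup>2" .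
qed

lemma L2_scale:
  assumes f: "f \<in> L2 M"
  shows "(\<lambda>x. c * f x) \<in> L2 M"
proof (rule L2I_bound)
  have [measurable]: "f \<in> borel_measurable M" using f by (rule L2_measurable)
  show "(\<lambda>x. c * f x) \<in> borel_measurable M" by measurable
  show "integrable M (\<lambda>x. (cmod c)\<^sup>2 * (cmod (f x))\<^sup>2)"
    using L2_integrable[OF f] by simp
qed (simp add: norm_mult power_mult_distrib)

lemma L2_semi_ip: "semi_ip (L2 M) (\<lambda>c f x. c * f x) (L2_inner M)"
proof
  show "0 \<in> L2 M" by (rule L2I_bound[of _ "\<lambda>_. 0"]) (auto simp: zero_fun_def)
  fix f g h :: "'a \<Rightarrow> complex" and c :: complex
  show "f + g \<in> L2 M" if "f \<in> L2 M" "g \<in> L2 M" using that by (rule L2_add)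
  show "(\<lambda>x. c * f x) \<in> L2 M" if "f \<in> L2 M" using that by (rule L2_scale)
  show "- f \<in> L2 M" if "f \<in> L2 M"
    using L2_scale[OF that, of "-1"] by (simp add: fun_Compl_def)
  show "L2_inner M (f + g) h = L2_inner M f h + L2_inner M g h" if "f \<in> L2 M" "g \<in> L2 M" "h \<in> L2 M"
    using L2_inner_integrable that by (simp add: L2_inner_def distrib_right)
  show "L2_inner M (\<lambda>x. c * f x) g = c * L2_inner M f g" if "f \<in> L2 M" "g \<in> L2 M"
    by (simp add: L2_inner_def mult.assoc)
  show "L2_inner M g f = cnj (L2_inner M f g)" if "f \<in> L2 M" "g \<in> L2 M"
  proof -
    have "cnj (L2_inner M f g) = (\<integral>x. cnj (f x * cnj (g x)) \<partial>M)"
      unfolding L2_inner_def by (rule Bochner_Integration.integral_cnj[symmetric])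
    then show ?thesis by (simp add: L2_inner_def mult.commute)
  qed
  show "0 \<le> Re (L2_inner M f f)" if "f \<in> L2 M"
  proof -
    have "L2_inner M f f = (\<integral>x. complex_of_real ((cmod (f x))\<^sup>2) \<partial>M)"
      by (simp only: L2_inner_def complex_norm_square)
    also have "\<dots> = complex_of_real (\<integral>x. (cmod (f x))\<^sup>2 \<partial>M)"
      by (rule integral_complex_of_real)
    finally show ?thesis by simp
  qed
qed

interpretation semi_ip "L2 M" "\<lambda>c f x. c * f x" "L2_inner M"
  by (rule L2_semi_ip)

lemma L2_nrm_sq: "f \<in> L2 M \<Longrightarrow> (nrm f)\<^sup>2 = (\<integral>x. (cmod (f x))\<^sup>2 \<partial>M)"
proof -
  assume f: "f \<in> L2 M"
  have "L2_inner M f f = (\<integral>x. complex_of_real ((cmod (f x))\<^sup>2) \<partial>M)"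
    by (simp only: L2_inner_def complex_norm_square)
  also have "\<dots> = complex_of_real (\<integral>x. (cmod (f x))\<^sup>2 \<partial>M)"
    by (rule integral_complex_of_real)
  finally show ?thesis using nrm_sq[OF f] by simp
qed

lemma L2_nn_integral: "f \<in> L2 M \<Longrightarrow> (\<integral>\<^sup>+x. ennreal ((cmod (f x))\<^sup>2) \<partial>M) = ennreal ((nrm f)\<^sup>2)"
  using nn_integral_eq_integral[OF L2_integrable] by (simp add: L2_nrm_sq)

text \<open>The nonnegative integral delivers membership in \<open>L2\<close> together with the
  bound, as Fatou's lemma and the domination estimate require.\<close>

lemma L2_nrm_leI:
  assumes f: "f \<in> borel_measurable M" and e: "0 \<le> e"
    and le: "(\<integral>\<^sup>+x. ennreal ((cmod (f x))\<^sup>2) \<partial>M) \<le> ennreal (e\<^sup>2)"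
  shows "f \<in> L2 M" "nrm f \<le> e"
proof -
  show fL: "f \<in> L2 M"
    unfolding L2_def using f le
    by (auto intro!: integrableI_bounded order.strict_trans1[OF _ ennreal_less_top])
  have "ennreal ((nrm f)\<^sup>2) \<le> ennreal (e\<^sup>2)" using le L2_nn_integral[OF fL] by simp
  then have "(nrm f)\<^sup>2 \<le> e\<^sup>2" by (simp add: ennreal_le_iff)
  then show "nrm f \<le> e" using e by (rule power2_le_imp_le)
qed

lemma L2_bounded:
  assumes f: "f \<in> borel_measurable M" and e: "0 \<le> e" and le: "AE x in M. cmod (f x) \<le> e"
  shows "f \<in> L2 M" "nrm f \<le> e"
proof -
  have "AE x in M. ennreal ((cmod (f x))\<^sup>2) \<le> ennreal (e\<^sup>2)"
    using le by eventually_elim (simp add: power_mono ennreal_leI)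
  then have "(\<integral>\<^sup>+x. ennreal ((cmod (f x))\<^sup>2) \<partial>M) \<le> (\<integral>\<^sup>+x. ennreal (e\<^sup>2) \<partial>M)"
    by (rule nn_integral_mono_AE)
  also have "\<dots> = ennreal (e\<^sup>2)" by (simp add: emeasure_space_1)
  finally show "f \<in> L2 M" "nrm f \<le> e" using L2_nrm_leI[OF f e] by blast+
qed

lemma L2_nrm_zero_iff: "f \<in> L2 M \<Longrightarrow> nrm f = 0 \<longleftrightarrow> (AE x in M. f x = 0)"
proof -
  assume f: "f \<in> L2 M"
  have "nrm f = 0 \<longleftrightarrow> (\<integral>x. (cmod (f x))\<^sup>2 \<partial>M) = 0" using L2_nrm_sq[OF f] by force
  also have "\<dots> \<longleftrightarrow> (AE x in M. (cmod (f x))\<^sup>2 = 0)"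
    using L2_integrable[OF f] by (intro integral_nonneg_eq_0_iff_AE) auto
  finally show ?thesis by simp
qed

text \<open>Cauchy-Schwarz against the constant 1, whose norm is at most 1 for a probability
  measure.\<close>

lemma L1_le_L2:
  assumes f: "f \<in> L2 M"
  shows "(\<integral>\<^sup>+x. ennreal (cmod (f x)) \<partial>M) \<le> ennreal (nrm f)"
proof -
  have [measurable]: "f \<in> borel_measurable M" using f by (rule L2_measurable)
  let ?g = "\<lambda>x. complex_of_real (cmod (f x))"
  have g: "?g \<in> L2 M"
    by (rule L2I_bound[OF _ L2_integrable[OF f]]) auto
  have o: "(\<lambda>_. 1) \<in> L2 M" by (rule L2_bounded(1)[of _ 1]) simp_all
  have no: "nrm (\<lambda>_. 1) \<le> 1" by (rule L2_bounded(2)) simp_all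
  have i: "integrable M (\<lambda>x. cmod (f x))"
    using L2_inner_integrable[OF g o] integrable_Re by fastforce
  have "L2_inner M ?g (\<lambda>_. 1) = complex_of_real (\<integral>x. cmod (f x) \<partial>M)"
    by (simp add: L2_inner_def)
  then have "(\<integral>x. cmod (f x) \<partial>M) \<le> nrm ?g * nrm (\<lambda>_. 1)"
    using cauchy_schwarz[OF g o] by (simp add: norm_of_real)
  also have "\<dots> \<le> nrm ?g" using mult_left_mono[OF no nrm_nonneg[OF g]] by simp
  also have "nrm ?g = nrm f"
  proof (rule power2_eq_imp_eq[OF _ nrm_nonneg[OF g] nrm_nonneg[OF f]])
    show "(nrm ?g)\<^sup>2 = (nrm f)\<^sup>2"
      unfolding L2_nrm_sq[OF g] L2_nrm_sq[OF f] by simp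
  qed
  finally show ?thesis
    using nn_integral_eq_integral[OF i] by (simp add: ennreal_leI)
qed

text \<open>Riesz-Fischer: along a subsequence the increments have norm at most 2^-j, hence are
  summable in L^1, which gives convergence almost everywhere; Fatou's lemma then gives convergence
  in norm.\<close>

lemma L2_complete:
  assumes X: "\<And>n. X n \<in> L2 M"
    and cauchy: "\<And>e. 0 < e \<Longrightarrow> \<exists>N. \<forall>m\<ge>N. \<forall>n\<ge>N. nrm (X m - X n) < e"
  shows "\<exists>x\<in>L2 M. (\<lambda>n. nrm (X n - x)) \<longlonglongrightarrow> 0"
proof -
  have [measurable]: "X n \<in> borel_measurable M" for n using X by (rule L2_measurable)
  have "\<exists>N. \<forall>m\<ge>N. \<forall>n\<ge>N. nrm (X m - X n) < (1/2) ^ j" for j :: nat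
    by (rule cauchy) simp
  then obtain N where N: "\<And>j m n. N j \<le> m \<Longrightarrow> N j \<le> n \<Longrightarrow> nrm (X m - X n) < (1/2) ^ j" by metis
  \<comment> \<open>The sum puts both k j and k (Suc j) beyond N j, and the summand j makes k
    unbounded.\<close>
  define k where "k j = (\<Sum>i\<le>j. N i) + j" for j
  have kN: "N j \<le> k j" for j
    unfolding k_def using member_le_sum[of j "{..j}" N] by simp
  have kj: "j \<le> k j" for j by (simp add: k_def)
  have kS: "N j \<le> k (Suc j)" for j
    using kN[of j] by (simp add: k_def)
  define g where "g j x = X (k (Suc j)) x - X (k j) x" for j x
  have gL: "g j \<in> L2 M" "nrm (g j) \<le> (1/2) ^ j" for j
  proof -
    have e: "g j = X (k (Suc j)) - X (k j)" by (simp add: g_def fun_eq_iff)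
    show "g j \<in> L2 M" unfolding e by (intro minus_H X)
    show "nrm (g j) \<le> (1/2) ^ j" unfolding e using N[OF kS kN] by (rule less_imp_le)
  qed
  have [measurable]: "g j \<in> borel_measurable M" for j using gL(1) by (rule L2_measurable)
  have "(\<integral>\<^sup>+x. (\<Sum>j. ennreal (cmod (g j x))) \<partial>M) = (\<Sum>j. \<integral>\<^sup>+x. ennreal (cmod (g j x)) \<partial>M)"
    by (rule nn_integral_suminf) measurable
  also have "\<dots> \<le> (\<Sum>j. ennreal ((1/2) ^ j))"
  proof (rule suminf_le)
    show "(\<integral>\<^sup>+x. ennreal (cmod (g j x)) \<partial>M) \<le> ennreal ((1/2) ^ j)" for j
      using L1_le_L2[OF gL(1)] ennreal_leI[OF gL(2)] by (rule order_trans)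
  qed auto
  also have "\<dots> = ennreal (\<Sum>j. (1/2) ^ j)"
    by (intro suminf_ennreal2) auto
  also have "\<dots> < \<infinity>" by simp
  finally have "AE x in M. (\<Sum>j. ennreal (cmod (g j x))) \<noteq> \<infinity>"
    by (intro nn_integral_PInf_AE) auto
  then have conv: "AE x in M. convergent (\<lambda>j. X (k j) x)"
  proof eventually_elim
    case (elim x)
    then have "summable (\<lambda>j. cmod (g j x))" by (intro summable_suminf_not_top) auto
    then have "summable (\<lambda>j. g j x)" by (rule summable_norm_cancel)
    then have "convergent (\<lambda>n. \<Sum>j<n. g j x)" by (simp add: summable_iff_convergent)
    moreover have "(\<Sum>j<n. g j x) = X (k n) x - X (k 0) x" for n
      unfolding g_def by (rule sum_lessThan_telescope)
    ultimately have "convergent (\<lambda>n. X (k n) x - X (k 0) x)" by simp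
    then show ?case by (rule convergent_diff_const_right_iff[THEN iffD1])
  qed
  define x where "x y = lim (\<lambda>j. X (k j) y)" for y
  have [measurable]: "x \<in> borel_measurable M"
    unfolding x_def by (rule borel_measurable_lim_metric) measurable
  have lim: "AE y in M. (\<lambda>j. X (k j) y) \<longlonglongrightarrow> x y"
    using conv by eventually_elim (simp add: x_def convergent_LIMSEQ_iff)
  have close: "X n - x \<in> L2 M \<and> nrm (X n - x) \<le> (1/2) ^ i" if n: "N i \<le> n" for n i
  proof -
    have "(\<integral>\<^sup>+y. ennreal ((cmod ((X n - x) y))\<^sup>2) \<partial>M)
        = (\<integral>\<^sup>+y. liminf (\<lambda>j. ennreal ((cmod (X n y - X (k j) y))\<^sup>2)) \<partial>M)"
    proof (rule nn_integral_cong_AE)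
      show "AE y in M. ennreal ((cmod ((X n - x) y))\<^sup>2) = liminf (\<lambda>j. ennreal ((cmod (X n y - X (k j) y))\<^sup>2))"
        using lim
      proof eventually_elim
        case (elim y)
        have "(\<lambda>j. ennreal ((cmod (X n y - X (k j) y))\<^sup>2)) \<longlonglongrightarrow> ennreal ((cmod (X n y - x y))\<^sup>2)"
          by (intro tendsto_ennrealI tendsto_intros elim)
        from lim_imp_Liminf[OF _ this] show ?case by simp
      qed
    qed
    also have "\<dots> \<le> liminf (\<lambda>j. \<integral>\<^sup>+y. ennreal ((cmod (X n y - X (k j) y))\<^sup>2) \<partial>M)"
      by (rule nn_integral_liminf) measurable
    also have "\<dots> \<le> liminf (\<lambda>j. ennreal (((1/2) ^ i)\<^sup>2))"
    proof (rule Liminf_mono)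
      show "\<forall>\<^sub>F j in sequentially. (\<integral>\<^sup>+y. ennreal ((cmod (X n y - X (k j) y))\<^sup>2) \<partial>M) \<le> ennreal (((1/2) ^ i)\<^sup>2)"
        using eventually_ge_at_top[of "N i"]
      proof eventually_elim
        case (elim j)
        have d: "X n - X (k j) \<in> L2 M" by (intro minus_H X)
        have "nrm (X n - X (k j)) \<le> (1/2) ^ i"
          using N[OF n, of "k j"] elim kj[of j] by simp
        then have "(nrm (X n - X (k j)))\<^sup>2 \<le> ((1/2) ^ i)\<^sup>2"
          using nrm_nonneg[OF d] by (intro power_mono)
        then show ?case
          using L2_nn_integral[OF d] by (simp add: ennreal_leI)
      qed
    qed
    also have "\<dots> = ennreal (((1/2) ^ i)\<^sup>2)" by (simp add: Liminf_const)
    finally have le: "(\<integral>\<^sup>+y. ennreal ((cmod ((X n - x) y))\<^sup>2) \<partial>M) \<le> ennreal (((1/2) ^ i)\<^sup>2)" .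
    have m: "X n - x \<in> borel_measurable M" unfolding fun_diff_def by measurable
    have "0 \<le> (1/2 :: real) ^ i" by simp
    from L2_nrm_leI[OF m this le] show ?thesis by (rule conjI)
  qed
  have "x = X (N 0) - (X (N 0) - x)" by simp
  then have xL: "x \<in> L2 M" using minus_H[OF X conjunct1[OF close[OF order_refl]]] by metis
  have "(\<lambda>n. nrm (X n - x)) \<longlonglongrightarrow> 0"
  proof (rule LIMSEQ_I)
    fix e :: real assume "0 < e"
    then obtain i where i: "(1/2) ^ i < e" using real_arch_pow_inv[of e "1/2"] by auto
    have "norm (nrm (X n - x) - 0) < e" if "N i \<le> n" for n
      using close[OF that] i nrm_nonneg[of "X n - x"] by simp
    then show "\<exists>no. \<forall>n\<ge>no. norm (nrm (X n - x) - 0) < e" by blast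
  qed
  then show ?thesis using xL by blast
qed

lemma L2_semi_hilbert: "semi_hilbert (L2 M) (\<lambda>c f x. c * f x) (L2_inner M)"
  by unfold_locales (rule L2_complete)

end

section \<open>The unitary representation on a compact homogeneous space\<close>

locale nil_space = top_group G T + prob_space \<mu>
  for G (structure) and T :: "'a topology" and \<mu> :: "'a set measure" +
  fixes \<Gamma> :: "'a set"
  assumes T_second_countable: "second_countable T" and Gamma: "subgroup \<Gamma> G"
    and discrete: "subtopology T \<Gamma> = discrete_topology \<Gamma>"
    and compact: "compact_space (lcoset_topology G T \<Gamma>)"
    and sets_mu: "sets \<mu> = sets (borel_of (lcoset_topology G T \<Gamma>))"
    and invariant: "g \<in> carrier G \<Longrightarrow> distr \<mu> \<mu> (\<lambda>x. g <# x) = \<mu>"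
begin

abbreviation "Y \<equiv> lcoset_topology G T \<Gamma>"
abbreviation "X \<equiv> lcosets \<Gamma>"
abbreviation "q g \<equiv> g <# \<Gamma>"

lemma Gamma_G: "\<gamma> \<in> \<Gamma> \<Longrightarrow> \<gamma> \<in> carrier G"
  using subgroup.subset[OF Gamma] by blast

lemma topY: "topspace Y = X"
  by (rule topspace_lcoset_topology[OF topspace])

lemma space_mu: "space \<mu> = X"
  using sets_eq_imp_space_eq[OF sets_mu] by (simp add: borel_of_def space_measure_of_conv topY)

lemma q_X: "g \<in> carrier G \<Longrightarrow> q g \<in> X"
  by (auto simp: LCOSETS_def)

lemma X_cases: "x \<in> X \<Longrightarrow> (\<And>g. g \<in> carrier G \<Longrightarrow> x = q g \<Longrightarrow> P) \<Longrightarrow> P"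
  by (auto simp: LCOSETS_def)

lemma act_q: "g \<in> carrier G \<Longrightarrow> h \<in> carrier G \<Longrightarrow> g <# q h = q (g \<otimes> h)"
  using lcos_m_assoc subgroup.subset[OF Gamma] by blast

lemma act_X: "g \<in> carrier G \<Longrightarrow> x \<in> X \<Longrightarrow> g <# x \<in> X"
  by (erule X_cases) (simp add: act_q q_X)

lemma act_act: "g \<in> carrier G \<Longrightarrow> h \<in> carrier G \<Longrightarrow> x \<in> X \<Longrightarrow> g <# (h <# x) = (g \<otimes> h) <# x"
  by (erule X_cases) (simp add: act_q m_assoc)

lemma act_one: "x \<in> X \<Longrightarrow> \<one> <# x = x"
  by (erule X_cases) (simp add: act_q)

lemma act_inv_cancel:
  "g \<in> carrier G \<Longrightarrow> x \<in> X \<Longrightarrow> g <# (inv g <# x) = x"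
  "g \<in> carrier G \<Longrightarrow> x \<in> X \<Longrightarrow> inv g <# (g <# x) = x"
  by (simp_all add: act_act act_one)

lemma q_eq_iff:
  assumes "g \<in> carrier G" "h \<in> carrier G"
  shows "q g = q h \<longleftrightarrow> inv h \<otimes> g \<in> \<Gamma>"
proof
  assume "q g = q h"
  then have "g \<in> q h" using lcos_self[OF assms(1) Gamma] by simp
  then obtain \<gamma> where "\<gamma> \<in> \<Gamma>" "g = h \<otimes> \<gamma>" by (auto simp: l_coset_def)
  then show "inv h \<otimes> g \<in> \<Gamma>" using assms Gamma_G by (simp flip: m_assoc)
next
  assume a: "inv h \<otimes> g \<in> \<Gamma>"
  have "q g = q (h \<otimes> (inv h \<otimes> g))" using assms by (simp flip: m_assoc)
  also have "\<dots> = h <# q (inv h \<otimes> g)" using assms by (simp add: act_q)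
  also have "q (inv h \<otimes> g) = \<Gamma>"
    using a Gamma_G subgroup.lcos_module_rev[OF Gamma] coset_join3 Gamma by blast
  finally show "q g = q h" .
qed

lemma q_continuous: "continuous_map T Y q"
  using quotient_imp_continuous_map[OF quotient_map_lcoset_topology[OF topspace]] .

text \<open>The saturation of V is the union of its right translates by elements of \<Gamma>, each
  of which is open.\<close>

lemma q_open:
  assumes V: "openin T V"
  shows "openin Y (q ` V)"
proof -
  have VG: "V \<subseteq> carrier G" using openin_subset[OF V] topspace by simp
  have "{g \<in> topspace T. q g \<in> q ` V} = (\<Union>\<gamma>\<in>\<Gamma>. {g \<in> topspace T. g \<otimes> inv \<gamma> \<in> V})"
  proof safe
    fix g v assume g: "g \<in> topspace T" and v: "v \<in> V" and e: "q g = q v"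
    have gv: "g \<in> carrier G" "v \<in> carrier G" using g v VG topspace by auto
    have "inv v \<otimes> g \<in> \<Gamma>" using e q_eq_iff[OF gv] by simp
    moreover have "g \<otimes> inv (inv v \<otimes> g) = v" using gv by (simp add: inv_mult_group flip: m_assoc)
    ultimately show "g \<in> (\<Union>\<gamma>\<in>\<Gamma>. {g \<in> topspace T. g \<otimes> inv \<gamma> \<in> V})"
      using g v by (intro UN_I[of "inv v \<otimes> g"]) simp_all
  next
    fix g \<gamma> assume g: "g \<in> topspace T" and \<gamma>: "\<gamma> \<in> \<Gamma>" and v: "g \<otimes> inv \<gamma> \<in> V"
    have gG: "g \<in> carrier G" "\<gamma> \<in> carrier G" using g \<gamma> topspace Gamma_G by auto
    have "inv (g \<otimes> inv \<gamma>) \<otimes> g = \<gamma>" using gG by (simp add: inv_mult_group m_assoc)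
    then have "q g = q (g \<otimes> inv \<gamma>)" using q_eq_iff[of g "g \<otimes> inv \<gamma>"] gG \<gamma> by simp
    then show "q g \<in> q ` V" using v by blast
  qed
  moreover have "openin T {g \<in> topspace T. g \<otimes> inv \<gamma> \<in> V}" if "\<gamma> \<in> \<Gamma>" for \<gamma>
    by (rule openin_continuous_map_preimage[OF continuous_mult[OF continuous_map_id[unfolded id_def] continuous_const] V])
      (use that Gamma_G in auto)
  ultimately have "openin T {g \<in> topspace T. q g \<in> q ` V}" by auto
  moreover have "q ` V \<subseteq> X" using VG q_X by blast
  ultimately show ?thesis by (simp add: openin_lcoset_topology)
qed

text \<open>Continuity is checked on the group, where the action is the product; an open rectangle
  found there has an open image because \<open>q\<close> is open.\<close>

lemma act_continuous: "continuous_map (prod_topology T Y) Y (\<lambda>(g, x). g <# x)"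
  unfolding continuous_map_def
proof (intro conjI allI impI)
  show "(\<lambda>(g, x). g <# x) \<in> topspace (prod_topology T Y) \<rightarrow> topspace Y"
    by (auto simp: topY topspace act_X)
  fix W assume W: "openin Y W"
  let ?S = "{z \<in> topspace (prod_topology T Y). (\<lambda>(g, x). g <# x) z \<in> W}"
  have "\<exists>Z. openin (prod_topology T Y) Z \<and> z \<in> Z \<and> Z \<subseteq> ?S" if z: "z \<in> ?S" for z
  proof -
    obtain g x where gx: "z = (g, x)" "g \<in> carrier G" "x \<in> X" "g <# x \<in> W"
      using z by (auto simp: topY topspace)
    obtain h where h: "h \<in> carrier G" "x = q h" using gx(3) by (rule X_cases)
    have cont: "continuous_map (prod_topology T T) Y (\<lambda>z. q ((\<lambda>(x, y). x \<otimes> y) z))"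
      using continuous_map_compose[OF mult_cont q_continuous] by (simp add: o_def)
    have o: "openin (prod_topology T T) {z \<in> topspace (prod_topology T T). q ((\<lambda>(x, y). x \<otimes> y) z) \<in> W}"
      by (rule openin_continuous_map_preimage[OF cont W])
    have m: "(g, h) \<in> {z \<in> topspace (prod_topology T T). q ((\<lambda>(x, y). x \<otimes> y) z) \<in> W}"
      using gx h by (simp add: topspace act_q)
    obtain A B where AB: "openin T A" "openin T B" "g \<in> A" "h \<in> B"
      "A \<times> B \<subseteq> {z \<in> topspace (prod_topology T T). q ((\<lambda>(x, y). x \<otimes> y) z) \<in> W}"
      using o[unfolded openin_prod_topology_alt, rule_format, OF m] by (elim exE conjE) (rule that)
    have sub: "A \<subseteq> carrier G" "B \<subseteq> carrier G"
      using openin_subset[OF AB(1)] openin_subset[OF AB(2)] topspace by auto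
    show ?thesis
    proof (intro exI[of _ "A \<times> q ` B"] conjI)
      show "openin (prod_topology T Y) (A \<times> q ` B)"
        using AB q_open by (simp add: openin_prod_Times_iff)
      show "z \<in> A \<times> q ` B" using gx h AB by simp
      show "A \<times> q ` B \<subseteq> ?S"
      proof
        fix w assume "w \<in> A \<times> q ` B"
        then obtain a b where ab: "w = (a, q b)" "a \<in> A" "b \<in> B" by auto
        then have "q (a \<otimes> b) \<in> W" using AB(5) by auto
        then show "w \<in> ?S"
          using ab sub by (auto simp: topspace topY act_q q_X subset_iff)
      qed
    qed
  qed
  then show "openin (prod_topology T Y) ?S"
    by (subst openin_subopen) blast
qed

lemma act_continuous1:
  assumes "g \<in> carrier G"
  shows "continuous_map Y Y (\<lambda>x. g <# x)"
proof -
  have "continuous_map Y (prod_topology T Y) (\<lambda>x. (g, x))"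
    using assms by (simp add: continuous_map_pairwise o_def topspace continuous_map_id[unfolded id_def])
  from continuous_map_compose[OF this act_continuous] show ?thesis by (simp add: o_def)
qed

lemma act_continuous2:
  assumes "x \<in> X"
  shows "continuous_map T Y (\<lambda>g. g <# x)"
proof -
  have "continuous_map T (prod_topology T Y) (\<lambda>g. (g, x))"
    using assms by (simp add: continuous_map_pairwise o_def topY continuous_map_id[unfolded id_def])
  from continuous_map_compose[OF this act_continuous] show ?thesis by (simp add: o_def)
qed

lemma Y_second_countable: "second_countable Y"
proof (rule second_countable_open_map_image[OF q_continuous _ _ T_second_countable])
  show "open_map T Y q" unfolding open_map_def using q_open by blast
  show "q ` topspace T = topspace Y" by (auto simp: topspace topY LCOSETS_def)
qed

subsection \<open>Measurability\<close>

lemma sets_mu_sigma: "sets \<mu> = sigma_sets X {V. openin Y V}"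
  unfolding sets_mu borel_of_def topY
  by (rule sets_measure_of) (use openin_subset topY in blast)

lemma open_sets: "openin Y V \<Longrightarrow> V \<in> sets \<mu>"
  unfolding sets_mu_sigma by (rule sigma_sets.Basic) simp

lemma measurable_muI:
  assumes "f \<in> space M \<rightarrow> X" "\<And>V. openin Y V \<Longrightarrow> f -` V \<inter> space M \<in> sets M"
  shows "f \<in> measurable M \<mu>"
proof (rule measurable_sigma_sets[OF sets_mu_sigma])
  show "{V. openin Y V} \<subseteq> Pow X" using openin_subset[of Y] unfolding topY by blast
qed (use assms in auto)

lemma act_measurable [measurable]: "g \<in> carrier G \<Longrightarrow> (\<lambda>x. g <# x) \<in> measurable \<mu> \<mu>"
proof (rule measurable_muI)
  assume g: "g \<in> carrier G"
  show "(\<lambda>x. g <# x) \<in> space \<mu> \<rightarrow> X" using g act_X space_mu by auto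
  fix V assume V: "openin Y V"
  have "(\<lambda>x. g <# x) -` V \<inter> space \<mu> = {x \<in> topspace Y. g <# x \<in> V}"
    using space_mu topY by auto
  then show "(\<lambda>x. g <# x) -` V \<inter> space \<mu> \<in> sets \<mu>"
    using open_sets[OF openin_continuous_map_preimage[OF act_continuous1[OF g] V]] by simp
qed

lemma integral_act:
  fixes f :: "'a set \<Rightarrow> 'c::{banach, second_countable_topology}"
  assumes g: "g \<in> carrier G" and f: "f \<in> borel_measurable \<mu>"
  shows "(\<integral>x. f (g <# x) \<partial>\<mu>) = (\<integral>x. f x \<partial>\<mu>)"
  using integral_distr[OF act_measurable[OF g] f] invariant[OF g] by simp

lemma nn_integral_act:
  assumes g: "g \<in> carrier G" and f: "f \<in> borel_measurable \<mu>"
  shows "(\<integral>\<^sup>+x. f (g <# x) \<partial>\<mu>) = (\<integral>\<^sup>+x. f x \<partial>\<mu>)"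
  using nn_integral_distr[OF act_measurable[OF g], of f] f invariant[OF g] by simp

lemma emeasure_act:
  assumes g: "g \<in> carrier G" and A: "A \<in> sets \<mu>"
  shows "emeasure \<mu> {x \<in> X. g <# x \<in> A} = emeasure \<mu> A"
proof -
  have "emeasure (distr \<mu> \<mu> (\<lambda>x. g <# x)) A = emeasure \<mu> ((\<lambda>x. g <# x) -` A \<inter> space \<mu>)"
    by (rule emeasure_distr[OF act_measurable[OF g] A])
  moreover have "(\<lambda>x. g <# x) -` A \<inter> space \<mu> = {x \<in> X. g <# x \<in> A}"
    using space_mu by auto
  ultimately show ?thesis using invariant[OF g] by simp
qed

lemma act_set [measurable]:
  assumes g: "g \<in> carrier G" and A: "A \<in> sets \<mu>"
  shows "{x \<in> X. g <# x \<in> A} \<in> sets \<mu>"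
proof -
  have "(\<lambda>x. g <# x) -` A \<inter> space \<mu> \<in> sets \<mu>"
    by (rule measurable_sets[OF act_measurable[OF g] A])
  moreover have "(\<lambda>x. g <# x) -` A \<inter> space \<mu> = {x \<in> X. g <# x \<in> A}"
    using space_mu by auto
  ultimately show ?thesis by simp
qed

subsection \<open>The representation\<close>

sublocale H: semi_hilbert "L2 \<mu>" "\<lambda>c f x. c * f x" "L2_inner \<mu>"
  by (rule L2_semi_hilbert)

text \<open>The value 0 off the space of cosets makes \<open>U_mult\<close> an identity of
  functions, whereas \<open>U \<one>\<close> is the identity only almost everywhere.\<close>

definition U :: "'a \<Rightarrow> ('a set \<Rightarrow> complex) \<Rightarrow> 'a set \<Rightarrow> complex" where
  "U g f = (\<lambda>x. if x \<in> X then f (inv g <# x) else 0)"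

lemma U_measurable: "g \<in> carrier G \<Longrightarrow> f \<in> borel_measurable \<mu> \<Longrightarrow> U g f \<in> borel_measurable \<mu>"
proof -
  assume g: "g \<in> carrier G" and f: "f \<in> borel_measurable \<mu>"
  have "(\<lambda>x. f (inv g <# x)) \<in> borel_measurable \<mu>"
    by (rule measurable_compose[OF act_measurable f]) (simp add: g)
  then show ?thesis
    by (rule measurable_cong[THEN iffD2, rotated]) (simp add: U_def space_mu)
qed

lemma U_inner:
  assumes g: "g \<in> carrier G" and f: "f \<in> borel_measurable \<mu>" and h: "h \<in> borel_measurable \<mu>"
  shows "L2_inner \<mu> (U g f) (U g h) = L2_inner \<mu> f h"
proof -
  have [measurable]: "f \<in> borel_measurable \<mu>" "h \<in> borel_measurable \<mu>" by fact+
  have "L2_inner \<mu> (U g f) (U g h) = (\<integral>x. (\<lambda>x. f x * cnj (h x)) (inv g <# x) \<partial>\<mu>)"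
    unfolding L2_inner_def by (rule Bochner_Integration.integral_cong) (auto simp: U_def space_mu)
  also have "\<dots> = (\<integral>x. f x * cnj (h x) \<partial>\<mu>)"
    by (rule integral_act) (use g in auto)
  finally show ?thesis by (simp add: L2_inner_def)
qed

lemma U_L2:
  assumes g: "g \<in> carrier G" and f: "f \<in> L2 \<mu>"
  shows "U g f \<in> L2 \<mu>"
proof -
  have [measurable]: "f \<in> borel_measurable \<mu>" by (rule L2_measurable[OF f])
  have "(\<integral>\<^sup>+x. ennreal ((cmod (U g f x))\<^sup>2) \<partial>\<mu>) = (\<integral>\<^sup>+x. (\<lambda>x. ennreal ((cmod (f x))\<^sup>2)) (inv g <# x) \<partial>\<mu>)"
    by (rule nn_integral_cong) (auto simp: U_def space_mu)
  also have "\<dots> = (\<integral>\<^sup>+x. ennreal ((cmod (f x))\<^sup>2) \<partial>\<mu>)"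
    by (rule nn_integral_act) (use g in auto)
  also have "\<dots> = ennreal ((H.nrm f)\<^sup>2)" by (rule L2_nn_integral[OF f])
  finally show ?thesis
    using L2_nrm_leI(1)[OF U_measurable[OF g L2_measurable[OF f]] H.nrm_nonneg[OF f]] by simp
qed

lemma U_nrm: "g \<in> carrier G \<Longrightarrow> f \<in> L2 \<mu> \<Longrightarrow> H.nrm (U g f) = H.nrm f"
  using U_inner[of g f f] L2_measurable by (simp add: H.nrm_def)

lemma U_mult:
  assumes g: "g \<in> carrier G" and h: "h \<in> carrier G"
  shows "U (g \<otimes> h) f = U g (U h f)"
proof
  fix x
  show "U (g \<otimes> h) f x = U g (U h f) x"
    using g h by (auto simp: U_def act_X act_act inv_mult_group)
qed

lemma U_one_nrm: "f \<in> L2 \<mu> \<Longrightarrow> H.nrm (U \<one> f - f) = 0"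
proof -
  assume f: "f \<in> L2 \<mu>"
  have "U \<one> f - f \<in> L2 \<mu>" by (intro H.minus_H U_L2 f) simp
  then show ?thesis
    using L2_nrm_zero_iff by (auto intro!: AE_I2 simp: U_def act_one space_mu)
qed

lemma U_diff: "U g f - U g h = U g (f - h)"
  by (auto simp: U_def fun_eq_iff)

lemma U_adjoint:
  assumes g: "g \<in> carrier G" and f: "f \<in> L2 \<mu>" and h: "h \<in> L2 \<mu>"
  shows "L2_inner \<mu> (U g f) h = L2_inner \<mu> f (U (inv g) h)"
proof -
  have "L2_inner \<mu> f (U (inv g) h) = L2_inner \<mu> (U g f) (U g (U (inv g) h))"
    using g f h by (intro U_inner[symmetric] L2_measurable U_L2) auto
  also have "U g (U (inv g) h) = U \<one> h" using g by (simp flip: U_mult)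
  also have "L2_inner \<mu> (U g f) (U \<one> h) = L2_inner \<mu> (U g f) h"
  proof -
    have "L2_inner \<mu> (U g f) (U \<one> h - h) = 0"
      by (rule H.ip_eq_0_if_nrm_0(2)) (use f g h U_one_nrm[OF h] in \<open>auto intro!: H.minus_H U_L2\<close>)
    then show ?thesis using H.ip_diff2[of "U \<one> h" h "U g f"] U_L2 f g h by simp
  qed
  finally show ?thesis ..
qed

lemma U_nrm_translate:
  assumes g: "g \<in> carrier G" and h: "h \<in> carrier G" and f: "f \<in> L2 \<mu>"
  shows "H.nrm (U g f - U h f) = H.nrm (U (inv h \<otimes> g) f - f)"
proof -
  have "U g f = U h (U (inv h \<otimes> g) f)" using g h by (simp flip: U_mult m_assoc)
  then have "U g f - U h f = U h (U (inv h \<otimes> g) f - f)" by (simp only: U_diff)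
  then show ?thesis using g h f by (simp add: U_nrm H.minus_H U_L2)
qed

end

section \<open>Neighbourhoods of the identity\<close>

context top_group
begin

lemma right_translate_open:
  assumes V: "openin T V" and h: "h \<in> carrier G"
  shows "openin T ((\<lambda>v. v \<otimes> h) ` V)"
proof -
  have VG: "V \<subseteq> carrier G" using openin_subset[OF V] topspace by simp
  have "openin T {g \<in> topspace T. g \<otimes> inv h \<in> V}"
    by (rule openin_continuous_map_preimage[OF continuous_mult[OF continuous_map_id[unfolded id_def] continuous_const] V])
      (use h in simp)
  moreover have "{g \<in> topspace T. g \<otimes> inv h \<in> V} = (\<lambda>v. v \<otimes> h) ` V"
  proof safe
    fix g assume "g \<in> topspace T" "g \<otimes> inv h \<in> V"
    then show "g \<in> (\<lambda>v. v \<otimes> h) ` V"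
      using h topspace by (intro image_eqI[of _ _ "g \<otimes> inv h"]) (auto simp: m_assoc)
  next
    fix v assume "v \<in> V"
    then show "v \<otimes> h \<in> topspace T" "v \<otimes> h \<otimes> inv h \<in> V"
      using h VG topspace by (auto simp: m_assoc subset_iff)
  qed
  ultimately show ?thesis by simp
qed

lemma symmetric_neighbourhood:
  assumes V: "openin T V" "\<one> \<in> V"
  obtains W where "openin T W" "\<one> \<in> W" "\<And>w. w \<in> W \<Longrightarrow> inv w \<in> W" "\<And>w w'. w \<in> W \<Longrightarrow> w' \<in> W \<Longrightarrow> w \<otimes> w' \<in> V"
    "W \<subseteq> V"
proof -
  have o: "openin (prod_topology T T) {z \<in> topspace (prod_topology T T). (\<lambda>(x, y). x \<otimes> y) z \<in> V}"
    by (rule openin_continuous_map_preimage[OF mult_cont V(1)])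
  have m: "(\<one>, \<one>) \<in> {z \<in> topspace (prod_topology T T). (\<lambda>(x, y). x \<otimes> y) z \<in> V}"
    using V(2) by (simp add: topspace)
  obtain A B where AB: "openin T A" "openin T B" "\<one> \<in> A" "\<one> \<in> B"
    "A \<times> B \<subseteq> {z \<in> topspace (prod_topology T T). (\<lambda>(x, y). x \<otimes> y) z \<in> V}"
    using o[unfolded openin_prod_topology_alt, rule_format, OF m] by (elim exE conjE) (rule that)
  define W0 where "W0 = A \<inter> B"
  define W where "W = W0 \<inter> {g \<in> topspace T. inv g \<in> W0}"
  have W0: "openin T W0" "\<one> \<in> W0" using AB by (auto simp: W0_def)
  have "openin T {g \<in> topspace T. inv g \<in> W0}"
    by (rule openin_continuous_map_preimage[OF inv_cont W0(1)])
  then have W: "openin T W" using W0 by (simp add: W_def openin_Int)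
  have WG: "W \<subseteq> carrier G" using openin_subset[OF W] topspace by simp
  have mult: "w \<otimes> w' \<in> V" if "w \<in> W" "w' \<in> W" for w w'
    using that AB(5) by (auto simp: W_def W0_def)
  show ?thesis
  proof (rule that[OF W])
    show 1: "\<one> \<in> W" using W0 by (simp add: W_def topspace)
    show "inv w \<in> W" if "w \<in> W" for w using that WG by (auto simp: W_def topspace)
    show "w \<otimes> w' \<in> V" if "w \<in> W" "w' \<in> W" for w w' using mult that .
    show "W \<subseteq> V" using mult[OF _ 1] WG by force
  qed
qed

end

context nil_space
begin

section \<open>Strong continuity\<close>

text \<open>The symmetric difference of A and its translate by inv g.\<close>

definition shift_diff :: "'a \<Rightarrow> 'a set set \<Rightarrow> 'a set set" where
  "shift_diff g A = {x \<in> X. (g <# x \<in> A) \<noteq> (x \<in> A)}"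

lemma sets_X: "A \<in> sets \<mu> \<Longrightarrow> A \<subseteq> X"
  using sets.sets_into_space[of A \<mu>] space_mu by simp

lemma shift_diff_sets [measurable]: "g \<in> carrier G \<Longrightarrow> A \<in> sets \<mu> \<Longrightarrow> shift_diff g A \<in> sets \<mu>"
proof -
  assume g: "g \<in> carrier G" and A: "A \<in> sets \<mu>"
  have "shift_diff g A = ({x \<in> X. g <# x \<in> A} - A) \<union> (A - {x \<in> X. g <# x \<in> A})"
    using sets_X[OF A] by (auto simp: shift_diff_def)
  then show ?thesis using act_set[OF g A] A by simp
qed

definition shift_continuous :: "'a set set \<Rightarrow> bool" where
  "shift_continuous A \<longleftrightarrow> (\<forall>g. (\<forall>n. g n \<in> carrier G) \<longrightarrow> limitin T g \<one> sequentially \<longrightarrow>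
     (\<lambda>n. measure \<mu> (shift_diff (g n) A)) \<longlonglongrightarrow> 0)"

lemma measure_act:
  "g \<in> carrier G \<Longrightarrow> A \<in> sets \<mu> \<Longrightarrow> measure \<mu> {x \<in> X. g <# x \<in> A} = measure \<mu> A"
  using emeasure_act by (simp add: measure_def)

text \<open>For x in the open set A eventually g n x lies in A, so the part of A that leaves A has
  measure tending to 0 by dominated convergence. The part outside that enters A has the same measure
  by invariance.\<close>

lemma shift_continuous_open:
  assumes A: "openin Y A"
  shows "shift_continuous A"
  unfolding shift_continuous_def
proof (intro allI impI)
  fix g :: "nat \<Rightarrow> 'a"
  assume g: "\<forall>n. g n \<in> carrier G" and lim: "limitin T g \<one> sequentially"
  note Am[measurable] = open_sets[OF A]
  define P where "P n = {x \<in> X. g n <# x \<in> A}" for n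
  have Pm [measurable]: "P n \<in> sets \<mu>" for n unfolding P_def using g by (intro act_set Am) auto
  have "(\<lambda>n. \<integral>x. indicat_real (A - P n) x \<partial>\<mu>) \<longlonglongrightarrow> (\<integral>x. 0 \<partial>\<mu>)"
  proof (rule integral_dominated_convergence[where w = "\<lambda>_. 1"])
    show "AE x in \<mu>. (\<lambda>n. indicat_real (A - P n) x) \<longlonglongrightarrow> 0"
    proof (rule AE_I2)
      fix x assume "x \<in> space \<mu>"
      then have x: "x \<in> X" by (simp add: space_mu)
      have "limitin Y (\<lambda>n. g n <# x) x sequentially"
        using continuous_map_limit[OF act_continuous2[OF x] lim] act_one[OF x] by (simp add: o_def)
      then have "x \<in> A \<Longrightarrow> \<forall>\<^sub>F n in sequentially. g n <# x \<in> A" using A by (simp add: limitin_def)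
      then have "\<forall>\<^sub>F n in sequentially. indicat_real (A - P n) x = 0"
      proof (cases "x \<in> A")
        case True
        assume "x \<in> A \<Longrightarrow> \<forall>\<^sub>F n in sequentially. g n <# x \<in> A"
        from this[OF True] show ?thesis by eventually_elim (simp add: P_def x)
      qed simp
      then show "(\<lambda>n. indicat_real (A - P n) x) \<longlonglongrightarrow> 0" by (rule tendsto_eventually)
    qed
    show "AE x in \<mu>. norm (indicat_real (A - P n) x) \<le> 1" for n by (simp add: indicator_def)
  qed simp_all
  then have out: "(\<lambda>n. measure \<mu> (A - P n)) \<longlonglongrightarrow> 0"
    by (simp add: sets.Int_space_eq2)
  have "measure \<mu> (shift_diff (g n) A) = 2 * measure \<mu> (A - P n)" for n
  proof -
    have "measure \<mu> (P n) = measure \<mu> A" unfolding P_def using g by (intro measure_act Am) auto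
    moreover have "measure \<mu> (P n - A) = measure \<mu> (P n) - measure \<mu> (P n \<inter> A)"
      "measure \<mu> (A - P n) = measure \<mu> A - measure \<mu> (P n \<inter> A)"
      by (simp_all add: finite_measure_Diff' Int_commute)
    moreover have "shift_diff (g n) A = (P n - A) \<union> (A - P n)"
      using sets_X[OF Am] by (auto simp: shift_diff_def P_def)
    then have "measure \<mu> (shift_diff (g n) A) = measure \<mu> (P n - A) + measure \<mu> (A - P n)"
      using finite_measure_Union[of "P n - A" "A - P n"] by fastforce
    ultimately show ?thesis by simp
  qed
  then show "(\<lambda>n. measure \<mu> (shift_diff (g n) A)) \<longlonglongrightarrow> 0"
    using tendsto_mult_left[OF out, of 2] by simp
qed

lemma shift_continuous_UN:
  fixes A :: "nat \<Rightarrow> 'a set set"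
  assumes A: "\<And>i. A i \<in> sets \<mu>" and gd: "\<And>i. shift_continuous (A i)"
  shows "shift_continuous (\<Union>i. A i)"
  unfolding shift_continuous_def
proof (intro allI impI)
  fix g :: "nat \<Rightarrow> 'a"
  assume g: "\<forall>n. g n \<in> carrier G" and lim: "limitin T g \<one> sequentially"
  note [measurable] = A
  let ?A = "\<Union>i. A i"
  define B where "B N = (\<Union>i<N. A i)" for N
  have Bm [measurable]: "B N \<in> sets \<mu>" for N unfolding B_def by measurable
  show "(\<lambda>n. measure \<mu> (shift_diff (g n) ?A)) \<longlonglongrightarrow> 0"
  proof (rule LIMSEQ_I)
    fix e :: real assume e: "0 < e"
    have "(\<lambda>N. measure \<mu> (B N)) \<longlonglongrightarrow> measure \<mu> (\<Union>N. B N)"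
      by (rule finite_Lim_measure_incseq) (use Bm in \<open>force simp: B_def incseq_def\<close>)+
    moreover have "(\<Union>N. B N) = ?A" unfolding B_def by blast
    ultimately have "(\<lambda>N. measure \<mu> (B N)) \<longlonglongrightarrow> measure \<mu> ?A" by simp
    from LIMSEQ_D[OF this, of "e / 4"] e obtain N where N: "\<bar>measure \<mu> (B N) - measure \<mu> ?A\<bar> < e / 4" by auto
    define R where "R = ?A - B N"
    have Rm [measurable]: "R \<in> sets \<mu>" unfolding R_def by measurable
    have "measure \<mu> R = measure \<mu> ?A - measure \<mu> (?A \<inter> B N)"
      unfolding R_def by (rule finite_measure_Diff') measurable
    moreover have "?A \<inter> B N = B N" by (auto simp: B_def)
    ultimately have "measure \<mu> R = measure \<mu> ?A - measure \<mu> (B N)" by simp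
    then have R: "measure \<mu> R < e / 4" using N by linarith
    have "(\<lambda>n. \<Sum>i<N. measure \<mu> (shift_diff (g n) (A i))) \<longlonglongrightarrow> (\<Sum>i<N. 0)"
      using gd g lim by (intro tendsto_sum) (simp add: shift_continuous_def)
    then have "(\<lambda>n. \<Sum>i<N. measure \<mu> (shift_diff (g n) (A i))) \<longlonglongrightarrow> 0" by simp
    from LIMSEQ_D[OF this, of "e / 4"] e
    obtain n0 where n0: "\<And>n. n0 \<le> n \<Longrightarrow> \<bar>\<Sum>i<N. measure \<mu> (shift_diff (g n) (A i))\<bar> < e / 4" by auto
    have "norm (measure \<mu> (shift_diff (g n) ?A) - 0) < e" if n: "n0 \<le> n" for n
    proof -
      have gn: "g n \<in> carrier G" using g by simp
      have PR: "{x \<in> X. g n <# x \<in> R} \<in> sets \<mu>" by (rule act_set[OF gn Rm])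
      have S: "(\<Union>i<N. shift_diff (g n) (A i)) \<in> sets \<mu>"
        using shift_diff_sets[OF gn A] by (intro sets.finite_UN) auto
      have "shift_diff (g n) ?A \<subseteq> ((\<Union>i<N. shift_diff (g n) (A i)) \<union> R) \<union> {x \<in> X. g n <# x \<in> R}"
        by (auto simp: shift_diff_def R_def B_def)
      then have "measure \<mu> (shift_diff (g n) ?A) \<le> measure \<mu> (((\<Union>i<N. shift_diff (g n) (A i)) \<union> R) \<union> {x \<in> X. g n <# x \<in> R})"
        using S PR by (intro finite_measure_mono) auto
      also have "\<dots> \<le> measure \<mu> ((\<Union>i<N. shift_diff (g n) (A i)) \<union> R) + measure \<mu> {x \<in> X. g n <# x \<in> R}"
        using S PR by (intro measure_Un_le) auto
      also have "\<dots> \<le> (measure \<mu> (\<Union>i<N. shift_diff (g n) (A i)) + measure \<mu> R) + measure \<mu> R"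
        using S by (intro add_mono measure_Un_le) (auto simp: measure_act[OF gn Rm])
      also have "measure \<mu> (\<Union>i<N. shift_diff (g n) (A i)) \<le> (\<Sum>i<N. measure \<mu> (shift_diff (g n) (A i)))"
        using shift_diff_sets[OF gn A] by (intro finite_measure_subadditive_finite) auto
      finally show ?thesis using n0[OF n] R by simp
    qed
    then show "\<exists>no. \<forall>n\<ge>no. norm (measure \<mu> (shift_diff (g n) ?A) - 0) < e" by blast
  qed
qed

text \<open>Induction over the generated sigma-algebra takes the place of an approximation by
  continuous functions.\<close>

lemma shift_continuous_all:
  assumes "A \<in> sets \<mu>"
  shows "shift_continuous A"
proof -
  have "A \<in> sigma_sets X {V. openin Y V}" using assms sets_mu_sigma by simp
  then show ?thesis
  proof (induction rule: sigma_sets.induct)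
    case (Basic V)
    then show ?case using shift_continuous_open by simp
  next
    case Empty
    then show ?case by (simp add: shift_continuous_def shift_diff_def)
  next
    case (Compl V)
    have "shift_diff g (X - V) = shift_diff g V" if "g \<in> carrier G" for g
      using that act_X by (auto simp: shift_diff_def)
    then show ?case using Compl.IH by (simp add: shift_continuous_def)
  next
    case (Union A)
    then show ?case by (intro shift_continuous_UN) (simp_all add: sets_mu_sigma)
  qed
qed

definition strongly_continuous :: "('a set \<Rightarrow> complex) \<Rightarrow> bool" where
  "strongly_continuous f \<longleftrightarrow> f \<in> L2 \<mu> \<and> (\<forall>g. (\<forall>n. g n \<in> carrier G) \<longrightarrow> limitin T g \<one> sequentially \<longrightarrow>
     (\<lambda>n. H.nrm (U (g n) f - f)) \<longlonglongrightarrow> 0)"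

lemma indicator_L2: "A \<in> sets \<mu> \<Longrightarrow> (indicator A :: _ \<Rightarrow> complex) \<in> L2 \<mu>"
  by (rule L2_bounded(1)[of _ 1]) (auto simp: indicator_def)

lemma nrm_U_indicator:
  assumes g: "g \<in> carrier G" and A: "A \<in> sets \<mu>"
  shows "(H.nrm (U g (indicator A) - indicator A))\<^sup>2 = measure \<mu> (shift_diff (inv g) A)"
proof -
  have d: "U g (indicator A) - indicator A \<in> L2 \<mu>"
    by (intro H.minus_H U_L2 indicator_L2 g A)
  have "(H.nrm (U g (indicator A) - indicator A))\<^sup>2 = (\<integral>x. indicat_real (shift_diff (inv g) A) x \<partial>\<mu>)"
    unfolding L2_nrm_sq[OF d]
    by (rule Bochner_Integration.integral_cong) (auto simp: U_def shift_diff_def space_mu indicator_def)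
  also have "\<dots> = measure \<mu> (shift_diff (inv g) A)"
    using shift_diff_sets[of "inv g" A] g A by (simp add: sets.Int_space_eq2)
  finally show ?thesis .
qed

lemma strongly_continuous_indicator:
  assumes A: "A \<in> sets \<mu>"
  shows "strongly_continuous (indicator A)"
  unfolding strongly_continuous_def
proof (intro conjI allI impI indicator_L2[OF A])
  fix g :: "nat \<Rightarrow> 'a"
  assume g: "\<forall>n. g n \<in> carrier G" and lim: "limitin T g \<one> sequentially"
  have "limitin T (\<lambda>n. inv (g n)) \<one> sequentially" using limit_inv[OF lim] by simp
  then have "(\<lambda>n. measure \<mu> (shift_diff (inv (g n)) A)) \<longlonglongrightarrow> 0"
    using shift_continuous_all[OF A] g by (simp add: shift_continuous_def)
  then have "(\<lambda>n. sqrt ((H.nrm (U (g n) (indicator A) - indicator A))\<^sup>2)) \<longlonglongrightarrow> sqrt 0"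
    using g by (intro tendsto_real_sqrt) (simp add: nrm_U_indicator[OF _ A])
  moreover have "0 \<le> H.nrm (U (g n) (indicator A) - indicator A)" for n
    using g by (intro H.nrm_nonneg H.minus_H U_L2 indicator_L2 A) auto
  ultimately show "(\<lambda>n. H.nrm (U (g n) (indicator A) - indicator A)) \<longlonglongrightarrow> 0" by simp
qed

lemma strongly_continuous_scale_add:
  assumes f: "strongly_continuous f" and h: "strongly_continuous h"
  shows "strongly_continuous ((\<lambda>x. c * f x) + h)"
  unfolding strongly_continuous_def
proof (intro conjI allI impI)
  have L: "f \<in> L2 \<mu>" "h \<in> L2 \<mu>" using f h by (auto simp: strongly_continuous_def)
  show "(\<lambda>x. c * f x) + h \<in> L2 \<mu>" by (intro H.add_H H.sc_H L)
  fix g :: "nat \<Rightarrow> 'a"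
  assume g: "\<forall>n. g n \<in> carrier G" and lim: "limitin T g \<one> sequentially"
  show "(\<lambda>n. H.nrm (U (g n) ((\<lambda>x. c * f x) + h) - ((\<lambda>x. c * f x) + h))) \<longlonglongrightarrow> 0"
  proof (rule Lim_null_comparison)
    have "(\<lambda>n. cmod c * H.nrm (U (g n) f - f) + H.nrm (U (g n) h - h)) \<longlonglongrightarrow> cmod c * 0 + 0"
      using f h g lim by (intro tendsto_intros) (auto simp: strongly_continuous_def)
    then show "(\<lambda>n. cmod c * H.nrm (U (g n) f - f) + H.nrm (U (g n) h - h)) \<longlonglongrightarrow> 0" by simp
    show "\<forall>\<^sub>F n in sequentially. norm (H.nrm (U (g n) ((\<lambda>x. c * f x) + h) - ((\<lambda>x. c * f x) + h)))
        \<le> cmod c * H.nrm (U (g n) f - f) + H.nrm (U (g n) h - h)"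
    proof (intro always_eventually allI)
      fix n
      have gn: "g n \<in> carrier G" using g by simp
      have d: "U (g n) f - f \<in> L2 \<mu>" "U (g n) h - h \<in> L2 \<mu>" by (intro H.minus_H U_L2 gn L)+
      have e: "U (g n) ((\<lambda>x. c * f x) + h) - ((\<lambda>x. c * f x) + h)
          = (\<lambda>x. c * (U (g n) f - f) x) + (U (g n) h - h)"
        by (auto simp: U_def fun_eq_iff algebra_simps)
      have s: "(\<lambda>x. c * (U (g n) f - f) x) \<in> L2 \<mu>" by (rule H.sc_H[OF d(1)])
      have "H.nrm ((\<lambda>x. c * (U (g n) f - f) x) + (U (g n) h - h))
          \<le> H.nrm (\<lambda>x. c * (U (g n) f - f) x) + H.nrm (U (g n) h - h)"
        by (rule H.nrm_triangle[OF s d(2)])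
      moreover have "H.nrm (\<lambda>x. c * (U (g n) f - f) x) = cmod c * H.nrm (U (g n) f - f)"
        by (rule H.nrm_sc[OF d(1)])
      moreover have "0 \<le> H.nrm ((\<lambda>x. c * (U (g n) f - f) x) + (U (g n) h - h))"
        by (rule H.nrm_nonneg[OF H.add_H[OF s d(2)]])
      ultimately show "norm (H.nrm (U (g n) ((\<lambda>x. c * f x) + h) - ((\<lambda>x. c * f x) + h)))
        \<le> cmod c * H.nrm (U (g n) f - f) + H.nrm (U (g n) h - h)"
        unfolding e by simp
    qed
  qed
qed

text \<open>Translations are isometries, so an error of approximation is not enlarged by them; three
  terms of size e / 3 suffice.\<close>

lemma strongly_continuous_close:
  assumes f: "f \<in> L2 \<mu>" and appr: "\<And>e. 0 < e \<Longrightarrow> \<exists>h. strongly_continuous h \<and> H.nrm (f - h) < e"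
  shows "strongly_continuous f"
  unfolding strongly_continuous_def
proof (intro conjI allI impI f)
  fix g :: "nat \<Rightarrow> 'a"
  assume g: "\<forall>n. g n \<in> carrier G" and lim: "limitin T g \<one> sequentially"
  show "(\<lambda>n. H.nrm (U (g n) f - f)) \<longlonglongrightarrow> 0"
  proof (rule LIMSEQ_I)
    fix e :: real assume e: "0 < e"
    obtain h where h: "strongly_continuous h" "H.nrm (f - h) < e / 3" using appr[of "e / 3"] e by auto
    have hL: "h \<in> L2 \<mu>" using h by (simp add: strongly_continuous_def)
    have "(\<lambda>n. H.nrm (U (g n) h - h)) \<longlonglongrightarrow> 0" using h g lim by (simp add: strongly_continuous_def)
    from LIMSEQ_D[OF this, of "e / 3"] e obtain n0 where n0: "\<And>n. n0 \<le> n \<Longrightarrow> \<bar>H.nrm (U (g n) h - h)\<bar> < e / 3"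
      by auto
    have "norm (H.nrm (U (g n) f - f) - 0) < e" if n: "n0 \<le> n" for n
    proof -
      have gn: "g n \<in> carrier G" using g by simp
      have L: "U (g n) f \<in> L2 \<mu>" "U (g n) h \<in> L2 \<mu>" by (intro U_L2 gn f hL)+
      have t1: "H.nrm (U (g n) f - f) \<le> H.nrm (U (g n) f - U (g n) h) + H.nrm (U (g n) h - f)"
        by (rule H.nrm_triangle3[OF L f])
      have t2: "H.nrm (U (g n) h - f) \<le> H.nrm (U (g n) h - h) + H.nrm (h - f)"
        by (rule H.nrm_triangle3[OF L(2) hL f])
      have t3: "H.nrm (U (g n) f - U (g n) h) = H.nrm (f - h)"
        unfolding U_diff by (rule U_nrm[OF gn H.minus_H[OF f hL]])
      have t4: "H.nrm (h - f) = H.nrm (f - h)" by (rule H.nrm_minus_commute[OF hL f])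
      have "H.nrm (U (g n) f - f) < e" using t1 t2 t3 t4 h(2) n0[OF n] by argo
      moreover have "norm (H.nrm (U (g n) f - f) - 0) = H.nrm (U (g n) f - f)"
        unfolding diff_zero real_norm_def by (rule abs_of_nonneg[OF H.nrm_nonneg[OF H.minus_H[OF L(1) f]]])
      ultimately show ?thesis by argo
    qed
    then show "\<exists>no. \<forall>n\<ge>no. norm (H.nrm (U (g n) f - f) - 0) < e" by blast
  qed
qed

lemma strongly_continuous_cong:
  assumes h: "strongly_continuous h" and f: "f \<in> borel_measurable \<mu>" and eq: "\<And>x. x \<in> X \<Longrightarrow> f x = h x"
  shows "strongly_continuous f"
proof -
  have hL: "h \<in> L2 \<mu>" using h by (simp add: strongly_continuous_def)
  have fh: "f - h \<in> L2 \<mu>" "H.nrm (f - h) \<le> 0"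
    by (rule L2_bounded; use eq space_mu f L2_measurable[OF hL] in \<open>auto simp: fun_diff_def\<close>)+
  have "f = (f - h) + h" by simp
  then have "f \<in> L2 \<mu>" using H.add_H[OF fh(1) hL] by metis
  then show ?thesis
    by (rule strongly_continuous_close) (use h fh(2) in \<open>auto intro!: exI[of _ h]\<close>)
qed

lemma strongly_continuous_simple:
  assumes s: "simple_function \<mu> s"
  shows "strongly_continuous (s :: _ \<Rightarrow> complex)"
proof -
  have fin: "finite (s ` X)" and m: "\<And>y. y \<in> s ` X \<Longrightarrow> s -` {y} \<inter> X \<in> sets \<mu>"
    using s by (auto simp: simple_function_def space_mu)
  have "strongly_continuous (\<lambda>x. \<Sum>y\<in>F. y * indicator (s -` {y} \<inter> X) x)" if "finite F" "F \<subseteq> s ` X" for F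
    using that
  proof (induction F)
    case empty
    show ?case using strongly_continuous_indicator[of "{}"] by (simp add: indicator_def[abs_def])
  next
    case (insert y F)
    have "strongly_continuous ((\<lambda>x. y * indicator (s -` {y} \<inter> X) x) + (\<lambda>x. \<Sum>y\<in>F. y * indicator (s -` {y} \<inter> X) x))"
      using insert m by (intro strongly_continuous_scale_add strongly_continuous_indicator) auto
    moreover have "(\<lambda>x. \<Sum>y\<in>insert y F. y * indicator (s -` {y} \<inter> X) x)
      = (\<lambda>x. y * indicator (s -` {y} \<inter> X) x) + (\<lambda>x. \<Sum>y\<in>F. y * indicator (s -` {y} \<inter> X) x)"
      unfolding plus_fun_def by (rule ext) (rule sum.insert[OF insert.hyps])
    ultimately show ?case by argo
  qed
  from this[OF fin order_refl] show ?thesis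
  proof (rule strongly_continuous_cong)
    show "s \<in> borel_measurable \<mu>" using s by (rule borel_measurable_simple_function)
    fix x assume x: "x \<in> X"
    have "(\<Sum>y\<in>s ` X. y * indicator (s -` {y} \<inter> X) x) = (\<Sum>y\<in>s ` X. if y = s x then y else 0)"
      by (rule sum.cong) (auto simp: indicator_def x)
    then show "s x = (\<Sum>y\<in>s ` X. y * indicator (s -` {y} \<inter> X) x)"
      using fin x by simp
  qed
qed

theorem strong_continuity:
  assumes f: "f \<in> L2 \<mu>"
  shows "strongly_continuous f"
proof (rule strongly_continuous_close[OF f])
  fix e :: real assume e: "0 < e"
  have [measurable]: "f \<in> borel_measurable \<mu>" using f by (rule L2_measurable)
  obtain F where "\<forall>i. simple_function \<mu> (F i)" "\<forall>x\<in>space \<mu>. (\<lambda>i. F i x) \<longlonglongrightarrow> f x"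
    "\<forall>i. \<forall>x\<in>space \<mu>. dist (F i x) 0 \<le> 2 * dist (f x) 0"
    using borel_measurable_implies_sequence_metric[OF \<open>f \<in> borel_measurable \<mu>\<close>, of 0]
    by (elim exE conjE) (rule that)
  then have F: "\<And>i. simple_function \<mu> (F i)"
    "\<And>x. x \<in> space \<mu> \<Longrightarrow> (\<lambda>i. F i x) \<longlonglongrightarrow> f x"
    "\<And>i x. x \<in> space \<mu> \<Longrightarrow> dist (F i x) 0 \<le> 2 * dist (f x) 0"
    by blast+
  have [measurable]: "F i \<in> borel_measurable \<mu>" for i using F(1) by (rule borel_measurable_simple_function)
  have gF: "strongly_continuous (F i)" for i by (rule strongly_continuous_simple[OF F(1)])
  then have FL: "F i \<in> L2 \<mu>" for i by (simp add: strongly_continuous_def)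
  have "(\<lambda>i. \<integral>x. (cmod ((f - F i) x))\<^sup>2 \<partial>\<mu>) \<longlonglongrightarrow> (\<integral>x. 0 \<partial>\<mu>)"
  \<comment> \<open>The simple functions are bounded by 2 |f|, so |f - F i| <= 3 |f|, whence the
    factor 9.\<close>
  proof (rule integral_dominated_convergence[where w = "\<lambda>x. 9 * (cmod (f x))\<^sup>2"])
    show "integrable \<mu> (\<lambda>x. 9 * (cmod (f x))\<^sup>2)" using L2_integrable[OF f] by simp
    show "(\<lambda>x. (cmod ((f - F i) x))\<^sup>2) \<in> borel_measurable \<mu>" for i by simp
    show "AE x in \<mu>. (\<lambda>i. (cmod ((f - F i) x))\<^sup>2) \<longlonglongrightarrow> 0"
    proof (rule AE_I2)
      fix x assume x: "x \<in> space \<mu>"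
      have "(\<lambda>i. (cmod (f x - F i x))\<^sup>2) \<longlonglongrightarrow> (cmod (f x - f x))\<^sup>2"
        by (intro tendsto_intros F(2) x)
      then show "(\<lambda>i. (cmod ((f - F i) x))\<^sup>2) \<longlonglongrightarrow> 0" by simp
    qed
    show "AE x in \<mu>. norm ((cmod ((f - F i) x))\<^sup>2) \<le> 9 * (cmod (f x))\<^sup>2" for i
    proof (rule AE_I2)
      fix x assume x: "x \<in> space \<mu>"
      have "cmod (f x - F i x) \<le> 3 * cmod (f x)"
        using F(3)[OF x, of i] norm_triangle_ineq4[of "f x" "F i x"] by (simp add: dist_norm)
      then have "(cmod (f x - F i x))\<^sup>2 \<le> (3 * cmod (f x))\<^sup>2" by (intro power_mono) auto
      then show "norm ((cmod ((f - F i) x))\<^sup>2) \<le> 9 * (cmod (f x))\<^sup>2" by (simp add: power_mult_distrib)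
    qed
  qed simp
  then have "(\<lambda>i. (H.nrm (f - F i))\<^sup>2) \<longlonglongrightarrow> 0"
    using L2_nrm_sq[OF H.minus_H[OF f FL]] by simp
  then have "\<forall>\<^sub>F i in sequentially. (H.nrm (f - F i))\<^sup>2 < e\<^sup>2"
    by (rule order_tendstoD(2)) (use e in simp)
  then obtain i where i: "(H.nrm (f - F i))\<^sup>2 < e\<^sup>2"
    by (rule eventually_happens'[OF sequentially_bot, THEN exE])
  have "H.nrm (f - F i) < e" by (rule power_less_imp_less_base[OF i less_imp_le[OF e]])
  then show "\<exists>h. strongly_continuous h \<and> H.nrm (f - h) < e" using gF by blast
qed

text \<open>A countable base at the identity turns failure on every neighbourhood into a sequence
  that tends to the identity.\<close>

lemma strong_continuity_neighbourhood:
  assumes f: "f \<in> L2 \<mu>" and e: "0 < e"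
  obtains V where "openin T V" "\<one> \<in> V" "\<And>b. b \<in> V \<Longrightarrow> H.nrm (U b f - f) < e"
proof -
  obtain \<B> where B: "countable \<B>" "\<And>V. V \<in> \<B> \<Longrightarrow> openin T V"
    "\<And>W. openin T W \<Longrightarrow> \<one> \<in> W \<Longrightarrow> \<exists>V\<in>\<B>. \<one> \<in> V \<and> V \<subseteq> W"
    using T_second_countable unfolding second_countable_def by metis
  let ?C = "{V \<in> \<B>. \<one> \<in> V}"
  have "openin T (topspace T)" "\<one> \<in> topspace T" by (rule openin_topspace) (simp add: topspace)
  then have ne: "?C \<noteq> {}" using B(3) by blast
  have cC: "countable ?C" using B(1) by simp
  define Z where "Z n = (\<Inter>i\<le>n. from_nat_into ?C i)" for n :: nat
  have Zi: "openin T (from_nat_into ?C i)" "\<one> \<in> from_nat_into ?C i" for i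
    using from_nat_into[OF ne, of i] B(2) by auto
  have Z: "openin T (Z n)" "\<one> \<in> Z n" for n
    unfolding Z_def using Zi by (auto intro!: openin_Inter)
  have "\<exists>n. \<forall>b\<in>Z n. H.nrm (U b f - f) < e"
  proof (rule ccontr)
    assume "\<not> ?thesis"
    then have "\<forall>n. \<exists>b. b \<in> Z n \<and> e \<le> H.nrm (U b f - f)" by (auto simp: not_less)
    then obtain b where b: "\<And>n. b n \<in> Z n" "\<And>n. e \<le> H.nrm (U (b n) f - f)" by metis
    have bG: "b n \<in> carrier G" for n using b(1) openin_subset[OF Z(1)] topspace by blast
    have "limitin T b \<one> sequentially"
      unfolding limitin_def
    proof (intro conjI allI impI)
      show "\<one> \<in> topspace T" by (simp add: topspace)
      fix W assume "openin T W \<and> \<one> \<in> W"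
      then obtain V where V: "V \<in> ?C" "V \<subseteq> W" using B(3) by blast
      obtain i where i: "V = from_nat_into ?C i" using from_nat_into_surj[OF cC V(1)] by metis
      have "b n \<in> W" if "i \<le> n" for n
        using b(1)[of n] that V(2) i unfolding Z_def by blast
      then show "\<forall>\<^sub>F n in sequentially. b n \<in> W" unfolding eventually_sequentially by blast
    qed
    then have "(\<lambda>n. H.nrm (U (b n) f - f)) \<longlonglongrightarrow> 0"
      using strong_continuity[OF f] bG by (simp add: strongly_continuous_def)
    from LIMSEQ_D[OF this e] obtain n where "\<bar>H.nrm (U (b n) f - f)\<bar> < e" by auto
    then show False using b(2)[of n] by simp
  qed
  then obtain n where "\<forall>b\<in>Z n. H.nrm (U b f - f) < e" ..
  then show ?thesis by (intro that[OF Z]) blast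
qed

section \<open>Compactness\<close>

lemma finite_subcover:
  assumes "\<And>V. V \<in> \<V> \<Longrightarrow> openin Y V" "X \<subseteq> \<Union>\<V>"
  obtains \<F> where "finite \<F>" "\<F> \<subseteq> \<V>" "X \<subseteq> \<Union>\<F>"
proof -
  have "compactin Y X" using compact by (simp add: compact_space_def topY)
  then show ?thesis using assms that unfolding compactin_def by metis
qed

lemma orbit_open:
  assumes V: "openin T V" and x: "x \<in> X"
  shows "openin Y ((\<lambda>v. v <# x) ` V)"
proof -
  have VG: "V \<subseteq> carrier G" using openin_subset[OF V] topspace by simp
  obtain h where h: "h \<in> carrier G" "x = q h" using x by (rule X_cases)
  have "(\<lambda>v. v <# x) ` V = q ` ((\<lambda>v. v \<otimes> h) ` V)"
    unfolding image_image by (rule image_cong[OF refl]) (use h VG act_q in auto)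
  then show ?thesis using q_open[OF right_translate_open[OF V h(1)]] by simp
qed

lemma finite_orbit_cover:
  assumes V: "openin T V" "\<one> \<in> V"
  obtains F where "finite F" "F \<subseteq> X" "X \<subseteq> (\<Union>x\<in>F. (\<lambda>v. v <# x) ` V)"
proof -
  have c: "X \<subseteq> \<Union>((\<lambda>x. (\<lambda>v. v <# x) ` V) ` X)"
  proof
    fix x assume x: "x \<in> X"
    then have "x \<in> (\<lambda>v. v <# x) ` V" using V(2) act_one by force
    then show "x \<in> \<Union>((\<lambda>x. (\<lambda>v. v <# x) ` V) ` X)" using x by blast
  qed
  obtain \<F> where F: "finite \<F>" "\<F> \<subseteq> (\<lambda>x. (\<lambda>v. v <# x) ` V) ` X" "X \<subseteq> \<Union>\<F>"
    by (rule finite_subcover[OF _ c]) (use orbit_open[OF V(1)] in auto)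
  obtain F' where "F' \<subseteq> X" "finite F'" "\<F> = (\<lambda>x. (\<lambda>v. v <# x) ` V) ` F'"
    using finite_subset_image[OF F(1,2)] by metis
  then show ?thesis using F(3) by (intro that[of F']) auto
qed

text \<open>By transitivity the translates of A cover the compact space; finitely many suffice, and
  all have the measure of A.\<close>

lemma open_positive:
  assumes A: "openin Y A" and x: "x \<in> A"
  shows "0 < measure \<mu> A"
proof (rule ccontr)
  assume "\<not> 0 < measure \<mu> A"
  then have "measure \<mu> A = 0" using measure_nonneg[of \<mu> A] by linarith
  then have null: "A \<in> null_sets \<mu>" using open_sets[OF A] emeasure_eq_measure by (simp add: null_sets_def)
  have xX: "x \<in> X" using openin_subset[OF A] x topY by blast
  obtain h where h: "h \<in> carrier G" "x = q h" using xX by (rule X_cases)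
  let ?tr = "\<lambda>g. {y \<in> topspace Y. g <# y \<in> A}"
  have c: "X \<subseteq> \<Union>(?tr ` carrier G)"
  proof
    fix y assume y: "y \<in> X"
    obtain k where k: "k \<in> carrier G" "y = q k" using y by (rule X_cases)
    have "(h \<otimes> inv k) <# y = x" using h k by (simp add: act_q m_assoc)
    then have "y \<in> ?tr (h \<otimes> inv k)" using x y topY by simp
    then show "y \<in> \<Union>(?tr ` carrier G)"
      by (rule UnionI[rotated, of _ "?tr (h \<otimes> inv k)"]) (intro imageI m_closed inv_closed h k)
  qed
  obtain \<F> where F: "finite \<F>" "\<F> \<subseteq> ?tr ` carrier G" "X \<subseteq> \<Union>\<F>"
    by (rule finite_subcover[OF _ c]) (use openin_continuous_map_preimage[OF act_continuous1 A] in auto)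
  have "V \<in> null_sets \<mu>" if "V \<in> \<F>" for V
  proof -
    obtain g where g: "g \<in> carrier G" "V = ?tr g" using \<open>V \<in> \<F>\<close> F(2) by blast
    have "V = {y \<in> X. g <# y \<in> A}" using g topY by simp
    then show ?thesis
      using act_set[OF g(1) open_sets[OF A]] emeasure_act[OF g(1) open_sets[OF A]] null by (simp add: null_sets_def)
  qed
  then have "\<Union>\<F> \<in> null_sets \<mu>" using F(1) by (intro null_sets.finite_Union) auto
  then have N: "\<Union>\<F> \<in> sets \<mu>" "emeasure \<mu> (\<Union>\<F>) = 0" unfolding null_sets_def by simp_all
  have "emeasure \<mu> (space \<mu>) \<le> emeasure \<mu> (\<Union>\<F>)"
    by (rule emeasure_mono[OF _ N(1)]) (unfold space_mu, rule F(3))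
  then show False unfolding emeasure_space_1 N(2) by simp
qed

end

section \<open>From equicontinuity to precompactness\<close>

section \<open>Averaging over small translations\<close>

context nil_space
begin

text \<open>Discreteness isolates the identity in \<Gamma> by a neighbourhood W; V is chosen with
  all products inv h g, for g and h in V, inside W, so that equal cosets force g = h.\<close>

lemma injective_neighbourhood:
  obtains V where "openin T V" "\<one> \<in> V" "inj_on q V"
proof -
  have "openin (subtopology T \<Gamma>) {\<one>}"
    unfolding discrete using subgroup.one_closed[OF Gamma] by simp
  then obtain W where W: "openin T W" "{\<one>} = W \<inter> \<Gamma>"
    unfolding openin_subtopology by (elim exE conjE) (rule that)
  have "\<one> \<in> W" using W(2) by blast
  obtain V where V: "openin T V" "\<one> \<in> V" "\<And>w. w \<in> V \<Longrightarrow> inv w \<in> V"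
    "\<And>w w'. w \<in> V \<Longrightarrow> w' \<in> V \<Longrightarrow> w \<otimes> w' \<in> W" "V \<subseteq> W"
    by (rule symmetric_neighbourhood[OF W(1) \<open>\<one> \<in> W\<close>]) (rule that)
  have VG: "V \<subseteq> carrier G" using openin_subset[OF V(1)] topspace by simp
  have "inj_on q V"
  proof (rule inj_onI)
    fix g h assume gh: "g \<in> V" "h \<in> V" "q g = q h"
    have gG: "g \<in> carrier G" "h \<in> carrier G" using gh VG by auto
    have "inv h \<otimes> g \<in> W \<inter> \<Gamma>" using V(3,4) gh q_eq_iff[OF gG] by simp
    then have "inv h \<otimes> g = \<one>" using W(2) by blast
    then show "g = h" using gG by (metis inv_equality inv_inv inv_closed)
  qed
  then show ?thesis by (rule that[OF V(1,2)])
qed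

text \<open>By second countability an open set of the product is a countable union of open
  rectangles.\<close>

lemma open_prod_sets:
  assumes Z: "openin (prod_topology Y Y) Z"
  shows "Z \<in> sets (\<mu> \<Otimes>\<^sub>M \<mu>)"
proof -
  obtain \<B> where B: "countable \<B>" "\<forall>V\<in>\<B>. openin Y V"
    "\<forall>W x. openin Y W \<and> x \<in> W \<longrightarrow> (\<exists>V\<in>\<B>. x \<in> V \<and> V \<subseteq> W)"
    using Y_second_countable unfolding second_countable_def by (elim exE conjE) (rule that)
  let ?P = "{(A, B). A \<in> \<B> \<and> B \<in> \<B> \<and> A \<times> B \<subseteq> Z}"
  have c: "countable ?P"
    by (rule countable_subset[OF _ countable_SIGMA[OF B(1) B(1)]]) auto
  have "Z = (\<Union>(A, B)\<in>?P. A \<times> B)"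
  proof
    show "Z \<subseteq> (\<Union>(A, B)\<in>?P. A \<times> B)"
    proof
      fix z assume z: "z \<in> Z"
      obtain x y where xy: "z = (x, y)" by (cases z)
      have xyZ: "(x, y) \<in> Z" using z xy by simp
      obtain C D where CD: "openin Y C" "openin Y D" "x \<in> C" "y \<in> D" "C \<times> D \<subseteq> Z"
        using Z[unfolded openin_prod_topology_alt, rule_format, OF xyZ] by (elim exE conjE) (rule that)
      obtain A where A: "A \<in> \<B>" "x \<in> A" "A \<subseteq> C"
        using B(3)[rule_format, OF conjI[OF CD(1,3)]] by (elim bexE conjE) (rule that)
      obtain B where B: "B \<in> \<B>" "y \<in> B" "B \<subseteq> D"
        using B(3)[rule_format, OF conjI[OF CD(2,4)]] by (elim bexE conjE) (rule that)
      have "A \<times> B \<subseteq> Z" using A(3) B(3) CD(5) by blast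
      then show "z \<in> (\<Union>(A, B)\<in>?P. A \<times> B)"
        using A B xy by (intro UN_I[of "(A, B)"]) auto
    qed
  qed auto
  also have "\<dots> \<in> sets (\<mu> \<Otimes>\<^sub>M \<mu>)"
    by (rule sets.countable_UN''[OF c]) (use B(2) open_sets in \<open>auto intro!: pair_measureI\<close>)
  finally show ?thesis .
qed

end

locale nil_section = nil_space +
  fixes V1 :: "'a set"
  assumes V1: "openin T V1" "\<one> \<in> V1" "inj_on q V1"
begin

lemma V1_G: "v \<in> V1 \<Longrightarrow> v \<in> carrier G"
  using openin_subset[OF V1(1)] topspace by auto

definition \<tau> :: "'a set \<Rightarrow> 'a" where
  "\<tau> = inv_into V1 q"

lemma \<tau>_q: "v \<in> V1 \<Longrightarrow> \<tau> (q v) = v"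
  unfolding \<tau>_def by (rule inv_into_f_f[OF V1(3)])

text \<open>For y = v \<Gamma> with v in \<open>V1\<close> this is v^-1 x. Points of the quotient
  near the base point thus parametrize the small elements of G, and averages over small translations
  are taken against \<mu> instead of a Haar measure on G.\<close>

definition \<Psi> :: "'a set \<Rightarrow> 'a set \<Rightarrow> 'a set" where
  "\<Psi> y x = (if y \<in> q ` V1 then inv \<tau> y <# x else x)"

lemma \<Psi>_q: "v \<in> V1 \<Longrightarrow> \<Psi> (q v) x = inv v <# x"
  by (simp add: \<Psi>_def \<tau>_q)

lemma \<Psi>_X: "x \<in> X \<Longrightarrow> \<Psi> y x \<in> X"
  using V1_G by (auto simp: \<Psi>_def \<tau>_q act_X)

text \<open>Both v and x are moved by g, and (g v)^-1 g = v^-1.\<close>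

lemma \<Psi>_shift:
  assumes "g \<in> carrier G" "v \<in> V1" "g \<otimes> v \<in> V1" "x \<in> X"
  shows "\<Psi> (g <# q v) (g <# x) = \<Psi> (q v) x"
proof -
  have v: "v \<in> carrier G" using assms(2) V1_G by simp
  have "\<Psi> (g <# q v) (g <# x) = inv (g \<otimes> v) <# (g <# x)"
    using assms(1,3) v by (simp add: act_q \<Psi>_q)
  also have "\<dots> = (inv (g \<otimes> v) \<otimes> g) <# x" using assms(1,4) v by (simp add: act_act)
  also have "inv (g \<otimes> v) \<otimes> g = inv v" using assms(1) v by (simp add: inv_mult_group m_assoc)
  finally show ?thesis using assms(2) by (simp add: \<Psi>_q)
qed

lemma q_V1_open: "openin Y (q ` V1)"
  by (rule q_open[OF V1(1)])

lemma \<tau>_continuous: "continuous_map (subtopology Y (q ` V1)) T \<tau>"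
  unfolding continuous_map_def
proof (intro conjI allI impI)
  have top: "topspace (subtopology Y (q ` V1)) = q ` V1"
    using openin_subset[OF q_V1_open] by auto
  show "\<tau> \<in> topspace (subtopology Y (q ` V1)) \<rightarrow> topspace T"
    unfolding top using V1_G topspace by (auto simp: \<tau>_q)
  fix W assume W: "openin T W"
  have "{y \<in> q ` V1. \<tau> y \<in> W} = q ` (V1 \<inter> W)" by (auto simp: \<tau>_q)
  moreover have "openin Y (q ` (V1 \<inter> W))" by (intro q_open openin_Int V1(1) W)
  ultimately show "openin (subtopology Y (q ` V1)) {y \<in> topspace (subtopology Y (q ` V1)). \<tau> y \<in> W}"
    unfolding top openin_open_subtopology[OF q_V1_open] by auto
qed

lemma \<Psi>_measurable: "(\<lambda>(y, x). \<Psi> y x) \<in> measurable (\<mu> \<Otimes>\<^sub>M \<mu>) \<mu>"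
proof (rule measurable_muI)
  let ?O = "q ` V1"
  let ?P = "prod_topology (subtopology Y ?O) Y"
  have sp: "space (\<mu> \<Otimes>\<^sub>M \<mu>) = X \<times> X" by (simp add: space_pair_measure space_mu)
  show "(\<lambda>(y, x). \<Psi> y x) \<in> space (\<mu> \<Otimes>\<^sub>M \<mu>) \<rightarrow> X" unfolding sp by (auto simp: \<Psi>_X)
  fix A assume A: "openin Y A"
  have OX: "?O \<subseteq> X" using openin_subset[OF q_V1_open] topY by simp
  have top: "topspace ?P = ?O \<times> X" using OX by (auto simp: topY)
  have c1: "continuous_map ?P T (\<lambda>z. inv (\<tau> (fst z)))"
    using continuous_map_compose[OF continuous_map_compose[OF continuous_map_fst \<tau>_continuous] inv_cont]
    by (simp add: o_def)
  have "continuous_map ?P (prod_topology T Y) (\<lambda>z. (inv (\<tau> (fst z)), snd z))"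
    using c1 continuous_map_snd by (simp add: continuous_map_pairwise o_def)
  from continuous_map_compose[OF this act_continuous]
  have c: "continuous_map ?P Y (\<lambda>z. inv (\<tau> (fst z)) <# snd z)" by (simp add: o_def)
  have o: "openin ?P {z \<in> topspace ?P. inv (\<tau> (fst z)) <# snd z \<in> A}"
    by (rule openin_continuous_map_preimage[OF c A])
  have eqP: "?P = subtopology (prod_topology Y Y) (?O \<times> X)"
    using prod_topology_subtopology(1)[of Y ?O Y] by (simp add: topY)
  have oP: "openin (prod_topology Y Y) (?O \<times> X)"
    using q_V1_open openin_topspace[of Y] by (simp add: openin_prod_Times_iff topY)
  have 1: "{z \<in> ?O \<times> X. inv (\<tau> (fst z)) <# snd z \<in> A} \<in> sets (\<mu> \<Otimes>\<^sub>M \<mu>)"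
    using o[unfolded eqP, unfolded top[unfolded eqP]] by (intro open_prod_sets) (simp only: openin_open_subtopology[OF oP])
  have "X - ?O \<in> sets \<mu>" using open_sets[OF q_V1_open] by (metis sets.compl_sets space_mu)
  then have 2: "(X - ?O) \<times> A \<in> sets (\<mu> \<Otimes>\<^sub>M \<mu>)" using open_sets[OF A] by (rule pair_measureI)
  have AX: "A \<subseteq> X" using openin_subset[OF A] topY by simp
  have "(\<lambda>(y, x). \<Psi> y x) -` A \<inter> space (\<mu> \<Otimes>\<^sub>M \<mu>)
    = {z \<in> ?O \<times> X. inv (\<tau> (fst z)) <# snd z \<in> A} \<union> (X - ?O) \<times> A"
    unfolding sp using OX AX by (auto simp: \<Psi>_def split: if_splits)
  then show "(\<lambda>(y, x). \<Psi> y x) -` A \<inter> space (\<mu> \<Otimes>\<^sub>M \<mu>) \<in> sets (\<mu> \<Otimes>\<^sub>M \<mu>)"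
    using sets.Un[OF 1 2] by simp
qed

lemma \<Psi>_section_measurable: "x \<in> X \<Longrightarrow> (\<lambda>y. \<Psi> y x) \<in> measurable \<mu> \<mu>"
  using measurable_compose[OF measurable_Pair2' \<Psi>_measurable, of x] 
    measurable_compose[OF measurable_Pair1' \<Psi>_measurable] by (simp add: space_mu)

subsection \<open>Domination by the invariant measure\<close>

text \<open>Compactness makes \<open>open_positive\<close> uniform: x = w x0 for one of finitely
  many x0 and some w in \<open>W0\<close>, and then the set W0 x0 = (W0 w^-1) x is contained in W
  x.\<close>

lemma orbit_measure_bound:
  assumes W: "openin T W" "\<one> \<in> W"
  obtains \<delta> where "0 < \<delta>" "\<And>x. x \<in> X \<Longrightarrow> \<delta> \<le> measure \<mu> ((\<lambda>w. w <# x) ` W)"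
proof -
  obtain W0 where W0: "openin T W0" "\<one> \<in> W0" "\<And>w. w \<in> W0 \<Longrightarrow> inv w \<in> W0"
    "\<And>w w'. w \<in> W0 \<Longrightarrow> w' \<in> W0 \<Longrightarrow> w \<otimes> w' \<in> W" "W0 \<subseteq> W"
    by (rule symmetric_neighbourhood[OF W]) (rule that)
  have W0G: "W0 \<subseteq> carrier G" using openin_subset[OF W0(1)] topspace by simp
  let ?m = "\<lambda>x. measure \<mu> ((\<lambda>w. w <# x) ` W0)"
  obtain F where F: "finite F" "F \<subseteq> X" "X \<subseteq> (\<Union>x\<in>F. (\<lambda>v. v <# x) ` W0)"
    by (rule finite_orbit_cover[OF W0(1,2)]) (rule that)
  have pos: "0 < ?m x" if "x \<in> F" for x
  proof (rule open_positive[OF orbit_open[OF W0(1)]])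
    show "x \<in> X" using that F(2) by blast
    then show "x \<in> (\<lambda>w. w <# x) ` W0" using W0(2) act_one by (intro image_eqI[of _ _ \<one>]) simp_all
  qed
  obtain \<delta> where \<delta>: "0 < \<delta>" "\<And>x. x \<in> F \<Longrightarrow> \<delta> \<le> ?m x"
  proof (rule that)
    show "0 < Min (insert 1 (?m ` F))" using F(1) pos by (subst Min_gr_iff) auto
    show "Min (insert 1 (?m ` F)) \<le> ?m x" if "x \<in> F" for x using F(1) that by (intro Min_le) auto
  qed
  have "\<delta> \<le> measure \<mu> ((\<lambda>w. w <# x) ` W)" if x: "x \<in> X" for x
  proof -
    obtain x0 w where w: "x0 \<in> F" "w \<in> W0" "x = w <# x0" using F(3) x by blast
    have x0: "x0 \<in> X" using F(2) w(1) by blast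
    have "(\<lambda>w. w <# x0) ` W0 \<subseteq> (\<lambda>w. w <# x) ` W"
    proof
      fix z assume "z \<in> (\<lambda>w. w <# x0) ` W0"
      then obtain u where u: "u \<in> W0" "z = u <# x0" by blast
      have G: "u \<in> carrier G" "w \<in> carrier G" using u w W0G by auto
      have "(u \<otimes> inv w) <# x = z" using u w G x0 by (simp add: act_act m_assoc)
      moreover have "u \<otimes> inv w \<in> W" using W0(3,4) u w by blast
      ultimately show "z \<in> (\<lambda>w. w <# x) ` W" by (intro image_eqI[of _ _ "u \<otimes> inv w"]) simp_all
    qed
    then have "?m x0 \<le> measure \<mu> ((\<lambda>w. w <# x) ` W)"
      using open_sets[OF orbit_open[OF W(1) x]] by (intro finite_measure_mono) auto
    then show ?thesis using \<delta>(2)[OF w(1)] by linarith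
  qed
  then show ?thesis by (rule that[OF \<delta>(1)])
qed

text \<open>The image of \<open>\<mu>\<close>, restricted to a small neighbourhood of the base point, under
  \<open>y \<mapsto> \<Psi> y x\<close> increases at most to the one for a larger neighbourhood when \<open>x\<close> moves a little;
  averaging the latter over \<open>x\<close> gives a multiple of \<open>\<mu>\<close>.\<close>

lemma domination:
  obtains V C where "openin T V" "\<one> \<in> V" "V \<subseteq> V1" "0 \<le> C"
    "\<And>h x. h \<in> borel_measurable \<mu> \<Longrightarrow> x \<in> X \<Longrightarrow>
      (\<integral>\<^sup>+y. indicator (q ` V) y * h (\<Psi> y x) \<partial>\<mu>) \<le> ennreal C * (\<integral>\<^sup>+x. h x \<partial>\<mu>)"
proof -
  obtain V where V: "openin T V" "\<one> \<in> V" "\<And>w. w \<in> V \<Longrightarrow> inv w \<in> V"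
    "\<And>w w'. w \<in> V \<Longrightarrow> w' \<in> V \<Longrightarrow> w \<otimes> w' \<in> V1" "V \<subseteq> V1"
    by (rule symmetric_neighbourhood[OF V1(1,2)]) (rule that)
  have VG: "V \<subseteq> carrier G" using openin_subset[OF V(1)] topspace by simp
  obtain \<delta> where \<delta>: "0 < \<delta>" "\<And>x. x \<in> X \<Longrightarrow> \<delta> \<le> measure \<mu> ((\<lambda>w. w <# x) ` V)"
    by (rule orbit_measure_bound[OF V(1,2)]) (rule that)
  have [measurable]: "q ` V \<in> sets \<mu>" "q ` V1 \<in> sets \<mu>"
    by (intro open_sets q_open V(1) V1(1))+
  have main: "(\<integral>\<^sup>+y. indicator (q ` V) y * h (\<Psi> y x) \<partial>\<mu>) \<le> ennreal (1 / \<delta>) * (\<integral>\<^sup>+x. h x \<partial>\<mu>)"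
    if h [measurable]: "h \<in> borel_measurable \<mu>" and x: "x \<in> X" for h :: "'a set \<Rightarrow> ennreal" and x
  proof -
    let ?I = "\<integral>\<^sup>+y. indicator (q ` V) y * h (\<Psi> y x) \<partial>\<mu>"
    let ?J = "\<lambda>x'. \<integral>\<^sup>+y. indicator (q ` V1) y * h (\<Psi> y x') \<partial>\<mu>"
    let ?W = "(\<lambda>w. w <# x) ` V"
    have Wm: "?W \<in> sets \<mu>" by (rule open_sets[OF orbit_open[OF V(1) x]])
    \<comment> \<open>Substituting w y for y and using \<open>\<Psi>_shift\<close> moves x to w x,
      at the price of enlarging V to \<open>V1\<close>.\<close>
    have le: "?I \<le> ?J (w <# x)" if w: "w \<in> V" for w
    proof -
      have wG: "w \<in> carrier G" using w VG by blast
      have wx: "w <# x \<in> X" using wG x by (rule act_X)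
      have [measurable]: "(\<lambda>y. \<Psi> y (w <# x)) \<in> measurable \<mu> \<mu>" by (rule \<Psi>_section_measurable[OF wx])
      have "?J (w <# x) = (\<integral>\<^sup>+y. (\<lambda>y. indicator (q ` V1) y * h (\<Psi> y (w <# x))) (w <# y) \<partial>\<mu>)"
        by (rule nn_integral_act[OF wG, symmetric]) measurable
      moreover have "?I \<le> \<dots>"
      proof (rule nn_integral_mono)
        fix y assume "y \<in> space \<mu>"
        show "indicator (q ` V) y * h (\<Psi> y x) \<le> indicator (q ` V1) (w <# y) * h (\<Psi> (w <# y) (w <# x))"
        proof (cases "y \<in> q ` V")
          case True
          then obtain v where v: "v \<in> V" "y = q v" by blast
          have wv: "w \<otimes> v \<in> V1" using V(4)[OF w v(1)] .
          have "v \<in> V1" "v \<in> carrier G" using v V(5) VG by auto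
          then have "\<Psi> (w <# y) (w <# x) = \<Psi> y x" "w <# y = q (w \<otimes> v)"
            using \<Psi>_shift[OF wG _ wv x] v(2) act_q[OF wG] by auto
          then show ?thesis using True wv by (simp add: indicator_def)
        qed simp
      qed
      ultimately show ?thesis by simp
    qed
    \<comment> \<open>The points w x fill a set of measure at least \<delta>; averaging over them
      makes x an integration variable, and Tonelli and invariance then remove
      \<open>\<Psi>\<close>.\<close>
    have "?I * ennreal \<delta> \<le> ?I * emeasure \<mu> ?W"
      using \<delta>(2)[OF x] by (intro mult_left_mono) (auto simp: emeasure_eq_measure)
    also have "\<dots> = (\<integral>\<^sup>+x'. ?I * indicator ?W x' \<partial>\<mu>)"
      by (rule nn_integral_cmult_indicator[OF Wm, symmetric])
    also have "\<dots> \<le> (\<integral>\<^sup>+x'. ?J x' \<partial>\<mu>)"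
      by (rule nn_integral_mono) (use le in \<open>auto simp: indicator_def\<close>)
    also have "\<dots> = (\<integral>\<^sup>+y. \<integral>\<^sup>+x'. indicator (q ` V1) y * h (\<Psi> y x') \<partial>\<mu> \<partial>\<mu>)"
    proof -
      interpret P: pair_sigma_finite \<mu> \<mu> ..
      note \<Psi>_measurable[measurable]
      have "(\<lambda>(y, x). indicator (q ` V1) y * h (\<Psi> y x)) \<in> borel_measurable (\<mu> \<Otimes>\<^sub>M \<mu>)"
      proof -
        have "(\<lambda>z. indicator (q ` V1) (fst z) * h ((\<lambda>(y, x). \<Psi> y x) z)) \<in> borel_measurable (\<mu> \<Otimes>\<^sub>M \<mu>)"
          by measurable
        then show ?thesis by (simp add: case_prod_beta)
      qed
      from P.Fubini'[OF this] show ?thesis .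
    qed
    also have "\<dots> \<le> (\<integral>\<^sup>+y. (\<integral>\<^sup>+x. h x \<partial>\<mu>) \<partial>\<mu>)"
    proof (rule nn_integral_mono)
      fix y
      show "(\<integral>\<^sup>+x'. indicator (q ` V1) y * h (\<Psi> y x') \<partial>\<mu>) \<le> (\<integral>\<^sup>+x. h x \<partial>\<mu>)"
      proof (cases "y \<in> q ` V1")
        case True
        then obtain v where v: "v \<in> V1" "y = q v" by blast
        have "inv v \<in> carrier G" using v V1_G by simp
        then show ?thesis using nn_integral_act[OF _ h] v by (simp add: \<Psi>_q)
      qed simp
    qed
    also have "\<dots> = (\<integral>\<^sup>+x. h x \<partial>\<mu>)" using emeasure_space_1 by simp
    finally have "?I * ennreal \<delta> \<le> (\<integral>\<^sup>+x. h x \<partial>\<mu>)" .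
    then have "ennreal (1 / \<delta>) * (?I * ennreal \<delta>) \<le> ennreal (1 / \<delta>) * (\<integral>\<^sup>+x. h x \<partial>\<mu>)"
      by (rule mult_left_mono) simp
    moreover have "ennreal (1 / \<delta>) * (?I * ennreal \<delta>) = ?I"
    proof -
      have "ennreal (1 / \<delta>) * ennreal \<delta> = 1" using \<delta>(1) by (simp flip: ennreal_mult)
      moreover have "ennreal (1 / \<delta>) * (?I * ennreal \<delta>) = ?I * (ennreal (1 / \<delta>) * ennreal \<delta>)"
        by (simp only: ac_simps)
      ultimately show ?thesis by simp
    qed
    ultimately show ?thesis by simp
  qed
  show ?thesis by (rule that[OF V(1,2,5) _ main]) (use \<delta>(1) in simp)
qed

end

subsection \<open>Equicontinuity implies total boundedness\<close>

locale nil_kernel = nil_section +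
  fixes V0 :: "'a set" and C :: real
  assumes V0: "openin T V0" "\<one> \<in> V0" "V0 \<subseteq> V1" and C: "0 \<le> C"
    and dominated: "h \<in> borel_measurable \<mu> \<Longrightarrow> x \<in> X \<Longrightarrow>
      (\<integral>\<^sup>+y. indicator (q ` V0) y * h (\<Psi> y x) \<partial>\<mu>) \<le> ennreal C * (\<integral>\<^sup>+x. h x \<partial>\<mu>)"
begin

definition base_indicator :: "'a set \<Rightarrow> 'a set \<Rightarrow> complex" ("\<chi>") where
  "\<chi> V = indicator (q ` V)"

text \<open>The conjugate cancels the one in \<open>L2_inner\<close>, so the inner product of
  \<open>\<chi> V\<close> with \<open>K V x u\<close> is the unnormalized average of u(v^-1 x) over
  v in V.\<close>

definition K :: "'a set \<Rightarrow> 'a set \<Rightarrow> ('a set \<Rightarrow> complex) \<Rightarrow> 'a set \<Rightarrow> complex" where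
  "K V x u = (\<lambda>y. indicator (q ` V) y * cnj (u (\<Psi> y x)))"

lemma q_sets: "openin T V \<Longrightarrow> q ` V \<in> sets \<mu>"
  by (intro open_sets q_open)

lemma \<chi>_L2: "openin T V \<Longrightarrow> \<chi> V \<in> L2 \<mu>"
  unfolding base_indicator_def by (intro indicator_L2 q_sets)

lemma \<chi>_inner: "openin T V \<Longrightarrow> L2_inner \<mu> (\<chi> V) (\<chi> V) = of_real (measure \<mu> (q ` V))"
proof -
  assume V: "openin T V"
  have "L2_inner \<mu> (\<chi> V) (\<chi> V) = (\<integral>y. of_real (indicator (q ` V) y) \<partial>\<mu>)"
    unfolding L2_inner_def base_indicator_def by (rule Bochner_Integration.integral_cong) (auto simp: indicator_def)
  also have "\<dots> = of_real (\<integral>y. indicator (q ` V) y \<partial>\<mu>)" by (rule integral_complex_of_real)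
  also have "(\<integral>y. indicator (q ` V) y \<partial>\<mu>) = measure \<mu> (q ` V)"
    using q_sets[OF V] by simp
  finally show ?thesis .
qed

lemma \<chi>_nrm: "openin T V \<Longrightarrow> (H.nrm (\<chi> V))\<^sup>2 = measure \<mu> (q ` V)"
  using \<chi>_inner \<chi>_L2 by (simp add: H.nrm_sq)

lemma K_measurable:
  assumes V: "openin T V" and x: "x \<in> X" and u: "u \<in> borel_measurable \<mu>"
  shows "K V x u \<in> borel_measurable \<mu>"
proof -
  have [measurable]: "q ` V \<in> sets \<mu>" by (rule q_sets[OF V])
  have [measurable]: "(\<lambda>y. u (\<Psi> y x)) \<in> borel_measurable \<mu>"
    by (rule measurable_compose[OF \<Psi>_section_measurable[OF x] u])
  show ?thesis unfolding K_def by measurable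
qed

text \<open>The bound holds at every point x with one constant, although u is controlled only in
  L^2; this is the purpose of \<open>dominated\<close>.\<close>

lemma K_L2:
  assumes V: "openin T V" "V \<subseteq> V0" and x: "x \<in> X" and u: "u \<in> L2 \<mu>"
  shows "K V x u \<in> L2 \<mu>" "H.nrm (K V x u) \<le> sqrt C * H.nrm u"
proof -
  have [measurable]: "u \<in> borel_measurable \<mu>" using u by (rule L2_measurable)
  have e: "0 \<le> sqrt C * H.nrm u" using C H.nrm_nonneg[OF u] by simp
  have "(\<integral>\<^sup>+y. ennreal ((cmod (K V x u y))\<^sup>2) \<partial>\<mu>)
      \<le> (\<integral>\<^sup>+y. indicator (q ` V0) y * ennreal ((cmod (u (\<Psi> y x)))\<^sup>2) \<partial>\<mu>)"
    by (rule nn_integral_mono) (use V(2) in \<open>auto simp: K_def indicator_def\<close>)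
  also have "\<dots> \<le> ennreal C * (\<integral>\<^sup>+x. ennreal ((cmod (u x))\<^sup>2) \<partial>\<mu>)"
    by (rule dominated[OF _ x]) measurable
  also have "\<dots> = ennreal ((sqrt C * H.nrm u)\<^sup>2)"
    using C by (simp add: L2_nn_integral[OF u] power_mult_distrib ennreal_mult)
  finally have le: "(\<integral>\<^sup>+y. ennreal ((cmod (K V x u y))\<^sup>2) \<partial>\<mu>) \<le> ennreal ((sqrt C * H.nrm u)\<^sup>2)" .
  show "K V x u \<in> L2 \<mu>" "H.nrm (K V x u) \<le> sqrt C * H.nrm u"
    by (rule L2_nrm_leI[OF K_measurable[OF V(1) x] e le]; measurable)+
qed

lemma K_diff: "K V x (u - w) = K V x u - K V x w"
  by (auto simp: K_def fun_eq_iff algebra_simps)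

lemma K_restrict:
  assumes "V \<subseteq> V0"
  shows "L2_inner \<mu> (\<chi> V) (K V0 x u) = L2_inner \<mu> (\<chi> V) (K V x u)"
  unfolding L2_inner_def
  by (rule Bochner_Integration.integral_cong) (use assms in \<open>auto simp: base_indicator_def K_def indicator_def\<close>)

text \<open>The dependence on the point is moved to the indicator \<open>\<chi> V\<close>.\<close>

lemma K_shift:
  assumes V: "openin T V" "V \<subseteq> V0" and g: "g \<in> carrier G" "\<And>v. v \<in> V \<Longrightarrow> inv g \<otimes> v \<in> V0"
    and x: "x \<in> X" and u: "u \<in> L2 \<mu>"
  shows "L2_inner \<mu> (\<chi> V) (K V0 (g <# x) u) = L2_inner \<mu> (U (inv g) (\<chi> V)) (K V0 x u)"
proof -
  have gx: "g <# x \<in> X" by (rule act_X[OF g(1) x])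
  have VG: "V \<subseteq> carrier G" using openin_subset[OF V(1)] topspace by simp
  have "L2_inner \<mu> (\<chi> V) (K V0 (g <# x) u) = L2_inner \<mu> (U (inv g) (\<chi> V)) (U (inv g) (K V0 (g <# x) u))"
    by (intro U_inner[symmetric] L2_measurable \<chi>_L2 K_L2(1) V0 V gx u inv_closed g(1)) simp
  also have "\<dots> = L2_inner \<mu> (U (inv g) (\<chi> V)) (K V0 x u)"
    unfolding L2_inner_def
  proof (rule Bochner_Integration.integral_cong[OF refl])
    fix y assume "y \<in> space \<mu>"
    then have y: "y \<in> X" by (simp add: space_mu)
    show "U (inv g) (\<chi> V) y * cnj (U (inv g) (K V0 (g <# x) u) y) = U (inv g) (\<chi> V) y * cnj (K V0 x u y)"
    proof (cases "g <# y \<in> q ` V")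
      case True
      then obtain v where v: "v \<in> V" "g <# y = q v" by blast
      let ?v = "inv g \<otimes> v"
      have vG: "v \<in> carrier G" using v VG by blast
      have gv: "g \<otimes> ?v = v" using g(1) vG by (simp flip: m_assoc)
      have v': "?v \<in> V0" "?v \<in> V1" using g(2)[OF v(1)] V0(3) by auto
      have yv: "y = q ?v" using act_inv_cancel(2)[OF g(1) y] v(2) g(1) vG by (simp add: act_q)
      have "v \<in> V1" using v V(2) V0(3) by blast
      then have "\<Psi> (g <# y) (g <# x) = \<Psi> y x"
        unfolding yv using g(1) v' x gv by (intro \<Psi>_shift) simp_all
      moreover have "g <# y \<in> q ` V0" "y \<in> q ` V0" using True V(2) v'(1) yv by auto
      ultimately show ?thesis using y g(1) by (simp add: U_def K_def)
    qed (use y g(1) in \<open>simp add: U_def base_indicator_def\<close>)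
  qed
  finally show ?thesis .
qed

text \<open>Strong continuity at the single vector \<open>\<chi> V\<close> therefore makes the
  averages equicontinuous in x, uniformly over all u of bounded norm.\<close>

lemma average_continuity:
  assumes V: "openin T V" "V \<subseteq> V0" and g: "g \<in> carrier G" "\<And>v. v \<in> V \<Longrightarrow> inv g \<otimes> v \<in> V0"
    and x: "x \<in> X" and u: "u \<in> L2 \<mu>"
  shows "cmod (L2_inner \<mu> (\<chi> V) (K V0 (g <# x) u) - L2_inner \<mu> (\<chi> V) (K V0 x u))
    \<le> H.nrm (U (inv g) (\<chi> V) - \<chi> V) * (sqrt C * H.nrm u)"
proof -
  have L: "U (inv g) (\<chi> V) \<in> L2 \<mu>" "\<chi> V \<in> L2 \<mu>" "K V0 x u \<in> L2 \<mu>"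
    by (intro U_L2 inv_closed g(1) \<chi>_L2 V(1) K_L2(1) V0 order_refl x u)+
  have eq: "L2_inner \<mu> (\<chi> V) (K V0 (g <# x) u) - L2_inner \<mu> (\<chi> V) (K V0 x u)
    = L2_inner \<mu> (U (inv g) (\<chi> V) - \<chi> V) (K V0 x u)"
    by (simp only: K_shift[OF V g x u] H.ip_diff[OF L])
  show ?thesis
    unfolding eq
    by (rule order_trans[OF H.cauchy_schwarz[OF H.minus_H[OF L(1,2)] L(3)]
      mult_left_mono[OF K_L2(2)[OF V0(1) order_refl x u] H.nrm_nonneg[OF H.minus_H[OF L(1,2)]]]])
qed

text \<open>Compare m w(x), where m is the measure of the image of V, with the average of w near x:
  Cauchy-Schwarz bounds the deviation by a mean square of w(v^-1 x) - w(x). The factors 2 come from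
  (a + b)^2 <= 2 a^2 + 2 b^2.\<close>

lemma average_pointwise:
  assumes V: "openin T V" "V \<subseteq> V0" and x: "x \<in> X" and w: "w \<in> L2 \<mu>"
  shows "ennreal ((measure \<mu> (q ` V) * cmod (w x))\<^sup>2)
    \<le> ennreal (2 * (cmod (L2_inner \<mu> (\<chi> V) (K V0 x w)))\<^sup>2) + ennreal (2 * measure \<mu> (q ` V)) *
      (\<integral>\<^sup>+y. indicator (q ` V) y * ennreal ((cmod (w (\<Psi> y x) - w x))\<^sup>2) \<partial>\<mu>)"
proof -
  let ?m = "measure \<mu> (q ` V)"
  define Z where "Z = K V x w - (\<lambda>y. cnj (w x) * \<chi> V y)"
  define A where "A = L2_inner \<mu> (\<chi> V) (K V0 x w)"
  have L: "K V x w \<in> L2 \<mu>" "\<chi> V \<in> L2 \<mu>" "(\<lambda>y. cnj (w x) * \<chi> V y) \<in> L2 \<mu>"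
    by (intro K_L2(1) \<chi>_L2 V x w H.sc_H)+
  have Z: "Z \<in> L2 \<mu>" unfolding Z_def by (rule H.minus_H[OF L(1,3)])
  have "L2_inner \<mu> (\<chi> V) Z = A - w x * of_real ?m"
    unfolding Z_def H.ip_diff2[OF L(1,3,2)] H.ip_sc2[OF L(2,2)] A_def K_restrict[OF V(2)] \<chi>_inner[OF V(1)]
    by simp
  then have "cmod (A - w x * of_real ?m) \<le> H.nrm (\<chi> V) * H.nrm Z"
    using H.cauchy_schwarz[OF L(2) Z] by simp
  then have 1: "(cmod (A - w x * of_real ?m))\<^sup>2 \<le> ?m * (H.nrm Z)\<^sup>2"
    unfolding \<chi>_nrm[OF V(1), symmetric] power_mult_distrib[symmetric] by (rule power_mono) simp
  have "?m * cmod (w x) \<le> cmod A + cmod (A - w x * of_real ?m)"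
    using norm_triangle_ineq4[of A "A - w x * of_real ?m"] by (simp add: norm_mult mult.commute)
  then have "(?m * cmod (w x))\<^sup>2 \<le> (cmod A + cmod (A - w x * of_real ?m))\<^sup>2"
    by (rule power_mono) simp
  also have "\<dots> \<le> 2 * (cmod A)\<^sup>2 + 2 * (cmod (A - w x * of_real ?m))\<^sup>2"
    using sum_squares_bound[of "cmod A" "cmod (A - w x * of_real ?m)"] by (simp add: power2_sum)
  also have "\<dots> \<le> 2 * (cmod A)\<^sup>2 + 2 * ?m * (H.nrm Z)\<^sup>2" using 1 by simp
  finally have "ennreal ((?m * cmod (w x))\<^sup>2) \<le> ennreal (2 * (cmod A)\<^sup>2 + 2 * ?m * (H.nrm Z)\<^sup>2)"
    by (rule ennreal_leI)
  also have "\<dots> = ennreal (2 * (cmod A)\<^sup>2) + ennreal (2 * ?m) * ennreal ((H.nrm Z)\<^sup>2)"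
    by (simp add: ennreal_plus ennreal_mult)
  also have "ennreal ((H.nrm Z)\<^sup>2) = (\<integral>\<^sup>+y. ennreal ((cmod (Z y))\<^sup>2) \<partial>\<mu>)"
    by (rule L2_nn_integral[OF Z, symmetric])
  also have "\<dots> = (\<integral>\<^sup>+y. indicator (q ` V) y * ennreal ((cmod (w (\<Psi> y x) - w x))\<^sup>2) \<partial>\<mu>)"
  proof (rule nn_integral_cong)
    fix y
    have "Z y = indicator (q ` V) y * cnj (w (\<Psi> y x) - w x)"
      by (simp add: Z_def K_def base_indicator_def algebra_simps)
    then have "cmod (Z y) = indicator (q ` V) y * cmod (w (\<Psi> y x) - w x)"
      by (simp add: norm_mult indicator_def flip: complex_cnj_diff)
    then show "ennreal ((cmod (Z y))\<^sup>2) = indicator (q ` V) y * ennreal ((cmod (w (\<Psi> y x) - w x))\<^sup>2)"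
      by (simp add: indicator_def)
  qed
  finally show ?thesis unfolding A_def .
qed

text \<open>Integrate \<open>average_pointwise\<close> over x. By Tonelli the deviation term becomes
  an integral over v in V of the squared norm of U v w - w, which \<open>\<epsilon>\<close>
  controls.\<close>

lemma average_bound:
  assumes V: "openin T V" "V \<subseteq> V0" "\<one> \<in> V" and w: "w \<in> L2 \<mu>"
    and \<epsilon>: "0 \<le> \<epsilon>" "\<And>b. b \<in> V \<Longrightarrow> H.nrm (U b w - w) \<le> \<epsilon>"
    and \<beta>: "0 \<le> \<beta>" "\<And>x. x \<in> X \<Longrightarrow> cmod (L2_inner \<mu> (\<chi> V) (K V0 x w)) \<le> \<beta>"
  shows "H.nrm w \<le> 2 * (\<beta> / measure \<mu> (q ` V) + \<epsilon>)"
proof -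
  let ?m = "measure \<mu> (q ` V)"
  let ?D = "\<lambda>x y. indicator (q ` V) y * ennreal ((cmod (w (\<Psi> y x) - w x))\<^sup>2)"
  have m: "0 < ?m" by (rule open_positive[OF q_open[OF V(1)], of "q \<one>"]) (use V(3) in blast)
  have [measurable]: "w \<in> borel_measurable \<mu>" using w by (rule L2_measurable)
  have [measurable]: "q ` V \<in> sets \<mu>" by (rule q_sets[OF V(1)])
  have VG: "V \<subseteq> carrier G" using openin_subset[OF V(1)] topspace by simp
  have Dm: "(\<lambda>(y, x). ?D x y) \<in> borel_measurable (\<mu> \<Otimes>\<^sub>M \<mu>)"
  proof -
    note \<Psi>_measurable[measurable]
    have "(\<lambda>z. indicator (q ` V) (fst z) * ennreal ((cmod (w ((\<lambda>(y, x). \<Psi> y x) z) - w (snd z)))\<^sup>2))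
      \<in> borel_measurable (\<mu> \<Otimes>\<^sub>M \<mu>)"
      by measurable
    then show ?thesis by (simp add: case_prod_beta)
  qed
  have Dm': "(\<lambda>x. \<integral>\<^sup>+y. ?D x y \<partial>\<mu>) \<in> borel_measurable \<mu>"
  proof -
    have "(\<lambda>z. (case (snd z, fst z) of (y, x) \<Rightarrow> ?D x y)) \<in> borel_measurable (\<mu> \<Otimes>\<^sub>M \<mu>)"
      by (rule measurable_compose[OF _ Dm]) measurable
    then show ?thesis by (intro borel_measurable_nn_integral) (simp add: case_prod_beta)
  qed
  have tonelli: "(\<integral>\<^sup>+x. \<integral>\<^sup>+y. ?D x y \<partial>\<mu> \<partial>\<mu>) = (\<integral>\<^sup>+y. \<integral>\<^sup>+x. ?D x y \<partial>\<mu> \<partial>\<mu>)"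
  proof -
    interpret P: pair_sigma_finite \<mu> \<mu> ..
    show ?thesis using P.Fubini'[OF Dm] .
  qed
  have "(\<integral>\<^sup>+y. \<integral>\<^sup>+x. ?D x y \<partial>\<mu> \<partial>\<mu>) \<le> (\<integral>\<^sup>+y. ennreal (\<epsilon>\<^sup>2) * indicator (q ` V) y \<partial>\<mu>)"
  proof (rule nn_integral_mono)
    fix y
    show "(\<integral>\<^sup>+x. ?D x y \<partial>\<mu>) \<le> ennreal (\<epsilon>\<^sup>2) * indicator (q ` V) y"
    proof (cases "y \<in> q ` V")
      case True
      then obtain v where v: "v \<in> V" "y = q v" by blast
      have vV: "v \<in> V1" "v \<in> carrier G" using v V(2) V0(3) VG by auto
      have L: "U v w - w \<in> L2 \<mu>" by (intro H.minus_H U_L2 vV w)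
      have "(\<integral>\<^sup>+x. ?D x y \<partial>\<mu>) = (\<integral>\<^sup>+x. ennreal ((cmod ((U v w - w) x))\<^sup>2) \<partial>\<mu>)"
        by (rule nn_integral_cong) (use True v vV in \<open>simp add: \<Psi>_q U_def space_mu\<close>)
      also have "\<dots> = ennreal ((H.nrm (U v w - w))\<^sup>2)" by (rule L2_nn_integral[OF L])
      also have "\<dots> \<le> ennreal (\<epsilon>\<^sup>2)"
        by (intro ennreal_leI power_mono \<epsilon>(2)[OF v(1)] H.nrm_nonneg[OF L])
      finally show ?thesis using True by simp
    qed simp
  qed
  also have "\<dots> = ennreal (\<epsilon>\<^sup>2) * ennreal ?m"
    by (simp add: nn_integral_cmult_indicator emeasure_eq_measure)
  finally have int: "(\<integral>\<^sup>+x. \<integral>\<^sup>+y. ?D x y \<partial>\<mu> \<partial>\<mu>) \<le> ennreal (\<epsilon>\<^sup>2) * ennreal ?m" unfolding tonelli .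
  have "ennreal ((?m * H.nrm w)\<^sup>2) = ennreal (?m\<^sup>2) * (\<integral>\<^sup>+x. ennreal ((cmod (w x))\<^sup>2) \<partial>\<mu>)"
    by (simp add: L2_nn_integral[OF w] power_mult_distrib ennreal_mult)
  also have "\<dots> = (\<integral>\<^sup>+x. ennreal (?m\<^sup>2) * ennreal ((cmod (w x))\<^sup>2) \<partial>\<mu>)"
    by (rule nn_integral_cmult[symmetric]) measurable
  also have "\<dots> = (\<integral>\<^sup>+x. ennreal ((?m * cmod (w x))\<^sup>2) \<partial>\<mu>)"
    by (rule nn_integral_cong) (simp add: power_mult_distrib ennreal_mult)
  also have "\<dots> \<le> (\<integral>\<^sup>+x. ennreal (2 * \<beta>\<^sup>2) + ennreal (2 * ?m) * (\<integral>\<^sup>+y. ?D x y \<partial>\<mu>) \<partial>\<mu>)"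
  proof (rule nn_integral_mono)
    fix x assume "x \<in> space \<mu>"
    then have x: "x \<in> X" by (simp add: space_mu)
    have "(cmod (L2_inner \<mu> (\<chi> V) (K V0 x w)))\<^sup>2 \<le> \<beta>\<^sup>2"
      by (rule power_mono[OF \<beta>(2)[OF x]]) simp
    then have "ennreal (2 * (cmod (L2_inner \<mu> (\<chi> V) (K V0 x w)))\<^sup>2) \<le> ennreal (2 * \<beta>\<^sup>2)"
      by (intro ennreal_leI) simp
    then show "ennreal ((?m * cmod (w x))\<^sup>2) \<le> ennreal (2 * \<beta>\<^sup>2) + ennreal (2 * ?m) * (\<integral>\<^sup>+y. ?D x y \<partial>\<mu>)"
      by (intro order_trans[OF average_pointwise[OF V(1,2) x w]] add_right_mono)
  qed
  also have "\<dots> = ennreal (2 * \<beta>\<^sup>2) + ennreal (2 * ?m) * (\<integral>\<^sup>+x. \<integral>\<^sup>+y. ?D x y \<partial>\<mu> \<partial>\<mu>)"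
    using Dm' emeasure_space_1 by (simp add: nn_integral_add nn_integral_cmult)
  also have "\<dots> \<le> ennreal (2 * \<beta>\<^sup>2) + ennreal (2 * ?m) * (ennreal (\<epsilon>\<^sup>2) * ennreal ?m)"
    by (intro add_left_mono mult_left_mono int) simp
  also have "\<dots> = ennreal (2 * \<beta>\<^sup>2 + 2 * ?m * (\<epsilon>\<^sup>2 * ?m))"
    by (simp add: ennreal_plus ennreal_mult)
  finally have "(?m * H.nrm w)\<^sup>2 \<le> 2 * \<beta>\<^sup>2 + 2 * ?m * (\<epsilon>\<^sup>2 * ?m)"
    by (subst (asm) ennreal_le_iff) simp_all
  also have "\<dots> \<le> (2 * (\<beta> + ?m * \<epsilon>))\<^sup>2"
  proof -
    have "0 \<le> \<beta> * (?m * \<epsilon>)" using \<beta>(1) \<epsilon>(1) m by simp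
    moreover have "0 \<le> \<beta>\<^sup>2" "0 \<le> (?m * \<epsilon>)\<^sup>2" by simp_all
    ultimately show ?thesis by (simp add: power2_eq_square algebra_simps)
  qed
  finally have "?m * H.nrm w \<le> 2 * (\<beta> + ?m * \<epsilon>)"
    by (rule power2_le_imp_le) (use \<beta>(1) \<epsilon>(1) m in simp)
  then show ?thesis using m by (simp add: field_simps)
qed

text \<open>An Arzela-Ascoli argument for the averages of the u n: they are bounded and
  equicontinuous in x, so their values on a finite set F, rounded to a finite grid, determine them
  up to a small error. By \<open>average_bound\<close>, close averages force close vectors.\<close>

theorem equicontinuous_totally_bounded:
  fixes u :: "nat \<Rightarrow> 'a set \<Rightarrow> complex"
  assumes u: "\<And>n. u n \<in> L2 \<mu>" and R: "\<And>n. H.nrm (u n) \<le> R"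
    and equi: "\<And>e. 0 < e \<Longrightarrow> \<exists>V. openin T V \<and> \<one> \<in> V \<and> (\<forall>b\<in>V. \<forall>n. H.nrm (U b (u n) - u n) \<le> e)"
    and e: "0 < e"
  shows "\<exists>D. finite D \<and> D \<subseteq> L2 \<mu> \<and> (\<forall>n. \<exists>d\<in>D. H.nrm (u n - d) < e)"
proof -
  have R0: "0 \<le> R" using R[of 0] H.nrm_nonneg[OF u[of 0]] by linarith
  have "0 < e / 8" using e by simp
  obtain V' where V': "openin T V'" "\<one> \<in> V'" "\<forall>b\<in>V'. \<forall>n. H.nrm (U b (u n) - u n) \<le> e / 8"
    using equi[OF \<open>0 < e / 8\<close>] by (elim exE conjE) (rule that)
  have "openin T (V' \<inter> V0)" "\<one> \<in> V' \<inter> V0" using V' V0 by (auto intro: openin_Int)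
  then obtain V where V: "openin T V" "\<one> \<in> V" "\<And>w. w \<in> V \<Longrightarrow> inv w \<in> V"
    "\<And>w w'. w \<in> V \<Longrightarrow> w' \<in> V \<Longrightarrow> w \<otimes> w' \<in> V' \<inter> V0" "V \<subseteq> V' \<inter> V0"
    by (rule symmetric_neighbourhood) (rule that)
  have VV0: "V \<subseteq> V0" using V(5) by blast
  let ?m = "measure \<mu> (q ` V)"
  have m: "0 < ?m" by (rule open_positive[OF q_open[OF V(1)], of "q \<one>"]) (use V(2) in blast)
  \<comment> \<open>Values with the same rounding differ by at most 2 \<eta>, and passing from F to
    all x costs another \<eta>. With e / 4 from two terms e / 8, the final bound is 2 (3 \<eta> / m
    + e / 4) = 3 e / 16 + e / 2 < e, where m is the measure of the image of V.\<close>
  define \<eta> where "\<eta> = ?m * e / 32"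
  have \<eta>: "0 < \<eta>" unfolding \<eta>_def using m e by simp
  define B where "B = sqrt C * (2 * R)"
  have B0: "0 \<le> B" unfolding B_def using C R0 by simp
  \<comment> \<open>\<open>B\<close> bounds the factor that multiplies the displacement of
    \<open>\<chi> V\<close>; the 1 avoids a division by 0.\<close>
  have "0 < \<eta> / (B + 1)" using \<eta> B0 by simp
  obtain W1 where W1: "openin T W1" "\<one> \<in> W1" "\<And>b. b \<in> W1 \<Longrightarrow> H.nrm (U b (\<chi> V) - \<chi> V) < \<eta> / (B + 1)"
    by (rule strong_continuity_neighbourhood[OF \<chi>_L2[OF V(1)] \<open>0 < \<eta> / (B + 1)\<close>]) (rule that)
  have "openin T (W1 \<inter> V)" "\<one> \<in> W1 \<inter> V" using W1 V by (auto intro: openin_Int)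
  then obtain W where W: "openin T W" "\<one> \<in> W" "\<And>w. w \<in> W \<Longrightarrow> inv w \<in> W"
    "\<And>w w'. w \<in> W \<Longrightarrow> w' \<in> W \<Longrightarrow> w \<otimes> w' \<in> W1 \<inter> V" "W \<subseteq> W1 \<inter> V"
    by (rule symmetric_neighbourhood) (rule that)
  have WG: "W \<subseteq> carrier G" using openin_subset[OF W(1)] topspace by simp
  obtain F where F: "finite F" "F \<subseteq> X" "X \<subseteq> (\<Union>x\<in>F. (\<lambda>v. v <# x) ` W)"
    by (rule finite_orbit_cover[OF W(1,2)]) (rule that)
  define a where "a n x = L2_inner \<mu> (\<chi> V) (K V0 x (u n))" for n x
  have KL: "K V0 x w \<in> L2 \<mu>" if "x \<in> X" "w \<in> L2 \<mu>" for x w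
    by (rule K_L2(1)[OF V0(1) order_refl that])
  define B' where "B' = H.nrm (\<chi> V) * (sqrt C * R)"
  have a_bound: "a n x \<in> cball 0 B'" if x: "x \<in> X" for n x
  proof -
    have "cmod (a n x) \<le> H.nrm (\<chi> V) * H.nrm (K V0 x (u n))"
      unfolding a_def by (rule H.cauchy_schwarz[OF \<chi>_L2[OF V(1)] KL[OF x u]])
    also have "\<dots> \<le> B'"
      unfolding B'_def
    proof (rule mult_left_mono[OF _ H.nrm_nonneg[OF \<chi>_L2[OF V(1)]]])
      have "sqrt C * H.nrm (u n) \<le> sqrt C * R" using R C by (intro mult_left_mono) simp_all
      then show "H.nrm (K V0 x (u n)) \<le> sqrt C * R" using K_L2(2)[OF V0(1) order_refl x u[of n]] by linarith
    qed
    finally show ?thesis by simp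
  qed
  have "compact (cball (0::complex) B')" by (rule compact_cball)
  then have "\<exists>Z. finite Z \<and> cball (0::complex) B' \<subseteq> (\<Union>z\<in>Z. ball z \<eta>)"
    unfolding compact_eq_totally_bounded using \<eta> by simp
  then obtain Z where Z: "finite Z" "cball (0::complex) B' \<subseteq> (\<Union>z\<in>Z. ball z \<eta>)"
    by (elim exE conjE) (rule that)
  have "\<forall>n x. \<exists>z. x \<in> X \<longrightarrow> z \<in> Z \<and> dist z (a n x) < \<eta>"
  proof (intro allI)
    fix n x
    show "\<exists>z. x \<in> X \<longrightarrow> z \<in> Z \<and> dist z (a n x) < \<eta>"
    proof (cases "x \<in> X")
      case True
      from subsetD[OF Z(2) a_bound[OF True]] show ?thesis by auto
    qed simp
  qed
  then obtain z where z: "\<And>n x. x \<in> X \<Longrightarrow> z n x \<in> Z" "\<And>n x. x \<in> X \<Longrightarrow> dist (z n x) (a n x) < \<eta>"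
    by metis
  \<comment> \<open>The rounded averages at the points of F. There are finitely many codes, and one
    index for each of them gives the net.\<close>
  define code where "code n = restrict (z n) F" for n
  have "range code \<subseteq> (F \<rightarrow>\<^sub>E Z)" unfolding code_def using z(1) F(2) by (auto simp: PiE_def)
  then have fin: "finite (range code)" using finite_PiE[OF F(1), of "\<lambda>_. Z"] Z(1) finite_subset by blast
  define r where "r c = (SOME n. code n = c)" for c
  have r: "code (r (code n)) = code n" for n unfolding r_def by (rule someI[of "\<lambda>k. code k = code n"]) simp
  have close: "H.nrm (u n - u (r (code n))) < e" for n
  proof -
    let ?k = "r (code n)"
    let ?w = "u n - u ?k"
    have w: "?w \<in> L2 \<mu>" by (rule H.minus_H[OF u u])
    have wn: "H.nrm ?w \<le> 2 * R"
      using H.nrm_triangle[OF u[of n] H.uminus_H[OF u[of ?k]]] H.nrm_uminus[OF u[of ?k]] R[of n] R[of ?k]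
      unfolding diff_conv_add_uminus by linarith
    have Kw: "sqrt C * H.nrm ?w \<le> B" unfolding B_def by (rule mult_left_mono[OF wn]) (use C in simp)
    have at: "cmod (L2_inner \<mu> (\<chi> V) (K V0 x ?w)) \<le> 2 * \<eta>" if x: "x \<in> F" for x
    proof -
      have xX: "x \<in> X" using x F(2) by blast
      have "z n x = z ?k x" using fun_cong[OF r[of n], of x] x by (simp add: code_def)
      then have "dist (a n x) (a ?k x) \<le> 2 * \<eta>"
        using z(2)[OF xX, of n] z(2)[OF xX, of ?k] dist_triangle3[of "a n x" "a ?k x" "z n x"] by simp
      moreover have "L2_inner \<mu> (\<chi> V) (K V0 x ?w) = a n x - a ?k x"
        unfolding K_diff a_def by (rule H.ip_diff2[OF KL[OF xX u] KL[OF xX u] \<chi>_L2[OF V(1)]])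
      ultimately show ?thesis by (simp add: dist_norm)
    qed
    have all: "cmod (L2_inner \<mu> (\<chi> V) (K V0 x ?w)) \<le> 3 * \<eta>" if x: "x \<in> X" for x
    proof -
      obtain x0 g where g: "x0 \<in> F" "g \<in> W" "x = g <# x0" using F(3) x by blast
      have x0: "x0 \<in> X" using g(1) F(2) by blast
      have gG: "g \<in> carrier G" using g(2) WG by blast
      have ig: "inv g \<in> W1" "inv g \<in> V" using W(3)[OF g(2)] W(5) by auto
      have "cmod (L2_inner \<mu> (\<chi> V) (K V0 x ?w) - L2_inner \<mu> (\<chi> V) (K V0 x0 ?w))
          \<le> H.nrm (U (inv g) (\<chi> V) - \<chi> V) * (sqrt C * H.nrm ?w)"
        unfolding g(3) by (rule average_continuity[OF V(1) VV0 gG _ x0 w]) (use V(4) ig(2) in blast)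
      also have "\<dots> \<le> (\<eta> / (B + 1)) * B"
        by (rule mult_mono[OF less_imp_le[OF W1(3)[OF ig(1)]] Kw])
          (use \<eta> B0 C H.nrm_nonneg[OF w] in simp_all)
      also have "\<dots> \<le> \<eta>" using \<eta> B0 by (simp add: field_simps)
      finally show ?thesis
        using at[OF g(1)] norm_triangle_sub[of "L2_inner \<mu> (\<chi> V) (K V0 x ?w)" "L2_inner \<mu> (\<chi> V) (K V0 x0 ?w)"]
        by linarith
    qed
    have "H.nrm (U b ?w - ?w) \<le> e / 4" if b: "b \<in> V" for b
    proof -
      have bG: "b \<in> carrier G" using b openin_subset[OF V(1)] topspace by blast
      have bV: "b \<in> V'" using b V(5) by blast
      have L: "U b (u n) - u n \<in> L2 \<mu>" "U b (u ?k) - u ?k \<in> L2 \<mu>"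
        by (intro H.minus_H U_L2 bG u)+
      have eq: "U b ?w - ?w = (U b (u n) - u n) + - (U b (u ?k) - u ?k)"
        unfolding U_diff[symmetric] by (simp add: algebra_simps)
      have "H.nrm (U b ?w - ?w) \<le> H.nrm (U b (u n) - u n) + H.nrm (U b (u ?k) - u ?k)"
        unfolding eq by (rule H.nrm_triangle[OF L(1) H.uminus_H[OF L(2)], unfolded H.nrm_uminus[OF L(2)]])
      then show ?thesis using V'(3)[rule_format, OF bV, of n] V'(3)[rule_format, OF bV, of ?k] by linarith
    qed
    then have "H.nrm ?w \<le> 2 * (3 * \<eta> / ?m + e / 4)"
      using \<eta> e by (intro average_bound[OF V(1) VV0 V(2) w] all) simp_all
    also have "\<dots> = 3 * e / 16 + e / 2" unfolding \<eta>_def using m by (simp add: field_simps)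
    also have "\<dots> < e" using e by simp
    finally show ?thesis .
  qed
  show ?thesis
  proof (intro exI[of _ "(\<lambda>c. u (r c)) ` range code"] conjI allI)
    show "finite ((\<lambda>c. u (r c)) ` range code)" using fin by (rule finite_imageI)
    show "(\<lambda>c. u (r c)) ` range code \<subseteq> L2 \<mu>" using u by blast
    show "\<exists>d\<in>(\<lambda>c. u (r c)) ` range code. H.nrm (u n - d) < e" for n
      using close[of n] by blast
  qed
qed

end

theorem (in nil_space) equicontinuous_precompact:
  fixes u :: "nat \<Rightarrow> 'a set \<Rightarrow> complex"
  assumes u: "\<And>n. u n \<in> L2 \<mu>" and R: "\<And>n. H.nrm (u n) \<le> R"
    and equi: "\<And>e. 0 < e \<Longrightarrow> \<exists>V. openin T V \<and> \<one> \<in> V \<and> (\<forall>b\<in>V. \<forall>n. H.nrm (U b (u n) - u n) \<le> e)"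
    and e: "0 < e"
  shows "\<exists>D. finite D \<and> D \<subseteq> L2 \<mu> \<and> (\<forall>n. \<exists>d\<in>D. H.nrm (u n - d) < e)"
proof -
  obtain V1 where V1: "openin T V1" "\<one> \<in> V1" "inj_on q V1" by (rule injective_neighbourhood)
  interpret nil_section G T \<mu> \<Gamma> V1 by unfold_locales (rule V1)+
  obtain V0 C where V0: "openin T V0" "\<one> \<in> V0" "V0 \<subseteq> V1" "0 \<le> C"
    "\<And>h x. h \<in> borel_measurable \<mu> \<Longrightarrow> x \<in> X \<Longrightarrow>
      (\<integral>\<^sup>+y. indicator (q ` V0) y * h (\<Psi> y x) \<partial>\<mu>) \<le> ennreal C * (\<integral>\<^sup>+x. h x \<partial>\<mu>)"
    by (rule domination) (rule that)
  interpret nil_kernel G T \<mu> \<Gamma> V1 V0 C by unfold_locales (rule V0, assumption?)+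
  show ?thesis by (rule equicontinuous_totally_bounded[OF u R equi e])
qed

section \<open>Stabilizers of weak limits and the conclusion\<close>

section \<open>The stabilizer of a weak limit\<close>

context nil_space
begin

text \<open>A length function on G. It is subadditive, so the closure properties of the stabilizer
  reduce to triangle inequalities.\<close>

definition disp :: "('a set \<Rightarrow> complex) \<Rightarrow> 'a \<Rightarrow> real" where
  "disp v g = H.nrm (U g v - v)"

definition stab :: "('a set \<Rightarrow> complex) \<Rightarrow> 'a set" where
  "stab v = {g \<in> carrier G. disp v g = 0}"

lemma disp_nonneg: "v \<in> L2 \<mu> \<Longrightarrow> g \<in> carrier G \<Longrightarrow> 0 \<le> disp v g"
  unfolding disp_def by (intro H.nrm_nonneg H.minus_H U_L2)

lemma disp_one: "v \<in> L2 \<mu> \<Longrightarrow> disp v \<one> = 0"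
  unfolding disp_def by (rule U_one_nrm)

lemma disp_mult:
  assumes v: "v \<in> L2 \<mu>" and g: "g \<in> carrier G" and h: "h \<in> carrier G"
  shows "disp v (g \<otimes> h) \<le> disp v g + disp v h"
proof -
  have L: "U g (U h v) \<in> L2 \<mu>" "U g v \<in> L2 \<mu>" "U h v \<in> L2 \<mu>" by (intro U_L2 g h v)+
  have "disp v (g \<otimes> h) \<le> H.nrm (U g (U h v) - U g v) + H.nrm (U g v - v)"
    unfolding disp_def U_mult[OF g h] by (rule H.nrm_triangle3[OF L(1,2) v])
  also have "H.nrm (U g (U h v) - U g v) = H.nrm (U h v - v)"
    unfolding U_diff by (rule U_nrm[OF g H.minus_H[OF L(3) v]])
  finally show ?thesis unfolding disp_def by linarith
qed

lemma disp_inv_le: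
  assumes v: "v \<in> L2 \<mu>" and g: "g \<in> carrier G"
  shows "disp v (inv g) \<le> disp v g"
proof -
  have L: "U \<one> v \<in> L2 \<mu>" "U g v \<in> L2 \<mu>" by (intro U_L2 g v one_closed)+
  have "disp v (inv g) = H.nrm (U \<one> v - U g v)"
    using U_nrm_translate[OF one_closed g v] g unfolding disp_def by simp
  also have "\<dots> \<le> H.nrm (U \<one> v - v) + H.nrm (v - U g v)"
    by (rule H.nrm_triangle3[OF L(1) v L(2)])
  also have "H.nrm (v - U g v) = disp v g"
    unfolding disp_def by (rule H.nrm_minus_commute[OF v L(2)])
  finally show ?thesis unfolding U_one_nrm[OF v] by linarith
qed

lemma disp_tendsto:
  assumes v: "v \<in> L2 \<mu>" and g: "limitin T g \<one> sequentially" "\<And>n. g n \<in> carrier G"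
  shows "(\<lambda>n. disp v (g n)) \<longlonglongrightarrow> 0"
  using strong_continuity[OF v] g unfolding strongly_continuous_def disp_def by blast

text \<open>Write x = y n (inv (y n) x); the second factor tends to the identity.\<close>

lemma disp_limit_0:
  assumes v: "v \<in> L2 \<mu>" and y: "limitin T y x sequentially" "\<And>n. y n \<in> carrier G"
    and d: "(\<lambda>n. disp v (y n)) \<longlonglongrightarrow> 0"
  shows "x \<in> stab v"
proof -
  have x: "x \<in> carrier G" by (rule limit_carrier[OF y(1)])
  have "limitin T (\<lambda>n. inv (y n) \<otimes> x) (inv x \<otimes> x) sequentially"
    by (intro limit_mult limit_inv y limit_const x)
  then have "limitin T (\<lambda>n. inv (y n) \<otimes> x) \<one> sequentially" using x by simp
  then have "(\<lambda>n. disp v (inv (y n) \<otimes> x)) \<longlonglongrightarrow> 0"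
    by (rule disp_tendsto[OF v]) (use x y in simp)
  from tendsto_add[OF d this] have lim: "(\<lambda>n. disp v (y n) + disp v (inv (y n) \<otimes> x)) \<longlonglongrightarrow> 0" by simp
  have "disp v x \<le> disp v (y n) + disp v (inv (y n) \<otimes> x)" for n
  proof -
    have "y n \<otimes> (inv (y n) \<otimes> x) = x" using x y(2)[of n] by (simp flip: m_assoc)
    then show ?thesis using disp_mult[OF v y(2)[of n], of "inv (y n) \<otimes> x"] x y(2)[of n] by simp
  qed
  then have "disp v x \<le> 0" by (intro LIMSEQ_le_const[OF lim]) blast
  then show ?thesis using disp_nonneg[OF v x] x by (simp add: stab_def)
qed

lemma stab_subgroup:
  assumes v: "v \<in> L2 \<mu>"
  shows "subgroup (stab v) G"
proof (rule subgroupI)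
  show "stab v \<subseteq> carrier G" by (auto simp: stab_def)
  show "stab v \<noteq> {}" using disp_one[OF v] by (auto simp: stab_def)
  show "inv g \<in> stab v" if "g \<in> stab v" for g
    using that disp_inv_le[OF v, of g] disp_nonneg[OF v, of "inv g"] by (simp add: stab_def)
  show "g \<otimes> h \<in> stab v" if "g \<in> stab v" "h \<in> stab v" for g h
    using that disp_mult[OF v, of g h] disp_nonneg[OF v, of "g \<otimes> h"] by (simp add: stab_def)
qed

lemma stab_closed:
  assumes v: "v \<in> L2 \<mu>" and s: "\<And>n. s n \<in> stab v" "limitin T s x sequentially"
  shows "x \<in> stab v"
  by (rule disp_limit_0[OF v s(2)]) (use s(1) in \<open>simp_all add: stab_def\<close>)

text \<open>Solved for y n, the equation writes it as b n, its inverse and elements of the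
  stabilizer, so it displaces v at most twice as far as b n does.\<close>

lemma stab_mautner:
  assumes v: "v \<in> L2 \<mu>" and b: "limitin T b \<one> sequentially" "\<And>n. b n \<in> carrier G"
    and s: "\<And>n. s n \<in> stab v" "\<And>n. s' n \<in> stab v"
    and eq: "\<And>n. b n \<otimes> s n \<otimes> inv (b n) = y n \<otimes> s' n"
    and y: "\<And>n. y n \<in> carrier G" "limitin T y x sequentially"
  shows "x \<in> stab v"
proof (rule disp_limit_0[OF v y(2,1)])
  have sG: "s n \<in> carrier G" "s' n \<in> carrier G" "disp v (s n) = 0" "disp v (s' n) = 0" for n
    using s by (simp_all add: stab_def)
  have le: "disp v (y n) \<le> 2 * disp v (b n)" for n
  proof -
    have "y n = (y n \<otimes> s' n) \<otimes> inv (s' n)" using y(1) sG by (simp add: m_assoc)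
    then have yn: "y n = b n \<otimes> s n \<otimes> inv (b n) \<otimes> inv (s' n)" using eq by simp
    have "disp v (y n) \<le> disp v (b n \<otimes> s n \<otimes> inv (b n)) + disp v (inv (s' n))"
      unfolding yn by (intro disp_mult v m_closed inv_closed b(2) sG)
    also have "disp v (b n \<otimes> s n \<otimes> inv (b n)) \<le> disp v (b n \<otimes> s n) + disp v (inv (b n))"
      by (intro disp_mult v m_closed inv_closed b(2) sG)
    also have "disp v (b n \<otimes> s n) \<le> disp v (b n) + disp v (s n)"
      by (intro disp_mult v b(2) sG)
    finally show ?thesis
      using disp_inv_le[OF v b(2), of n] disp_inv_le[OF v sG(2), of n] sG(3,4)[of n] by simp
  qed
  have "(\<lambda>n. 2 * disp v (b n)) \<longlonglongrightarrow> 0"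
    using tendsto_mult_left[OF disp_tendsto[OF v b], of 2] by simp
  then show "(\<lambda>n. disp v (y n)) \<longlonglongrightarrow> 0"
    by (rule tendsto_sandwich[OF _ _ tendsto_const, rotated 2]) (use le disp_nonneg[OF v y(1)] in simp_all)
qed

end

locale weak_orbit_limit = nil_space + mean_filter +
  fixes \<alpha> :: 'a and f v :: "'a set \<Rightarrow> complex" and k :: nat
  assumes nilpotent: "nilpotent_step k G" and \<alpha>: "\<alpha> \<in> carrier G" and f: "f \<in> L2 \<mu>" and v: "v \<in> L2 \<mu>"
    and weak: "y \<in> L2 \<mu> \<Longrightarrow> ((\<lambda>n. L2_inner \<mu> (U (\<alpha> [^] n) f) y) \<longlongrightarrow> L2_inner \<mu> v y) F"
begin

lemma pow_G: "\<alpha> [^] (n::nat) \<in> carrier G"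
  using \<alpha> by simp

text \<open>If \<open>s\<^sub>n y\<^sub>n\<close> with \<open>s\<^sub>n\<close> in the stabilizer moves \<open>\<alpha>\<^sup>n f\<close> little, then
  \<open>\<langle>\<alpha>\<^sup>n f, v\<rangle>\<close> is close to \<open>\<langle>\<alpha>\<^sup>n f, y\<^sub>n\<^sup>-\<^sup>1 v\<rangle>\<close>, and in the limit \<open>\<langle>v, v\<rangle> = \<langle>v, x\<^sup>-\<^sup>1 v\<rangle>\<close>.\<close>

lemma stab_contraction:
  assumes b: "limitin T b \<one> sequentially" "\<And>n. b n \<in> carrier G"
    and s: "\<And>n. s n \<in> stab v"
    and eq: "\<And>n. \<alpha> [^] n \<otimes> b n \<otimes> inv (\<alpha> [^] n) = s n \<otimes> y n"
    and y: "\<And>n. y n \<in> carrier G" "limitin T y x sequentially"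
  shows "x \<in> stab v"
proof -
  have x: "x \<in> carrier G" by (rule limit_carrier[OF y(2)])
  have sG: "s n \<in> carrier G" "disp v (s n) = 0" for n using s by (simp_all add: stab_def)
  have xL: "U (inv x) v \<in> L2 \<mu>" by (intro U_L2 inv_closed x v)
  let ?z = "\<lambda>n :: nat. U (\<alpha> [^] n) f"
  have z: "?z n \<in> L2 \<mu>" for n by (intro U_L2 pow_G f)
  have le: "cmod (L2_inner \<mu> (?z n) v - L2_inner \<mu> (?z n) (U (inv x) v))
      \<le> disp f (b n) * H.nrm v + H.nrm f * disp v (x \<otimes> inv (y n))" for n
  proof -
    let ?p = "s n \<otimes> y n"
    have p: "?p \<in> carrier G" "inv ?p \<in> carrier G" using sG y(1) by simp_all
    have pz: "U ?p (?z n) \<in> L2 \<mu>" by (intro U_L2 p z)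
    have pv: "U (inv ?p) v \<in> L2 \<mu>" by (intro U_L2 p v)
    \<comment> \<open>Since \<open>?p\<close> is the conjugate of b n by \<alpha>^n, it moves the
      n-th orbit point of f exactly as far as b n moves f.\<close>
    have "?p \<otimes> \<alpha> [^] n = \<alpha> [^] n \<otimes> b n"
      unfolding eq[symmetric] using pow_G b(2) by (simp add: m_assoc)
    then have "U ?p (?z n) = U (\<alpha> [^] n) (U (b n) f)"
      using U_mult[OF p(1) pow_G, of n f] U_mult[OF pow_G b(2), of n n f] by simp
    then have e: "U ?p (?z n) - ?z n = U (\<alpha> [^] n) (U (b n) f - f)" by (simp only: U_diff)
    have bL: "U (b n) f - f \<in> L2 \<mu>" by (intro H.minus_H U_L2 b(2) f)
    have "H.nrm (U ?p (?z n) - ?z n) = disp f (b n)"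
      unfolding e disp_def by (rule U_nrm[OF pow_G bL])
    then have "H.nrm (?z n - U ?p (?z n)) = disp f (b n)"
      using H.nrm_minus_commute[OF z pz] by simp
    then have 1: "cmod (L2_inner \<mu> (?z n) v - L2_inner \<mu> (U ?p (?z n)) v) \<le> disp f (b n) * H.nrm v"
      using H.cauchy_schwarz[OF H.minus_H[OF z[of n] pz] v] unfolding H.ip_diff[OF z[of n] pz v] by simp
    \<comment> \<open>The factor s n fixes v up to a null vector, so the distance between the images
      of v under \<open>inv ?p\<close> and \<open>inv x\<close> is governed by x (y n)^-1, which
      tends to the identity.\<close>
    have "inv (inv x) \<otimes> inv ?p = (x \<otimes> inv (y n)) \<otimes> inv (s n)"
      using x y(1) sG by (simp add: inv_mult_group m_assoc)
    then have "H.nrm (U (inv ?p) v - U (inv x) v) = disp v ((x \<otimes> inv (y n)) \<otimes> inv (s n))"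
      using U_nrm_translate[OF p(2) inv_closed[OF x] v] unfolding disp_def by simp
    also have "\<dots> \<le> disp v (x \<otimes> inv (y n)) + disp v (inv (s n))"
      by (intro disp_mult v m_closed inv_closed x y(1) sG(1))
    finally have 2: "H.nrm (U (inv ?p) v - U (inv x) v) \<le> disp v (x \<otimes> inv (y n))"
      using disp_inv_le[OF v sG(1), of n] sG(2)[of n] by simp
    have "L2_inner \<mu> (U ?p (?z n)) v = L2_inner \<mu> (?z n) (U (inv ?p) v)"
      by (rule U_adjoint[OF p(1) z v])
    then have "cmod (L2_inner \<mu> (U ?p (?z n)) v - L2_inner \<mu> (?z n) (U (inv x) v))
        = cmod (L2_inner \<mu> (?z n) (U (inv ?p) v - U (inv x) v))"
      by (simp only: H.ip_diff2[OF pv xL z])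
    also have "\<dots> \<le> H.nrm (?z n) * H.nrm (U (inv ?p) v - U (inv x) v)"
      by (rule H.cauchy_schwarz[OF z H.minus_H[OF pv xL]])
    also have "\<dots> \<le> H.nrm (?z n) * disp v (x \<otimes> inv (y n))"
      by (rule mult_left_mono[OF 2 H.nrm_nonneg[OF z]])
    also have "H.nrm (?z n) = H.nrm f" by (rule U_nrm[OF pow_G f])
    finally show ?thesis
      using 1 norm_triangle_ineq[of "L2_inner \<mu> (?z n) v - L2_inner \<mu> (U ?p (?z n)) v"
        "L2_inner \<mu> (U ?p (?z n)) v - L2_inner \<mu> (?z n) (U (inv x) v)"] by simp
  qed
  have "limitin T (\<lambda>n. x \<otimes> inv (y n)) (x \<otimes> inv x) sequentially"
    by (intro limit_mult limit_inv y limit_const x)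
  then have "limitin T (\<lambda>n. x \<otimes> inv (y n)) \<one> sequentially" using x by simp
  then have d: "(\<lambda>n. disp v (x \<otimes> inv (y n))) \<longlonglongrightarrow> 0"
    by (rule disp_tendsto[OF v]) (use x y in simp)
  have "(\<lambda>n. disp f (b n) * H.nrm v + H.nrm f * disp v (x \<otimes> inv (y n))) \<longlonglongrightarrow> 0 * H.nrm v + H.nrm f * 0"
    by (intro tendsto_intros d disp_tendsto[OF f b])
  then have "(\<lambda>n. disp f (b n) * H.nrm v + H.nrm f * disp v (x \<otimes> inv (y n))) \<longlonglongrightarrow> 0" by simp
  then have "(\<lambda>n. L2_inner \<mu> (?z n) v - L2_inner \<mu> (?z n) (U (inv x) v)) \<longlonglongrightarrow> 0"
    by (rule Lim_null_comparison[rotated]) (use le in simp)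
  then have 3: "((\<lambda>n. L2_inner \<mu> (?z n) v - L2_inner \<mu> (?z n) (U (inv x) v)) \<longlongrightarrow> 0) F"
    by (rule tendsto_mono[OF le_seq])
  have "L2_inner \<mu> v v - L2_inner \<mu> v (U (inv x) v) = 0"
    by (rule tendsto_unique[OF nb tendsto_diff[OF weak[OF v] weak[OF xL]] 3])
  then have vx: "L2_inner \<mu> v (U (inv x) v) = L2_inner \<mu> v v" by simp
  \<comment> \<open>The equality case of Cauchy-Schwarz for two vectors of equal norm.\<close>
  have "(H.nrm (v - U (inv x) v))\<^sup>2 = (H.nrm v)\<^sup>2 - 2 * Re (L2_inner \<mu> v (U (inv x) v)) + (H.nrm (U (inv x) v))\<^sup>2"
    using H.nrm_sq_diff_sc[OF v xL, of 1] by simp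
  also have "\<dots> = 0" unfolding vx U_nrm[OF inv_closed[OF x] v] H.nrm_sq[OF v] by simp
  finally have "H.nrm (v - U (inv x) v) = 0" by simp
  then have "disp v (inv x) = 0" unfolding disp_def using H.nrm_minus_commute[OF v xL] by simp
  then have "inv x \<in> stab v" using x by (simp add: stab_def)
  from subgroup.m_inv_closed[OF stab_subgroup[OF v] this] show ?thesis using x by simp
qed

text \<open>The displacement of \<alpha>^n v by b is that of v by the conjugate of b by \<alpha>^-n.
  This conjugate is b s with s in the stabilizer, so b displaces every \<alpha>^n v at most as far
  as v.\<close>

lemma equicontinuous_orbit:
  assumes V: "openin T V" "\<one> \<in> V"
    "\<And>b n. b \<in> V \<Longrightarrow> inv b \<otimes> (inv (\<alpha> [^] (n::nat)) \<otimes> b \<otimes> \<alpha> [^] n) \<in> stab v"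
    and e: "0 < e"
  shows "\<exists>D. finite D \<and> D \<subseteq> L2 \<mu> \<and> (\<forall>n :: nat. \<exists>d\<in>D. H.nrm (U (\<alpha> [^] n) v - d) < e)"
proof (rule equicontinuous_precompact[OF _ _ _ e])
  show "U (\<alpha> [^] n) v \<in> L2 \<mu>" for n :: nat by (intro U_L2 pow_G v)
  show "H.nrm (U (\<alpha> [^] n) v) \<le> H.nrm v" for n :: nat using U_nrm[OF pow_G v, of n] by simp
  fix e' :: real assume "0 < e'"
  obtain W where W: "openin T W" "\<one> \<in> W" "\<And>b. b \<in> W \<Longrightarrow> H.nrm (U b v - v) < e'"
    by (rule strong_continuity_neighbourhood[OF v \<open>0 < e'\<close>]) (rule that)
  have "H.nrm (U b (U (\<alpha> [^] n) v) - U (\<alpha> [^] n) v) \<le> e'" if b: "b \<in> V \<inter> W" for b and n :: nat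
  proof -
    have bG: "b \<in> carrier G" using b openin_subset[OF W(1)] topspace by blast
    let ?s = "inv b \<otimes> (inv (\<alpha> [^] n) \<otimes> b \<otimes> \<alpha> [^] n)"
    have s: "?s \<in> carrier G" "disp v ?s = 0" using V(3)[of b n] b by (simp_all add: stab_def)
    have eq: "inv (\<alpha> [^] n) \<otimes> (b \<otimes> \<alpha> [^] n) = b \<otimes> ?s"
      using bG pow_G[of n] by (simp add: m_assoc[symmetric])
    have "H.nrm (U b (U (\<alpha> [^] n) v) - U (\<alpha> [^] n) v) = disp v (inv (\<alpha> [^] n) \<otimes> (b \<otimes> \<alpha> [^] n))"
      unfolding U_mult[OF bG pow_G, symmetric] disp_def
      by (rule U_nrm_translate[OF m_closed[OF bG pow_G] pow_G v])
    also have "\<dots> \<le> disp v b + disp v ?s" unfolding eq by (rule disp_mult[OF v bG s(1)])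
    also have "\<dots> \<le> e'" using W(3)[of b] b s(2) unfolding disp_def by simp
    finally show ?thesis .
  qed
  then show "\<exists>V. openin T V \<and> \<one> \<in> V \<and> (\<forall>b\<in>V. \<forall>n :: nat. H.nrm (U b (U (\<alpha> [^] n) v) - U (\<alpha> [^] n) v) \<le> e')"
    using V(1,2) W(1,2) by (intro exI[of _ "V \<inter> W"]) (auto intro: openin_Int)
qed

lemma unitary: "unitary_op (L2 \<mu>) (\<lambda>c f x. c * f x) (L2_inner \<mu>) (U \<alpha>) (U (inv \<alpha>))"
  by unfold_locales (rule U_L2 U_adjoint U_inner inv_closed \<alpha> L2_measurable, (assumption | rule U_L2 inv_closed \<alpha> L2_measurable)+)+

text \<open>At n = 0 the two sides are h and \<open>U \<one> h\<close>, which agree only almost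
  everywhere.\<close>

lemma pow_U: "n \<noteq> 0 \<Longrightarrow> (U \<alpha> ^^ n) h = U (\<alpha> [^] n) h"
proof (induction n)
  case (Suc n)
  show ?case
  proof (cases "n = 0")
    case True
    then show ?thesis using \<alpha> by simp
  next
    case False
    then show ?thesis using Suc U_mult[OF \<alpha> pow_G, of n h] nat_pow_Suc2[OF \<alpha>, of n] by simp
  qed
qed simp

lemma null_limit:
  assumes V: "openin T V" "\<one> \<in> V"
    "\<And>b n. b \<in> V \<Longrightarrow> inv b \<otimes> (inv (\<alpha> [^] (n::nat)) \<otimes> b \<otimes> \<alpha> [^] n) \<in> stab v"
    and perp: "f \<in> unitary_op.E_perp (L2 \<mu>) (\<lambda>c f x. c * f x) (L2_inner \<mu>) (U \<alpha>)"
  shows "H.nrm v = 0"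
proof -
  interpret O: unitary_op "L2 \<mu>" "\<lambda>c f x. c * f x" "L2_inner \<mu>" "U \<alpha>" "U (inv \<alpha>)" by (rule unitary)
  interpret P: precompact_orbit "L2 \<mu>" "\<lambda>c f x. c * f x" "L2_inner \<mu>" "U \<alpha>" "U (inv \<alpha>)" F v
  proof (unfold_locales, rule v)
    fix e :: real assume e: "0 < e"
    have "\<exists>D. finite D \<and> D \<subseteq> L2 \<mu> \<and> (\<forall>n::nat. \<exists>d\<in>D. H.nrm (U (\<alpha> [^] n) v - d) < e)"
      by (rule equicontinuous_orbit[OF V(1,2) _ e]) (rule V(3))
    then obtain D where D: "finite D" "D \<subseteq> L2 \<mu>" "\<forall>n::nat. \<exists>d\<in>D. H.nrm (U (\<alpha> [^] n) v - d) < e"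
      by (elim exE conjE) (rule that)
    \<comment> \<open>The vector v is added to the net for the power 0, which \<open>pow_U\<close>
      does not cover.\<close>
    have "\<exists>d\<in>insert v D. H.nrm ((U \<alpha> ^^ n) v - d) < e" for n
    proof (cases "n = 0")
      case True
      have "H.nrm (v - v) < e" using e H.nrm_zero by simp
      then show ?thesis using True by simp
    next
      case False
      show ?thesis using D(3) unfolding pow_U[OF False] by blast
    qed
    then show "\<exists>D. finite D \<and> D \<subseteq> L2 \<mu> \<and> (\<forall>n. \<exists>d\<in>D. H.nrm ((U \<alpha> ^^ n) v - d) < e)"
      using D(1,2) v by (intro exI[of _ "insert v D"]) simp
  qed
  have "U (\<alpha> [^] n) f \<in> O.E_perp" for n :: nat
  proof (induction n)
    case 0
    have "L2_inner \<mu> (U \<one> f) h = 0" if h: "O.eigen c h" for c h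
    proof -
      have "h \<in> L2 \<mu>" using h by (simp add: O.eigen_def)
      then have "L2_inner \<mu> (U \<one> f) h = L2_inner \<mu> f h"
        by (rule H.ip_cong_nrm_0[OF U_L2[OF one_closed f] f _ U_one_nrm[OF f]])
      then show ?thesis using O.E_perpD[OF perp h] by simp
    qed
    then show ?case by (intro O.E_perpI) (simp_all add: U_L2 f)
  next
    case (Suc n)
    then show ?case
      unfolding nat_pow_Suc2[OF \<alpha>] U_mult[OF \<alpha> pow_G] by (rule O.E_perp_V)
  qed
  then have "v \<in> O.E_perp"
    by (rule P.weak_limit_E_perp[OF _ v weak])
  then show ?thesis by (rule P.orbit_null)
qed

end

theorem theorem1p6:
  fixes G :: "('g, 'm) monoid_scheme"
    and T :: "'g topology"
    and A :: "('g set \<times> ('g \<Rightarrow> 'e::euclidean_space)) set"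
    and \<Gamma> :: "'g set"
    and \<mu> :: "'g set measure"
    and a :: 'g
    and k :: nat
    and f :: "'g set \<Rightarrow> complex"
  assumes "k \<ge> 1"
    and "lie_group G T A"
    and "nilpotent_step k G"
    and "subgroup \<Gamma> G"
    and "subtopology T \<Gamma> = discrete_topology \<Gamma>"
    and "compact_space (lcoset_topology G T \<Gamma>)"
    and "haar_on_lcosets G T \<Gamma> \<mu>"
    and "a \<in> carrier G"
    and "ergodic_translation G \<mu> a"
    and "f \<in> L_infinity \<mu>"
    and "\<And>h. h \<in> complex_span (eigenfunctions G \<mu> a) \<Longrightarrow> L2_inner \<mu> f h = 0"
  shows "(\<lambda>n. \<integral>x. (koopman G a ^^ n) f x * cnj (f x) \<partial>\<mu>) \<longlonglongrightarrow> 0"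
proof (rule ccontr)
  note lie = assms(2) and nil = assms(3) and haar = assms(7) and a = assms(8) and perp = assms(11)
  let ?c = "\<lambda>n. \<integral>x. (koopman G a ^^ n) f x * cnj (f x) \<partial>\<mu>"
  assume not_lim: "\<not> ?c \<longlonglongrightarrow> 0"
  interpret top_group G T by (rule lie_group_top_group[OF lie])
  interpret prob_space \<mu> using haar by (simp add: haar_on_lcosets_def)
  interpret nil_space G T \<mu> \<Gamma>
  proof (intro nil_space.intro nil_space_axioms.intro)
    show "top_group G T" "prob_space \<mu>" by unfold_locales
    show "second_countable T" using lie by (simp add: lie_group_def)
    show "sets \<mu> = sets (borel_of (lcoset_topology G T \<Gamma>))" using haar by (simp add: haar_on_lcosets_def)
    show "distr \<mu> \<mu> (\<lambda>x. g <#\<^bsub>G\<^esub> x) = \<mu>" if "g \<in> carrier G" for g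
      using haar that by (simp add: haar_on_lcosets_def)
  qed (rule assms)+
  \<comment> \<open>\<open>U g\<close> translates the argument by inv g, so the powers of the
    Koopman operator are \<open>U\<close> at the powers of inv a.\<close>
  define \<alpha> where "\<alpha> = inv\<^bsub>G\<^esub> a"
  have \<alpha>_G: "\<alpha> \<in> carrier G" "inv\<^bsub>G\<^esub> \<alpha> = a" using a by (simp_all add: \<alpha>_def)
  have f: "f \<in> L2 \<mu>"
  proof -
    obtain C where C: "f \<in> borel_measurable \<mu>" "AE x in \<mu>. cmod (f x) \<le> C"
      using assms(10) by (auto simp: L_infinity_def)
    have "AE x in \<mu>. cmod (f x) \<le> max C 0" using C(2) by eventually_elim simp
    from L2_bounded(1)[OF C(1) _ this] show ?thesis by simp
  qed
  have pow: "(koopman G a ^^ n) f x = f (a [^]\<^bsub>G\<^esub> n <#\<^bsub>G\<^esub> x)" if "x \<in> X" for n x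
    using that
  proof (induction n arbitrary: x)
    case 0
    then show ?case by (simp add: act_one)
  next
    case (Suc n)
    then show ?case using a by (simp add: koopman_def act_X act_act)
  qed
  have inv_pow: "inv\<^bsub>G\<^esub> (\<alpha> [^]\<^bsub>G\<^esub> n) = a [^]\<^bsub>G\<^esub> n" for n :: nat
    using nat_pow_inv[OF \<alpha>_G(1), of n] \<alpha>_G(2) by simp
  have c: "?c n = L2_inner \<mu> (U (\<alpha> [^]\<^bsub>G\<^esub> n) f) f" for n
    unfolding L2_inner_def
    by (rule Bochner_Integration.integral_cong) (simp_all add: U_def space_mu pow inv_pow)
  obtain e where e: "0 < e" "\<exists>\<^sub>F n in sequentially. e \<le> cmod (?c n)"
    using not_lim unfolding tendsto_iff by (auto simp: not_eventually not_less)
  \<comment> \<open>The ultrafilter is taken inside this set of indices, so that the correlations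
    cannot tend to 0 along it.\<close>
  let ?P = "{n. e \<le> cmod (?c n)}"
  have "inf sequentially (principal ?P) \<noteq> bot"
    using e(2) unfolding trivial_limit_def eventually_inf_principal frequently_def by simp
  then obtain F where F: "F \<le> inf sequentially (principal ?P)" "universal_filter F"
    by (rule universal_filter_exists)
  have F1: "F \<le> sequentially" "F \<le> principal ?P" using F(1) by simp_all
  let ?z = "\<lambda>n. U (\<alpha> [^]\<^bsub>G\<^esub> n) f"
  have z: "?z n \<in> L2 \<mu>" "H.nrm (?z n) \<le> H.nrm f" for n :: nat
    using U_L2[OF _ f] U_nrm[OF _ f] \<alpha>_G(1) by simp_all
  obtain v where v: "v \<in> L2 \<mu>" "\<And>y. y \<in> L2 \<mu> \<Longrightarrow> ((\<lambda>n. L2_inner \<mu> (?z n) y) \<longlongrightarrow> L2_inner \<mu> v y) F"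
    by (rule H.weak_limit[where X = ?z, OF F(2) z]) (rule that)
  interpret weak_orbit_limit G T \<mu> \<Gamma> F \<alpha> f v k
    by unfold_locales ((rule F(2) F1(1) nil \<alpha>_G(1) f v(1))+, rule v(2))
  obtain V where V: "openin T V" "\<one>\<^bsub>G\<^esub> \<in> V" "\<And>b n. b \<in> V \<Longrightarrow>
      inv\<^bsub>G\<^esub> b \<otimes>\<^bsub>G\<^esub> (inv\<^bsub>G\<^esub> (\<alpha> [^]\<^bsub>G\<^esub> (n::nat)) \<otimes>\<^bsub>G\<^esub> b \<otimes>\<^bsub>G\<^esub> \<alpha> [^]\<^bsub>G\<^esub> n) \<in> stab v"
  \<comment> \<open>In the discrete case the identity alone is an open set, and its conjugates are
    trivial; otherwise there is a chart at the identity.\<close>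
  proof (cases "T = discrete_topology (carrier G)")
    case True
    show ?thesis
    proof (rule that[of "{\<one>\<^bsub>G\<^esub>}"])
      show "openin T {\<one>\<^bsub>G\<^esub>}" unfolding True by simp
      fix b and n :: nat assume "b \<in> {\<one>\<^bsub>G\<^esub>}"
      then show "inv\<^bsub>G\<^esub> b \<otimes>\<^bsub>G\<^esub> (inv\<^bsub>G\<^esub> (\<alpha> [^]\<^bsub>G\<^esub> n) \<otimes>\<^bsub>G\<^esub> b \<otimes>\<^bsub>G\<^esub> \<alpha> [^]\<^bsub>G\<^esub> n) \<in> stab v"
        using \<alpha>_G(1) disp_one[OF v(1)] by (simp add: stab_def)
    qed simp
  next
    case False
    obtain W \<phi> r C where chart: "chart_group G T W (\<phi> :: 'g \<Rightarrow> 'e) r C"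
      by (rule lie_group_chart[OF lie False]) (rule that)
    have "mautner_subgroup_axioms G T (stab v) \<alpha> k"
    proof (rule mautner_subgroup_axioms.intro)
      show "nilpotent_step k G" "\<alpha> \<in> carrier G" "subgroup (stab v) G"
        by (rule nil \<alpha>_G(1) stab_subgroup[OF v(1)])+
    qed (rule stab_closed[OF v(1)] stab_mautner[OF v(1)] stab_contraction; assumption)+
    with chart have ms: "mautner_subgroup G T W \<phi> r C (stab v) \<alpha> k" by (rule mautner_subgroup.intro)
    show ?thesis by (rule mautner_subgroup.conj_pow_coset[OF ms]) (rule that)
  qed
  have "f \<in> unitary_op.E_perp (L2 \<mu>) (\<lambda>c f x. c * f x) (L2_inner \<mu>) (U \<alpha>)"
    unfolding unitary_op.E_perp_def[OF unitary] unitary_op.eigen_def[OF unitary]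
  proof (intro CollectI conjI allI impI f, elim conjE)
    fix c h assume h: "h \<in> L2 \<mu>" and n: "H.nrm (U \<alpha> h - (\<lambda>x. c * h x)) = 0"
    show "L2_inner \<mu> f h = 0"
    \<comment> \<open>Null vectors satisfy \<open>eigen\<close> but are excluded from
      \<open>eigenfunctions\<close>.\<close>
    proof (cases "H.nrm h = 0")
      case True
      then show ?thesis by (rule H.ip_eq_0_if_nrm_0(2)[OF h f])
    next
      case False
      have "U \<alpha> h - (\<lambda>x. c * h x) \<in> L2 \<mu>" by (intro H.minus_H U_L2 \<alpha>_G(1) h H.sc_H)
      from L2_nrm_zero_iff[OF this] n have "AE x in \<mu>. (U \<alpha> h - (\<lambda>x. c * h x)) x = 0" by simp
      then have "AE x in \<mu>. koopman G a h x = c * h x"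
        using AE_space by eventually_elim (simp add: U_def koopman_def space_mu \<alpha>_G(2))
      then have "h \<in> eigenfunctions G \<mu> a"
        using h False L2_nrm_zero_iff[OF h] by (auto simp: eigenfunctions_def)
      then have "h \<in> complex_span (eigenfunctions G \<mu> a)"
        unfolding complex_span_def by (intro CollectI exI[of _ "{h}"] exI[of _ "\<lambda>_. 1"]) simp
      then show ?thesis by (rule perp)
    qed
  qed
  from null_limit[OF V(1,2) _ this] V(3) have "H.nrm v = 0" by blast
  then have "L2_inner \<mu> v f = 0" by (rule H.ip_eq_0_if_nrm_0(1)[OF v(1) f])
  then have "((\<lambda>n. cmod (?c n)) \<longlongrightarrow> 0) F"
    using tendsto_norm[OF weak[OF f]] unfolding c by simp
  moreover have "\<forall>\<^sub>F n in F. e \<le> cmod (?c n)"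
    using F1(2) unfolding le_principal by simp
  ultimately have "e \<le> 0" by (rule tendsto_lowerbound[OF _ _ nb])
  then show False using e(1) by simp
qed

end
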